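(* Let $\bar\rho_-<\bar\rho_+$ be Diophantine rotation numbers (that is, $\bar\rho_\pm\in\mathcal{D}\cap\bar\theta((-I_c,I_c))$) such that there are no critical values of the function $\bar\theta$ in $[\bar\rho_-,\bar\rho_+]$. Then there exists $\bar\epsilon>0$ such that for every $\epsilon\in\mathbb{R}$ with $|\epsilon|<\bar\epsilon$ and for every $\rho\in[\bar\rho_-,\bar\rho_+]$ the perturbed first return map $\mathcal{F}(\xi,I;\epsilon)$ admits at least one orbit with rotation number $\rho$. When $\rho=2\pi\frac{m}{n}$, then for $\epsilon$ sufficiently small there are at least $2$ $(m,n)$-orbits, namely orbits $\{(\xi_k,I_k)\}_{k\in\mathbb{N}}=\{\mathcal{F}^k(\xi_0,I_0;\epsilon)\}_{k\in\mathbb{N}}$ such that $$\forall k\in\mathbb{N}\qquad(\xi_{k+n},I_{k+n})=(\xi_k+2\pi m,I_k)\equiv_{2\pi}(\xi_k,I_k).$$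
   Context: Parameters: $\omega>0$, $\mathcal{E}>\omega^2$, $h>0$, $\mu>0$; $I_c=\sqrt{\mathcal{E}-\omega^2/2}$. Potentials: $V_I(z)=\mathcal{E}+h+\frac{\mu}{|z|}$, $V_E(z)=\mathcal{E}-\frac{\omega^2}{2}|z|^2$. Perturbed domain: $D_\epsilon\subset\mathbb{R}^2\simeq\mathbb{C}$ is the domain containing the origin bounded by the curve $\gamma_\epsilon(\xi)=(1+\epsilon f(\xi;\epsilon))e^{i\xi}$, $\xi\in\mathbb{R}/2\pi\mathbb{Z}$, where $f$ is a function of class $C^k$, $k>5$, on $\mathbb{R}/2\pi\mathbb{Z}\times[-C,C]$ for some $C>0$; $D_0$ is the unit disk. Dynamics: outer arcs solve $z''=\nabla V_E(z)$, $\frac12|z'|^2=V_E(z)$ outside $D_\epsilon$; inner arcs solve $z''=\nabla V_I(z)$, $\frac12|z'|^2=V_I(z)$ inside $D_\epsilon$ (arcs colliding with the origin are regularized as ejection-collision arcs); at crossings of $\partial D_\epsilon$ the tangential component of the velocity is preserved (Snell's law). Perturbed first return map: let $S_E(\xi_0,\tilde\xi;\epsilon)$ be the Jacobi length $\int|\dot z|\sqrt{V_E(z)}\,dt$ of the outer arc joining $\gamma_\epsilon(\xi_0)$ to $\gamma_\epsilon(\tilde\xi)$, and $S_I(\tilde\xi,\xi_1;\epsilon)$ the Jacobi length $\int|\dot z|\sqrt{V_I(z)}\,dt$ of the inner arc joining $\gamma_\epsilon(\tilde\xi)$ to $\gamma_\epsilon(\xi_1)$ whose winding number about the origin (after closing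 it with the short boundary arc between the endpoints) is $\pm1$, or the ejection-collision arc when the endpoints coincide. Let $S(\xi_0,\xi_1;\epsilon)=S_E(\xi_0,\tilde\xi;\epsilon)+S_I(\tilde\xi,\xi_1;\epsilon)$, where $\tilde\xi=\tilde\xi(\xi_0,\xi_1;\epsilon)$ solves $\partial_{\tilde\xi}\big(S_E(\xi_0,\tilde\xi;\epsilon)+S_I(\tilde\xi,\xi_1;\epsilon)\big)=0$ and is the continuation in $\epsilon$ of the crossing angle of the unperturbed trajectory. With the canonical actions $I_0=-\partial_{\xi_0}S$, $I_1=\partial_{\xi_1}S$, the map is $\mathcal{F}(\xi_0,I_0;\epsilon)=(\xi_1,I_1)$; it corresponds to following one outer arc and then one inner arc. It is considered on annuli $\mathbb{R}/2\pi\mathbb{Z}\times[a,b]$ with $[a,b]\subset(-I_c,I_c)$ containing no zero of $\bar\theta'$, on which it is well defined for $|\epsilon|$ small. For $\epsilon=0$ one has $\mathcal{F}(\xi_0,I_0;0)=(\xi_0+\bar\theta(I_0),I_0)$ where $\bar\theta=\varphi_E+\varphi_I$ on $(-I_c,I_c)$, $\varphi_E,\varphi_I$ are odd, and for $I\in(0,I_c)$ $$\varphi_E(I)=\operatorname{arccot}\left(\tfrac{\mathcal{E}-2I^2}{I\sqrt{4\mathcal{E}-2(2I^2+\omega^2)}}\right),\qquad \varphi_I(I)=2\arccos\left(\tfrac{2I^2-\mu}{\sqrt{4(\mathcal{E}+h)I^2+\mu^2}}\right)-2\pi,$$ with $\operatorname{arccot}\in(0,\pi)$, $\arccos\in[0,\pi]$.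 Rotation number of an orbit $(\xi_k,I_k)=\mathcal{F}^k(\xi_0,I_0;\epsilon)$: $\lim_{k\to\infty}(\xi_k-\xi_0)/k$, angles being lifted to $\mathbb{R}$. Diophantine set: $\mathcal{D}=\bigcup_{\sigma>0}\{\rho\in\mathbb{R}: |n\rho-2\pi m|\ge\sigma n^{-3/2}\ \forall m,n\in\mathbb{Z},\,n>0\}$. In $\rho=2\pi m/n$, $m,n$ are integers with $n>0$. *)

theory Defs
  imports "HOL-Complex_Analysis.Winding_Numbers"
begin

(* Throughout, the plane is the type complex and points of R/2piZ are represented by their real lifts. *)

section \<open>Potentials and domain\<close>

definition V_I :: "real \<Rightarrow> real \<Rightarrow> real \<Rightarrow> complex \<Rightarrow> real" where
  "V_I \<E> h \<mu> z = \<E> + h + \<mu> / norm z"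

definition V_E :: "real \<Rightarrow> real \<Rightarrow> complex \<Rightarrow> real" where
  "V_E \<omega> \<E> z = \<E> - \<omega>\<^sup>2 / 2 * (norm z)\<^sup>2"

definition I_crit :: "real \<Rightarrow> real \<Rightarrow> real" where
  "I_crit \<omega> \<E> = sqrt (\<E> - \<omega>\<^sup>2 / 2)"

text \<open>Functions of class \<open>C^k\<close> on \<open>\<real> \<times> [-C, C]\<close>: all iterated partial derivatives up to order
  \<open>k\<close> exist and are continuous; in the second variable they are one-sided at \<open>\<plusminus>C\<close>.\<close>

primrec C_class :: "nat \<Rightarrow> real \<Rightarrow> (real \<Rightarrow> real \<Rightarrow> real) \<Rightarrow> bool" where
  "C_class 0 C g \<longleftrightarrow> continuous_on (UNIV \<times> {-C..C}) (\<lambda>(x, e). g x e)"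
| "C_class (Suc k) C g \<longleftrightarrow>
     (\<exists>gx ge. (\<forall>x. \<forall>e\<in>{-C..C}.
                 ((\<lambda>y. g y e) has_real_derivative gx x e) (at x) \<and>
                 ((\<lambda>d. g x d) has_real_derivative ge x e) (at e within {-C..C})) \<and>
              C_class k C gx \<and> C_class k C ge)"

definition bdry :: "(real \<Rightarrow> real \<Rightarrow> real) \<Rightarrow> real \<Rightarrow> real \<Rightarrow> complex" where
  "bdry f \<epsilon> \<xi> = of_real (1 + \<epsilon> * f \<xi> \<epsilon>) * cis \<xi>"

definition D_eps :: "(real \<Rightarrow> real \<Rightarrow> real) \<Rightarrow> real \<Rightarrow> complex set" where
  "D_eps f \<epsilon> = connected_component_set (- range (bdry f \<epsilon>)) 0"

section \<open>Arcs and their Jacobi lengths\<close>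

text \<open>\<open>z'' = \<nabla>V(z)\<close> and \<open>|z'|\<^sup>2 / 2 = V(z)\<close> at all times in \<open>A \<subseteq> [0, T]\<close>.\<close>

definition solves_on :: "(complex \<Rightarrow> real) \<Rightarrow> real \<Rightarrow> real set \<Rightarrow> (real \<Rightarrow> complex) \<Rightarrow> bool" where
  "solves_on V T A z \<longleftrightarrow>
     (\<exists>v. \<forall>t\<in>A. (z has_vector_derivative v t) (at t within {0..T}) \<and>
        (\<exists>a. (GDERIV V (z t) :> a) \<and> (v has_vector_derivative a) (at t within {0..T})) \<and>
        (norm (v t))\<^sup>2 / 2 = V (z t))"

definition jacobi_length :: "(complex \<Rightarrow> real) \<Rightarrow> real \<Rightarrow> (real \<Rightarrow> complex) \<Rightarrow> real" where
  "jacobi_length V T z =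
     integral {0..T} (\<lambda>t. norm (vector_derivative z (at t within {0..T})) * sqrt (V (z t)))"

text \<open>The arc, closed by the boundary arc running from the lifted angle \<open>\<xi>'\<close> back to \<open>\<xi>\<close>.\<close>

definition closed_arc ::
    "(real \<Rightarrow> real \<Rightarrow> real) \<Rightarrow> real \<Rightarrow> real \<Rightarrow> real \<Rightarrow> real \<Rightarrow> (real \<Rightarrow> complex) \<Rightarrow> real \<Rightarrow> complex" where
  "closed_arc f \<epsilon> \<xi> \<xi>' T z = (\<lambda>s. z (T * s)) +++ (bdry f \<epsilon> \<circ> linepath \<xi>' \<xi>)"

text \<open>Winding number \<open>0\<close> means that the angle swept by the arc is \<open>\<xi>' - \<xi>\<close>. This is needed even
  modulo \<open>2\<pi>\<close>: for a non-circular domain, a nearly tangential arc can miss the domain at its next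
  pericentre and go once around it, so that it joins points already joined by another outer arc.\<close>

definition outer_arc ::
    "real \<Rightarrow> real \<Rightarrow> (real \<Rightarrow> real \<Rightarrow> real) \<Rightarrow> real \<Rightarrow> real \<Rightarrow> real \<Rightarrow> real \<Rightarrow> (real \<Rightarrow> complex) \<Rightarrow> bool" where
  "outer_arc \<omega> \<E> f \<epsilon> \<xi> \<xi>' T z \<longleftrightarrow>
     0 < T \<and> z 0 = bdry f \<epsilon> \<xi> \<and> z T = bdry f \<epsilon> \<xi>' \<and>
     solves_on (V_E \<omega> \<E>) T {0..T} z \<and> z ` {0<..<T} \<inter> closure (D_eps f \<epsilon>) = {} \<and>
     winding_number (closed_arc f \<epsilon> \<xi> \<xi>' T z) 0 = 0"

text \<open>A collision arc passes through the origin at time \<open>T / 2\<close> and runs back along itself; it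
  satisfies the equations away from the collision. For the other inner arcs, the closing boundary
  arc is the short one if \<open>|\<xi>' - \<xi>| < \<pi>\<close>. Fixing it by the lifts, up to
  \<open>|\<xi>' - \<xi>| < 2\<pi>\<close>, makes the selected arc depend continuously on the endpoints and agree, for
  the unit disk, with \<open>\<xi>' = \<xi> + \<phi>\<^sub>I(I)\<close> for all actions \<open>I\<close>, including those with
  \<open>|\<phi>\<^sub>I(I)| \<ge> \<pi>\<close> (that is, \<open>2 I\<^sup>2 \<ge> \<mu>\<close>), whose arcs sweep an angle of at most \<open>\<pi>\<close>.\<close>

definition inner_arc ::
    "real \<Rightarrow> real \<Rightarrow> real \<Rightarrow> (real \<Rightarrow> real \<Rightarrow> real) \<Rightarrow> real \<Rightarrow> real \<Rightarrow> real \<Rightarrow> real \<Rightarrow> (real \<Rightarrow> complex) \<Rightarrow> bool" where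
  "inner_arc \<E> h \<mu> f \<epsilon> \<xi> \<xi>' T z \<longleftrightarrow>
     0 < T \<and> \<bar>\<xi>' - \<xi>\<bar> < 2 * pi \<and> z 0 = bdry f \<epsilon> \<xi> \<and> z T = bdry f \<epsilon> \<xi>' \<and>
     z ` {0<..<T} \<subseteq> D_eps f \<epsilon> \<and>
     (if \<xi> = \<xi>'
      then continuous_on {0..T} z \<and> z (T / 2) = 0 \<and> (\<forall>t\<in>{0..T}. z (T - t) = z t) \<and>
           solves_on (V_I \<E> h \<mu>) T ({0..T} - {T / 2}) z
      else solves_on (V_I \<E> h \<mu>) T {0..T} z \<and>
           winding_number (closed_arc f \<epsilon> \<xi> \<xi>' T z) 0 \<in> {1, -1})"

definition is_S_E ::
    "real \<Rightarrow> real \<Rightarrow> (real \<Rightarrow> real \<Rightarrow> real) \<Rightarrow> real \<Rightarrow> real \<Rightarrow> real \<Rightarrow> real \<Rightarrow> bool" where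
  "is_S_E \<omega> \<E> f \<epsilon> \<xi> \<xi>' l \<longleftrightarrow>
     (\<exists>T z. outer_arc \<omega> \<E> f \<epsilon> \<xi> \<xi>' T z \<and> l = jacobi_length (V_E \<omega> \<E>) T z)"

definition is_S_I ::
    "real \<Rightarrow> real \<Rightarrow> real \<Rightarrow> (real \<Rightarrow> real \<Rightarrow> real) \<Rightarrow> real \<Rightarrow> real \<Rightarrow> real \<Rightarrow> real \<Rightarrow> bool" where
  "is_S_I \<E> h \<mu> f \<epsilon> \<xi> \<xi>' l \<longleftrightarrow>
     (\<exists>T z. inner_arc \<E> h \<mu> f \<epsilon> \<xi> \<xi>' T z \<and> l = jacobi_length (V_I \<E> h \<mu>) T z)"

definition S_E :: "real \<Rightarrow> real \<Rightarrow> (real \<Rightarrow> real \<Rightarrow> real) \<Rightarrow> real \<Rightarrow> real \<Rightarrow> real \<Rightarrow> real" where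
  "S_E \<omega> \<E> f \<epsilon> \<xi> \<xi>' = (THE l. is_S_E \<omega> \<E> f \<epsilon> \<xi> \<xi>' l)"

definition S_I :: "real \<Rightarrow> real \<Rightarrow> real \<Rightarrow> (real \<Rightarrow> real \<Rightarrow> real) \<Rightarrow> real \<Rightarrow> real \<Rightarrow> real \<Rightarrow> real" where
  "S_I \<E> h \<mu> f \<epsilon> \<xi> \<xi>' = (THE l. is_S_I \<E> h \<mu> f \<epsilon> \<xi> \<xi>' l)"

section \<open>The unperturbed shift\<close>

definition arccot :: "real \<Rightarrow> real" where
  "arccot y = (THE x. 0 < x \<and> x < pi \<and> cot x = y)"

text \<open>The formulas on \<open>(0, I_c)\<close> are extended as odd functions.\<close>

definition phi_E :: "real \<Rightarrow> real \<Rightarrow> real \<Rightarrow> real" where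
  "phi_E \<omega> \<E> I =
     sgn I * arccot ((\<E> - 2 * I\<^sup>2) / (\<bar>I\<bar> * sqrt (4 * \<E> - 2 * (2 * I\<^sup>2 + \<omega>\<^sup>2))))"

definition phi_I :: "real \<Rightarrow> real \<Rightarrow> real \<Rightarrow> real \<Rightarrow> real" where
  "phi_I \<E> h \<mu> I =
     sgn I * (2 * arccos ((2 * I\<^sup>2 - \<mu>) / sqrt (4 * (\<E> + h) * I\<^sup>2 + \<mu>\<^sup>2)) - 2 * pi)"

definition theta_bar :: "real \<Rightarrow> real \<Rightarrow> real \<Rightarrow> real \<Rightarrow> real \<Rightarrow> real" where
  "theta_bar \<omega> \<E> h \<mu> I = phi_E \<omega> \<E> I + phi_I \<E> h \<mu> I"

definition critical_action :: "real \<Rightarrow> real \<Rightarrow> real \<Rightarrow> real \<Rightarrow> real \<Rightarrow> bool" where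
  "critical_action \<omega> \<E> h \<mu> I \<longleftrightarrow> (theta_bar \<omega> \<E> h \<mu> has_real_derivative 0) (at I)"

definition critical_values :: "real \<Rightarrow> real \<Rightarrow> real \<Rightarrow> real \<Rightarrow> real set" where
  "critical_values \<omega> \<E> h \<mu> =
     theta_bar \<omega> \<E> h \<mu> ` {I \<in> {- I_crit \<omega> \<E> <..< I_crit \<omega> \<E>}. critical_action \<omega> \<E> h \<mu> I}"

definition twist_annulus :: "real \<Rightarrow> real \<Rightarrow> real \<Rightarrow> real \<Rightarrow> real \<Rightarrow> real \<Rightarrow> bool" where
  "twist_annulus \<omega> \<E> h \<mu> a b \<longleftrightarrow>
     a < b \<and> {a..b} \<subseteq> {- I_crit \<omega> \<E> <..< I_crit \<omega> \<E>} \<and>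
     (\<forall>I\<in>{a..b}. \<not> critical_action \<omega> \<E> h \<mu> I)"

section \<open>Generating function and first return map\<close>

text \<open>\<open>\<partial>\<^sub>y (S\<^sub>E(\<xi>\<^sub>0, y; \<epsilon>) + S\<^sub>I(y, \<xi>\<^sub>1; \<epsilon>)) = 0\<close>, where the two lengths are required to be
  well defined near \<open>y\<close>; this is Snell's law at the crossing point with angle \<open>y\<close>.\<close>

definition stationary ::
    "real \<Rightarrow> real \<Rightarrow> real \<Rightarrow> real \<Rightarrow> (real \<Rightarrow> real \<Rightarrow> real) \<Rightarrow> real \<Rightarrow> real \<Rightarrow> real \<Rightarrow> real \<Rightarrow> bool" where
  "stationary \<omega> \<E> h \<mu> f \<epsilon> \<xi>0 \<xi>1 y \<longleftrightarrow>
     (\<forall>\<^sub>F x in nhds y. (\<exists>!l. is_S_E \<omega> \<E> f \<epsilon> \<xi>0 x l) \<and> (\<exists>!l. is_S_I \<E> h \<mu> f \<epsilon> x \<xi>1 l)) \<and>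
     ((\<lambda>x. S_E \<omega> \<E> f \<epsilon> \<xi>0 x + S_I \<E> h \<mu> f \<epsilon> x \<xi>1) has_real_derivative 0) (at y)"

text \<open>\<open>y\<close> is reached by continuation in the perturbation parameter, from \<open>0\<close> to \<open>\<epsilon>\<close>, starting
  at the crossing angle \<open>\<xi>\<^sub>0 + \<phi>\<^sub>E(I)\<close> of the unperturbed trajectory from \<open>\<xi>\<^sub>0\<close> to
  \<open>\<xi>\<^sub>1 = \<xi>\<^sub>0 + \<theta>(I)\<close> with action \<open>I\<close> in \<open>(a, b)\<close>. If \<open>[a, b]\<close> contains no critical action
  then \<open>I\<close> is unique.\<close>

definition is_crossing ::
    "real \<Rightarrow> real \<Rightarrow> real \<Rightarrow> real \<Rightarrow> real \<Rightarrow> real \<Rightarrow> (real \<Rightarrow> real \<Rightarrow> real) \<Rightarrow>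
     real \<Rightarrow> real \<Rightarrow> real \<Rightarrow> real \<Rightarrow> bool" where
  "is_crossing \<omega> \<E> h \<mu> a b f \<epsilon> \<xi>0 \<xi>1 y \<longleftrightarrow>
     (\<exists>I c. I \<in> {a<..<b} \<and> theta_bar \<omega> \<E> h \<mu> I = \<xi>1 - \<xi>0 \<and>
        continuous_on (closed_segment 0 \<epsilon>) c \<and>
        c 0 = \<xi>0 + phi_E \<omega> \<E> I \<and> c \<epsilon> = y \<and>
        (\<forall>e\<in>closed_segment 0 \<epsilon>. stationary \<omega> \<E> h \<mu> f e \<xi>0 \<xi>1 (c e)))"

definition crossing ::
    "real \<Rightarrow> real \<Rightarrow> real \<Rightarrow> real \<Rightarrow> real \<Rightarrow> real \<Rightarrow> (real \<Rightarrow> real \<Rightarrow> real) \<Rightarrow>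
     real \<Rightarrow> real \<Rightarrow> real \<Rightarrow> real" where
  "crossing \<omega> \<E> h \<mu> a b f \<epsilon> \<xi>0 \<xi>1 = (THE y. is_crossing \<omega> \<E> h \<mu> a b f \<epsilon> \<xi>0 \<xi>1 y)"

definition S_gen ::
    "real \<Rightarrow> real \<Rightarrow> real \<Rightarrow> real \<Rightarrow> real \<Rightarrow> real \<Rightarrow> (real \<Rightarrow> real \<Rightarrow> real) \<Rightarrow>
     real \<Rightarrow> real \<Rightarrow> real \<Rightarrow> real" where
  "S_gen \<omega> \<E> h \<mu> a b f \<epsilon> \<xi>0 \<xi>1 =
     S_E \<omega> \<E> f \<epsilon> \<xi>0 (crossing \<omega> \<E> h \<mu> a b f \<epsilon> \<xi>0 \<xi>1) +
     S_I \<E> h \<mu> f \<epsilon> (crossing \<omega> \<E> h \<mu> a b f \<epsilon> \<xi>0 \<xi>1) \<xi>1"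

definition generates ::
    "real \<Rightarrow> real \<Rightarrow> real \<Rightarrow> real \<Rightarrow> real \<Rightarrow> real \<Rightarrow> (real \<Rightarrow> real \<Rightarrow> real) \<Rightarrow>
     real \<Rightarrow> real \<times> real \<Rightarrow> real \<times> real \<Rightarrow> bool" where
  "generates \<omega> \<E> h \<mu> a b f \<epsilon> p q \<longleftrightarrow>
     (\<forall>\<^sub>F r in nhds (fst p, fst q). \<exists>!y. is_crossing \<omega> \<E> h \<mu> a b f \<epsilon> (fst r) (snd r) y) \<and>
     ((\<lambda>x. S_gen \<omega> \<E> h \<mu> a b f \<epsilon> x (fst q)) has_real_derivative - snd p) (at (fst p)) \<and>
     ((\<lambda>x. S_gen \<omega> \<E> h \<mu> a b f \<epsilon> (fst p) x) has_real_derivative snd q) (at (fst q))"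

text \<open>The first return map is a partial map on lifted angles and actions, which commutes with
  \<open>(\<xi>, I) \<mapsto> (\<xi> + 2\<pi>, I)\<close>. The annulus \<open>[a, b]\<close> only serves to select the unperturbed
  trajectories from which the continuation starts.\<close>

definition return_defined ::
    "real \<Rightarrow> real \<Rightarrow> real \<Rightarrow> real \<Rightarrow> real \<Rightarrow> real \<Rightarrow> (real \<Rightarrow> real \<Rightarrow> real) \<Rightarrow>
     real \<Rightarrow> real \<times> real \<Rightarrow> bool" where
  "return_defined \<omega> \<E> h \<mu> a b f \<epsilon> p \<longleftrightarrow> (\<exists>!q. generates \<omega> \<E> h \<mu> a b f \<epsilon> p q)"

definition return_map ::
    "real \<Rightarrow> real \<Rightarrow> real \<Rightarrow> real \<Rightarrow> real \<Rightarrow> real \<Rightarrow> (real \<Rightarrow> real \<Rightarrow> real) \<Rightarrow>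
     real \<Rightarrow> real \<times> real \<Rightarrow> real \<times> real" where
  "return_map \<omega> \<E> h \<mu> a b f \<epsilon> p = (THE q. generates \<omega> \<E> h \<mu> a b f \<epsilon> p q)"

section \<open>Orbits\<close>

definition is_orbit ::
    "real \<Rightarrow> real \<Rightarrow> real \<Rightarrow> real \<Rightarrow> real \<Rightarrow> real \<Rightarrow> (real \<Rightarrow> real \<Rightarrow> real) \<Rightarrow>
     real \<Rightarrow> (nat \<Rightarrow> real \<times> real) \<Rightarrow> bool" where
  "is_orbit \<omega> \<E> h \<mu> a b f \<epsilon> x \<longleftrightarrow>
     (\<forall>k. snd (x k) \<in> {a..b} \<and> return_defined \<omega> \<E> h \<mu> a b f \<epsilon> (x k) \<and>
          x (Suc k) = return_map \<omega> \<E> h \<mu> a b f \<epsilon> (x k))"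

definition has_rotation_number :: "(nat \<Rightarrow> real \<times> real) \<Rightarrow> real \<Rightarrow> bool" where
  "has_rotation_number x \<rho> \<longleftrightarrow> (\<lambda>k. (fst (x k) - fst (x 0)) / real k) \<longlonglongrightarrow> \<rho>"

definition is_mn_orbit ::
    "real \<Rightarrow> real \<Rightarrow> real \<Rightarrow> real \<Rightarrow> real \<Rightarrow> real \<Rightarrow> (real \<Rightarrow> real \<Rightarrow> real) \<Rightarrow>
     real \<Rightarrow> int \<Rightarrow> nat \<Rightarrow> (nat \<Rightarrow> real \<times> real) \<Rightarrow> bool" where
  "is_mn_orbit \<omega> \<E> h \<mu> a b f \<epsilon> m n x \<longleftrightarrow>
     is_orbit \<omega> \<E> h \<mu> a b f \<epsilon> x \<and>
     (\<forall>k. x (k + n) = (fst (x k) + 2 * pi * of_int m, snd (x k)))"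

text \<open>Orbits are compared on the annulus \<open>\<real>/2\<pi>\<int> \<times> [a, b]\<close> as sets of points, so that shifting
  the time or the lift of an orbit does not count as a different orbit.\<close>

definition disjoint_orbits :: "(nat \<Rightarrow> real \<times> real) \<Rightarrow> (nat \<Rightarrow> real \<times> real) \<Rightarrow> bool" where
  "disjoint_orbits x y \<longleftrightarrow>
     \<not> (\<exists>j k. \<exists>l::int. y j = (fst (x k) + 2 * pi * of_int l, snd (x k)))"

definition Diophantine :: "real set" where
  "Diophantine = (\<Union>\<sigma>\<in>{0<..}. {\<rho>. \<forall>m n :: int. n > 0 \<longrightarrow>
     \<bar>of_int n * \<rho> - 2 * pi * of_int m\<bar> \<ge> \<sigma> * of_int n powr (- 3 / 2)})"

end

theory Submission
 imports Defs "HOL-Complex_Analysis.Complex_Analysis"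
begin

text \<open>Outer arcs are arcs of a harmonic oscillator, and the Levi-Civita substitution \<open>z = w\<^sup>2\<close> turns
  inner arcs into arcs of a linear hyperbolic equation. Hence both lengths are explicit functions of
  the radii of the endpoints and of the angle between them; the arcs with these lengths stay outside,
  respectively inside, the domain and are the only ones as long as the boundary is close to the circle.
  Eliminating the crossing angle by the implicit function theorem yields a generating function whose
  partial derivatives are, together with their Lipschitz constants, close to the unperturbed ones, so
  that the return map is a near-integrable twist map on an annulus slightly larger than needed.

  Minimizers of the action among \<open>(m, n)\<close>-periodic configurations can be chosen ordered with respect
  to their translates, so their \<open>i\<close>-th point deviates by at most \<open>2 * pi\<close> from a uniform rotation; as the
  action variable drifts slowly, each single step is then close to the rotation number, the
  constraint on the steps is inactive, and limits of such configurations provide every rotation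
  number. A second periodic orbit maximizes, over the starting angle, the minimal action. No
  invariant curves are used: it suffices that the rotation numbers lie in the interior of an interval
  of regular values.\<close>

text \<open>The lengths behind the return map are definite descriptions, so existence and uniqueness
  of the arcs come before any differentiation. The delicate places are the ends of an arc and nearly
  coincident endpoints, where the clearance from the boundary degenerates. Every error is therefore
  bounded by a small factor times the degenerating quantity, which is why \<open>curve\<close>
  records Lipschitz and second-difference bounds of the radius besides its closeness to 1. The
  crossing angle can be eliminated because the second derivative of the total length at an
  unperturbed crossing is \<open>theta'\<close> times a nonzero factor, so regular values are what
  is needed; the sign \<open>si\<close> reduces both directions of twist to one. The order of
  quantifiers calls for two estimates of the steps. For all rotation numbers at once, the number
  \<open>N\<close> of compared steps depends only on the margin, thanks to the order of the
  minimizers; for fixed \<open>m\<close> and \<open>n\<close> the error may be chosen small compared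
  with \<open>1/n^2\<close>, which makes minimizers with a prescribed start unique.\<close>

lemmas square_simps = power2_eq_square algebra_simps

section \<open>Actions of near-integrable twist maps\<close>

lemma compact_box_nat:
 fixes l u :: "nat => real"
 shows "compact {x. ALL k. l k <= x k & x k <= u k}" proof -
 have "compactin (product_topology (%i::nat. euclidean::real topology) UNIV) (PiE UNIV (%k. {l k..u k}))"
  by (simp only: compactin_PiE) simp
 moreover have "PiE UNIV (%k. {l k..u k}) = {x. ALL k. l k <= x k & x k <= u k}"
  by (auto simp: PiE_def Pi_def)
 ultimately show ?thesis by (simp add: euclidean_product_topology)
qed

lemma tendsto_fun_nth:
 fixes X :: "'a => nat => real"
 assumes "(X \<longlongrightarrow> x) F"
 shows "((%j. X j k) \<longlongrightarrow> x k) F"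
 using continuous_on_tendsto_compose[OF continuous_on_product_coordinates assms] by simp

lemma box_convergent_subseq:
 fixes X :: "nat => nat => real"
 assumes "!!j k. l k <= X j k" "!!j k. X j k <= u k"
 obtains r x where "strict_mono r" "!!k. (%j. X (r j) k) \<longlonglongrightarrow> x k" proof -
 have "seq_compact {x. ALL k. l k <= x k & x k <= u k}"
  using compact_box_nat by (simp add: compact_eq_seq_compact_metric)
 then obtain x r where "strict_mono r" "(X \<circ> r) \<longlonglongrightarrow> x"
  by (rule seq_compactE[where f = X]) (use assms in auto)
 thus thesis using that[of r x] tendsto_fun_nth by (fastforce simp: o_def)
qed

text \<open>The model is an \<open>H x y\<close> depending on \<open>y - x\<close> alone with
  derivative \<open>g (y - x)\<close>, so that \<open>g\<close> is, up to a sign, the action as a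
  function of the angular step. The partial derivatives \<open>a\<close> and \<open>b\<close> are
  within \<open>et\<close> of the model in value and in Lipschitz constant. Everything is required
  only for steps in \<open>[aa, bb]\<close>.\<close>

locale near_integrable =
 fixes H a b :: "real => real => real" and g :: "real => real" and aa bb c et :: real
 assumes c_pos: "0 < c" and eta_nonneg: "0 <= et" and eta_less: "et < c"
  and H_per: "[|aa <= y - x; y - x <= bb|] ==> H (x + 2*pi) (y + 2*pi) = H x y"
  and H_deriv: "[|aa <= y - x; y - x <= bb|] ==>
    ((%(x, y). H x y) has_derivative (%(u, v). a x y*u + b x y * v)) (at (x, y))"
  and g_cont: "continuous_on {aa..bb} g"
  and g_mono: "[|aa <= d; d <= d'; d' <= bb|] ==> c*(d' - d) <= g d' - g d"
  and a_close: "[|aa <= y - x; y - x <= bb|] ==> abs (a x y + g (y - x)) <= et"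
  and b_close: "[|aa <= y - x; y - x <= bb|] ==> abs (b x y - g (y - x)) <= et"
  and a_lip: "[|aa <= y - x; y - x <= bb; aa <= y' - x'; y' - x' <= bb|] ==>
    abs ((a x' y' + g (y' - x')) - (a x y + g (y - x))) <= et*(abs (x' - x) + abs (y' - y))"
  and b_lip: "[|aa <= y - x; y - x <= bb; aa <= y' - x'; y' - x' <= bb|] ==>
    abs ((b x' y' - g (y' - x')) - (b x y - g (y - x))) <= et*(abs (x' - x) + abs (y' - y))"
begin

lemma H_deriv_along:
 assumes "aa <= v t - u t" "v t - u t <= bb"
  and "(u has_real_derivative u') (at t)" "(v has_real_derivative v') (at t)"
 shows "((%t. H (u t) (v t)) has_real_derivative a (u t) (v t)*u' + b (u t) (v t) * v') (at t)" proof -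
 have "((%t. (u t, v t)) has_derivative (%s. (u' * s, v' * s))) (at t)"
  using assms(3,4) by (intro has_derivative_Pair) (simp_all add: has_field_derivative_def)
 from has_derivative_compose[OF this H_deriv[OF assms(1,2)]]
 have "((%t. H (u t) (v t)) has_derivative (%s. a (u t) (v t)*(u' * s) + b (u t) (v t)*(v' * s))) (at t)"
  by simp
 thus ?thesis
  unfolding has_field_derivative_def by (rule has_derivative_eq_rhs) (simp add: fun_eq_iff algebra_simps)
qed

lemma H_deriv_fst: "[|aa <= y - x; y - x <= bb|] ==> ((%t. H t y) has_real_derivative a x y) (at x)"
 using H_deriv_along[of "%_. y" x "%t. t" 1 0] by simp

lemma H_deriv_snd: "[|aa <= y - x; y - x <= bb|] ==> ((%t. H x t) has_real_derivative b x y) (at y)"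
 using H_deriv_along[of "%t. t" y "%_. x" 0 1] by simp

lemma H_tendsto:
 assumes "(X \<longlongrightarrow> x) F" "(Y \<longlongrightarrow> y) F" "aa <= y - x" "y - x <= bb"
 shows "((%j. H (X j) (Y j)) \<longlongrightarrow> H x y) F" proof -
 have "isCont (%(x, y). H x y) (x, y)" using H_deriv[OF assms(3,4)] by (rule has_derivative_continuous)
 moreover have "((%j. (X j, Y j)) \<longlongrightarrow> (x, y)) F" using assms by (intro tendsto_Pair)
 ultimately show ?thesis using isCont_tendsto_compose by fastforce
qed

lemma g_less: "[|aa <= d; d < d'; d' <= bb|] ==> g d < g d'"
 using g_mono[of d d'] c_pos by (smt (verit) mult_pos_pos)

lemma g_tendsto:
 assumes "(D \<longlongrightarrow> d) F" "!!j. aa <= D j" "!!j. D j <= bb" "aa <= d" "d <= bb"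
 shows "((%j. g (D j)) \<longlongrightarrow> g d) F"
 by (rule continuous_on_tendsto_compose[OF g_cont assms(1)]) (use assms in auto)

lemma ab_tendsto:
 assumes "(X \<longlongrightarrow> x) F" "(Y \<longlongrightarrow> y) F" and lim: "aa <= y - x" "y - x <= bb"
  and strip: "!!j. aa <= Y j - X j" "!!j. Y j - X j <= bb"
 shows "((%j. a (X j) (Y j)) \<longlongrightarrow> a x y) F" "((%j. b (X j) (Y j)) \<longlongrightarrow> b x y) F"
proof -
 have z: "((%j. et*(abs (X j - x) + abs (Y j - y))) \<longlongrightarrow> et*(abs (x - x) + abs (y - y))) F"
  using assms by (intro tendsto_intros)
 have g: "((%j. g (Y j - X j)) \<longlongrightarrow> g (y - x)) F"
  using assms by (intro g_tendsto tendsto_intros) auto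
 have "((%j. (a (X j) (Y j) + g (Y j - X j)) - (a x y + g (y - x))) \<longlongrightarrow> 0) F"
  by (rule tendsto_0_le[where K=1 and f="%j. et*(abs (X j - x) + abs (Y j - y))"])
   (use z in simp, use a_lip[OF lim strip] in "force simp: eta_nonneg")
 from tendsto_diff[OF tendsto_add[OF this tendsto_const[of "a x y + g (y - x)"]] g]
 show "((%j. a (X j) (Y j)) \<longlongrightarrow> a x y) F" by simp
 have "((%j. (b (X j) (Y j) - g (Y j - X j)) - (b x y - g (y - x))) \<longlongrightarrow> 0) F"
  by (rule tendsto_0_le[where K=1 and f="%j. et*(abs (X j - x) + abs (Y j - y))"])
   (use z in simp, use b_lip[OF lim strip] in "force simp: eta_nonneg")
 from tendsto_add[OF tendsto_add[OF this tendsto_const[of "b x y - g (y - x)"]] g]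
 show "((%j. b (X j) (Y j)) \<longlongrightarrow> b x y) F" by simp
qed

text \<open>The twist condition: the growth rate \<open>c\<close> of \<open>g\<close> beats the
  Lipschitz error \<open>et\<close>.\<close>

lemma a_decreasing:
 assumes "aa <= y - x" "y < y'" "y' - x <= bb"
 shows "a x y' < a x y" proof -
 have "abs ((a x y' + g (y' - x)) - (a x y + g (y - x))) <= et*(abs (x - x) + abs (y' - y))"
  using assms by (intro a_lip) auto
 moreover have "c*((y' - x) - (y - x)) <= g (y' - x) - g (y - x)" using assms by (intro g_mono) auto
 moreover have "et*(y' - y) < c*(y' - y)" using assms eta_less by simp
 ultimately show ?thesis using assms by (simp add: algebra_simps)
qed

text \<open>Integrated form of the twist condition: \<open>H t y - H t y'\<close> is nonincreasing
  in \<open>t\<close>. The hypotheses on the two extreme steps keep the whole rectangle in the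
  strip.\<close>

lemma H_submodular:
 assumes "x <= x'" "y' <= y" "y - x <= bb" "aa <= y' - x'"
 shows "H x y' + H x' y <= H x y + H x' y'" proof -
 have "((%t. H t y - H t y') has_real_derivative a t y - a t y') (at t)" if "x <= t" "t <= x'" for t
  using assms that by (intro derivative_intros H_deriv_fst) auto
 moreover have "a t y - a t y' <= 0" if "x <= t" "t <= x'" for t
  using assms that a_decreasing[of y' t y] by (cases "y = y'") auto
 ultimately have "H x' y - H x' y' <= H x y - H x y'"
  using DERIV_nonpos_imp_nonincreasing[OF assms(1), of "%t. H t y - H t y'"] by blast
 thus ?thesis by simp
qed

lemma H_min_max:
 assumes "aa <= y - x" "y - x <= bb" "aa <= y' - x'" "y' - x' <= bb"
 shows "H (min x x') (min y y') + H (max x x') (max y y') <= H x y + H x' y'"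
 using assms H_submodular[of x x' y' y] H_submodular[of x' x y y']
 by (cases "x <= x'"; cases "y <= y'") (auto simp: min_def max_def)

lemma H_per_int:
 assumes "aa <= y - x" "y - x <= bb"
 shows "H (x + 2*pi * of_int j) (y + 2*pi * of_int j) = H x y" proof (induction j rule: int_induct[of _ 0])
 case (step1 i)
 thus ?case using H_per[of "y + 2*pi * of_int i" "x + 2*pi * of_int i"] assms by (simp add: algebra_simps)
next
 case (step2 i)
 thus ?case using H_per[of "y + 2*pi * of_int (i - 1)" "x + 2*pi * of_int (i - 1)"] assms
  by (simp add: algebra_simps)
qed simp

text \<open>Periodicity of \<open>H\<close> is known only inside the strip, hence on one side at its
  edge. Derivatives within an interval of positive length are still unique, and this is where
  \<open>aa < bb\<close> enters.\<close>

lemma ab_per_int: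
 assumes s: "aa <= y - x" "y - x <= bb" "aa < bb"
 shows "a (x + 2*pi * of_int j) (y + 2*pi * of_int j) = a x y"
  "b (x + 2*pi * of_int j) (y + 2*pi * of_int j) = b x y" proof -
 let ?p = "2*pi * of_int j"
 have s': "aa <= (y + ?p) - (x + ?p)" "(y + ?p) - (x + ?p) <= bb" using s by auto
 have d1: "((%t. H (t + ?p) (y + ?p)) has_real_derivative a (x + ?p) (y + ?p)) (at x within {y - bb..y - aa})"
  using H_deriv_fst[OF s'] has_field_derivative_at_within DERIV_shift by blast
 have d2: "((%t. H (t + ?p) (y + ?p)) has_real_derivative a x y) (at x within {y - bb..y - aa})"
  by (rule has_field_derivative_transform_within[OF has_field_derivative_at_within[OF H_deriv_fst[OF s(1,2)]], of 1])
   (use s H_per_int in auto)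
 have nb: "at x within {y - bb..y - aa} ~= bot"
  using s islimpt_Icc[of "y - bb" "y - aa" x] by (simp add: trivial_limit_within)
 show "a (x + ?p) (y + ?p) = a x y" using vector_derivative_unique_within[OF nb] d1 d2
  unfolding has_real_derivative_iff_has_vector_derivative by blast
 have e1: "((%t. H (x + ?p) (t + ?p)) has_real_derivative b (x + ?p) (y + ?p)) (at y within {x + aa..x + bb})"
  using H_deriv_snd[OF s'] has_field_derivative_at_within DERIV_shift by blast
 have e2: "((%t. H (x + ?p) (t + ?p)) has_real_derivative b x y) (at y within {x + aa..x + bb})"
  by (rule has_field_derivative_transform_within[OF has_field_derivative_at_within[OF H_deriv_snd[OF s(1,2)]], of 1])
   (use s H_per_int in auto)
 have nb': "at y within {x + aa..x + bb} ~= bot"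
  using s islimpt_Icc[of "x + aa" "x + bb" y] by (simp add: trivial_limit_within)
 show "b (x + ?p) (y + ?p) = b x y" using vector_derivative_unique_within[OF nb'] e1 e2
  unfolding has_real_derivative_iff_has_vector_derivative by blast
qed

text \<open>The bounds on the steps are a constraint, imposed because \<open>H\<close> is controlled
  only there. A priori a minimizer may touch it; that it does not is proved later.\<close>

definition conf :: "nat => int => (nat => real) => bool" where
 "conf n m x \<longleftrightarrow> (ALL k. aa <= x (Suc k) - x k & x (Suc k) - x k <= bb) &
   (ALL k. x (k + n) = x k + 2*pi * of_int m)"

definition action :: "nat => (nat => real) => real" where "action n x = (SUM k<n. H (x k) (x (Suc k)))"

lemma confD:
 assumes "conf n m x"
 shows "aa <= x (Suc k) - x k" "x (Suc k) - x k <= bb" "x (k + n) = x k + 2*pi * of_int m"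
 using assms by (auto simp: conf_def)

lemma conf_shift:
 assumes "conf n m x"
 shows "conf n m (%k. x (k + i))" unfolding conf_def using confD(1,2)[OF assms] confD(3)[OF assms, of "_ + i"]
 by (simp add: ac_simps)

lemma conf_trans: "conf n m x ==> conf n m (%k. x k + t)" by (auto simp: conf_def)

lemma conf_max: "conf n m x ==> conf n m y ==> conf n m (%k. max (x k) (y k))"
 unfolding conf_def max_def by (smt (verit))

lemma conf_min: "conf n m x ==> conf n m y ==> conf n m (%k. min (x k) (y k))"
 unfolding conf_def min_def by (smt (verit))

lemma conf_mult: "conf n m x ==> x (k + n*q) = x k + 2*pi * of_int m*real q" proof (induction q)
 case (Suc q)
 have "x (k + n*q + n) = x (k + n*q) + 2*pi * of_int m" using confD(3)[OF Suc.prems] .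
 thus ?case using Suc by (simp add: algebra_simps)
qed simp

lemma action_shift:
 assumes "conf n m x"
 shows "action n (%k. x (k + i)) = action n x" proof (induction i)
 case (Suc i)
 let ?y = "%k. x (k + i)"
 let ?f = "%k. H (?y k) (?y (Suc k))"
 have y: "conf n m ?y" using conf_shift[OF assms] .
 have "?y n = ?y 0 + 2*pi * of_int m" "?y (Suc n) = ?y 1 + 2*pi * of_int m"
  using confD(3)[OF y, of 0] confD(3)[OF y, of 1] by auto
 hence "?f n = ?f 0" using H_per_int confD[OF y, of 0] by simp
 moreover have "(SUM k<n. ?f (Suc k)) + ?f 0 = (SUM k<n. ?f k) + ?f n"
  using sum.lessThan_Suc_shift[of ?f n] by simp
 ultimately have "(SUM k<n. ?f (Suc k)) = (SUM k<n. ?f k)" by simp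
 hence "action n (%k. x (k + Suc i)) = action n ?y" by (simp add: action_def)
 thus ?case using Suc by simp
qed simp

lemma action_trans:
 assumes "conf n m x"
 shows "action n (%k. x k + 2*pi * of_int j) = action n x"
 using H_per_int confD[OF assms] by (simp add: action_def)

lemma action_max_min:
 assumes "conf n m x" "conf n m y"
 shows "action n (%k. min (x k) (y k)) + action n (%k. max (x k) (y k)) <= action n x + action n y"
 unfolding action_def sum.distrib[symmetric]
 by (intro sum_mono H_min_max) (use confD[OF assms(1)] confD[OF assms(2)] in auto)

lemma action_tendsto:
 assumes "!!j::'i. conf n m (X j)" "!!k. ((%j. X j k) \<longlongrightarrow> x k) F" "F ~= bot"
 shows "conf n m x" "((%j. action n (X j)) \<longlongrightarrow> action n x) F" proof -
 have "aa <= x (Suc k) - x k" for k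
  using assms(1)[THEN confD(1)] by (intro tendsto_lowerbound[OF tendsto_diff[OF assms(2,2)] _ assms(3)]) auto
 moreover have "x (Suc k) - x k <= bb" for k
  using assms(1)[THEN confD(2)] by (intro tendsto_upperbound[OF tendsto_diff[OF assms(2,2)] _ assms(3)]) auto
 moreover have "x (k + n) = x k + 2*pi * of_int m" for k
  using tendsto_unique[OF assms(3) assms(2)[of "k + n"]]
   tendsto_add[OF assms(2)[of k] tendsto_const[of "2*pi * of_int m"]] assms(1)[THEN confD(3)] by simp
 ultimately show c: "conf n m x" by (auto simp: conf_def)
 show "((%j. action n (X j)) \<longlongrightarrow> action n x) F"
  unfolding action_def by (intro tendsto_sum H_tendsto assms(2)) (use confD[OF c] in auto)
qed

lemma conf_bounds:
 assumes "conf n m x" "l <= x 0" "x 0 <= u"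
 shows "l + aa*real k <= x k" "x k <= u + bb*real k" proof (induction k)
 case (Suc k)
 case 1 show ?case using Suc(1) confD(1)[OF assms(1), of k] by (simp add: algebra_simps)
 case 2 show ?case using Suc(2) confD(2)[OF assms(1), of k] by (simp add: algebra_simps)
qed (use assms in auto)

lemma conf_convergent:
 assumes "!!j::nat. conf n m (X j)" "!!j. l <= X j 0" "!!j. X j 0 <= u"
 obtains r x where "strict_mono r" "!!k. (%j. X (r j) k) \<longlonglongrightarrow> x k"
  "conf n m x" "(%j. action n (X (r j))) \<longlonglongrightarrow> action n x" proof -
 obtain r x where "strict_mono r" "!!k. (%j. X (r j) k) \<longlonglongrightarrow> x k"
  by (rule box_convergent_subseq[of "%k. l + aa*real k" X "%k. u + bb*real k"])
   (use conf_bounds[OF assms(1-3)] in auto)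
 thus thesis using that[of r x] action_tendsto[of n m "%j. X (r j)" x sequentially] assms(1)
  by (meson trivial_limit_sequentially)
qed

text \<open>Otherwise a sequence with actions tending to minus infinity would have a subsequence
  converging to a configuration of finite action.\<close>

lemma action_bounded_below:
 assumes "l <= u"
 obtains B where "!!x. conf n m x ==> l <= x 0 ==> x 0 <= u ==> B <= action n x" proof (rule ccontr)
 assume "~ thesis"
 hence "EX x. conf n m x & l <= x 0 & x 0 <= u & action n x < - real j" for j
  using that[of "- real j"] by force
 then obtain X where X: "!!j::nat. conf n m (X j)" "!!j. l <= X j 0" "!!j. X j 0 <= u"
  "!!j. action n (X j) < - real j" by metis
 obtain r x where r: "strict_mono r" "(%j. action n (X (r j))) \<longlonglongrightarrow> action n x"
  by (rule conf_convergent[OF X(1-3)]) (rule that; assumption)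
 have "\<forall>\<^sub>F j in sequentially. action n x - 1 < action n (X (r j))"
  by (rule order_tendstoD(1)[OF r(2)]) simp
 moreover have "\<forall>\<^sub>F j in sequentially. 1 - action n x < real j"
  using filterlim_real_sequentially by (simp add: filterlim_at_top_dense)
 ultimately have "\<forall>\<^sub>F j in sequentially. False" proof eventually_elim
  case (elim j)
  thus False using X(4)[of "r j"] seq_suble[OF r(1), of j] by simp
 qed
 thus False by simp
qed

text \<open>The interval for \<open>x 0\<close> serves two purposes: a full period yields global
  minimizers, a single point yields minimizers with prescribed start.\<close>

lemma minimizer_exists:
 assumes ne: "conf n m x0" "l <= x0 0" "x0 0 <= u"
 obtains x where "conf n m x" "l <= x 0" "x 0 <= u"
  "!!y. conf n m y ==> l <= y 0 ==> y 0 <= u ==> action n x <= action n y" proof -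
 let ?S = "{x. conf n m x & l <= x 0 & x 0 <= u}"
 have "l <= u" using ne by simp
 then obtain B where B: "!!x. x : ?S ==> B <= action n x"
  using action_bounded_below[of l u n m] by (metis (no_types, lifting) mem_Collect_eq)
 let ?I = "INF x\<in>?S. action n x"
 have bdd: "bdd_below (action n ` ?S)" using B by (intro bdd_belowI[of _ B]) auto
 have ne': "action n ` ?S ~= {}" using ne by auto
 have "EX x:?S. action n x < ?I + 1/real (Suc j)" for j
  using cInf_lessD[OF ne', of "?I + 1/real (Suc j)"] by auto
 hence "ALL j. EX x. x : ?S & action n x < ?I + 1/real (Suc j)" by blast
 from choice[OF this] obtain X where X: "!!j::nat. X j : ?S" "!!j. action n (X j) < ?I + 1/real (Suc j)"
  by blast
 obtain r x where r: "strict_mono r" "!!k. (%j. X (r j) k) \<longlonglongrightarrow> x k" "conf n m x"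
  "(%j. action n (X (r j))) \<longlonglongrightarrow> action n x"
  by (rule conf_convergent[of n m X l u]) (use X(1) in auto)
 have "(%j. ?I + 1/real (Suc (r j))) \<longlonglongrightarrow> ?I + 0"
  by (intro tendsto_add tendsto_const LIMSEQ_subseq_LIMSEQ[OF LIMSEQ_inverse_real_of_nat r(1), unfolded o_def inverse_eq_divide])
 hence lim: "(%j. ?I + 1/real (Suc (r j))) \<longlonglongrightarrow> ?I" by (simp only: add_0_right)
 have "action n x <= ?I"
  by (rule tendsto_le[OF trivial_limit_sequentially lim r(4)], intro always_eventually allI less_imp_le X(2))
 moreover have "l <= x 0" by (rule tendsto_lowerbound[OF r(2)]) (use X(1) in auto)
 moreover have "x 0 <= u" by (rule tendsto_upperbound[OF r(2)]) (use X(1) in auto)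
 ultimately show thesis using that[of x] r(3) cINF_lower[OF bdd] by (smt (verit) mem_Collect_eq)
qed

end

section \<open>Minimizers, their order and their first variation\<close>

context near_integrable begin

definition is_min :: "nat => int => (nat => real) => bool" where
 "is_min n m x \<longleftrightarrow> conf n m x & (ALL y. conf n m y --> action n x <= action n y)"

definition is_min_from :: "nat => int => (nat => real) => bool" where
 "is_min_from n m x \<longleftrightarrow> conf n m x & (ALL y. conf n m y --> y 0 = x 0 --> action n x <= action n y)"

text \<open>The Euler-Lagrange equation at index \<open>k + 1\<close>: the action at the end of one
  step equals the action at the start of the next.\<close>

definition stationary_at :: "(nat => real) => nat => bool" where
 "stationary_at x k \<longleftrightarrow> b (x k) (x (Suc k)) + a (x (Suc k)) (x (Suc (Suc k))) = 0"

lemma is_min_imp_from: "is_min n m x ==> is_min_from n m x" by (auto simp: is_min_def is_min_from_def)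

lemma conf_linear:
 assumes "n > 0" "aa <= 2*pi * of_int m/real n" "2*pi * of_int m/real n <= bb"
 shows "conf n m (%k. t + real k*(2*pi * of_int m/real n))" using assms by (simp add: conf_def field_simps)

lemma is_min_exists:
 assumes "n > 0" "aa <= 2*pi * of_int m/real n" "2*pi * of_int m/real n <= bb"
 obtains x where "is_min n m x" proof -
 obtain x where x: "conf n m x" "!!y. conf n m y ==> 0 <= y 0 ==> y 0 <= 2*pi ==> action n x <= action n y"
  by (rule minimizer_exists[OF conf_linear[OF assms, of 0], of 0 "2*pi"]) auto
 have "action n x <= action n y" if y: "conf n m y" for y proof -
  define j where "j = - \<lfloor>y 0/(2*pi)\<rfloor>"
  have "of_int \<lfloor>y 0/(2*pi)\<rfloor> <= y 0/(2*pi)" "y 0/(2*pi) <= of_int \<lfloor>y 0/(2*pi)\<rfloor> + 1"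
   by linarith+
  hence "of_int \<lfloor>y 0/(2*pi)\<rfloor> * (2*pi) <= y 0" "y 0 <= (of_int \<lfloor>y 0/(2*pi)\<rfloor> + 1)*(2*pi)"
   by (simp_all only: pos_le_divide_eq pos_divide_le_eq pi_gt_zero mult_pos_pos zero_less_numeral)
  hence "0 <= y 0 + 2*pi * of_int j" "y 0 + 2*pi * of_int j <= 2*pi" by (simp_all add: j_def algebra_simps)
  hence "action n x <= action n (%k. y k + 2*pi * of_int j)" using x(2) conf_trans[OF y] by simp
  thus ?thesis using action_trans[OF y] by simp
 qed
 thus thesis using that[of x] x(1) by (simp add: is_min_def)
qed

lemma is_min_from_exists:
 assumes "n > 0" "aa <= 2*pi * of_int m/real n" "2*pi * of_int m/real n <= bb"
 obtains x where "is_min_from n m x" "x 0 = t" proof -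
 obtain x where x: "conf n m x" "x 0 = t"
  "!!y. conf n m y ==> t <= y 0 ==> y 0 <= t ==> action n x <= action n y"
  by (rule minimizer_exists[OF conf_linear[OF assms, of t], of t t]) auto
 thus thesis using that[of x] by (simp add: is_min_from_def)
qed

lemma is_min_shift:
 assumes "is_min n m x"
 shows "is_min n m (%k. x (k + i))" proof -
 have "conf n m x" using assms by (simp add: is_min_def)
 thus ?thesis using assms conf_shift action_shift by (simp add: is_min_def)
qed

lemma is_min_trans:
 assumes "is_min n m x"
 shows "is_min n m (%k. x k + 2*pi * of_int j)" proof -
 have "conf n m x" using assms by (simp add: is_min_def)
 thus ?thesis using assms conf_trans action_trans by (simp add: is_min_def)
qed

lemma is_min_max:
 assumes "is_min n m x" "is_min n m y"
 shows "is_min n m (%k. max (x k) (y k))" proof -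
 have c: "conf n m x" "conf n m y" using assms by (auto simp: is_min_def)
 have "action n x <= action n (%k. min (x k) (y k))" using assms c conf_min unfolding is_min_def by blast
 hence "action n (%k. max (x k) (y k)) <= action n y" using action_max_min[OF c] by linarith
 thus ?thesis using assms conf_max[OF c] unfolding is_min_def by (meson order_trans)
qed

lemma is_min_Max:
 assumes "finite I" "I ~= {}" "!!i. i : I ==> is_min n m (X i)"
 shows "is_min n m (%k. Max ((%i. X i k) ` I))" using assms proof (induction I rule: finite_ne_induct)
 case (insert i I)
 have "Max ((%i. X i k) ` insert i I) = max (X i k) (Max ((%i. X i k) ` I))" for k using insert.hyps by simp
 thus ?case using is_min_max insert by simp
qed simp

text \<open>The supremum of the translates of a minimizer lying to its left is again a minimizer by
  submodularity, and it is comparable with all its translates.\<close>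

lemma ordered_min_exists:
 assumes n: "n > 0" and "aa <= 2*pi * of_int m/real n" "2*pi * of_int m/real n <= bb"
 obtains y where "is_min n m y" "!!k i. abs (y (k + i) - y k - real i*(2*pi * of_int m/real n)) <= 2*pi"
proof -
 obtain x where x: "is_min n m x" using is_min_exists[OF assms] .
 hence cx: "conf n m x" by (simp add: is_min_def)
 define rh where "rh = of_int m/real n"
 have rhn: "real n*rh = of_int m" using n by (simp add: rh_def)
 \<comment> \<open>Rounding up subtracts at least the average advance \<open>2*pi*i*rh\<close> of
   \<open>i\<close> steps. Since \<open>n*rh\<close> is an integer, \<open>v\<close> has period
   \<open>n\<close> in \<open>i\<close>, so the maximum over \<open>{..<n}\<close> dominates all
   these translates.\<close>
 define v where "v i k = x (k + i) + 2*pi * of_int (- \<lceil>real i*rh\<rceil>)" for i k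
 define y where "y k = Max ((%i. v i k) ` {..<n})" for k
 have "is_min n m (%k. v i k)" for i unfolding v_def by (intro is_min_trans is_min_shift x)
 hence y: "is_min n m y" unfolding y_def using n by (intro is_min_Max) auto
 hence cy: "conf n m y" by (simp add: is_min_def)
 have v_per: "v (i + n*q) k = v i k" for i q k proof -
  have "real (i + n*q)*rh = real i*rh + of_int (m*int q)" using rhn by (simp add: algebra_simps)
  hence "\<lceil>real (i + n*q)*rh\<rceil> = \<lceil>real i*rh\<rceil> + m*int q" by (metis ceiling_add_of_int)
  moreover have "x (k + (i + n*q)) = x (k + i) + 2*pi * of_int m*real q"
   using conf_mult[OF cx, of "k + i" q] by (simp add: add.assoc)
  ultimately show ?thesis by (simp add: v_def algebra_simps)
 qed
 have le: "v i k <= y k" for i k proof -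
  have "v i k = v (i mod n) k" using v_per[of "i mod n" "i div n" k] by simp
  thus ?thesis using n by (simp add: y_def)
 qed
 \<comment> \<open>Subadditivity of rounding up turns a translate competing at \<open>k + i\<close>
   into one competing at \<open>k\<close>.\<close>
 have up: "y (k + i) <= y k + 2*pi * of_int \<lceil>real i*rh\<rceil>" for k i proof -
  have "Max ((%j. v j (k + i)) ` {..<n}) : (%j. v j (k + i)) ` {..<n}" using n by (intro Max_in) auto
  then obtain j where j: "y (k + i) = v j (k + i)" by (auto simp: y_def)
  have "\<lceil>real (i + j)*rh\<rceil> <= \<lceil>real i*rh\<rceil> + \<lceil>real j*rh\<rceil>"
   by (simp add: distrib_right ceiling_add_le)
  hence "2*pi * of_int \<lceil>real (i + j)*rh\<rceil> <= 2*pi * of_int (\<lceil>real i*rh\<rceil> + \<lceil>real j*rh\<rceil>)"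
   by (intro mult_left_mono) (simp_all only: of_int_le_iff, simp)
  hence "v j (k + i) <= v (i + j) k + 2*pi * of_int \<lceil>real i*rh\<rceil>"
   by (simp add: v_def algebra_simps)
  thus ?thesis using j le[of "i + j" k] by linarith
 qed
 have "abs (y (k + i) - y k - real i*(2*pi * of_int m/real n)) <= 2*pi" for k i proof -
  have eq: "real i*(2*pi * of_int m/real n) = 2*pi*(real i*rh)" by (simp add: rh_def)
  have "2*pi * of_int \<lceil>real i*rh\<rceil> <= 2*pi*(real i*rh + 1)"
   by (intro mult_left_mono) (linarith, simp)
  hence 1: "y (k + i) - y k - 2*pi*(real i*rh) <= 2*pi" using up[of k i] by (simp add: distrib_left)
  \<comment> \<open>The opposite inequality is the upper bound over the \<open>j\<close> steps that
    complete \<open>i\<close> steps to \<open>i\<close> full periods.\<close>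
  define j where "j = n*i - i"
  have ij: "i + j = n*i" "real j = real n*real i - real i" using n by (simp_all add: j_def of_nat_diff)
  have "real j*rh = real i*(real n*rh) - real i*rh" unfolding ij(2) by (simp add: algebra_simps)
  hence "real j*rh = of_int (m*int i) - real i*rh" unfolding rhn by simp
  hence "of_int \<lceil>real j*rh\<rceil> <= real_of_int m*real i - real i*rh + 1" by simp
  hence "2*pi * of_int \<lceil>real j*rh\<rceil> <= 2*pi*(of_int m*real i - real i*rh + 1)"
   by (intro mult_left_mono) auto
  moreover have "y (k + i + j) = y k + 2*pi * of_int m*real i"
   using conf_mult[OF cy, of k i] ij by (simp add: add.assoc)
  ultimately have "y k - y (k + i) + 2*pi*(real i*rh) <= 2*pi"
   using up[of "k + i" j] by (simp add: algebra_simps)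
  thus ?thesis using 1 eq by (simp add: abs_le_iff)
 qed
 thus thesis using that y by blast
qed

text \<open>Moving a whole residue class modulo \<open>n\<close> preserves periodicity. Only classes
  \<open>Suc j < n\<close> are moved, so the starting point stays fixed and minimizers with
  prescribed start can be tested too.\<close>

definition vary :: "nat => nat => real => (nat => real) => nat => real" where
 "vary n j t x k = (if k mod n = j then x k + t else x k)"

lemma vary_conf:
 assumes c: "conf n m x" and j: "Suc j < n" and s: "aa <= x (Suc j) + t - x j" "x (Suc j) + t - x j <= bb"
   "aa <= x (Suc (Suc j)) - (x (Suc j) + t)" "x (Suc (Suc j)) - (x (Suc j) + t) <= bb"
 shows "conf n m (vary n (Suc j) t x)" proof -
 have inc: "x (k + n*q) = x k + 2*pi * of_int m*real q" for k q using conf_mult[OF c] .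
 have "aa <= vary n (Suc j) t x (Suc k) - vary n (Suc j) t x k &
    vary n (Suc j) t x (Suc k) - vary n (Suc j) t x k <= bb" for k proof -
  define i q where "i = k mod n" and "q = k div n"
  have k: "k = i + n*q" "i < n" using j by (simp_all add: i_def q_def)
  have xk: "x k = x i + 2*pi * of_int m*real q" "x (Suc k) = x (Suc i) + 2*pi * of_int m*real q"
   using inc[of i q] inc[of "Suc i" q] k by auto
  consider "i = Suc j" | "i = j" | "i ~= Suc j" "i ~= j" by blast
  thus ?thesis proof cases
   case 1
   hence "Suc k mod n ~= Suc j" using k j by (simp add: mod_Suc)
   thus ?thesis using 1 s xk by (simp add: vary_def i_def[symmetric] algebra_simps)
  next
   case 2
   hence "Suc k mod n = Suc j" using k j by (simp add: mod_Suc)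
   thus ?thesis using 2 s xk by (simp add: vary_def i_def[symmetric] algebra_simps)
  next
   case 3
   hence "Suc k mod n ~= Suc j" using k j by (simp add: mod_Suc)
   thus ?thesis using 3 confD[OF c] by (simp add: vary_def i_def[symmetric])
  qed
 qed
 moreover have "vary n (Suc j) t x (k + n) = vary n (Suc j) t x k + 2*pi * of_int m" for k
  using confD(3)[OF c] by (simp add: vary_def)
 ultimately show ?thesis by (simp add: conf_def)
qed

lemma vary_action:
 assumes j: "Suc j < n"
 shows "action n (vary n (Suc j) t x) = action n x
   + (H (x j) (x (Suc j) + t) + H (x (Suc j) + t) (x (Suc (Suc j))))
   - (H (x j) (x (Suc j)) + H (x (Suc j)) (x (Suc (Suc j))))" proof -
 let ?v = "vary n (Suc j) t x"
 have split: "action n z = (SUM k:{..<n} - {j, Suc j}. H (z k) (z (Suc k)))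
   + (H (z j) (z (Suc j)) + H (z (Suc j)) (z (Suc (Suc j))))" for z unfolding action_def using j
  by (subst sum.subset_diff[of "{j, Suc j}"]) auto
 have "?v k = x k" if "k ~= Suc j" "k <= n" for k using that j by (cases "k = n") (auto simp: vary_def)
 hence "?v j = x j" "?v (Suc (Suc j)) = x (Suc (Suc j))"
  "(SUM k:{..<n} - {j, Suc j}. H (?v k) (?v (Suc k))) = (SUM k:{..<n} - {j, Suc j}. H (x k) (x (Suc k)))"
  using j by (auto intro!: sum.cong)
 moreover have "?v (Suc j) = x (Suc j) + t" using j by (simp add: vary_def)
 ultimately show ?thesis by (simp add: split[of ?v] split[of x])
qed

text \<open>First variation under a constraint: each direction \<open>sg\<close> in which the point
  may move a little without violating the bounds on the steps contributes one inequality.\<close>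

lemma min_from_one_sided:
 assumes x: "is_min_from n m x" and j: "Suc j < n" and "sg : {1, -1::real}"
  and s: "EX de>0. ALL t:{0..de}. aa <= x (Suc j) + sg*t - x j & x (Suc j) + sg*t - x j <= bb &
   aa <= x (Suc (Suc j)) - (x (Suc j) + sg*t) & x (Suc (Suc j)) - (x (Suc j) + sg*t) <= bb"
 shows "0 <= sg*(b (x j) (x (Suc j)) + a (x (Suc j)) (x (Suc (Suc j))))" proof (rule ccontr)
 let ?ps = "%t. H (x j) (x (Suc j) + sg*t) + H (x (Suc j) + sg*t) (x (Suc (Suc j)))"
 let ?D = "sg*(b (x j) (x (Suc j)) + a (x (Suc j)) (x (Suc (Suc j))))"
 assume "~ 0 <= ?D"
 hence neg: "?D < 0" by simp
 have c: "conf n m x" using x by (simp add: is_min_from_def)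
 obtain de where de: "de > 0" "!!t. 0 <= t ==> t <= de ==> conf n m (vary n (Suc j) (sg*t) x)"
  using s vary_conf[OF c j] by fastforce
 have d1: "((%t. x (Suc j) + sg*t) has_real_derivative sg) (at 0)" by (auto intro!: derivative_eq_intros)
 have "((%t. H (x j) (x (Suc j) + sg*t)) has_real_derivative
   a (x j) (x (Suc j) + sg*0)*0 + b (x j) (x (Suc j) + sg*0) * sg) (at 0)"
  by (rule H_deriv_along[OF _ _ _ d1]) (use confD[OF c] in auto)
 moreover have "((%t. H (x (Suc j) + sg*t) (x (Suc (Suc j)))) has_real_derivative
   a (x (Suc j) + sg*0) (x (Suc (Suc j))) * sg + b (x (Suc j) + sg*0) (x (Suc (Suc j)))*0) (at 0)"
  by (rule H_deriv_along[OF _ _ d1]) (use confD[OF c] in auto)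
 ultimately have "(?ps has_real_derivative (b (x j) (x (Suc j)) * sg + a (x (Suc j)) (x (Suc (Suc j))) * sg)) (at 0)"
  using DERIV_add by fastforce
 hence "(?ps has_real_derivative ?D) (at 0)" by (simp add: algebra_simps)
 from DERIV_neg_dec_right[OF this neg] obtain d where
  d: "d > 0" "!!h. 0 < h ==> h < d ==> ?ps (0 + h) < ?ps 0" by auto
 define h where "h = min (d/2) de"
 have h: "0 < h" "h < d" "h <= de" using d de by (auto simp: h_def min_def)
 have "vary n (Suc j) (sg*h) x 0 = x 0" by (simp add: vary_def)
 hence "action n x <= action n (vary n (Suc j) (sg*h) x)" using x de(2)[of h] h by (simp add: is_min_from_def)
 thus False using d(2)[OF h(1,2)] vary_action[OF j, of "sg*h" x] by simp
qed

text \<open>This holds even where the constraint is active. If the second step is the longer one,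
  moving the middle point forward makes the steps more equal, so it is admissible, and the resulting
  inequality bounds the increase of \<open>g\<close>; the other bound is monotonicity of
  \<open>g\<close>.\<close>

lemma min_from_slow:
 assumes x: "is_min_from n m x" and j: "Suc j < n"
 shows "abs (g (x (Suc (Suc j)) - x (Suc j)) - g (x (Suc j) - x j)) <= 2*et" proof -
 have c: "conf n m x" using x by (simp add: is_min_from_def)
 let ?d = "x (Suc j) - x j" and ?e = "x (Suc (Suc j)) - x (Suc j)"
 have cl: "abs (b (x j) (x (Suc j)) - g ?d) <= et" "abs (a (x (Suc j)) (x (Suc (Suc j))) + g ?e) <= et"
  using confD[OF c] by (auto intro!: a_close b_close)
 consider "?d < ?e" | "?e < ?d" | "?d = ?e" by linarith
 thus ?thesis proof cases
  case 1
  \<comment> \<open>Displacements up to the difference of the two steps keep both steps between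
    their old values.\<close>
  have "0 <= 1*(b (x j) (x (Suc j)) + a (x (Suc j)) (x (Suc (Suc j))))"
   by (rule min_from_one_sided[OF x j]) (use 1 confD(1,2)[OF c, of j] confD(1,2)[OF c, of "Suc j"]
    in \<open>auto intro!: exI[of _ "?e - ?d"]\<close>)
  moreover have "g ?d < g ?e" using 1 confD(1,2)[OF c, of j] confD(1,2)[OF c, of "Suc j"] by (intro g_less)
  ultimately show ?thesis using cl by (simp add: abs_le_iff)
 next
  case 3
  show ?thesis unfolding 3 using eta_nonneg by simp
 next
  case 2
  have "0 <= (-1)*(b (x j) (x (Suc j)) + a (x (Suc j)) (x (Suc (Suc j))))"
   by (rule min_from_one_sided[OF x j]) (use 2 confD(1,2)[OF c, of j] confD(1,2)[OF c, of "Suc j"]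
    in \<open>auto intro!: exI[of _ "?d - ?e"]\<close>)
  moreover have "g ?e < g ?d" using 2 confD(1,2)[OF c, of j] confD(1,2)[OF c, of "Suc j"] by (intro g_less)
  ultimately show ?thesis using cl by (simp add: abs_le_iff)
 qed
qed

lemma min_from_stationary:
 assumes x: "is_min_from n m x" and j: "Suc j < n" and s: "aa < x (Suc j) - x j" "x (Suc j) - x j < bb"
   "aa < x (Suc (Suc j)) - x (Suc j)" "x (Suc (Suc j)) - x (Suc j) < bb"
 shows "stationary_at x j" proof -
 let ?d = "x (Suc j) - x j" and ?e = "x (Suc (Suc j)) - x (Suc j)"
 define de where "de = Min {?d - aa, bb - ?d, ?e - aa, bb - ?e}"
 have de: "de > 0" "de <= ?d - aa" "de <= bb - ?d" "de <= ?e - aa" "de <= bb - ?e"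
  using s by (auto simp: de_def)
 have "0 <= sg*(b (x j) (x (Suc j)) + a (x (Suc j)) (x (Suc (Suc j))))" if "sg : {1, -1}" for sg
  by (rule min_from_one_sided[OF x j that]) (use de that in "auto intro!: exI[of _ de]")
 from this[of 1] this[of "-1"] show ?thesis by (simp add: stationary_at_def)
qed

end

section \<open>Stationary configurations of every rotation number\<close>

lemma slow_variation:
 fixes u :: "nat => real"
 assumes "!!j. i <= j ==> j < k ==> abs (u (Suc j) - u j) <= e" "i <= k"
 shows "abs (u k - u i) <= e*real (k - i)" using assms(2,1) proof (induction k rule: dec_induct)
 case (step k)
 have "abs (u k - u i) <= e*real (k - i)" using step by simp
 moreover have "abs (u (Suc k) - u k) <= e" using step by simp
 ultimately show ?case using step.hyps by (simp add: Suc_diff_le algebra_simps)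
qed simp

context near_integrable begin

lemma conf_per_incr: "conf n m x ==> x (Suc (k + n)) - x (k + n) = x (Suc k) - x k"
 using confD(3)[of n m x k] confD(3)[of n m x "Suc k"] by simp

lemma conf_incr_mod: "conf n m x ==> x (Suc k) - x k = x (Suc (k mod n)) - x (k mod n)"
 using conf_mult[of n m x "k mod n" "k div n"] conf_mult[of n m x "Suc (k mod n)" "k div n"] by simp

lemma stationary_at_per:
 assumes c: "conf n m x" and "aa < bb"
 shows "stationary_at x (k + n*q) = stationary_at x k" proof -
 have i: "x (i + n*q) = x i + 2*pi * of_int (m*int q)" for i using conf_mult[OF c] by simp
 have "a (x (Suc (k + n*q))) (x (Suc (Suc (k + n*q)))) = a (x (Suc k)) (x (Suc (Suc k)))"
  using i[of "Suc k"] i[of "Suc (Suc k)"] ab_per_int(1)[OF confD(1,2)[OF c, of "Suc k"] assms(2), of "m*int q"]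
  by (simp del: of_int_mult)
 moreover have "b (x (k + n*q)) (x (Suc (k + n*q))) = b (x k) (x (Suc k))"
  using i[of k] i[of "Suc k"] ab_per_int(2)[OF confD(1,2)[OF c, of k] assms(2), of "m*int q"]
  by (simp del: of_int_mult)
 ultimately show ?thesis by (simp add: stationary_at_def)
qed

text \<open>The derivative of the action under rigid translation; by periodicity it is also the sum
  of the Euler-Lagrange expressions over one period.\<close>

definition drift :: "nat => (nat => real) => real" where
 "drift n x = (SUM k<n. a (x k) (x (Suc k)) + b (x k) (x (Suc k)))"

lemma action_trans_deriv:
 assumes "conf n m x"
 shows "((%t. action n (%k. x k + t)) has_real_derivative drift n (%k. x k + t)) (at t)" proof -
 have "((%t. H (x k + t) (x (Suc k) + t)) has_real_derivative
   a (x k + t) (x (Suc k) + t)*1 + b (x k + t) (x (Suc k) + t)*1) (at t)" for k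
  by (rule H_deriv_along) (use confD[OF assms] in "auto intro!: derivative_eq_intros")
 thus ?thesis unfolding action_def drift_def by (intro DERIV_sum) simp
qed

text \<open>Variations with fixed start miss the equation at the base point. The \<open>n\<close>
  equations of one period add up to \<open>drift\<close>, so the missing one follows.\<close>

lemma all_stationary:
 assumes c: "conf n m x" and n: "n > 0" and "aa < bb"
  and st: "!!j. Suc j < n ==> stationary_at x j" and d: "drift n x = 0"
 shows "stationary_at x k" proof -
 let ?a = "%k. a (x k) (x (Suc k))" and ?b = "%k. b (x k) (x (Suc k))"
 have "?a n = ?a 0"
  using confD(3)[OF c, of 0] confD(3)[OF c, of 1] ab_per_int(1)[OF confD(1,2)[OF c, of 0] assms(3), of m]
  by simp
 moreover have "(SUM k<n. ?a (Suc k)) + ?a 0 = (SUM k<n. ?a k) + ?a n"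
  using sum.lessThan_Suc_shift[of ?a n] by simp
 ultimately have "(SUM k<n. ?b k + ?a (Suc k)) = drift n x" by (simp add: drift_def sum.distrib)
 moreover have "(SUM k<n. ?b k + ?a (Suc k)) = ?b (n - 1) + ?a (Suc (n - 1)) + (SUM k:{..<n} - {n - 1}. ?b k + ?a (Suc k))"
  using n by (subst sum.remove[of _ "n - 1"]) auto
 moreover have "(SUM k:{..<n} - {n - 1}. ?b k + ?a (Suc k)) = 0" proof (intro sum.neutral ballI)
  fix k assume "k : {..<n} - {n - 1}"
  hence "Suc k < n" by auto
  thus "?b k + ?a (Suc k) = 0" using st by (simp add: stationary_at_def)
 qed
 ultimately have "stationary_at x (n - 1)" using d by (simp add: stationary_at_def)
 hence "stationary_at x j" if "j < n" for j
  using st[of j] that by (cases "Suc j < n") (auto dest: less_antisym Suc_lessI)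
 hence "stationary_at x (k mod n)" using n by simp
 thus ?thesis using stationary_at_per[OF c assms(3), of "k mod n" "k div n"] by simp
qed

lemma is_min_drift:
 assumes x: "is_min n m x"
 shows "drift n x = 0" proof -
 have c: "conf n m x" using x by (simp add: is_min_def)
 have "action n (%k. x k + 0) <= action n (%k. x k + t)" for t
  using x conf_trans[OF c] by (simp add: is_min_def)
 thus ?thesis using DERIV_local_min[OF action_trans_deriv[OF c, of 0], of 1] by simp
qed

lemma is_min_slow:
 assumes x: "is_min n m x" and n: "n > 0"
 \<comment> \<open>For \<open>n = 1\<close> all steps are equal; otherwise a shift moves index
   \<open>k\<close> to \<open>0\<close>, away from the pinned base point.\<close>
 shows "abs (g (x (Suc (Suc k)) - x (Suc k)) - g (x (Suc k) - x k)) <= 2*et" proof (cases "n = 1")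
 case True
 have c: "conf n m x" using x by (simp add: is_min_def)
 show ?thesis using conf_per_incr[OF c, of k] True eta_nonneg by simp
next
 case False
 thus ?thesis using min_from_slow[OF is_min_imp_from[OF is_min_shift[OF x, of k]], of 0] n by simp
qed

lemma is_min_stationary:
 assumes x: "is_min n m x" and n: "n > 0" and s: "!!k. aa < x (Suc k) - x k & x (Suc k) - x k < bb"
 shows "stationary_at x k" proof (rule all_stationary)
 show "conf n m x" using x by (simp add: is_min_def)
 show "aa < bb" using s[of 0] by linarith
 show "stationary_at x j" if "Suc j < n" for j
  using min_from_stationary[OF is_min_imp_from[OF x] that] s by blast
qed (use n is_min_drift[OF x] in auto)

text \<open>By slow variation a step too long by \<open>de\<close> is followed by steps too long by
  \<open>de/2\<close>, \<open>N\<close> of them in all. Their excess \<open>N*de/2 > 2*pi\<close>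
  over the uniform rotation contradicts the order. As \<open>N\<close> depends only on
  \<open>de\<close>, the smallness of \<open>et\<close> does not depend on \<open>n\<close>.\<close>

lemma ordered_min_close:
 assumes x: "is_min n m x" and n: "n > 0" and ord: "!!k i. abs (x (k + i) - x k - real i*rh) <= 2*pi"
  and de: "aa <= rh - de" "rh + de <= bb" "de > 0" and N: "4*pi < real N*de" "4*et*real N <= c*de"
 shows "abs (x (Suc k) - x k - rh) <= de" proof -
 have c: "conf n m x" using x by (simp add: is_min_def)
 let ?d = "%k. x (Suc k) - x k"
 have d: "aa <= ?d k" "?d k <= bb" for k using confD[OF c] by auto
 have slow: "abs (g (?d (k + i)) - g (?d k)) <= c*(de/2)" if "i < N" for i proof -
  have "abs (g (?d (k + i)) - g (?d k)) <= 2*et*real (k + i - k)"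
   by (rule slow_variation[of k "k + i" "%k. g (?d k)"]) (use is_min_slow[OF x n] in auto)
  also have "... <= 2*et*real N" using that eta_nonneg by (intro mult_left_mono) auto
  finally show ?thesis using N(2) by simp
 qed
 have tele: "(SUM i<N. ?d (k + i)) = x (k + N) - x k"
  using sum_lessThan_telescope[of "%i. x (k + i)" N] by simp
 show ?thesis proof (rule ccontr)
  assume "~ ?thesis"
  then consider "?d k > rh + de" | "?d k < rh - de" by linarith
  thus False proof cases
   case 1
   have "rh + de/2 <= ?d (k + i)" if "i < N" for i proof (rule ccontr)
    assume "~ ?thesis"
    hence "g (?d (k + i)) < g (rh + de/2)" using d[of "k + i"] de by (intro g_less) auto
    moreover have "g (rh + de) < g (?d k)" using 1 d[of k] de by (intro g_less) auto
    moreover have "c*(de/2) <= g (rh + de) - g (rh + de/2)" using de g_mono[of "rh + de/2" "rh + de"] by simp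
    ultimately show False using slow[OF that] by linarith
   qed
   hence "(SUM i<N. rh + de/2) <= (SUM i<N. ?d (k + i))" by (intro sum_mono) auto
   hence "real N*rh + real N*de/2 <= x (k + N) - x k" unfolding tele by (simp add: algebra_simps)
   thus False using ord[of k N] N by linarith
  next
   case 2
   have "?d (k + i) <= rh - de/2" if "i < N" for i proof (rule ccontr)
    assume "~ ?thesis"
    hence "g (rh - de/2) < g (?d (k + i))" using d[of "k + i"] de by (intro g_less) auto
    moreover have "g (?d k) < g (rh - de)" using 2 d[of k] de by (intro g_less) auto
    moreover have "c*(de/2) <= g (rh - de/2) - g (rh - de)" using de g_mono[of "rh - de" "rh - de/2"] by simp
    ultimately show False using slow[OF that] by linarith
   qed
   hence "(SUM i<N. ?d (k + i)) <= (SUM i<N. rh - de/2)" by (intro sum_mono) auto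
   hence "x (k + N) - x k <= real N*rh - real N*de/2" unfolding tele by (simp add: algebra_simps)
   thus False using ord[of k N] N by linarith
  qed
 qed
qed

lemma periodic_stationary_exists:
 assumes n: "n > 0" and rh: "rh = 2*pi * of_int m/real n"
  and de: "aa < rh - de" "rh + de < bb" "de > 0" and N: "4*pi < real N*de" "4*et*real N <= c*de"
 obtains x where "conf n m x" "!!k. stationary_at x k" "!!k. abs (x (Suc k) - x k - rh) <= de"
  "!!k i. abs (x (k + i) - x k - real i*rh) <= 2*pi" proof -
 obtain x where x: "is_min n m x" "!!k i. abs (x (k + i) - x k - real i*rh) <= 2*pi"
  unfolding rh by (rule ordered_min_exists[OF n]) (use de rh in auto)
 have cl: "abs (x (Suc k) - x k - rh) <= de" for k
  by (rule ordered_min_close[OF x(1) n x(2)]) (use de N in auto)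
 have "aa < x (Suc k) - x k & x (Suc k) - x k < bb" for k using cl[of k] de by linarith
 hence "stationary_at x k" for k by (rule is_min_stationary[OF x(1) n])
 thus thesis using that[of x] x cl by (simp add: is_min_def)
qed

text \<open>Stationarity, closeness of the steps to the rotation number and the deviation bound are
  closed conditions with constants independent of the period, so they survive in a limit of periodic
  configurations.\<close>

lemma stationary_exists:
 assumes de: "aa < rh - de" "rh + de < bb" "de > 0" and N: "4*pi < real N*de" "4*et*real N <= c*de"
 obtains x where "!!k. stationary_at x k" "!!k. abs (x (Suc k) - x k - rh) <= de"
  "!!i. abs (x i - x 0 - real i*rh) <= 2*pi" proof -
 \<comment> \<open>Rational multiples of \<open>2*pi\<close> tending to \<open>rh\<close> from
   below, so that only the lower edge of the strip requires a large index.\<close>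
 define r where "r j = 2*pi * of_int \<lfloor>rh/(2*pi)*real (Suc j)\<rfloor> / real (Suc j)" for j
 have r: "rh - 2*pi/real (Suc j) <= r j" "r j <= rh" for j proof -
  have 1: "of_int \<lfloor>rh/(2*pi)*real (Suc j)\<rfloor> <= rh/(2*pi)*real (Suc j)"
   "rh/(2*pi)*real (Suc j) - 1 <= of_int \<lfloor>rh/(2*pi)*real (Suc j)\<rfloor>" by linarith+
  have "rh - 2*pi/real (Suc j) = 2*pi*(rh/(2*pi)*real (Suc j) - 1)/real (Suc j)" proof -
   have "2*pi*(rh/(2*pi) * s - 1)/s = rh - 2*pi/s" if "s > 0" for s using that by (simp add: field_simps)
   thus ?thesis by simp
  qed
  also have "... <= r j" unfolding r_def by (intro divide_right_mono mult_left_mono 1) auto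
  finally show "rh - 2*pi/real (Suc j) <= r j" .
  have "r j <= 2*pi*(rh/(2*pi)*real (Suc j))/real (Suc j)"
   unfolding r_def by (intro divide_right_mono mult_left_mono 1) auto
  also have "... = rh" by simp
  finally show "r j <= rh" .
 qed
 have lim0: "(%j. rh - 2*pi/real (Suc j)) \<longlonglongrightarrow> rh - 2*pi*0"
  using LIMSEQ_inverse_real_of_nat
  by (intro tendsto_diff tendsto_const) (auto intro!: tendsto_mult_right_zero simp: divide_inverse)
 have rlim: "r \<longlonglongrightarrow> rh"
  by (rule tendsto_sandwich[OF _ _ lim0[simplified] tendsto_const]) (use r in auto)
 have "\<forall>\<^sub>F j in sequentially. aa + de < r j" by (rule order_tendstoD[OF rlim]) (use de in auto)
 then obtain J where J: "!!j. j >= J ==> aa + de < r j" by (auto simp: eventually_sequentially)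
 have "EX x. (ALL k. stationary_at x k) & (ALL k. abs (x (Suc k) - x k - r (J + j)) <= de) &
   (ALL k i. abs (x (k + i) - x k - real i*r (J + j)) <= 2*pi) & (ALL k. aa <= x (Suc k) - x k & x (Suc k) - x k <= bb)
   & 0 <= x 0 & x 0 <= 2*pi" for j proof -
  obtain n m where nm: "n > 0" "r (J + j) = 2*pi * of_int m/real n"
   using r_def[of "J + j"] zero_less_Suc by blast
  obtain x where x: "conf n m x" "!!k. stationary_at x k" "!!k. abs (x (Suc k) - x k - r (J + j)) <= de"
   "!!k i. abs (x (k + i) - x k - real i*r (J + j)) <= 2*pi"
   by (rule periodic_stationary_exists[OF nm, of de N]) (use J[of "J + j"] r(2)[of "J + j"] de N in auto)
  \<comment> \<open>The starting points are brought into one period, which makes the family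
    compact.\<close>
  define l where "l = - \<lfloor>x 0/(2*pi)\<rfloor>"
  have "of_int \<lfloor>x 0/(2*pi)\<rfloor> <= x 0/(2*pi)" "x 0/(2*pi) <= of_int \<lfloor>x 0/(2*pi)\<rfloor> + 1"
   by linarith+
  hence "of_int \<lfloor>x 0/(2*pi)\<rfloor> * (2*pi) <= x 0" "x 0 <= (of_int \<lfloor>x 0/(2*pi)\<rfloor> + 1)*(2*pi)"
   by (simp_all only: pos_le_divide_eq pos_divide_le_eq pi_gt_zero mult_pos_pos zero_less_numeral)
  hence "0 <= x 0 + 2*pi * of_int l" "x 0 + 2*pi * of_int l <= 2*pi" by (simp_all add: l_def algebra_simps)
  moreover have "stationary_at (%k. x k + 2*pi * of_int l) k" for k
   using x(2)[of k] confD(1,2)[OF x(1), of k] confD(1,2)[OF x(1), of "Suc k"] de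
   by (simp add: stationary_at_def ab_per_int)
  ultimately show ?thesis using x confD[OF x(1)] by (intro exI[of _ "%k. x k + 2*pi * of_int l"]) auto
 qed
 hence "ALL j. EX x. (ALL k. stationary_at x k) & (ALL k. abs (x (Suc k) - x k - r (J + j)) <= de) &
   (ALL k i. abs (x (k + i) - x k - real i*r (J + j)) <= 2*pi) & (ALL k. aa <= x (Suc k) - x k & x (Suc k) - x k <= bb)
   & 0 <= x 0 & x 0 <= 2*pi" by blast
 from choice[OF this] obtain X where X: "!!j k. stationary_at (X j) k"
  "!!j k. abs (X j (Suc k) - X j k - r (J + j)) <= de"
  "!!j k i. abs (X j (k + i) - X j k - real i*r (J + j)) <= 2*pi"
  "!!j k. aa <= X j (Suc k) - X j k" "!!j k. X j (Suc k) - X j k <= bb" "!!j. 0 <= X j 0" "!!j. X j 0 <= 2*pi"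
  by blast
 have bounds: "aa*real k <= X j k" "X j k <= 2*pi + bb*real k" for j k proof (induction k)
  case (Suc k)
  case 1 show ?case using Suc(1) X(4)[of j k] by (simp add: algebra_simps)
  case 2 show ?case using Suc(2) X(5)[where j=j and k=k] by (simp add: algebra_simps)
 qed (use X(6,7) in auto)
 obtain s x where s: "strict_mono s" "!!k. (%j. X (s j) k) \<longlonglongrightarrow> x k"
  by (rule box_convergent_subseq[of "%k. aa*real k" X "%k. 2*pi + bb*real k", OF bounds])
   (rule that; assumption)
 have rs: "(%j. r (J + s j)) \<longlonglongrightarrow> rh"
  using LIMSEQ_subseq_LIMSEQ[OF LIMSEQ_ignore_initial_segment[OF rlim, of J] s(1)]
  by (simp add: o_def add.commute)
 have lo: "aa <= x (Suc k) - x k" for k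
  by (rule tendsto_lowerbound[OF tendsto_diff[OF s(2,2)]]) (use X(4) in auto)
 have hi: "x (Suc k) - x k <= bb" for k
  by (rule tendsto_upperbound[OF tendsto_diff[OF s(2,2)]]) (use X(5) in auto)
 have "abs (x (Suc k) - x k - rh) <= de" for k
  by (rule tendsto_upperbound[OF tendsto_rabs[OF tendsto_diff[OF tendsto_diff[OF s(2,2)] rs]]]) (use X(2) in auto)
 moreover have "abs (x i - x 0 - real i*rh) <= 2*pi" for i
  by (rule tendsto_upperbound[OF tendsto_rabs[OF tendsto_diff[OF tendsto_diff[OF s(2,2)] tendsto_mult[OF tendsto_const rs]]]])
   (use X(3)[where k=0] in auto)
 moreover have "stationary_at x k" for k proof -
  have "(%j. b (X (s j) k) (X (s j) (Suc k)) + a (X (s j) (Suc k)) (X (s j) (Suc (Suc k))))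
   \<longlonglongrightarrow> b (x k) (x (Suc k)) + a (x (Suc k)) (x (Suc (Suc k)))"
   by (intro tendsto_add ab_tendsto s(2) lo hi X(4,5))
  moreover have "b (X (s j) k) (X (s j) (Suc k)) + a (X (s j) (Suc k)) (X (s j) (Suc (Suc k))) = 0" for j
   using X(1) by (simp add: stationary_at_def)
  ultimately show ?thesis by (simp add: stationary_at_def LIMSEQ_const_iff)
 qed
 ultimately show thesis using that by blast
qed

end

section \<open>Minimax configurations\<close>

text \<open>A discrete Poincare inequality: Cauchy-Schwarz applied to the telescoping sum for
  \<open>v k\<close>.\<close>

lemma sum_squares_le_increments:
 fixes v :: "nat => real"
 assumes "v 0 = 0"
 shows "(SUM k<=n. (v k)^2) <= real (Suc n)*real n*(SUM k<n. (v (Suc k) - v k)^2)" proof -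
 let ?S = "SUM k<n. (v (Suc k) - v k)^2"
 have "(v k)^2 <= real n*?S" if "k <= n" for k proof -
  have "v k = (SUM i<k. v (Suc i) - v i)" using assms by (simp add: sum_lessThan_telescope)
  hence "(v k)^2 <= real k*(SUM i<k. (v (Suc i) - v i)^2)"
   using Cauchy_Schwarz_ineq_sum[of "%_. 1" "%i. v (Suc i) - v i" "{..<k}"] by simp
  also have "... <= real n*?S" using that by (intro mult_mono sum_mono2 sum_nonneg) auto
  finally show ?thesis .
 qed
 hence "(SUM k<=n. (v k)^2) <= (SUM k<=n. real n*?S)" by (intro sum_mono) auto
 thus ?thesis by (simp add: algebra_simps)
qed

context near_integrable begin

text \<open>Minimizers with prescribed start need not be ordered. Instead, the steps of one period
  average to \<open>rh\<close>, so some step is at most and some at least \<open>rh\<close>, while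
  \<open>g\<close> varies by less than \<open>c*de\<close> within a period. The price is a smallness
  of \<open>et\<close> that depends on \<open>n\<close>.\<close>

lemma min_from_close:
 assumes x: "is_min_from n m x" and n: "n > 0" and rh: "rh = 2*pi * of_int m/real n"
  and de: "aa <= rh - de" "rh + de <= bb" "de > 0" and N: "2*et*real n < c*de"
 shows "abs (x (Suc k) - x k - rh) <= de" proof -
 have c: "conf n m x" using x by (simp add: is_min_from_def)
 let ?d = "%k. x (Suc k) - x k"
 have d: "aa <= ?d k" "?d k <= bb" for k using confD[OF c] by auto
 have slow1: "abs (g (?d k) - g (?d i)) < c*de" if "i <= k" "k < n" for i k proof -
  have "abs (g (?d k) - g (?d i)) <= 2*et*real (k - i)"
   by (rule slow_variation[of i k "%k. g (?d k)"]) (use min_from_slow[OF x] that in auto)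
  also have "... <= 2*et*real n" using that eta_nonneg by (intro mult_left_mono) auto
  finally show ?thesis using N by simp
 qed
 have slow: "abs (g (?d k) - g (?d i)) < c*de" if "i < n" "k < n" for i k
  using slow1[of i k] slow1[of k i] that by (cases "i <= k") (auto simp: abs_minus_commute)
 have tele: "(SUM i<n. ?d i) = real n*rh"
  using sum_lessThan_telescope[of x n] confD(3)[OF c, of 0] n rh by simp
 have main: "abs (?d k - rh) <= de" if k: "k < n" for k proof (rule ccontr)
  assume "~ ?thesis"
  then consider "?d k > rh + de" | "?d k < rh - de" by linarith
  thus False proof cases
   case 1
   have "EX i<n. ?d i <= rh" proof (rule ccontr)
    assume "~ ?thesis"
    hence "(SUM i<n. rh) < (SUM i<n. ?d i)" using n by (intro sum_strict_mono) auto
    thus False using tele by simp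
   qed
   then obtain i where i: "i < n" "?d i <= rh" by blast
   have "g (?d i) <= g rh" using i d[of i] de g_less[of "?d i" rh] by (cases "?d i = rh") auto
   moreover have "g (rh + de) < g (?d k)" using 1 d[of k] de by (intro g_less) auto
   moreover have "c*de <= g (rh + de) - g rh" using de g_mono[of rh "rh + de"] by simp
   ultimately show False using slow[OF i(1) k] by linarith
  next
   case 2
   have "EX i<n. ?d i >= rh" proof (rule ccontr)
    assume "~ ?thesis"
    hence "(SUM i<n. ?d i) < (SUM i<n. rh)" using n by (intro sum_strict_mono) auto
    thus False using tele by simp
   qed
   then obtain i where i: "i < n" "?d i >= rh" by blast
   have "g rh <= g (?d i)" using i d[of i] de g_less[of rh "?d i"] by (cases "?d i = rh") auto
   moreover have "g (?d k) < g (rh - de)" using 2 d[of k] de by (intro g_less) auto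
   moreover have "c*de <= g rh - g (rh - de)" using de g_mono[of "rh - de" rh] by simp
   ultimately show False using slow[OF i(1) k] by linarith
  qed
 qed
 show ?thesis using main[of "k mod n"] n conf_incr_mod[OF c, of k] by simp
qed

text \<open>Pairing the difference of the two systems of equations with \<open>v = y - x\<close>
  gives zero. By the growth of \<open>g\<close> and the Poincare inequality the same sum is at least
  a positive multiple of the squared increments of \<open>v\<close>, which therefore vanish.\<close>

lemma stationary_unique:
 assumes c: "conf n m x" "conf n m y" and n: "n > 0" and 0: "x 0 = y 0"
  and st: "!!j. Suc j < n ==> stationary_at x j" "!!j. Suc j < n ==> stationary_at y j"
  and small: "4*et*(real (Suc n)*real n) < c"
 shows "x = y" proof -
 define v where "v k = y k - x k" for k
 let ?A = "%k. a (y k) (y (Suc k)) - a (x k) (x (Suc k))"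
 let ?B = "%k. b (y k) (y (Suc k)) - b (x k) (x (Suc k))"
 let ?G = "%k. g (y (Suc k) - y k) - g (x (Suc k) - x k)"
 have v0: "v 0 = 0" and vn: "v n = 0"
  using 0 confD(3)[OF c(1), of 0] confD(3)[OF c(2), of 0] by (auto simp: v_def)
 \<comment> \<open>Summation by parts; the boundary terms vanish because both configurations agree
   at \<open>0\<close> and at \<open>n\<close>.\<close>
 have "(SUM k<n. ?A k * v k + ?B k * v (Suc k)) = (SUM k<n. ?A k * v k) + (SUM k<n. ?B k * v (Suc k))"
  by (rule sum.distrib)
 also have "(SUM k<n. ?A k * v k) = (SUM k<n. ?A (Suc k) * v (Suc k)) - ?A n * v n + ?A 0 * v 0"
  using sum.lessThan_Suc_shift[of "%k. ?A k * v k" n] by simp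
 finally have "(SUM k<n. ?A k * v k + ?B k * v (Suc k)) = (SUM k<n. (?A (Suc k) + ?B k) * v (Suc k))"
  using v0 vn by (simp add: sum.distrib distrib_right)
 also have "... = 0" proof (intro sum.neutral ballI)
  fix k assume "k : {..<n}"
  then consider "Suc k < n" | "Suc k = n" by force
  thus "(?A (Suc k) + ?B k) * v (Suc k) = 0" using st[of k] vn by cases (auto simp: stationary_at_def)
 qed
 finally have zero: "(SUM k<n. ?A k * v k + ?B k * v (Suc k)) = 0" .
 have increment: "c*(v (Suc k) - v k)^2 <= ?A k * v k + ?B k * v (Suc k) + 2*et*((v k)^2 + (v (Suc k))^2)" for k
 proof -
  let ?V = "abs (v k) + abs (v (Suc k))"
  have A: "abs (?A k + ?G k) <= et*?V"
   using a_lip[OF confD(1,2)[OF c(1), of k] confD(1,2)[OF c(2), of k]] by (simp add: v_def algebra_simps)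
  have B: "abs (?B k - ?G k) <= et*?V"
   using b_lip[OF confD(1,2)[OF c(1), of k] confD(1,2)[OF c(2), of k]] by (simp add: v_def algebra_simps)
  have G: "c*(v (Suc k) - v k)^2 <= ?G k*(v (Suc k) - v k)" proof (cases "x (Suc k) - x k <= y (Suc k) - y k")
   case True
   have "c*((y (Suc k) - y k) - (x (Suc k) - x k)) <= ?G k"
    using True confD[OF c(1)] confD[OF c(2)] by (intro g_mono) auto
   hence "c*(v (Suc k) - v k)*(v (Suc k) - v k) <= ?G k*(v (Suc k) - v k)"
    using True by (intro mult_right_mono) (auto simp: v_def algebra_simps)
   thus ?thesis by (simp add: power2_eq_square mult.assoc)
  next
   case False
   have "c*((x (Suc k) - x k) - (y (Suc k) - y k)) <= - ?G k"
    using False g_mono[of "y (Suc k) - y k" "x (Suc k) - x k"] confD[OF c(1)] confD[OF c(2)] by auto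
   hence "c*(v k - v (Suc k))*(v k - v (Suc k)) <= - ?G k*(v k - v (Suc k))"
    using False by (intro mult_right_mono) (auto simp: v_def algebra_simps)
   thus ?thesis by (simp add: square_simps)
  qed
  have "abs ((?A k + ?G k) * v k + (?B k - ?G k) * v (Suc k)) <= et*?V*abs (v k) + et*?V*abs (v (Suc k))"
   using mult_right_mono[OF A, of "abs (v k)"] mult_right_mono[OF B, of "abs (v (Suc k))"]
   by (intro order_trans[OF abs_triangle_ineq] add_mono) (simp_all add: abs_mult)
  also have "... = et*?V\<^sup>2" by (simp add: square_simps)
  also have "... <= et*(2*((v k)^2 + (v (Suc k))^2))" proof (intro mult_left_mono eta_nonneg)
   have "0 <= (abs (v k) - abs (v (Suc k)))^2" by simp
   thus "?V\<^sup>2 <= 2*((v k)^2 + (v (Suc k))^2)" by (simp add: power2_sum power2_diff)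
  qed
  finally have "- (et*(2*((v k)^2 + (v (Suc k))^2))) <= (?A k + ?G k) * v k + (?B k - ?G k) * v (Suc k)"
   by (simp only: abs_le_iff minus_le_iff)
  thus ?thesis using G by (simp add: algebra_simps)
 qed
 let ?S = "SUM k<n. (v (Suc k) - v k)^2"
 have "c*?S <= (SUM k<n. ?A k * v k + ?B k * v (Suc k)) + 2*et*(SUM k<n. (v k)^2 + (v (Suc k))^2)"
  unfolding sum_distrib_left sum.distrib[symmetric] by (intro sum_mono increment)
 also have "(SUM k<n. (v k)^2 + (v (Suc k))^2) = 2*(SUM k<=n. (v k)^2)"
  using sum.lessThan_Suc_shift[of "%k. (v k)^2" n] v0 vn
  by (simp add: sum.distrib lessThan_Suc_atMost[symmetric])
 also have "2*et*(2*(SUM k<=n. (v k)^2)) <= 2*et*(2*(real (Suc n)*real n*?S))"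
  using sum_squares_le_increments[of v n, OF v0] eta_nonneg by (intro mult_left_mono) auto
 finally have "(c - 4*et*(real (Suc n)*real n))*?S <= 0" using zero by (simp add: algebra_simps)
 moreover have "?S >= 0" by (intro sum_nonneg) simp
 ultimately have "?S = 0" using small by (simp add: mult_le_0_iff)
 hence inc: "v (Suc k) = v k" if "k < n" for k using that by (simp add: sum_nonneg_eq_0_iff)
 have "v k = 0" if "k <= n" for k using that by (induction k) (use v0 inc in auto)
 hence "v (k mod n) = 0" for k using n by (simp add: less_imp_le)
 hence "x k = y k" for k
  using conf_mult[OF c(1), of "k mod n" "k div n"] conf_mult[OF c(2), of "k mod n" "k div n"]
  by (simp add: v_def)
 thus ?thesis by auto
qed

text \<open>By the twist condition \<open>a\<close> is injective in its second argument, so the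
  equation determines each point from the two preceding ones.\<close>

lemma stationary_deterministic:
 assumes x: "!!k. stationary_at x k" "!!k. aa <= x (Suc k) - x k & x (Suc k) - x k <= bb"
  and y: "!!k. stationary_at y k" "!!k. aa <= y (Suc k) - y k & y (Suc k) - y k <= bb"
  and start: "y 0 = x 0 + 2*pi * of_int l" "y 1 = x 1 + 2*pi * of_int l" and "aa < bb"
 shows "y k = x k + 2*pi * of_int l & y (Suc k) = x (Suc k) + 2*pi * of_int l" proof (induction k)
 case (Suc k)
 let ?p = "2*pi * of_int l"
 have "b (y k) (y (Suc k)) = b (x k) (x (Suc k))"
  using Suc x(2)[of k] \<open>aa < bb\<close> by (simp add: ab_per_int)
 moreover have "a (x (Suc k) + ?p) (x (Suc (Suc k)) + ?p) = a (x (Suc k)) (x (Suc (Suc k)))"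
  using x(2)[of "Suc k"] \<open>aa < bb\<close> by (simp add: ab_per_int)
 ultimately have eq: "a (y (Suc k)) (y (Suc (Suc k))) = a (y (Suc k)) (x (Suc (Suc k)) + ?p)"
  using x(1)[of k] y(1)[of k] Suc by (simp add: stationary_at_def)
 have "y (Suc (Suc k)) = x (Suc (Suc k)) + ?p" proof (rule linorder_cases)
  assume "y (Suc (Suc k)) < x (Suc (Suc k)) + ?p"
  thus ?thesis using a_decreasing[of "y (Suc (Suc k))" "y (Suc k)" "x (Suc (Suc k)) + ?p"] eq
    x(2)[of "Suc k"] y(2)[of "Suc k"] Suc by simp
 next
  assume "y (Suc (Suc k)) > x (Suc (Suc k)) + ?p"
  thus ?thesis using a_decreasing[of "x (Suc (Suc k)) + ?p" "y (Suc k)" "y (Suc (Suc k))"] eq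
    x(2)[of "Suc k"] y(2)[of "Suc k"] Suc by simp
 qed
 thus ?case using Suc by simp
qed (use start in simp)

text \<open>The second periodic orbit maximizes, over the starting angle, the minimal action.\<close>

lemma minimax_stationary:
 assumes n: "n > 0" and rh: "rh = 2*pi * of_int m/real n"
  and de: "aa < rh - de" "rh + de < bb" "de > 0" and small: "2*et*real n < c*de"
   "4*et*(real (Suc n)*real n) < c"
 obtains z where "is_min_from n m z" "!!k. stationary_at z k"
  "!!y. is_min_from n m y ==> action n y <= action n z" proof -
 have ab: "aa < bb" using de by simp
 have close: "abs (x (Suc k) - x k - rh) <= de" if "is_min_from n m x" for x k
  using min_from_close[OF that n rh] de small by auto
 have st: "stationary_at x j" if "is_min_from n m x" "Suc j < n" for x j
  by (rule min_from_stationary[OF that]) (use close[OF that(1), of j] close[OF that(1), of "Suc j"] de in linarith)+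
 have uniq: "x = y" if "is_min_from n m x" "is_min_from n m y" "x 0 = y 0" for x y
  by (rule stationary_unique[OF _ _ n that(3) st[OF that(1)] st[OF that(2)] small(2)])
   (use that in "auto simp: is_min_from_def")
 have "EX x. is_min_from n m x & x 0 = t" for t proof -
  obtain x where "is_min_from n m x" "x 0 = t" by (rule is_min_from_exists[OF n, of m t]) (use de rh in auto)
  thus ?thesis by blast
 qed
 hence "ALL t. EX x. is_min_from n m x & x 0 = t" by blast
 from choice[OF this] obtain Z where Z: "!!t. is_min_from n m (Z t)" "!!t. Z t 0 = t" by blast
 have cZ: "conf n m (Z t)" for t using Z(1) by (simp add: is_min_from_def)
 \<comment> \<open>The minimal action with start \<open>t\<close>, the function to be
   maximized.\<close>
 define L where "L t = action n (Z t)" for t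
 have L_le: "L (x 0) <= action n x" if "conf n m x" for x
  using Z(1)[of "x 0"] Z(2) that by (simp add: L_def is_min_from_def)
 have drift_bound: "abs (drift n x) <= real n*(2*et)" if x: "conf n m x" for x proof -
  have "abs (a (x k) (x (Suc k)) + b (x k) (x (Suc k))) <= 2*et" for k
   using a_close[OF confD(1,2)[OF x, of k]] b_close[OF confD(1,2)[OF x, of k]] by linarith
  hence "(SUM k<n. abs (a (x k) (x (Suc k)) + b (x k) (x (Suc k)))) <= real (card {..<n})*(2*et)"
   by (intro sum_bounded_above)
  thus ?thesis unfolding drift_def by (intro order_trans[OF sum_abs]) simp
 qed
 have mvt: "EX s. abs s <= abs t & action n (%k. x k + t) - action n x = t*drift n (%k. x k + s)"
  if x: "conf n m x" for x t proof -
  consider "t = 0" | "0 < t" | "t < 0" by linarith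
  thus ?thesis proof cases
   case 2
   obtain s where "0 < s" "s < t"
    "action n (%k. x k + t) - action n (%k. x k + 0) = (t - 0)*drift n (%k. x k + s)"
    using MVT2[OF 2 action_trans_deriv[OF x]] by blast
   thus ?thesis by (intro exI[of _ s]) simp
  next
   case 3
   obtain s where "t < s" "s < 0"
    "action n (%k. x k + 0) - action n (%k. x k + t) = (0 - t)*drift n (%k. x k + s)"
    using MVT2[OF 3 action_trans_deriv[OF x]] by blast
   thus ?thesis using 3 by (intro exI[of _ s]) (auto simp: algebra_simps)
  next
   case 1
   show ?thesis unfolding 1 by (intro exI[of _ 0]) simp
  qed
 qed
 have Lip1: "L (t + s) - L t <= real n*(2*et)*abs s" for t s proof -
  obtain r where "action n (%k. Z t k + s) - action n (Z t) = s*drift n (%k. Z t k + r)"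
   using mvt[OF cZ] by blast
  moreover have "L (t + s) <= action n (%k. Z t k + s)"
   using L_le[OF conf_trans[OF cZ[of t], of s]] Z(2) by simp
  moreover have "s*drift n (%k. Z t k + r) <= abs s*abs (drift n (%k. Z t k + r))"
   by (simp only: abs_mult[symmetric] abs_ge_self)
  moreover have "abs s*abs (drift n (%k. Z t k + r)) <= abs s*(real n*(2*et))"
   by (intro mult_left_mono drift_bound conf_trans cZ) simp
  ultimately show ?thesis unfolding L_def by (simp add: mult.commute)
 qed
 have Lip: "abs (L t - L s) <= real n*(2*et)*abs (t - s)" for t s
  using Lip1[of t "s - t"] Lip1[of s "t - s"] by (simp add: abs_le_iff abs_minus_commute)
 have Llim: "(%j. L (T j)) \<longlonglongrightarrow> L t" if "T \<longlonglongrightarrow> t" for T t proof -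
  have "(%j. real n*(2*et)*abs (T j - t)) \<longlonglongrightarrow> real n*(2*et)*abs (t - t)"
   by (intro tendsto_intros that)
  hence z: "(%j. real n*(2*et)*abs (T j - t)) \<longlonglongrightarrow> 0" by simp
  have "norm (L (T j) - L t) <= norm (real n*(2*et)*abs (T j - t))*1" for j
   using Lip[of "T j" t] eta_nonneg by (simp add: abs_mult)
  hence "(%j. L (T j) - L t) \<longlonglongrightarrow> 0" by (intro tendsto_0_le[OF z] always_eventually allI)
  thus ?thesis by (simp add: LIM_zero_iff)
 qed
 have Lper: "L (t + 2*pi * of_int j) <= L t" for t j
  using L_le[OF conf_trans[OF cZ[of t], of "2*pi * of_int j"]] action_trans[OF cZ[of t]] Z(2)
  by (simp add: L_def)
 have "continuous_on {0..2*pi} L" unfolding continuous_on_sequentially using Llim by (auto simp: o_def)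
 then obtain u where "ALL t:{0..2*pi}. L t <= L u" using continuous_attains_sup[of "{0..2*pi}" L] by auto
 hence u: "!!t. 0 <= t ==> t <= 2*pi ==> L t <= L u" by simp
 have umax: "L t <= L u" for t proof -
  define l where "l = - \<lfloor>t/(2*pi)\<rfloor>"
  have "of_int \<lfloor>t/(2*pi)\<rfloor> <= t/(2*pi)" "t/(2*pi) <= of_int \<lfloor>t/(2*pi)\<rfloor> + 1"
   by linarith+
  hence "of_int \<lfloor>t/(2*pi)\<rfloor> * (2*pi) <= t" "t <= (of_int \<lfloor>t/(2*pi)\<rfloor> + 1)*(2*pi)"
   by (simp_all only: pos_le_divide_eq pos_divide_le_eq pi_gt_zero mult_pos_pos zero_less_numeral)
  hence "L (t + 2*pi * of_int l) <= L u" by (intro u) (simp_all add: l_def algebra_simps)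
  thus ?thesis using Lper[of "t + 2*pi * of_int l" "- l"] by simp
 qed
 have "drift n (Z u) = 0" proof (rule ccontr)
  assume D: "drift n (Z u) ~= 0"
  define T where "T j = drift n (Z u)/real (Suc j)" for j
  have T0: "T \<longlonglongrightarrow> 0"
   unfolding T_def using LIMSEQ_inverse_real_of_nat by (auto intro!: tendsto_mult_right_zero simp: divide_inverse)
  have uT: "(%j. u + T j) \<longlonglongrightarrow> u" using tendsto_add[OF tendsto_const T0, of u] by simp
  have "EX s. abs s <= abs (T j) & T j*drift n (%k. Z (u + T j) k + s) <= 0" for j proof -
   obtain s where s: "abs s <= abs (- T j)"
    "action n (%k. Z (u + T j) k + - T j) - action n (Z (u + T j)) = - T j*drift n (%k. Z (u + T j) k + s)"
    using mvt[OF cZ] by blast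
   have "L u <= action n (%k. Z (u + T j) k + - T j)"
    using L_le[OF conf_trans[OF cZ[of "u + T j"], of "- T j"]] Z(2) by simp
   thus ?thesis using s umax[of "u + T j"] by (intro exI[of _ s]) (auto simp: L_def)
  qed
  hence "ALL j. EX s. abs s <= abs (T j) & T j*drift n (%k. Z (u + T j) k + s) <= 0" by blast
  from choice[OF this] obtain S where S: "!!j. abs (S j) <= abs (T j)"
   "!!j. T j*drift n (%k. Z (u + T j) k + S j) <= 0" by blast
  have Tb: "abs (T j) <= abs (drift n (Z u))" for j by (simp add: T_def divide_le_eq mult_le_cancel_left1)
  have Zb: "u - abs (drift n (Z u)) <= Z (u + T j) 0" "Z (u + T j) 0 <= u + abs (drift n (Z u))" for j
   using Tb[of j] Z(2)[of "u + T j"] by linarith+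
  obtain r x where r: "strict_mono r" "!!k. (%j. Z (u + T (r j)) k) \<longlonglongrightarrow> x k" "conf n m x"
   "(%j. action n (Z (u + T (r j)))) \<longlonglongrightarrow> action n x"
   by (rule conf_convergent[OF cZ Zb]) (rule that; assumption)
  have uTr: "(%j. u + T (r j)) \<longlonglongrightarrow> u" using LIMSEQ_subseq_LIMSEQ[OF uT r(1)] by (simp add: o_def)
  have x0: "x 0 = u" using LIMSEQ_unique[OF r(2)[of 0]] uTr Z(2) by simp
  have "action n x = L u" using LIMSEQ_unique[OF r(4)] Llim[OF uTr] by (simp add: L_def)
  hence "is_min_from n m x" using r(3) x0 L_le unfolding is_min_from_def by metis
  hence xZ: "x = Z u" using uniq Z x0 by simp
  have Tr: "(%j. T (r j)) \<longlonglongrightarrow> 0" using LIMSEQ_subseq_LIMSEQ[OF T0 r(1)] by (simp add: o_def)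
  have "(%j. S (r j)) \<longlonglongrightarrow> 0" by (rule tendsto_0_le[OF Tr, of _ 1]) (use S(1) in auto)
  hence zs: "(%j. Z (u + T (r j)) k + S (r j)) \<longlonglongrightarrow> x k" for k
   using tendsto_add[OF r(2)[of k]] by fastforce
  have "(%j. drift n (%k. Z (u + T (r j)) k + S (r j))) \<longlonglongrightarrow> drift n x"
   unfolding drift_def using confD(1,2)[OF cZ] confD(1,2)[OF r(3)]
   by (intro tendsto_sum tendsto_add ab_tendsto zs) auto
  hence "(%j. drift n (Z u)*drift n (%k. Z (u + T (r j)) k + S (r j))) \<longlonglongrightarrow> drift n (Z u)*drift n (Z u)"
   unfolding xZ by (intro tendsto_mult tendsto_const)
  moreover have "drift n (Z u)*drift n (%k. Z (u + T (r j)) k + S (r j)) <= 0" for j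
   using S(2)[of "r j"] by (simp add: T_def divide_le_0_iff)
  ultimately have "drift n (Z u)*drift n (Z u) <= 0" by (intro tendsto_upperbound[of _ _ sequentially]) auto
  thus False using D by (auto simp: mult_le_0_iff)
 qed
 hence "stationary_at (Z u) k" for k using all_stationary[OF cZ n ab st[OF Z(1)]] by blast
 moreover have "action n y <= action n (Z u)" if "is_min_from n m y" for y
  using uniq[OF that Z(1)[of "y 0"]] Z(2) umax[of "y 0"] by (simp add: L_def)
 ultimately show thesis using that[of "Z u"] Z(1) by blast
qed

text \<open>If the minimax action differs from the minimal one, the action separates the two orbits.
  If they agree, every minimizer with prescribed start is a global one, and a start outside the
  countable set of all translates of points of the first orbit gives a different orbit.\<close>

lemma two_periodic_stationary:
 assumes n: "n > 0" and rh: "rh = 2*pi * of_int m/real n"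
  and de: "aa < rh - de" "rh + de < bb" "de > 0" and small: "2*et*real n < c*de"
   "4*et*(real (Suc n)*real n) < c"
 obtains x y where "conf n m x" "!!k. stationary_at x k" "!!k. abs (x (Suc k) - x k - rh) <= de"
  "conf n m y" "!!k. stationary_at y k" "!!k. abs (y (Suc k) - y k - rh) <= de"
  "!!i j l. ~ (y j = x i + 2*pi * of_int l & y (Suc j) = x (Suc i) + 2*pi * of_int l)" proof -
 have ab: "aa < bb" using de by simp
 have close: "abs (x (Suc k) - x k - rh) <= de" if "is_min_from n m x" for x k
  using min_from_close[OF that n rh] de small by auto
 have inner: "aa < x (Suc k) - x k & x (Suc k) - x k < bb" if "is_min_from n m x" for x k
  using close[OF that, of k] de by linarith
 obtain x where x: "is_min n m x" by (rule is_min_exists[OF n, of m]) (use de rh in auto)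
 have xf: "is_min_from n m x" using is_min_imp_from[OF x] .
 have cx: "conf n m x" using x by (simp add: is_min_def)
 obtain z where z: "is_min_from n m z" "!!k. stationary_at z k"
  "!!y. is_min_from n m y ==> action n y <= action n z"
  by (rule minimax_stationary[OF n rh de small]) (rule that; assumption)
 have st: "stationary_at y k" if "is_min n m y" for y k
  by (rule is_min_stationary[OF that n]) (use inner is_min_imp_from[OF that] in blast)
 have same: "EX q. ALL k. y (j + k) = x (i + k) + 2*pi * of_int q"
  if "is_min_from n m y" "!!k. stationary_at y k"
   "y j = x i + 2*pi * of_int l & y (Suc j) = x (Suc i) + 2*pi * of_int l" for y j i l proof -
  have "y (j + k) = x (i + k) + 2*pi * of_int l" for k
   using stationary_deterministic[of "%k. x (i + k)" "%k. y (j + k)" l k] st[OF x] that inner[OF xf] inner[OF that(1)] ab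
   by (force simp: stationary_at_def intro: less_imp_le)
  thus ?thesis by blast
 qed
 show thesis proof (cases "action n x = action n z")
  case False
  have "~ (z j = x i + 2*pi * of_int l & z (Suc j) = x (Suc i) + 2*pi * of_int l)" for i j l proof
   assume "z j = x i + 2*pi * of_int l & z (Suc j) = x (Suc i) + 2*pi * of_int l"
   from same[OF z(1,2) this] obtain q where "!!k. z (j + k) = x (i + k) + 2*pi * of_int q" by blast
   hence "action n (%k. z (k + j)) = action n (%k. x (k + i) + 2*pi * of_int q)" by (simp add: add.commute)
   thus False
    using False action_shift[of n m z j] action_shift[OF cx, of i] action_trans[OF conf_shift[OF cx, of i], of q] z(1)
    by (simp add: is_min_from_def)
  qed
  thus thesis using that[of x z] cx st[OF x] close[OF xf] z close[OF z(1)] by (auto simp: is_min_from_def)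
 next
  case True
  have "countable (range (%(k, l::int). x k + 2*pi * of_int l))" by simp
  then obtain t where t: "t ~: range (%(k, l::int). x k + 2*pi * of_int l)"
   using uncountable_UNIV_real by (metis (no_types, lifting) UNIV_eq_I countable_subset top_greatest)
  obtain y where y: "is_min_from n m y" "y 0 = t"
   by (rule is_min_from_exists[OF n, of m t]) (use de rh in auto)
  have "action n y = action n x"
   using z(3)[OF y(1)] True x y(1) by (auto simp: is_min_def is_min_from_def intro: antisym)
  hence ym: "is_min n m y" using x y(1) by (simp add: is_min_def is_min_from_def)
  hence cy: "conf n m y" by (simp add: is_min_def)
  have "~ (y j = x i + 2*pi * of_int l & y (Suc j) = x (Suc i) + 2*pi * of_int l)" for i j l proof
   assume "y j = x i + 2*pi * of_int l & y (Suc j) = x (Suc i) + 2*pi * of_int l"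
   from same[OF y(1) st[OF ym] this] obtain q where q: "!!k. y (j + k) = x (i + k) + 2*pi * of_int q" by blast
   \<comment> \<open>Coincidence from index \<open>j\<close> on is carried to index \<open>0\<close>
     by periodicity.\<close>
   have "j + (n*j - j) = 0 + n*j" using n by simp
   hence "y 0 + 2*pi * of_int m*real j = x (i + (n*j - j)) + 2*pi * of_int q"
    using q[of "n*j - j"] conf_mult[OF cy, of 0 j] by simp
   hence "t = x (i + (n*j - j)) + 2*pi * of_int (q - m*int j)" using y(2) by (simp add: algebra_simps)
   hence "t : range (%(k, l::int). x k + 2*pi * of_int l)"
    by (intro image_eqI[of _ _ "(i + (n*j - j), q - m*int j)"]) auto
   thus False using t by blast
  qed
  thus thesis using that[of x y] cx st[OF x] close[OF xf] cy st[OF ym] close[OF y(1)] by blast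
 qed
qed

end

section \<open>Boundary curves\<close>

text \<open>In logarithmic polar coordinates the two sides of the boundary become the two sides of a
  graph; the open mapping theorem carries their openness back to the plane.\<close>

lemma open_exp_image:
 fixes S :: "complex set"
 assumes "open S"
 shows "open (exp ` S)" proof (rule open_mapping_thm[of exp UNIV])
 have "exp (\<i> * of_real pi) ~= exp (0 :: complex)" by simp
 thus "~ exp constant_on (UNIV :: complex set)" unfolding constant_on_def by (metis UNIV_I)
qed (use assms in "auto intro: holomorphic_intros")

text \<open>Arc against chord. The chord is \<open>2*abs (sin (t/2))\<close>; halving the angle once
  more avoids the small cosine near \<open>t = pi\<close>.\<close>

lemma abs_le_cis_dist:
 assumes "abs t <= pi"
 shows "abs t <= 2*norm (cis t - 1)" proof -
 have pos: "t <= 4 * sin (t/2)" if t: "0 < t" "t <= pi" for t proof -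
  obtain x where x: "0 < x" "x < t/4" "sin (t/4) - sin 0 = (t/4 - 0)*cos x"
   using MVT2[of 0 "t/4" sin cos] t DERIV_sin by auto
  have c: "cos (t/4) <= cos x" using x t by (intro cos_monotone_0_pi_le) auto
  have c4: "cos (pi/4) <= cos (t/4)" using t by (intro cos_monotone_0_pi_le) auto
  hence "(cos (pi/4))^2 <= (cos (t/4))^2" by (intro power_mono) (auto simp: cos_45)
  hence half: "1/2 <= (cos (t/4))^2" by (simp add: cos_45 power_divide)
  have c0: "0 <= cos (t/4)" using t by (intro cos_ge_zero) auto
  have "t/4*cos (t/4) <= sin (t/4)" using x c t by (simp add: mult_left_mono)
  hence "t/4*cos (t/4)*cos (t/4) <= sin (t/4)*cos (t/4)" using c0 by (rule mult_right_mono)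
  moreover have "t/4*(1/2) <= t/4*(cos (t/4))^2" using half t by (intro mult_left_mono) auto
  moreover have "sin (t/2) = 2 * sin (t/4)*cos (t/4)" using sin_double[of "t/4"] by simp
  ultimately show ?thesis by (simp add: power2_eq_square mult.assoc)
 qed
 have "norm (cis t - 1) = 2*abs (sin (t/2))" using dist_exp_i_1[of t] by (simp add: cis_conv_exp)
 moreover have "abs t <= 4*abs (sin (t/2))" proof (cases "t = 0")
  case False
  thus ?thesis using pos[of t] pos[of "- t"] assms by (cases "t > 0") (auto simp: abs_if)
 qed simp
 ultimately show ?thesis by simp
qed

lemma angle_representative:
 obtains n :: int where "abs (x - (y + 2*pi * of_int n)) <= pi" proof -
 define n where "n = \<lfloor>(x - y)/(2*pi) + 1/2\<rfloor>"
 have "of_int n <= (x - y)/(2*pi) + 1/2" "(x - y)/(2*pi) + 1/2 < of_int n + 1" unfolding n_def by linarith+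
 hence "abs ((x - y)/(2*pi) - of_int n) <= 1/2" by linarith
 hence "abs ((x - y)/(2*pi) - of_int n)*(2*pi) <= 1/2*(2*pi)" by (intro mult_right_mono) auto
 also have "abs ((x - y)/(2*pi) - of_int n)*(2*pi) = abs (((x - y)/(2*pi) - of_int n)*(2*pi))"
  by (simp add: abs_mult)
 also have "((x - y)/(2*pi) - of_int n)*(2*pi) = x - (y + 2*pi * of_int n)" by (simp add: field_simps)
 finally show thesis using that by simp
qed

lemma norm_sgn_diff_le:
 fixes z w :: complex
 assumes "w ~= 0" "z ~= 0"
 shows "norm (sgn z - sgn w) <= 2*norm (z - w)/norm w" proof -
 have "sgn z - sgn w = (z - w)/of_real (norm w) + z * of_real (1/norm z - 1/norm w)"
  using assms by (simp add: sgn_eq field_simps)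
 also have "norm ... <= norm (z - w)/norm w + norm z*abs (1/norm z - 1/norm w)"
  by (intro order_trans[OF norm_triangle_ineq]) (simp add: norm_mult norm_divide del: of_real_diff)
 also have "norm z*abs (1/norm z - 1/norm w) = abs (norm w - norm z)/norm w" proof -
  have "1/norm z - 1/norm w = (norm w - norm z)/(norm z*norm w)" using assms by (simp add: field_simps)
  thus ?thesis using assms by (simp add: abs_mult)
 qed
 also have "... <= norm (z - w)/norm w"
  using norm_triangle_ineq3[of w z] by (intro divide_right_mono) (auto simp: norm_minus_commute)
 finally show ?thesis by simp
qed

text \<open>The one number \<open>et\<close> bounds the deviation of the radius, its Lipschitz
  constant and its second differences. The last bound is what excludes short arcs along the boundary
  in the uniqueness of outer arcs.\<close>

locale curve =
 fixes f :: "real => real => real" and ep et :: real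
 assumes f_per: "f (x + 2*pi) ep = f x ep" and rad_close: "abs (ep*f x ep) <= et"
  and rad_lip: "abs (ep*f x ep - ep*f y ep) <= et*abs (x - y)"
  and rad_mid: "abs (ep*f x ep + ep*f y ep - 2*(ep*f ((x + y)/2) ep)) <= et*(x - y)^2"
  and eta_small: "et <= 1/4"
begin

definition rad :: "real => real" where "rad x = 1 + ep*f x ep"

lemma eta_nonneg: "0 <= et" using rad_close[of 0] by linarith

lemma rad_bounds: "1 - et <= rad x" "rad x <= 1 + et" "3/4 <= rad x" "rad x <= 5/4"
 using rad_close[of x] eta_small by (auto simp: rad_def abs_le_iff)

lemma rad_pos: "0 < rad x" using rad_bounds(3)[of x] by linarith

lemma bdry_rad: "bdry f ep x = of_real (rad x)*cis x" by (simp add: bdry_def rad_def)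

lemma rad_lipschitz: "abs (rad x - rad y) <= et*abs (x - y)" using rad_lip by (simp add: rad_def)

lemma rad_per: "rad (x + 2*pi * of_int n) = rad x" proof (induction n rule: int_induct[of _ 0])
 case (step1 i)
 thus ?case using f_per[of "x + 2*pi * of_int i"] by (simp add: rad_def algebra_simps)
next
 case (step2 i)
 thus ?case using f_per[of "x + 2*pi * of_int (i - 1)"] by (simp add: rad_def algebra_simps)
qed simp

lemma rad_cong:
 assumes "cis x = cis y"
 shows "rad x = rad y" proof -
 have "sin x = sin y & cos x = cos y" using assms by (auto simp: complex_eq_iff)
 then obtain n :: int where "x = y + 2*pi * of_int n" using sin_cos_eq_iff by auto
 thus ?thesis using rad_per by simp
qed

lemma continuous_rad: "continuous_on UNIV rad" proof -
 have "et-lipschitz_on UNIV rad"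
  using rad_lipschitz eta_nonneg by (intro lipschitz_onI) (auto simp: dist_real_def)
 thus ?thesis by (rule lipschitz_on_continuous_on)
qed

lemma continuous_rad_compose [continuous_intros]: "continuous_on A g ==> continuous_on A (%t. rad (g t))"
 using continuous_on_compose2[OF continuous_rad] by blast

text \<open>Angle is bounded by twice the chord, and the chord between directions by twice the
  distance over \<open>t\<close>. Thus the boundary can be compared with an arc near its endpoints
  without computing angles.\<close>

lemma rad_lipschitz_plane:
 assumes "s > 0" "t > 0"
 shows "abs (rad x - rad y) <= 4*et*norm (of_real s*cis x - of_real t*cis y)/t" proof -
 obtain n :: int where n: "abs (x - (y + 2*pi * of_int n)) <= pi" by (rule angle_representative)
 let ?y = "y + 2*pi * of_int n"
 have cy: "cis ?y = cis y" by (simp add: cis_mult[symmetric])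
 have "abs (rad x - rad y) <= et*abs (x - ?y)" using rad_lipschitz[of x ?y] by (simp add: rad_per)
 also have "... <= et*(2*norm (cis (x - ?y) - 1))"
  using abs_le_cis_dist[OF n] by (intro mult_left_mono eta_nonneg)
 also have "norm (cis (x - ?y) - 1) = norm (cis x - cis y)" proof -
  have "cis x - cis y = cis y*(cis (x - ?y) - 1)"
   unfolding cy[symmetric] by (simp add: right_diff_distrib cis_mult)
  thus ?thesis by (simp add: norm_mult)
 qed
 also have "cis x - cis y = sgn (of_real s*cis x) - sgn (of_real t*cis y)"
  using assms by (simp add: sgn_mult sgn_of_real)
 also have "et*(2*norm ...) <= et*(2*(2*norm (of_real s*cis x - of_real t*cis y)/norm (of_real t*cis y)))"
  by (intro mult_left_mono eta_nonneg norm_sgn_diff_le) (use assms in auto)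
 finally show ?thesis using assms by (simp add: norm_mult mult.left_commute mult.commute)
qed

definition inside :: "complex set" where "inside = {of_real s*cis x |s x. 0 <= s & s < rad x}"
definition outside :: "complex set" where "outside = {of_real s*cis x |s x. rad x < s}"

lemma polar_unique:
 assumes "of_real s*cis x = of_real t*cis y" "s > 0" "t > 0"
 shows "s = t & cis x = cis y" proof -
 have "norm (of_real s*cis x) = norm (of_real t*cis y)" by (rule arg_cong[OF assms(1)])
 hence "s = t" using assms(2,3) by (simp add: norm_mult)
 thus ?thesis using assms by simp
qed

lemma polar_cases:
 obtains s x where "z = of_real s*cis x" "s >= 0"
 using that[of "norm z" "Arg z"] rcis_cmod_Arg[of z, symmetric] by (simp add: rcis_def)

lemma inside_iff: "s >= 0 ==> of_real s*cis x : inside \<longleftrightarrow> s < rad x" proof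
 assume s: "s >= 0" "of_real s*cis x : inside"
 then obtain t y where t: "of_real s*cis x = of_real t*cis y" "0 <= t" "t < rad y" by (auto simp: inside_def)
 show "s < rad x" proof (cases "s = 0 | t = 0")
  case True
  hence "s = 0" using t by auto
  thus ?thesis using rad_pos by simp
 next
  case False
  hence "s > 0" "t > 0" using s(1) t(2) by auto
  from polar_unique[OF t(1) this] show ?thesis using t(3) rad_cong[of x y] by simp
 qed
qed (auto simp: inside_def)

lemma outside_iff: "s >= 0 ==> of_real s*cis x : outside \<longleftrightarrow> rad x < s" proof
 assume s: "s >= 0" "of_real s*cis x : outside"
 then obtain t y where t: "of_real s*cis x = of_real t*cis y" "rad y < t" by (auto simp: outside_def)
 hence "t > 0" using rad_pos[of y] by linarith
 hence "of_real s*cis x ~= 0" unfolding t(1) by simp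
 hence "s > 0" using s(1) by (cases "s = 0") auto
 from polar_unique[OF t(1) this \<open>t > 0\<close>] show "rad x < s" using t(2) rad_cong[of x y] by simp
qed (auto simp: outside_def)

lemma bdry_range_iff: "s >= 0 ==> of_real s*cis x : range (bdry f ep) \<longleftrightarrow> s = rad x" proof
 assume s: "s >= 0" "of_real s*cis x : range (bdry f ep)"
 then obtain y where y: "of_real s*cis x = of_real (rad y)*cis y" by (auto simp: bdry_rad)
 hence "of_real s*cis x ~= 0" unfolding y using rad_pos[of y] by simp
 hence "s > 0" using s(1) by (cases "s = 0") auto
 from polar_unique[OF y this rad_pos] show "s = rad x" using rad_cong[of x y] by simp
qed (auto simp: bdry_rad)

lemma Complex_exp: "s > 0 ==> of_real s*cis x = exp (Complex (ln s) x)"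
 by (simp add: exp_eq_polar exp_of_real[symmetric] del: exp_of_real)

lemma open_outside: "open outside" proof -
 have "outside = exp ` {w. ln (rad (Im w)) < Re w}" proof (safe)
  fix z assume "z : outside"
  then obtain s x where s: "z = of_real s*cis x" "rad x < s" by (auto simp: outside_def)
  hence "s > 0" using rad_pos[of x] by linarith
  thus "z : exp ` {w. ln (rad (Im w)) < Re w}"
   using s Complex_exp[of s x] rad_pos[of x] by (intro image_eqI[of _ _ "Complex (ln s) x"]) auto
 next
  fix w assume "ln (rad (Im w)) < Re w"
  hence "rad (Im w) < exp (Re w)" using rad_pos[of "Im w"] by (metis exp_less_mono exp_ln)
  moreover have "exp w = of_real (exp (Re w))*cis (Im w)" by (simp add: exp_eq_polar exp_of_real)
  ultimately show "exp w : outside" unfolding outside_def by blast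
 qed
 moreover have "open {w. ln (rad (Im w)) < Re w}"
  by (intro open_Collect_less continuous_intros) (simp_all add: rad_pos[THEN less_imp_neq, symmetric])
 ultimately show ?thesis using open_exp_image by metis
qed

lemma open_inside: "open inside" proof -
 have "inside = ball 0 (1/2) \<union> exp ` {w. Re w < ln (rad (Im w))}" proof (safe)
  fix z assume z: "z : inside" "z ~: exp ` {w. Re w < ln (rad (Im w))}"
  then obtain s x where s: "z = of_real s*cis x" "0 <= s" "s < rad x" by (auto simp: inside_def)
  have "s = 0" proof (rule ccontr)
   assume "s ~= 0"
   hence "z : exp ` {w. Re w < ln (rad (Im w))}"
    using s Complex_exp[of s x] rad_pos[of x] by (intro image_eqI[of _ _ "Complex (ln s) x"]) auto
   thus False using z by blast
  qed
  thus "z : ball 0 (1/2)" using s by simp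
 next
  fix z :: complex assume z: "z : ball 0 (1/2)"
  obtain s x where s: "z = of_real s*cis x" "s >= 0" by (rule polar_cases)
  hence "s < rad x" using z rad_bounds(3)[of x] by (simp add: norm_mult)
  thus "z : inside" using s by (simp add: inside_iff)
 next
  fix w assume "Re w < ln (rad (Im w))"
  hence "exp (Re w) < rad (Im w)" using rad_pos[of "Im w"] by (metis exp_less_mono exp_ln)
  moreover have "exp w = of_real (exp (Re w))*cis (Im w)" by (simp add: exp_eq_polar exp_of_real)
  ultimately show "exp w : inside" using inside_iff[of "exp (Re w)"] by simp
 qed
 moreover have "open {w. Re w < ln (rad (Im w))}"
  by (intro open_Collect_less continuous_intros) (simp_all add: rad_pos[THEN less_imp_neq, symmetric])
 ultimately show ?thesis using open_exp_image by (metis open_Un open_ball)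
qed

lemma connected_inside: "connected inside" proof (rule starlike_imp_connected)
 have "of_real t*z : inside" if z: "z : inside" and t: "0 <= t" "t <= 1" for z and t :: real proof -
  obtain s x where s: "z = of_real s*cis x" "0 <= s" "s < rad x" using z by (auto simp: inside_def)
  have "t * s <= s" using s t by (simp add: mult_left_le_one_le)
  hence "of_real (t * s)*cis x : inside" using s t by (simp add: inside_iff del: of_real_mult)
  thus ?thesis using s by (simp add: mult.assoc)
 qed
 moreover have "0 : inside" using inside_iff[of 0 0] rad_pos by simp
 ultimately show "starlike inside"
  unfolding starlike_def by (intro bexI[of _ 0]) (auto simp: closed_segment_def scaleR_conv_of_real)
qed

text \<open>\<open>inside\<close> is connected and contains \<open>0\<close>; \<open>inside\<close>
  and \<open>outside\<close> are open, disjoint and cover the complement of the curve, so the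
  component of \<open>0\<close> cannot reach \<open>outside\<close>.\<close>

lemma D_eps_inside: "D_eps f ep = inside" proof
 have zero: "0 : inside" using inside_iff[of 0 0] rad_pos by simp
 have cover: "- range (bdry f ep) <= inside \<union> outside" proof
  fix z assume z: "z : - range (bdry f ep)"
  obtain s x where s: "z = of_real s*cis x" "s >= 0" by (rule polar_cases)
  thus "z : inside \<union> outside" using z bdry_range_iff inside_iff outside_iff by (auto simp: not_less)
 qed
 have disj: "inside \<inter> outside = {}"
  using inside_iff outside_iff by (auto simp: inside_def not_less intro: less_imp_le)
 have "inside <= - range (bdry f ep)" proof
  fix z assume z: "z : inside"
  obtain s x where s: "z = of_real s*cis x" "s >= 0" by (rule polar_cases)
  thus "z : - range (bdry f ep)" using z bdry_range_iff inside_iff by auto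
 qed
 thus "inside <= D_eps f ep" unfolding D_eps_def by (intro connected_component_maximal connected_inside zero)
 hence z': "0 : D_eps f ep" using zero by blast
 have sub: "D_eps f ep <= inside \<union> outside"
  unfolding D_eps_def using connected_component_subset cover by fastforce
 have "connected (D_eps f ep)" unfolding D_eps_def by (rule connected_connected_component)
 hence "outside \<inter> D_eps f ep = {}"
  using connectedD[OF _ open_inside open_outside _ sub] disj zero z' by blast
 thus "D_eps f ep <= inside" using sub by blast
qed

lemma closure_D_eps_iff:
 assumes "s >= 0"
 shows "of_real s*cis x : closure (D_eps f ep) \<longleftrightarrow> s <= rad x" proof
 have "closure inside <= - outside" proof (rule closure_minimal)
  show "inside <= - outside"
   using inside_iff outside_iff by (auto simp: inside_def not_less intro: less_imp_le)
 qed (use open_outside in "simp add: closed_Compl")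
 thus "of_real s*cis x : closure (D_eps f ep) ==> s <= rad x"
  using outside_iff[OF assms] D_eps_inside by force
next
 assume s: "s <= rad x"
 have "(%n. of_real ((1 - inverse (real (Suc n))) * s)*cis x) \<longlonglongrightarrow> of_real ((1 - 0) * s)*cis x"
  by (intro tendsto_intros LIMSEQ_inverse_real_of_nat)
 moreover have "of_real ((1 - inverse (real (Suc n))) * s)*cis x : inside" for n proof (cases "s = 0")
  case True
  thus ?thesis using inside_iff[of 0 x] rad_pos by simp
 next
  case False
  hence "(1 - inverse (real (Suc n))) * s < s" using assms by simp
  moreover have "0 <= (1 - inverse (real (Suc n))) * s" using assms by (intro mult_nonneg_nonneg) (auto simp: field_simps)
  ultimately show ?thesis using s by (simp add: inside_iff del: of_nat_Suc of_real_mult)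
 qed
 ultimately show "of_real s*cis x : closure (D_eps f ep)"
  unfolding D_eps_inside closure_sequential by (intro exI[of _ "%n. of_real ((1 - inverse (real (Suc n))) * s)*cis x"]) simp
qed

end

section \<open>Logarithmic lifts, the harmonic oscillator, gradients of the potentials\<close>

lemma vector_derivative_zero_const:
 fixes f :: "real => 'a::real_normed_vector"
 assumes "!!t. t : {a..b} ==> (f has_vector_derivative 0) (at t within {a..b})" "t : {a..b}"
 shows "f t = f a" proof -
 have "EX c. ALL x:{a..b}. f x = c"
  by (rule has_derivative_zero_constant) (use assms(1) in "auto simp: has_vector_derivative_def")
 thus ?thesis using assms(2) by auto
qed

text \<open>Near \<open>t\<close> a continuous logarithm equals \<open>u t + Ln (z s/z t)\<close>,
  where the argument of \<open>Ln\<close> is close to \<open>1\<close> and so away from the branch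
  cut.\<close>

lemma log_lift_derivative:
 fixes u z :: "real => complex"
 assumes u: "continuous_on S u" "!!t. t : S ==> z t = exp (u t)"
  and z: "(z has_vector_derivative v) (at t within S)" and t: "t : S"
 shows "(u has_vector_derivative v/z t) (at t within S)" proof -
 have nz: "z t ~= 0" using u t by simp
 have "((%s. z s/z t) has_vector_derivative v/z t) (at t within S)"
  using has_vector_derivative_divide[OF z, of "z t"] by simp
 moreover have "(Ln has_field_derivative inverse 1) (at (z t/z t) within (%s. z s/z t) ` S)"
  using nz has_field_derivative_Ln[of 1] by (simp add: has_field_derivative_at_within)
 ultimately have "(Ln \<circ> (%s. z s/z t) has_vector_derivative v/z t*inverse 1) (at t within S)"
  by (rule field_vector_diff_chain_within)
 hence "((%s. u t + Ln (z s/z t)) has_vector_derivative v/z t) (at t within S)"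
  using has_vector_derivative_add[OF has_vector_derivative_const] by (fastforce simp: o_def)
 moreover obtain d where d: "d > 0" "!!s. s : S ==> dist s t < d ==> dist (u s) (u t) < pi"
  using u(1) t pi_gt_zero unfolding continuous_on_iff by blast
 have "u t + Ln (z s/z t) = u s" if "s : S" "dist s t < d" for s proof -
  have "abs (Im (u s - u t)) < pi" using d(2)[OF that] abs_Im_le_cmod[of "u s - u t"] by (simp add: dist_norm)
  hence "Ln (exp (u s - u t)) = u s - u t" by (intro Ln_exp) auto
  thus ?thesis using u(2) that(1) t by (simp add: exp_diff)
 qed
 ultimately show ?thesis using has_vector_derivative_transform_within[OF _ d(1) t] by blast
qed

text \<open>\<open>?A\<close> and \<open>?B\<close> apply the inverse flow to the current position
  and velocity; their derivatives vanish, so they keep the initial values.\<close>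

lemma harmonic_solution:
 fixes z v :: "real => complex"
 assumes om: "om ~= 0" and z: "!!t. t : {0..T} ==> (z has_vector_derivative v t) (at t within {0..T})"
  and v: "!!t. t : {0..T} ==> (v has_vector_derivative - of_real (om^2)*z t) (at t within {0..T})"
  and t: "t : {0..T}"
 shows "z t = of_real (cos (om*t))*z 0 + of_real (sin (om*t)/om) * v 0"
  "v t = of_real (cos (om*t)) * v 0 - of_real (om * sin (om*t))*z 0" proof -
 let ?c = "%t. of_real (cos (om*t)) :: complex" and ?s = "%t. of_real (sin (om*t)) :: complex"
 have d: "(?c has_vector_derivative - of_real om*?s t) (at t within {0..T})"
  "(?s has_vector_derivative of_real om*?c t) (at t within {0..T})" for t
  by (auto intro!: derivative_eq_intros has_vector_derivative_of_real
    simp: has_real_derivative_iff_has_vector_derivative[symmetric])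
 let ?A = "%t. ?c t*z t - ?s t * v t/of_real om" and ?B = "%t. of_real om*?s t*z t + ?c t * v t"
 have "(?A has_vector_derivative 0) (at t within {0..T})" if "t : {0..T}" for t
  by (rule derivative_eq_intros d z[OF that] v[OF that] refl)+
   (use om in "simp add: field_simps power2_eq_square")
 from vector_derivative_zero_const[OF this t] have A: "?A t = z 0" by simp
 have "(?B has_vector_derivative 0) (at t within {0..T})" if "t : {0..T}" for t
  by (rule derivative_eq_intros d z[OF that] v[OF that] refl)+
   (use om in "simp add: field_simps power2_eq_square")
 from vector_derivative_zero_const[OF this t] have B: "?B t = v 0" by simp
 have cs: "?c t*?c t + ?s t*?s t = 1"
  using sin_cos_squared_add[of "om*t"] by (metis of_real_add of_real_mult of_real_1 power2_eq_square add.commute)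
 have "?c t*z 0 + ?s t/of_real om * v 0 = (?c t*?c t + ?s t*?s t)*z t"
  unfolding A[symmetric] B[symmetric] using om by (simp add: field_simps)
 thus "z t = of_real (cos (om*t))*z 0 + of_real (sin (om*t)/om) * v 0" using cs by simp
 have "?c t * v 0 - of_real om*?s t*z 0 = (?c t*?c t + ?s t*?s t) * v t"
  unfolding A[symmetric] B[symmetric] using om by (simp add: field_simps)
 thus "v t = of_real (cos (om*t)) * v 0 - of_real (om * sin (om*t))*z 0" using cs by simp
qed

lemma GDERIV_unique:
 assumes "GDERIV V z :> a" "GDERIV V z :> b"
 shows "a = b" proof -
 have "(%h. inner h a) = (%h. inner h b)" using assms unfolding gderiv_def by (rule has_derivative_unique)
 hence "inner (a - b) a = inner (a - b) b" by metis
 hence "inner (a - b) (a - b) = 0" by (simp add: inner_diff_right)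
 thus ?thesis by simp
qed

lemma GDERIV_V_E: "GDERIV (V_E om En) z :> - of_real (om^2)*z" proof -
 have "((%z. En - om^2/2*inner z z) has_derivative (%h. inner h (- of_real (om^2)*z))) (at z)"
  by (rule derivative_eq_intros refl)+ (simp add: inner_commute fun_eq_iff scaleR_conv_of_real[symmetric] del: of_real_power)
 thus ?thesis unfolding gderiv_def V_E_def[abs_def] by (simp add: power2_norm_eq_inner)
qed

lemma GDERIV_V_I: "z ~= 0 ==> GDERIV (V_I En h mu) z :> - of_real (mu/norm z ^ 3)*z" proof -
 assume z: "z ~= 0"
 have "GDERIV (%z. En + h + mu*inverse (norm z)) z :> 0 + (mu *\<^sub>R (- (inverse (norm z))\<^sup>2 *\<^sub>R sgn z) + inverse (norm z) *\<^sub>R 0)"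
  by (intro GDERIV_add GDERIV_const GDERIV_mult GDERIV_inverse GDERIV_norm z) (use z in simp)
 moreover have "0 + (mu *\<^sub>R (- (inverse (norm z))\<^sup>2 *\<^sub>R sgn z) + inverse (norm z) *\<^sub>R 0) = - of_real (mu/norm z ^ 3)*z"
  using z by (simp add: sgn_div_norm scaleR_conv_of_real field_simps power2_eq_square power3_eq_cube)
 ultimately show ?thesis unfolding V_I_def[abs_def] by (simp add: divide_inverse)
qed

text \<open>Division by zero gives \<open>V_I\<close> the finite value \<open>En + h\<close> at the
  origin, but the potential is unbounded nearby. So \<open>solves_on\<close> by itself keeps arcs
  away from the collision.\<close>

lemma no_GDERIV_V_I_0:
 assumes "mu ~= 0"
 shows "~ GDERIV (V_I En h mu) 0 :> a" proof
 assume "GDERIV (V_I En h mu) 0 :> a"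
 hence "isCont (V_I En h mu) 0" unfolding gderiv_def by (rule has_derivative_continuous)
 moreover have "(%n. complex_of_real (inverse (real (Suc n)))) \<longlonglongrightarrow> of_real 0"
  by (intro tendsto_of_real LIMSEQ_inverse_real_of_nat)
 ultimately have "(%n. V_I En h mu (of_real (inverse (real (Suc n))))) \<longlonglongrightarrow> V_I En h mu 0"
  by (metis isCont_tendsto_compose of_real_0)
 hence "(%n. (V_I En h mu (of_real (inverse (real (Suc n)))) - (En + h))/mu) \<longlonglongrightarrow> (V_I En h mu 0 - (En + h))/mu"
  by (intro tendsto_divide tendsto_diff tendsto_const assms)
 moreover have "(%n. (V_I En h mu (of_real (inverse (real (Suc n)))) - (En + h))/mu) = (%n. real (Suc n))"
  using assms by (intro ext) (simp add: V_I_def norm_inverse divide_inverse del: of_nat_Suc)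
 ultimately have "(%n. real (Suc n)) \<longlonglongrightarrow> (V_I En h mu 0 - (En + h))/mu" by simp
 moreover have "filterlim (%n. real (Suc n)) at_infinity sequentially"
  by (intro filterlim_at_top_imp_at_infinity filterlim_compose[OF filterlim_real_sequentially filterlim_Suc])
 ultimately show False using not_tendsto_and_filterlim_at_infinity trivial_limit_sequentially by blast
qed

section \<open>Winding numbers of closed arcs\<close>

context curve begin

lemma bdry_exp: "bdry f ep x = exp (Complex (ln (rad x)) x)"
 using Complex_exp[OF rad_pos] by (simp add: bdry_rad)

lemma bdry_nonzero: "bdry f ep x ~= 0" by (simp add: bdry_exp)

text \<open>The arc and the closing boundary arc lift through \<open>exp\<close> to a path whose
  endpoints differ by \<open>si\<close> times the imaginary unit, and the winding number is read off
  from that difference.\<close>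

lemma winding_closed_arc:
 assumes T: "T > 0" and u: "continuous_on {0..T} u" "!!t. t : {0..T} ==> z t = exp (u t)"
  and ends: "u 0 = Complex (ln (rad xi)) xi" "u T = Complex (ln (rad xi')) (xi' + si)" "cis si = 1"
 shows "winding_number (closed_arc f ep xi xi' T z) 0 = of_real (si/(2*pi))" proof -
 let ?p = "%s. u (T * s)" and ?q = "%s. Complex (ln (rad (linepath xi' xi s))) (linepath xi' xi s + si)"
 have p: "path ?p" unfolding path_def
  by (rule continuous_on_compose2[OF u(1)]) (use T in "auto intro!: continuous_intros simp: mult_le_cancel_left1")
 have q: "path ?q" unfolding path_def Complex_eq linepath_def
  by (intro continuous_intros) (simp_all add: rad_pos[THEN less_imp_neq, symmetric])
 have pq: "pathfinish ?p = pathstart ?q" using ends by (simp add: pathfinish_def pathstart_def linepath_def)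
 have "closed_arc f ep xi xi' T z t = (exp \<circ> (?p +++ ?q)) t" if t: "0 <= t" "t <= 1" for t
 proof (cases "t <= 1/2")
  case True
  have "T*(2*t) <= T*1" using True T by (intro mult_left_mono) auto
  hence "T*(2*t) : {0..T}" using True t T by simp
  thus ?thesis using True u(2) by (simp add: closed_arc_def joinpaths_def)
 next
  case False
  have "cis (y + si) = cis y" for y using ends(3) by (simp add: cis_mult[symmetric])
  hence "exp (Complex (ln (rad x)) (x + si)) = bdry f ep x" for x
   using rad_pos[of x] by (simp add: exp_eq_polar bdry_rad exp_of_real)
  thus ?thesis using False by (simp add: closed_arc_def joinpaths_def)
 qed
 hence "winding_number (closed_arc f ep xi xi' T z) 0 = winding_number (exp \<circ> (?p +++ ?q)) 0"
  by (rule winding_number_cong)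
 also have "... = (pathfinish (?p +++ ?q) - pathstart (?p +++ ?q))/(2 * of_real pi*\<i>)"
  by (rule winding_number_compose_exp) (use p q pq in simp)
 also have "... = of_real (si/(2*pi))"
  using ends by (simp add: pathfinish_def pathstart_def joinpaths_def linepath_def complex_eq_iff Re_divide Im_divide power2_eq_square)
 finally show ?thesis .
qed

lemma arc_lift_exists:
 assumes T: "T > 0" and z: "continuous_on {0..T} z" "!!t. t : {0..T} ==> z t ~= 0"
  and ends: "z 0 = bdry f ep xi" "z T = bdry f ep xi'"
 obtains u si where "continuous_on {0..T} u" "!!t. t : {0..T} ==> z t = exp (u t)"
  "u 0 = Complex (ln (rad xi)) xi" "u T = Complex (ln (rad xi')) (xi' + si)" "cis si = 1"
  "winding_number (closed_arc f ep xi xi' T z) 0 = of_real (si/(2*pi))" proof -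
 obtain w where w: "continuous_on {0..T} w" "!!t. t : {0..T} ==> z t = exp (w t)"
  using continuous_logarithm_on_contractible[OF z(1) convex_imp_contractible z(2)] by auto
 define u where "u t = w t + (Complex (ln (rad xi)) xi - w 0)" for t
 have uc: "continuous_on {0..T} u" unfolding u_def by (intro continuous_intros w(1))
 have e0: "exp (Complex (ln (rad xi)) xi - w 0) = 1"
  using w(2)[of 0] ends T by (simp add: exp_diff bdry_exp[symmetric] bdry_nonzero)
 have ue: "z t = exp (u t)" if "t : {0..T}" for t using w(2)[OF that] e0 by (simp add: u_def exp_add)
 define si where "si = Im (u T) - xi'"
 have eT: "exp (u T) = exp (Complex (ln (rad xi')) xi')" using ue[of T] ends T by (simp add: bdry_exp)
 have "exp (Re (u T)) = norm (exp (u T))" by simp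
 also have "... = rad xi'" unfolding eT using rad_pos by simp
 finally have "Re (u T) = ln (rad xi')" by (metis ln_exp)
 hence uT: "u T = Complex (ln (rad xi')) (xi' + si)" by (simp add: si_def complex_eq_iff)
 have "of_real (rad xi')*cis (xi' + si) = of_real (rad xi')*cis xi'"
  using eT rad_pos[of xi'] by (simp add: uT exp_eq_polar exp_of_real)
 hence "cis (xi' + si) = cis xi'" using rad_pos[of xi'] by simp
 hence "cis si = 1" by (simp add: cis_mult[symmetric])
 thus thesis using that[OF uc ue _ uT] winding_closed_arc[OF T uc ue _ uT] by (simp add: u_def)
qed

end

section \<open>Outer arcs\<close>

text \<open>For endpoints at distances \<open>r0\<close>, \<open>r1\<close> from the origin, at the angle \<open>De\<close>, put \<open>R = r0\<^sup>2 + r1\<^sup>2\<close> and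
  \<open>P = r0 * r1 * cos De\<close>. The flight time \<open>T\<close> of the outer arc satisfies \<open>cos (om * T) = c_E K R P\<close>
  with \<open>K = 2 * En / om\<^sup>2\<close>, by conservation of energy, and \<open>G_E\<close> is its Jacobi length.\<close>

definition c_E :: "real => real => real => real" where "c_E K R P = (P - sqrt (P^2 - K*(R - K)))/K"

context
 fixes K R P :: real
 assumes K: "K > 0" and RK: "R < K"
begin

text \<open>The product \<open>(R - K)/K\<close> of the two roots is negative, so they have opposite
  signs; \<open>c_E\<close> is the negative one.\<close>

lemma c_E_disc: "abs P < sqrt (P^2 - K*(R - K))" proof -
 have "K*(K - R) > 0" using K RK by simp
 hence "abs P^2 < P^2 - K*(R - K)" by (simp add: algebra_simps)
 thus ?thesis by (rule real_less_rsqrt)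
qed

lemma c_E_neg: "c_E K R P < 0" using c_E_disc K by (simp add: c_E_def divide_less_0_iff)

lemma c_E_root: "K*(c_E K R P)^2 - 2*P*c_E K R P + R - K = 0" proof -
 have "K*c_E K R P - P = - sqrt (P^2 - K*(R - K))" using K by (simp add: c_E_def)
 moreover have "K*(R - K) <= 0" using K RK by (intro mult_nonneg_nonpos) auto
 hence "0 <= P^2 - K*(R - K)" using zero_le_power2[of P] by linarith
 ultimately have "(K*c_E K R P - P)^2 = P^2 - K*(R - K)" by simp
 hence "K*(K*(c_E K R P)^2 - 2*P*c_E K R P + R - K) = 0" by (simp add: square_simps)
 thus ?thesis using K by simp
qed

lemma c_E_unique:
 assumes "K*x^2 - 2*P*x + R - K = 0" "x < 0"
 shows "x = c_E K R P" proof -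
 let ?D = "P^2 - K*(R - K)"
 have "K*(K*x^2 - 2*P*x + R - K) = 0" using assms by simp
 hence "(K*x - P)^2 = ?D" by (simp add: square_simps)
 hence "abs (K*x - P) = sqrt ?D" by (metis real_sqrt_abs)
 moreover have "K*x < 0" using K assms by (simp add: mult_pos_neg)
 ultimately have "K*x - P = - sqrt ?D" using c_E_disc by linarith
 hence "K*x = P - sqrt ?D" by simp
 thus ?thesis using K by (simp add: c_E_def field_simps)
qed

text \<open>The value of the quadratic at \<open>-1\<close> is \<open>R + 2*P\<close>. Since the
  second factor is positive, this decides the position of \<open>c_E\<close> relative to
  \<open>-1\<close>.\<close>

lemma c_E_plus_one: "(1 + c_E K R P)*(K*(1 - c_E K R P) + 2*P) = R + 2*P"
 using c_E_root by (simp add: square_simps)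

lemma c_E_factor_pos: "K*(1 - c_E K R P) + 2*P > 0" proof -
 have "c_E K R P*(K*c_E K R P - 2*P) = K - R" using c_E_root by (simp add: square_simps)
 hence "K*c_E K R P - 2*P < 0" using RK c_E_neg by (smt (verit) mult_nonneg_nonpos2 mult.commute)
 thus ?thesis using K by (simp add: algebra_simps)
qed

lemma c_E_gt: "R + 2*P > 0 ==> -1 < c_E K R P"
 using c_E_plus_one c_E_factor_pos by (smt (verit) mult_nonpos_nonneg)

end

definition G_E :: "real => real => real => real => real" where
 "G_E om En R P = (let c = c_E (2*En/om^2) R P in
   (om*(R*c - 2*P)/(2 * sqrt (1 - c^2)) + En*arccos c/om)/sqrt 2)"

lemma half_le_sin:
 assumes "0 <= x" "x <= pi/2"
 shows "x/2 <= sin x" proof -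
 have "norm (cis (2*x) - 1) = 2*abs (sin x)" using dist_exp_i_1[of "2*x"] by (simp add: cis_conv_exp)
 moreover have "abs (2*x) <= 2*norm (cis (2*x) - 1)" using assms by (intro abs_le_cis_dist) auto
 moreover have "0 <= sin x" using assms by (intro sin_ge_zero) auto
 ultimately show ?thesis using assms by simp
qed

lemma sin_sq_lower:
 assumes "0 < de"
 obtains m where "m > 0" "!!x. abs x <= pi - de ==> m*x^2 <= (sin x)^2" proof -
 define a where "a = min (1/2) (de/(2*pi))"
 have a: "a > 0" "a <= 1/2" "a <= de/(2*pi)" using assms by (auto simp: a_def)
 have pos: "a*x <= sin x" if x: "0 <= x" "x <= pi - de" for x proof (cases "x <= pi/2")
  case True
  have "a*x <= 1/2*x" using a x by (intro mult_right_mono) auto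
  thus ?thesis using half_le_sin[of x] True x by simp
 next
  case False
  have "a*x <= de/(2*pi)*pi" using a x assms by (intro mult_mono) auto
  also have "... = de/2" by simp
  also have "... <= (pi - x)/2" using x by simp
  also have "... <= sin (pi - x)" using False x assms by (intro half_le_sin) auto
  finally show ?thesis by simp
 qed
 have "a^2*x^2 <= (sin x)^2" if "abs x <= pi - de" for x proof -
  have "a*abs x <= abs (sin x)" using pos[of "abs x"] that by (cases "x >= 0") auto
  hence "(a*\<bar>x\<bar>)^2 <= \<bar>sin x\<bar>\<^sup>2" using a by (intro power_mono) auto
  thus ?thesis by (simp add: power_mult_distrib)
 qed
 thus thesis using that[of "a^2"] a by simp
qed

text \<open>The value at \<open>cos De\<close> of the quadratic polynomial with root \<open>cos (om * T)\<close>; its sign separates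
  the outer arc from the short arc that passes inside the domain.\<close>

lemma quadratic_at_cos:
 assumes K: "K > 2" and de: "0 < de"
 obtains ka et0 where "ka > 0" "et0 > 0" "et0 <= 1/4" "2 + 6*et0 <= (K + 2)/2"
  "!!r0 r1 De. abs (r0 - 1) <= et0 ==> abs (r1 - 1) <= et0 ==> abs (r0 - r1) <= et0*abs De ==> abs De <= pi - de ==>
   K*(cos De)^2 - 2*(r0*r1*cos De)*cos De + (r0^2 + r1^2) - K <= - (ka*De^2)" proof -
 obtain m where m: "m > 0" "!!x. abs x <= pi - de ==> m*x^2 <= (sin x)^2" using sin_sq_lower[OF de] by blast
 \<comment> \<open>\<open>(K - 2)/12\<close> keeps \<open>K - 2*r0*r1\<close> above
   \<open>(K - 2)/2\<close>; \<open>(K - 2)*m/4\<close> makes \<open>(r0 - r1)^2\<close> at most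
   half of the negative term.\<close>
 define et0 where "et0 = Min {1/4, (K - 2)/12, (K - 2)*m/4}"
 have "et0 <= y" if "y : {1/4, (K - 2)/12, (K - 2)*m/4}" for y
  unfolding et0_def using that by (intro Min_le) auto
 moreover have "et0 > 0" using K m by (simp add: et0_def)
 ultimately have e: "et0 > 0" "et0 <= 1/4" "et0 <= (K - 2)/12" "et0 <= (K - 2)*m/4" by blast+
 have e2: "et0^2 <= (K - 2)*m/4" proof -
  have "et0^2 <= 1*et0" unfolding power2_eq_square using e by (intro mult_right_mono) auto
  thus ?thesis using e by simp
 qed
 have "K*(cos De)^2 - 2*(r0*r1*cos De)*cos De + (r0^2 + r1^2) - K <= - ((K - 2)*m/4*De^2)"
  if h: "abs (r0 - 1) <= et0" "abs (r1 - 1) <= et0" "abs (r0 - r1) <= et0*abs De" "abs De <= pi - de" for r0 r1 De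
 proof -
  have "r0*r1 <= (1 + et0)*(1 + et0)" using h e by (intro mult_mono) auto
  also have "... <= 1 + 3*et0" using e by (simp add: algebra_simps)
  finally have "(K - 2)/2*(m*De^2) <= (K - 2*(r0*r1))*(sin De)^2"
   using e K m by (intro mult_mono m(2)[OF h(4)]) auto
  moreover have "(r0 - r1)^2 <= (K - 2)*m/4*De^2" proof -
   have "abs (r0 - r1)^2 <= (et0*abs De)^2" using h by (intro power_mono) auto
   also have "... = et0^2*De^2" by (simp add: power_mult_distrib)
   also have "... <= (K - 2)*m/4*De^2" using e2 by (intro mult_right_mono) auto
   finally show ?thesis by simp
  qed
  moreover have "K*(cos De)^2 - 2*(r0*r1*cos De)*cos De + (r0^2 + r1^2) - K
   = (r0 - r1)^2 - (K - 2*(r0*r1))*(sin De)^2" unfolding sin_squared_eq by (simp add: square_simps)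
  moreover have "(K - 2)*m/4*De^2 = ((K - 2)/2*(m*De^2))/2" by simp
  ultimately show ?thesis by linarith
 qed
 thus thesis using that[of "(K - 2)*m/4" et0] e K m by simp
qed

text \<open>The quadratic is at most \<open>- (ka1*De^2)\<close> at \<open>cos De\<close>; dividing
  by the other, bounded factor turns this into a distance from \<open>cos De\<close> to the roots.
  For the negative root the distance is uniform. For the positive root it must degenerate, because
  this root is \<open>1\<close> when \<open>De = 0\<close> and the radii agree.\<close>

lemma c_E_gap:
 assumes K: "K > 2" and de: "0 < de"
 obtains ka et0 where "ka > 0" "et0 > 0" "et0 <= 1/4" "2 + 6*et0 <= (K + 2)/2"
  "!!r0 r1 De. abs (r0 - 1) <= et0 ==> abs (r1 - 1) <= et0 ==> abs (r0 - r1) <= et0*abs De ==> abs De <= pi - de ==>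
   c_E K (r0^2 + r1^2) (r0*r1*cos De) + ka <= cos De"
  "!!r0 r1 De c. abs (r0 - 1) <= et0 ==> abs (r1 - 1) <= et0 ==> abs (r0 - r1) <= et0*abs De ==> abs De <= pi - de ==>
   0 < c ==> c <= 1 ==> De ~= 0 ==> K*c^2 - 2*(r0*r1*cos De)*c + (r0^2 + r1^2) - K = 0 ==>
   cos De + ka*De^2 <= c" proof -
 obtain ka1 et0 where k: "ka1 > 0" "et0 > 0" "et0 <= 1/4" "2 + 6*et0 <= (K + 2)/2"
  "!!r0 r1 De. abs (r0 - 1) <= et0 ==> abs (r1 - 1) <= et0 ==> abs (r0 - r1) <= et0*abs De ==> abs De <= pi - de ==>
   K*(cos De)^2 - 2*(r0*r1*cos De)*cos De + (r0^2 + r1^2) - K <= - (ka1*De^2)"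
  using quadratic_at_cos[OF K de] by blast
 define ka where "ka = min (ka1/(2*K + 4)) ((K - 2)/(2*(K + 4)))"
 have kp: "ka > 0" "ka <= ka1/(2*K + 4)" "ka <= (K - 2)/(2*(K + 4))" using k K by (auto simp: ka_def)
 have basic: "abs (r0*r1*cos De) <= 2" "r0^2 + r1^2 <= 2 + 6*et0"
  if h: "abs (r0 - 1) <= et0" "abs (r1 - 1) <= et0" for r0 r1 De :: real proof -
  have b: "0 <= r0" "r0 <= 1 + et0" "0 <= r1" "r1 <= 1 + et0" using h k by auto
  have sq: "(1 + et0)*(1 + et0) <= 1 + 3*et0" using k by (simp add: algebra_simps)
  have "r0*r1 <= (1 + et0)*(1 + et0)" using b k by (intro mult_mono) auto
  hence "r0*r1 <= 2" using sq k by linarith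
  hence "abs (r0*r1)*abs (cos De) <= 2*1" using b by (intro mult_mono) auto
  thus "abs (r0*r1*cos De) <= 2" by (simp add: abs_mult)
  have "r0*r0 <= (1 + et0)*(1 + et0)" "r1*r1 <= (1 + et0)*(1 + et0)" using b k by (auto intro!: mult_mono)
  thus "r0^2 + r1^2 <= 2 + 6*et0" using sq by (simp add: power2_eq_square)
 qed
 have neg: "c_E K (r0^2 + r1^2) (r0*r1*cos De) + ka <= cos De"
  if h: "abs (r0 - 1) <= et0" "abs (r1 - 1) <= et0" "abs (r0 - r1) <= et0*abs De" "abs De <= pi - de" for r0 r1 De
 proof -
  define P R c where "P = r0*r1*cos De" and "R = r0^2 + r1^2" and "c = c_E K R P"
  have PR: "abs P <= 2" "R <= (K + 2)/2" using basic[OF h(1,2)] k by (auto simp: P_def R_def intro: order_trans)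
  have RK: "R < K" "K > 0" using PR K by auto
  have b0: "0 <= r0" "0 <= r1" using h k by auto
  have "0 <= 1 + cos De" using cos_ge_minus_one[of De] by linarith
  hence "0 <= r0*r1*(1 + cos De)" using b0 by (intro mult_nonneg_nonneg)
  moreover have "0 <= (r0 - r1)^2" by simp
  ultimately have "0 <= R + 2*P" by (simp add: P_def R_def power2_diff algebra_simps)
  hence c1: "-1 <= c"
   using c_E_plus_one[OF RK(2,1), of P] c_E_factor_pos[OF RK(2,1), of P] unfolding c_def[symmetric]
   by (smt (verit) mult_neg_pos)
  have c0: "c < 0" using c_E_neg[OF RK(2,1)] by (simp add: c_def)
  have root: "K*c^2 - 2*P*c + R - K = 0" using c_E_root[OF RK(2,1)] by (simp add: c_def)
  \<comment> \<open>For \<open>cos De >= 0\<close> it suffices that the negative root is bounded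
    away from zero; otherwise \<open>De^2 >= 1\<close> makes the value at \<open>cos De\<close>
    uniformly negative.\<close>
  show ?thesis proof (cases "cos De >= 0")
   case True
   have "c*(K*c - 2*P) = K - R" using root by (simp add: square_simps)
   hence "(- c)*(2*P - K*c) = K - R" by (simp add: algebra_simps)
   moreover have "(- c)*(2*P - K*c) <= (- c)*(K + 4)" proof (intro mult_left_mono)
    have "K*(- c) <= K*1" using c1 K by (intro mult_left_mono) auto
    thus "2*P - K*c <= K + 4" using PR by auto
   qed (use c0 in simp)
   ultimately have "(K - 2)/2 <= (- c)*(K + 4)" using PR by (simp add: field_simps)
   hence "(K - 2)/(2*(K + 4)) <= - c" using K by (simp add: field_simps)
   thus ?thesis using kp True unfolding c_def P_def R_def by linarith
  next
   case False
   have "pi/2 < abs De" proof (rule ccontr)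
    assume "~ ?thesis"
    hence "cos \<bar>De\<bar> >= 0" by (intro cos_ge_zero) auto
    thus False using False by (simp add: abs_if split: if_splits)
   qed
   hence "1 <= abs De" using pi_gt3 by linarith
   hence D1: "1 <= De^2" using power_mono[of 1 "abs De" 2] by simp
   have "K*(cos De)^2 - 2*P*cos De + R - K <= - (ka1*De^2)" using k(5)[OF h] by (simp add: P_def R_def)
   also have "... <= - ka1" using D1 k by simp
   finally have q: "(cos De - c)*(K*(c + cos De) - 2*P) <= - ka1" using root by (simp add: square_simps)
   have "c*(K*c - 2*P) > 0" using root RK by (simp add: square_simps)
   hence "K*c - 2*P < 0" using c0 by (simp add: zero_less_mult_iff)
   hence F: "K*(c + cos De) - 2*P < 0" using mult_pos_neg[of K "cos De"] False K by (simp add: distrib_left)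
   have pos: "cos De - c > 0" using q F k(1) by (smt (verit) mult_nonpos_nonpos)
   have "- (c + cos De) <= 2" using c1 cos_ge_minus_one[of De] by linarith
   hence "K*(- (c + cos De)) <= K*2" using K by (intro mult_left_mono) auto
   hence "2*P - K*(c + cos De) <= 2*K + 4" using PR unfolding mult_minus_right by linarith
   hence "(cos De - c)*(2*P - K*(c + cos De)) <= (cos De - c)*(2*K + 4)"
    using pos by (intro mult_left_mono) auto
   hence "ka1 <= (cos De - c)*(2*K + 4)" using q by (simp add: algebra_simps)
   hence "ka1/(2*K + 4) <= cos De - c" using K by (simp add: field_simps)
   thus ?thesis using kp unfolding c_def P_def R_def by linarith
  qed
 qed
 have pos: "cos De + ka*De^2 <= c"
  if h: "abs (r0 - 1) <= et0" "abs (r1 - 1) <= et0" "abs (r0 - r1) <= et0*abs De" "abs De <= pi - de"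
   and c: "0 < c" "c <= 1" "De ~= 0" "K*c^2 - 2*(r0*r1*cos De)*c + (r0^2 + r1^2) - K = 0" for r0 r1 De c
 proof -
  define P R where "P = r0*r1*cos De" and "R = r0^2 + r1^2"
  have PR: "abs P <= 2" "R <= (K + 2)/2" using basic[OF h(1,2)] k by (auto simp: P_def R_def intro: order_trans)
  have root: "K*c^2 - 2*P*c + R - K = 0" using c by (simp add: P_def R_def)
  have "K*(cos De)^2 - 2*P*cos De + R - K <= - (ka1*De^2)" using k(5)[OF h] by (simp add: P_def R_def)
  hence q: "(c - cos De)*(K*(c + cos De) - 2*P) >= ka1*De^2" using root by (simp add: square_simps)
  have kD: "ka1*De^2 > 0" using k c by simp
  have "c*(K*c - 2*P) > 0" using root PR K by (simp add: square_simps)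
  hence Kc: "K*c - 2*P > 0" using c by (simp add: zero_less_mult_iff)
  have gt: "c > cos De" proof (rule ccontr)
   assume "~ ?thesis"
   hence "c <= cos De" by simp
   hence "K*(c + cos De) - 2*P > 0" proof -
    have "K*cos De > 0" using K c \<open>c <= cos De\<close> by (intro mult_pos_pos) linarith+
    thus ?thesis using Kc unfolding distrib_left by linarith
   qed
   hence "(c - cos De)*(K*(c + cos De) - 2*P) <= 0"
    using \<open>c <= cos De\<close> by (intro mult_nonpos_nonneg) auto
   thus False using q kD by linarith
  qed
  have "c + cos De <= 2" using c cos_le_one[of De] by linarith
  hence "K*(c + cos De) <= K*2" using K by (intro mult_left_mono) auto
  hence "K*(c + cos De) - 2*P <= 2*K + 4" using PR by linarith
  hence "(c - cos De)*(K*(c + cos De) - 2*P) <= (c - cos De)*(2*K + 4)"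
   using gt by (intro mult_left_mono) auto
  hence "ka1*De^2 <= (c - cos De)*(2*K + 4)" using q by linarith
  hence "ka1/(2*K + 4)*De^2 <= c - cos De" using K by (simp add: field_simps)
  moreover have "ka*De^2 <= ka1/(2*K + 4)*De^2" using kp by (intro mult_right_mono) auto
  ultimately show ?thesis by linarith
 qed
 show thesis by (rule that[OF kp(1) k(2-4) neg pos])
qed

section \<open>The boundary value problem of the oscillator\<close>

lemma norm_combination_sq: "(norm (of_real r0*cis x * of_real a + of_real r1*cis y * of_real b))^2
   = r0^2*a^2 + r1^2*b^2 + 2*(r0*r1*cos (y - x))*a*b" proof -
 have "(sin x)^2 + (cos x)^2 = 1" "(sin y)^2 + (cos y)^2 = 1" by simp_all
 thus ?thesis
  unfolding cmod_power2 cos_diff plus_complex.sel times_complex.sel cis.sel Re_complex_of_real Im_complex_of_real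
  by algebra
qed

lemma inner_polar: "inner (of_real r0*cis x) (of_real r1*cis y) = r0*r1*cos (y - x)"
 by (simp add: inner_complex_def cos_diff algebra_simps)

lemma solves_on_V_E: "solves_on (V_E om En) T {0..T} z \<longleftrightarrow> (EX v. ALL t:{0..T}.
   (z has_vector_derivative v t) (at t within {0..T}) &
   (v has_vector_derivative - of_real (om^2)*z t) (at t within {0..T}) &
   (norm (v t))\<^sup>2 = 2*En - om^2*(norm (z t))^2)" proof -
 have "(EX a. (GDERIV (V_E om En) (z t) :> a) & (v has_vector_derivative a) (at t within {0..T}))
  \<longleftrightarrow> (v has_vector_derivative - of_real (om^2)*z t) (at t within {0..T})" for t and v :: "real => complex"
  using GDERIV_V_E GDERIV_unique by blast
 thus ?thesis unfolding solves_on_def by (simp add: V_E_def field_simps)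
qed

text \<open>Solving for the initial velocity and inserting it into the energy at time
  \<open>0\<close> gives the quadratic equation for \<open>c\<close>. The length is integrated
  through \<open>inner z v\<close>, whose derivative is \<open>2*(norm v)^2 - 2*En\<close> by the
  energy relation.\<close>

lemma harmonic_arc:
 fixes z v :: "real => complex"
 assumes om: "om > 0" and T: "T > 0" and s: "sin (om*T) > 0"
  and z: "!!t. t : {0..T} ==> (z has_vector_derivative v t) (at t within {0..T})"
  and v: "!!t. t : {0..T} ==> (v has_vector_derivative - of_real (om^2)*z t) (at t within {0..T})"
  and en: "!!t. t : {0..T} ==> (norm (v t))^2 = 2*En - om^2*(norm (z t))^2"
  and ends: "z 0 = of_real r0*cis x" "z T = of_real r1*cis y"
 defines "R == r0^2 + r1^2" and "P == r0*r1*cos (y - x)" and "c == cos (om*T)" and "K == 2*En/om^2"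
 shows "K*c^2 - 2*P*c + R - K = 0"
  and "jacobi_length (V_E om En) T z = (om*(R*c - 2*P)/(2 * sin (om*T)) + En*T)/sqrt 2"
  and "!!t. t : {0..T} ==> z t = of_real r0*cis x * of_real (sin (om*(T - t))/sin (om*T))
    + of_real r1*cis y * of_real (sin (om*t)/sin (om*T))" proof -
 let ?s = "sin (om*T)"
 note sol = harmonic_solution[OF _ z v]
 have v0: "v 0 = of_real r1*cis y * of_real (om/?s) + of_real r0*cis x * of_real (- om*c/?s)"
  using sol(1)[of T] s om T ends by (simp add: c_def field_simps)
 have "- om*c/?s*c - om*?s = - om*(c^2 + ?s\<^sup>2)/?s"
  using s by (simp only: power2_eq_square) (simp add: field_simps)
 also have "c^2 + ?s\<^sup>2 = 1" by (simp add: c_def)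
 finally have e: "- om*c/?s*c - om*?s = - om/?s" by simp
 have "v T = of_real r1*cis y * of_real (om*c/?s) + of_real r0*cis x * of_real (- om*c/?s*c - om*?s)"
  using sol(2)[of T] om T ends(1) by (simp add: v0 c_def algebra_simps)
 hence vT: "v T = of_real r1*cis y * of_real (om*c/?s) + of_real r0*cis x * of_real (- om/?s)" unfolding e .
 have s2: "?s\<^sup>2 = 1 - c^2" by (simp add: c_def sin_squared_eq)
 have "(norm (v 0))^2 = r1^2*(om/?s)^2 + r0^2*(- om*c/?s)^2 + 2*P*(om/?s)*(- om*c/?s)"
  unfolding v0 norm_combination_sq P_def by (simp add: cos_diff algebra_simps)
 also have "... = om^2*(r1^2 + r0^2*c^2 - 2*P*c)/?s\<^sup>2"
  using s by (simp add: power_mult_distrib power_divide field_simps power2_eq_square)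
 finally have n0: "(norm (v 0))^2 = om^2*(r1^2 + r0^2*c^2 - 2*P*c)/?s\<^sup>2" .
 have KE: "om^2*K = 2*En" using om by (simp add: K_def)
 have "(norm (v 0))^2 = om^2*(K - r0^2)"
  unfolding right_diff_distrib KE using en[of 0] T ends by (simp add: norm_mult)
 hence "om^2*(r1^2 + r0^2*c^2 - 2*P*c)/?s\<^sup>2 = om^2*(K - r0^2)" unfolding n0 .
 hence "om^2*((r1^2 + r0^2*c^2 - 2*P*c)/?s\<^sup>2) = om^2*(K - r0^2)" by simp
 hence "(r1^2 + r0^2*c^2 - 2*P*c)/?s\<^sup>2 = K - r0^2" by (subst (asm) mult_left_cancel) (use om in auto)
 hence "r1^2 + r0^2*c^2 - 2*P*c = (K - r0^2)*?s\<^sup>2" using s by (simp add: divide_eq_eq)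
 thus "K*c^2 - 2*P*c + R - K = 0" unfolding s2 R_def by (simp add: algebra_simps)
 show "z t = of_real r0*cis x * of_real (sin (om*(T - t))/?s) + of_real r1*cis y * of_real (sin (om*t)/?s)"
  if t: "t : {0..T}" for t proof -
  have "sin (om*(T - t)) = ?s*cos (om*t) - c * sin (om*t)" by (simp add: c_def right_diff_distrib sin_diff)
  hence q: "sin (om*(T - t))/?s = cos (om*t) - c * sin (om*t)/?s" using s by (simp add: diff_divide_distrib)
  show ?thesis unfolding q using sol(1)[OF _ _ _ t] om ends by (simp add: v0 algebra_simps)
 qed
 have "((%t. (inner (z t) (v t) + 2*En*t)/(2 * sqrt 2)) has_vector_derivative
   norm (vector_derivative z (at t within {0..T})) * sqrt (V_E om En (z t))) (at t within {0..T})" if t: "t : {0..T}" for t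
 proof -
  have "vector_derivative z (at t within {0..T}) = v t"
   using T t z[OF t] by (rule vector_derivative_within_closed_interval)
  moreover have VE: "V_E om En (z t) = (norm (v t))^2/2" using en[OF t] by (simp add: V_E_def field_simps)
  have "sqrt (V_E om En (z t)) = norm (v t)/sqrt 2" unfolding VE by (simp add: real_sqrt_divide)
  moreover have "((%t. (inner (z t) (v t) + 2*En*t)/(2 * sqrt 2)) has_vector_derivative
   (inner (z t) (- of_real (om^2)*z t) + inner (v t) (v t) + 2*En)/(2 * sqrt 2)) (at t within {0..T})" proof -
   have "((%t. inner (z t) (v t)) has_vector_derivative inner (z t) (- of_real (om^2)*z t) + inner (v t) (v t)) (at t within {0..T})"
    by (rule bounded_bilinear.has_vector_derivative[OF bounded_bilinear_inner z[OF t] v[OF t]])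
   hence "((%t. inner (z t) (v t) + 2*En*t) has_real_derivative
     inner (z t) (- of_real (om^2)*z t) + inner (v t) (v t) + 2*En*1) (at t within {0..T})"
    unfolding has_real_derivative_iff_has_vector_derivative[symmetric]
    by (intro DERIV_add DERIV_cmult DERIV_ident)
   from DERIV_cdivide[OF this, of "2 * sqrt 2"] show ?thesis
    by (simp only: has_real_derivative_iff_has_vector_derivative[symmetric] mult_1_right)
  qed
  moreover have "(inner (z t) (- of_real (om^2)*z t) + inner (v t) (v t) + 2*En)/(2 * sqrt 2) = norm (v t)*(norm (v t)/sqrt 2)"
  proof -
   have "inner (z t) (- of_real (om^2)*z t) = - (om^2*(norm (z t))^2)"
    by (simp add: power2_norm_eq_inner scaleR_conv_of_real[symmetric] del: of_real_power)
   moreover have "inner (v t) (v t) = (norm (v t))^2" by (simp add: power2_norm_eq_inner)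
   ultimately have "inner (z t) (- of_real (om^2)*z t) + inner (v t) (v t) + 2*En = 2*(norm (v t))^2"
    using en[OF t] by linarith
   thus ?thesis by (simp add: power2_eq_square)
  qed
  ultimately show ?thesis by simp
 qed
 hence "((%t. norm (vector_derivative z (at t within {0..T})) * sqrt (V_E om En (z t))) has_integral
   (inner (z T) (v T) + 2*En*T)/(2 * sqrt 2) - (inner (z 0) (v 0) + 2*En*0)/(2 * sqrt 2)) {0..T}"
  by (rule fundamental_theorem_of_calculus[OF less_imp_le[OF T]])
 hence "jacobi_length (V_E om En) T z = (inner (z T) (v T) + 2*En*T)/(2 * sqrt 2) - (inner (z 0) (v 0) + 2*En*0)/(2 * sqrt 2)"
  unfolding jacobi_length_def by (rule integral_unique)
 also have "... = ((inner (z T) (v T) - inner (z 0) (v 0))/2 + En*T)/sqrt 2"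
  by (simp add: diff_divide_distrib add_divide_distrib)
 finally have length: "jacobi_length (V_E om En) T z = ((inner (z T) (v T) - inner (z 0) (v 0))/2 + En*T)/sqrt 2" .
 have "inner (z T) (v T) = (om*c/?s)*r1^2 - (om/?s)*P" proof -
  have "v T = (om*c/?s) *\<^sub>R (of_real r1*cis y) + (- om/?s) *\<^sub>R (of_real r0*cis x)"
   unfolding vT by (simp add: scaleR_conv_of_real mult.commute)
  thus ?thesis unfolding ends by (simp only: inner_add_right inner_scaleR_right inner_polar)
    (simp add: P_def power2_eq_square cos_diff algebra_simps)
 qed
 moreover have "inner (z 0) (v 0) = (om/?s)*P - (om*c/?s)*r0^2" proof -
  have "v 0 = (om/?s) *\<^sub>R (of_real r1*cis y) + (- om*c/?s) *\<^sub>R (of_real r0*cis x)"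
   unfolding v0 by (simp add: scaleR_conv_of_real mult.commute)
  thus ?thesis unfolding ends by (simp only: inner_add_right inner_scaleR_right inner_polar)
    (simp add: P_def power2_eq_square cos_diff algebra_simps)
 qed
 ultimately have "inner (z T) (v T) - inner (z 0) (v 0) = om*(R*c - 2*P)/?s"
  using s by (simp add: R_def field_simps)
 thus "jacobi_length (V_E om En) T z = (om*(R*c - 2*P)/(2*?s) + En*T)/sqrt 2" unfolding length by simp
qed

lemma sin_combination_sq: "(sin a)^2 + (sin b)^2 + 2*cos (a + b) * sin a * sin b = (sin (a + b :: real))^2"
proof -
 have "(sin a)^2 + (cos a)^2 = 1" "(sin b)^2 + (cos b)^2 = 1" by simp_all
 thus ?thesis unfolding sin_add cos_add by algebra
qed

lemma cis_minus_one_dist: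
 assumes "cis a = - cis b"
 shows "pi <= abs (a - b)" proof (rule ccontr)
 assume "~ ?thesis"
 hence "cos pi < cos \<bar>a - b\<bar>" by (intro cos_monotone_0_pi) auto
 hence "-1 < cos (a - b)" by (cases "a >= b") (auto simp: abs_if cos_minus[of "a - b", symmetric] simp del: cos_minus)
 moreover have "cis (a - b) = -1" using assms by (simp add: cis_divide[symmetric])
 hence "cos (a - b) = -1" by (simp add: complex_eq_iff)
 ultimately show False by simp
qed

text \<open>Half-angle formulas reduce both sides to \<open>sin (b/2)\<close>; the denominator
  absorbs the loss when \<open>a + b\<close> is close to \<open>pi\<close>.\<close>

lemma sine_increment:
 assumes "0 < a" "0 < b" "a + b < (pi :: real)"
 shows "abs (sin a - sin (a + b)) <= 2 * sin b/sin (a + b)" proof -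
 have s: "0 < sin (a + b)" "0 < sin (b/2)" using assms by (auto intro!: sin_gt_zero)
 have "a + b = 2*((a + b)/2)" by (simp add: field_simps)
 hence "sin (a + b) = 2 * sin ((a + b)/2)*cos ((a + b)/2)" using sin_double[of "(a + b)/2"] by metis
 also have "... <= 2*1*cos ((a + b)/2)" using assms by (intro mult_right_mono mult_left_mono cos_ge_zero) auto
 also have "... <= 2*cos (b/2)" using assms by (simp add: cos_mono_le_eq)
 finally have c: "sin (a + b) <= 2*cos (b/2)" .
 have "sin b = 2 * sin (b/2)*cos (b/2)" using sin_double[of "b/2"] by simp
 hence sb: "sin (b/2) * sin (a + b) <= sin b" using mult_left_mono[OF c, of "sin (b/2)"] s by simp
 have "abs (sin a - sin (a + b)) = 2*(sin (b/2)*abs (cos (a + b/2)))"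
  using s by (simp add: sin_diff_sin abs_mult algebra_simps add_divide_distrib)
 also have "... <= 2*(sin (b/2)*1)" using s by (intro mult_left_mono) auto
 also have "... <= 2*(sin b/sin (a + b))" using sb s by (simp add: field_simps)
 finally show ?thesis by simp
qed

text \<open>The gap hypotheses are the conclusions of \<open>c_E_gap\<close>. \<open>small1\<close>
  excludes the arc that passes through the domain, \<open>small2\<close> and \<open>small3\<close>
  keep the constructed arc outside.\<close>

locale outer_curve = curve +
 fixes om En K de ka et0 :: real
 assumes omega: "om > 0" and K_def: "K = 2*En/om^2" and K_gt: "K > 2" and delta: "de > 0"
  and kappa: "ka > 0" and eta0: "et <= et0" "2 + 6*et0 <= (K + 2)/2"
  and gap_neg: "!!r0 r1 De. abs (r0 - 1) <= et0 ==> abs (r1 - 1) <= et0 ==> abs (r0 - r1) <= et0*abs De ==> abs De <= pi - de ==>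
   c_E K (r0^2 + r1^2) (r0*r1*cos De) + ka <= cos De"
  and gap_pos: "!!r0 r1 De c. abs (r0 - 1) <= et0 ==> abs (r1 - 1) <= et0 ==> abs (r0 - r1) <= et0*abs De ==> abs De <= pi - de ==>
   0 < c ==> c <= 1 ==> De ~= 0 ==> K*c^2 - 2*(r0*r1*cos De)*c + (r0^2 + r1^2) - K = 0 ==>
   cos De + ka*De^2 <= c" and small1: "8*et < ka"
  and small2: "224*et*(2*K + 4) < ka*(1 - cos de)" and small3: "16*et <= ka"
begin

lemma K_E: "om^2*K = 2*En" using omega by (simp add: K_def)

context
 fixes xi xi' :: real
 assumes D: "abs (xi' - xi) <= pi - de"
begin

abbreviation (input) "r0 == rad xi"
abbreviation (input) "r1 == rad xi'"
definition "R = (rad xi)^2 + (rad xi')^2"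
definition "P = rad xi*rad xi'*cos (xi' - xi)"
abbreviation "c == c_E K R P"

lemma rad_hyps: "abs (rad xi - 1) <= et0" "abs (rad xi' - 1) <= et0" "abs (rad xi - rad xi') <= et0*abs (xi' - xi)"
proof -
 show "abs (rad xi - 1) <= et0" "abs (rad xi' - 1) <= et0"
  using rad_close[of xi] rad_close[of xi'] eta0 by (auto simp: rad_def)
 have "abs (rad xi - rad xi') <= et*abs (xi - xi')" by (rule rad_lipschitz)
 also have "... <= et0*abs (xi - xi')" using eta0 by (intro mult_right_mono) auto
 finally show "abs (rad xi - rad xi') <= et0*abs (xi' - xi)" by (simp add: abs_minus_commute)
qed

lemma Kpos: "K > 0" using K_gt by simp

lemma R_less: "R < K" proof -
 have "(rad x)^2 <= 1 + 3*et" for x proof -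
  have "(rad x)^2 <= (1 + et)^2" using rad_bounds[of x] by (intro power_mono) auto
  also have "... = 1 + 2*et + et*et" by (simp add: square_simps)
  also have "... <= 1 + 3*et" using eta_small eta_nonneg mult_right_mono[of et 1 et] by simp
  finally show ?thesis .
 qed
 from this[of xi] this[of xi'] show ?thesis using eta0 K_gt unfolding R_def by argo
qed

lemma RP_pos: "R + 2*P >= 9/8*(1 - cos de)" proof -
 have "cos (pi - de) <= cos \<bar>xi' - xi\<bar>" using D delta by (intro cos_monotone_0_pi_le) auto
 hence "1 - cos de <= 1 + cos (xi' - xi)"
  by (cases "xi' >= xi") (auto simp: abs_if cos_diff[of pi] cos_diff mult.commute)
 moreover have "9/16 <= rad xi*rad xi'"
  using mult_mono[OF rad_bounds(3) rad_bounds(3), of xi xi'] rad_pos[of xi] by (simp add: less_imp_le)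
 moreover have "0 <= 1 - cos de" using cos_le_one[of de] by linarith
 ultimately have "9/16*(1 - cos de) <= rad xi*rad xi'*(1 + cos (xi' - xi))" by (intro mult_mono) auto
 moreover have "0 <= (rad xi - rad xi')^2" by simp
 ultimately show ?thesis by (simp add: R_def P_def power2_diff algebra_simps)
qed

lemma cos_delta: "cos de < 1" proof -
 have "de <= pi" using D by linarith
 hence "cos de < cos 0" using delta by (intro cos_monotone_0_pi) auto
 thus ?thesis by simp
qed

text \<open>The last bound keeps the flight time away from half a period, uniformly over the
  endpoints.\<close>

lemma c_bounds: "-1 < c" "c < 0" "9/8*(1 - cos de) <= (2*K + 4)*(1 - c^2)" proof -
 have "R + 2*P > 0" using RP_pos cos_delta by argo
 thus c1: "-1 < c" by (rule c_E_gt[OF Kpos R_less])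
 show c0: "c < 0" by (rule c_E_neg[OF Kpos R_less])
 have P2: "P <= 2" proof -
  have "rad xi*rad xi'*cos (xi' - xi) <= rad xi*rad xi'*1"
   using rad_pos[of xi] rad_pos[of xi'] by (intro mult_left_mono cos_le_one) (simp add: less_imp_le)
  also have "rad xi*rad xi' <= 5/4*(5/4)"
   using rad_bounds(4) rad_pos[of xi'] by (intro mult_mono) (auto simp: less_imp_le)
  finally have "rad xi*rad xi'*cos (xi' - xi) <= 2" by simp
  thus ?thesis by (simp add: P_def)
 qed
 have "9/8*(1 - cos de) <= (1 + c)*(K*(1 - c) + 2*P)" using RP_pos c_E_plus_one[OF Kpos R_less] by simp
 also have "... <= (1 + c)*((2*K + 4)*(1 - c))" proof (intro mult_left_mono)
  have "K*(1 - c) <= 2*K*(1 - c)" using Kpos c0 by (intro mult_right_mono) auto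
  moreover have "2*P <= 4*(1 - c)" using P2 c0 by simp
  ultimately show "K*(1 - c) + 2*P <= (2*K + 4)*(1 - c)" by (simp add: algebra_simps)
 qed (use c1 in simp)
 also have "... = (2*K + 4)*(1 - c^2)" by (simp add: square_simps)
 finally show "9/8*(1 - cos de) <= (2*K + 4)*(1 - c^2)" .
qed

definition "sn = sqrt (1 - c^2)"
definition "Tm = arccos c/om"

lemma T_facts: "cos (om*Tm) = c" "sin (om*Tm) = sn" "0 < sn" "sn <= 1" "0 < Tm" "om*Tm < pi" "sn^2 = 1 - c^2"
proof -
 have wT: "om*Tm = arccos c" using omega by (simp add: Tm_def)
 show "cos (om*Tm) = c" "sin (om*Tm) = sn" using c_bounds by (auto simp: wT sn_def sin_arccos)
 have c2: "c^2 < 1" using c_bounds by (simp add: abs_square_less_1)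
 thus "0 < sn" "sn^2 = 1 - c^2" "sn <= 1" by (simp_all add: sn_def)
 have "0 < arccos c" "arccos c < pi" using c_bounds arccos_lt_bounded[of c] by auto
 thus "0 < Tm" "om*Tm < pi" using omega unfolding wT by (simp_all add: Tm_def)
qed

definition "zz t = of_real (rad xi)*cis xi * of_real (sin (om*(Tm - t))/sn)
  + of_real (rad xi')*cis xi' * of_real (sin (om*t)/sn)"
definition "vv t = of_real (rad xi)*cis xi * of_real (- om*cos (om*(Tm - t))/sn)
  + of_real (rad xi')*cis xi' * of_real (om*cos (om*t)/sn)"

lemma zz_deriv: "(zz has_vector_derivative vv t) (at t within S)" proof -
 have "((%t. sin (om*(Tm - t))/sn) has_real_derivative - om*cos (om*(Tm - t))/sn) (at t within S)"
  "((%t. sin (om*t)/sn) has_real_derivative om*cos (om*t)/sn) (at t within S)"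
  using T_facts(3) by (auto intro!: derivative_eq_intros)
 thus ?thesis unfolding zz_def[abs_def] vv_def
  by (intro has_vector_derivative_add has_vector_derivative_mult_right has_vector_derivative_of_real)
qed

lemma vv_deriv: "(vv has_vector_derivative - of_real (om^2)*zz t) (at t within S)" proof -
 have "((%t. - om*cos (om*(Tm - t))/sn) has_real_derivative - om\<^sup>2 * sin (om*(Tm - t))/sn) (at t within S)"
  "((%t. om*cos (om*t)/sn) has_real_derivative - om\<^sup>2 * sin (om*t)/sn) (at t within S)"
  using T_facts(3) by (auto intro!: derivative_eq_intros simp: power2_eq_square)
 hence "(vv has_vector_derivative of_real (rad xi)*cis xi * of_real (- om\<^sup>2 * sin (om*(Tm - t))/sn)
  + of_real (rad xi')*cis xi' * of_real (- om\<^sup>2 * sin (om*t)/sn)) (at t within S)"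
  unfolding vv_def[abs_def]
  by (intro has_vector_derivative_add has_vector_derivative_mult_right has_vector_derivative_of_real)
 thus ?thesis by (rule has_vector_derivative_eq_rhs) (simp add: zz_def algebra_simps)
qed

lemma zz_ends: "zz 0 = of_real (rad xi)*cis xi" "zz Tm = of_real (rad xi')*cis xi'"
 using T_facts by (simp_all add: zz_def)

lemma zz_norm: "sn^2*(norm (zz t))^2 = (rad xi)^2*(sin (om*(Tm - t)))^2 + (rad xi')^2*(sin (om*t))^2
  + 2*P * sin (om*(Tm - t)) * sin (om*t)"
 unfolding zz_def norm_combination_sq using T_facts(3) by (simp add: P_def power_divide power2_eq_square[of sn] field_simps)

lemma vv_norm: "sn^2*(norm (vv t))^2 = om^2*((rad xi)^2*(cos (om*(Tm - t)))^2 + (rad xi')^2*(cos (om*t))^2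
  - 2*P*cos (om*(Tm - t))*cos (om*t))"
 unfolding vv_def norm_combination_sq using T_facts(3) by (simp add: P_def power_divide power2_eq_square[of sn] power2_eq_square[of om] field_simps)

text \<open>The addition formula for \<open>cos\<close> removes the dependence on time, and the
  quadratic equation for \<open>c\<close> then identifies the constant.\<close>

lemma zz_energy: "(norm (vv t))^2 = 2*En - om^2*(norm (zz t))^2" proof -
 let ?a = "om*(Tm - t)" and ?b = "om*t"
 have ab: "cos ?a*cos ?b - sin ?a * sin ?b = c"
  using T_facts(1) by (simp add: cos_add[symmetric] distrib_left[symmetric])
 have "sn^2*((norm (vv t))^2 + om^2*(norm (zz t))^2) = sn^2*(norm (vv t))^2 + om^2*(sn^2*(norm (zz t))^2)"
  by (simp add: algebra_simps)
 also have "... = om^2*(R - 2*P*(cos ?a*cos ?b - sin ?a * sin ?b))" proof -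
  have "(sin ?a)^2 + (cos ?a)^2 = 1" "(sin ?b)^2 + (cos ?b)^2 = 1" by simp_all
  thus ?thesis unfolding zz_norm vv_norm R_def by algebra
 qed
 also have "... = om^2*(K * sn^2)" proof -
  have "R - 2*P*c = K*(1 - c^2)" using c_E_root[OF Kpos R_less, of P] by (simp add: algebra_simps)
  thus ?thesis unfolding ab T_facts(7) by simp
 qed
 also have "... = sn^2*(2*En)" by (simp add: K_E[symmetric])
 finally have "(norm (vv t))^2 + om^2*(norm (zz t))^2 = 2*En"
  using T_facts(3) by (subst (asm) mult_left_cancel) auto
 thus ?thesis by simp
qed

lemma sines:
 assumes "0 < t" "t < Tm"
 shows "0 < sin (om*(Tm - t))" "0 < sin (om*t)" proof -
 have a: "om*(Tm - t) < om*Tm" "om*t < om*Tm" using assms omega by (auto intro!: mult_strict_left_mono)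
 have "0 < om*(Tm - t)" "0 < om*t" using assms omega by auto
 thus "0 < sin (om*(Tm - t))" "0 < sin (om*t)" using a T_facts(6) by (metis less_trans sin_gt_zero)+
qed


lemma rad_lipschitz_plane':
 assumes "s >= 0" "t > 0"
 shows "abs (rad x - rad y) <= 4*et*norm (of_real s*cis x - of_real t*cis y)/t" proof (cases "s = 0")
 case True
 have "abs (rad x - rad y) <= 2*et" using rad_close[of x] rad_close[of y] by (simp add: rad_def abs_le_iff)
 also have "... <= 4*et" using eta_nonneg by simp
 finally show ?thesis using True assms by (simp add: norm_mult)
qed (use assms in "intro rad_lipschitz_plane; simp")

text \<open>The distance to an endpoint is of the order of the sine weight carried by the opposite
  endpoint. The constants use only that the radii are at most \<open>5/4\<close> and
  \<open>sn <= 1\<close>.\<close>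

lemma zz_near_ends:
 assumes "0 < t" "t < Tm"
 shows "norm (zz t - of_real (rad xi)*cis xi) <= 4 * sin (om*t)/sn^2"
  "norm (zz t - of_real (rad xi')*cis xi') <= 4 * sin (om*(Tm - t))/sn^2" proof -
 define a b where "a = om*(Tm - t)" and "b = om*t"
 have ab: "a + b = om*Tm" by (simp add: a_def b_def algebra_simps)
 have pos: "0 < a" "0 < b" using assms omega by (auto simp: a_def b_def)
 have lt: "a + b < pi" using T_facts(6) by (simp add: ab)
 have sab: "sin (a + b) = sn" using T_facts(2) by (simp add: ab)
 have sp: "0 < sin a" "0 < sin b" using sines[OF assms] by (auto simp: a_def b_def)
 have gen: "5/4*(abs (x - sn)/sn) + 5/4*(y/sn) <= 4*y/sn^2" if "abs (x - sn) <= 2*y/sn" "0 < y" for x y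
 proof -
  have "abs (x - sn)/sn <= 2*y/sn/sn" using that T_facts(3) by (intro divide_right_mono) auto
  moreover have "y/sn <= y/sn/sn" using that T_facts(3,4) by (simp add: field_simps mult_left_le)
  ultimately have "5/4*(abs (x - sn)/sn) + 5/4*(y/sn) <= 15/4*(y/sn/sn)" by (simp add: field_simps)
  also have "... <= 4*(y/sn/sn)" using that T_facts(3) by (intro mult_right_mono) auto
  finally show ?thesis by (simp add: power2_eq_square)
 qed
 have "zz t - of_real (rad xi)*cis xi = of_real (rad xi)*cis xi * of_real ((sin a - sn)/sn)
   + of_real (rad xi')*cis xi' * of_real (sin b/sn)"
  using T_facts(3) by (simp add: zz_def a_def b_def diff_divide_distrib right_diff_distrib)
 hence "norm (zz t - of_real (rad xi)*cis xi) <= rad xi*(abs (sin a - sn)/sn) + rad xi'*(sin b/sn)"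
  using norm_triangle_ineq[of "of_real (rad xi)*cis xi * of_real ((sin a - sn)/sn)" "of_real (rad xi')*cis xi' * of_real (sin b/sn)"]
   rad_pos[of xi] rad_pos[of xi'] sp T_facts(3) by (simp add: norm_mult norm_divide del: of_real_diff)
 also have "... <= 5/4*(abs (sin a - sn)/sn) + 5/4*(sin b/sn)"
  using rad_bounds(4) sp T_facts(3) by (intro add_mono mult_right_mono) auto
 also have "... <= 4 * sin b/sn^2" using gen[OF sine_increment[OF pos lt, unfolded sab] sp(2)] .
 finally show "norm (zz t - of_real (rad xi)*cis xi) <= 4 * sin (om*t)/sn^2" by (simp add: b_def)
 have "zz t - of_real (rad xi')*cis xi' = of_real (rad xi')*cis xi' * of_real ((sin b - sn)/sn)
   + of_real (rad xi)*cis xi * of_real (sin a/sn)"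
  using T_facts(3) by (simp add: zz_def a_def b_def diff_divide_distrib right_diff_distrib)
 hence "norm (zz t - of_real (rad xi')*cis xi') <= rad xi'*(abs (sin b - sn)/sn) + rad xi*(sin a/sn)"
  using norm_triangle_ineq[of "of_real (rad xi')*cis xi' * of_real ((sin b - sn)/sn)" "of_real (rad xi)*cis xi * of_real (sin a/sn)"]
   rad_pos[of xi] rad_pos[of xi'] sp T_facts(3) by (simp add: norm_mult norm_divide del: of_real_diff)
 also have "... <= 5/4*(abs (sin b - sn)/sn) + 5/4*(sin a/sn)"
  using rad_bounds(4) sp T_facts(3) by (intro add_mono mult_right_mono) auto
 also have "... <= 4 * sin a/sn^2"
  using gen[OF sine_increment[OF pos(2,1), unfolded add.commute[of b a], OF lt, unfolded sab] sp(1)] .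
 finally show "norm (zz t - of_real (rad xi')*cis xi') <= 4 * sin (om*(Tm - t))/sn^2" by (simp add: a_def)
qed

text \<open>Times \<open>sn^2\<close>, the excess of the squared distance over the squared boundary
  radius is \<open>2*(P - c*rh^2)*A*B\<close> plus two terms caused by the varying radius. The main
  term is at least \<open>ka/2*A*B\<close> by the gap; by \<open>zz_near_ends\<close> the others are
  at most a multiple of \<open>et*A*B\<close>, so the estimate survives at both ends of the
  arc.\<close>

lemma zz_outside:
 assumes t: "0 < t" "t < Tm"
 shows "zz t ~: closure (D_eps f ep)" proof -
 obtain s x where sx: "zz t = of_real s*cis x" "s >= 0" by (rule polar_cases)
 define rh where "rh = rad x"
 define A B where "A = sin (om*(Tm - t))" and "B = sin (om*t)"
 have AB: "0 < A" "0 < B" "A <= 1" "B <= 1" using sines[OF t] by (auto simp: A_def B_def)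
 have ns: "norm (zz t) = s" using sx by (simp add: norm_mult)
 have comb: "A^2 + B^2 + 2*c*A*B = sn^2" using sin_combination_sq[of "om*(Tm - t)" "om*t"] T_facts(1,2)
  by (simp add: A_def B_def distrib_left[symmetric])
 have eq: "sn^2*(s^2 - rh^2) = ((rad xi)^2 - rh^2)*A^2 + ((rad xi')^2 - rh^2)*B^2 + 2*(P - c*rh^2)*(A*B)"
  using zz_norm[of t] unfolding ns comb[symmetric] A_def[symmetric] B_def[symmetric] by (simp add: algebra_simps)
 have sqd: "abs ((rad y)^2 - rh^2) <= 14*et*norm (zz t - of_real (rad y)*cis y)" for y proof -
  have "abs (rh - rad y) <= 4*et*norm (zz t - of_real (rad y)*cis y)/rad y"
   unfolding rh_def sx(1) by (rule rad_lipschitz_plane'[OF sx(2) rad_pos])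
  also have "... <= 4*et*norm (zz t - of_real (rad y)*cis y)/(3/4)"
   using rad_bounds(3)[of y] rad_pos[of y] eta_nonneg by (intro divide_left_mono) auto
  finally have l: "abs (rh - rad y) <= 16/3*et*norm (zz t - of_real (rad y)*cis y)" by simp
  have "(rad y)^2 - rh^2 = - ((rad y + rh)*(rh - rad y))" by (simp add: square_simps)
  hence "abs ((rad y)^2 - rh^2) = (rad y + rh)*abs (rh - rad y)"
   using rad_pos[of y] rad_pos[of x] by (simp add: rh_def abs_mult)
  also have "... <= 5/2*(16/3*et*norm (zz t - of_real (rad y)*cis y))"
   using l rad_bounds(4)[of y] rad_bounds(4)[of x] rad_pos[of y] rad_pos[of x] by (intro mult_mono) (auto simp: rh_def)
  also have "... = 40/3*(et*norm (zz t - of_real (rad y)*cis y))" by simp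
  also have "... <= 14*(et*norm (zz t - of_real (rad y)*cis y))"
   using eta_nonneg by (intro mult_right_mono) auto
  finally show ?thesis by simp
 qed
 \<comment> \<open>One factor \<open>X\<close> is discarded by \<open>X <= 1\<close>; the other
   pairs with the \<open>Y\<close> coming from the distance to the endpoint.\<close>
 have term_bound: "- (56*et*(A*B)/sn^2) <= ((rad y)^2 - rh^2)*X^2"
  if "norm (zz t - of_real (rad y)*cis y) <= 4*Y/sn^2" "0 < X" "X <= 1" "0 < Y" "X*Y = A*B" for y X Y proof -
  have "abs (((rad y)^2 - rh^2)*X^2) <= (14*et*(4*Y/sn^2))*X" unfolding abs_mult proof (intro mult_mono)
   show "abs ((rad y)^2 - rh^2) <= 14*et*(4*Y/sn^2)"
    using sqd[of y] mult_left_mono[OF that(1), of "14*et"] eta_nonneg by linarith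
   show "abs (X^2) <= X" using that by (simp add: power2_eq_square mult_left_le)
  qed (use eta_nonneg that in auto)
  also have "... = 56*et*(A*B)/sn^2" using that(5) by (simp add: algebra_simps)
  finally show ?thesis by (simp only: abs_le_iff minus_le_iff)
 qed
 have t0: "- (56*et*(A*B)/sn^2) <= ((rad xi)^2 - rh^2)*A^2"
  by (rule term_bound[of xi B A]) (use zz_near_ends[OF t] AB in "auto simp: A_def B_def")
 have t1: "- (56*et*(A*B)/sn^2) <= ((rad xi')^2 - rh^2)*B^2"
  by (rule term_bound[of xi' A B]) (use zz_near_ends[OF t] AB in "auto simp: A_def B_def mult.commute")
 have main: "ka/4 <= P - c*rh^2" proof -
  have g: "c + ka <= cos (xi' - xi)" using gap_neg[OF rad_hyps D] by (simp add: R_def P_def)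
  have "9/16 <= rh^2" using power_mono[OF rad_bounds(3)[of x], of 2] by (simp add: rh_def power2_eq_square)
  hence 1: "9/16 * ka <= rh^2*(cos (xi' - xi) - c)" using g kappa by (intro mult_mono) auto
  have pr: "(1 - et)*(1 - et) <= rad y*rad z & rad y*rad z <= (1 + et)*(1 + et)" for y z
   using rad_bounds(1,2)[of y] rad_bounds(1,2)[of z] eta_small eta_nonneg by (auto intro!: mult_mono)
  have "abs (rad xi*rad xi' - rh^2) <= (1 + et)*(1 + et) - (1 - et)*(1 - et)"
   using pr[of xi xi'] pr[of x x] by (simp add: rh_def power2_eq_square abs_le_iff)
  hence "abs (rad xi*rad xi' - rh^2) <= 4*et" by (simp add: algebra_simps)
  hence "abs (rad xi*rad xi' - rh^2)*abs (cos (xi' - xi)) <= 4*et*1"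
   using eta_nonneg by (intro mult_mono) auto
  hence "- (4*et) <= (rad xi*rad xi' - rh^2)*cos (xi' - xi)"
   unfolding abs_mult[symmetric] by (simp add: abs_le_iff)
  moreover have "P - c*rh^2 = rh^2*(cos (xi' - xi) - c) + (rad xi*rad xi' - rh^2)*cos (xi' - xi)"
   by (simp add: P_def algebra_simps)
  ultimately show ?thesis using 1 small3 kappa by linarith
 qed
 have "224*et < ka * sn^2" proof -
  have "ka*(1 - cos de) <= ka*((2*K + 4) * sn^2)"
   using c_bounds(3) cos_delta kappa unfolding T_facts(7) by (intro mult_left_mono) (argo, simp)
  hence "224*et*(2*K + 4) < ka * sn^2*(2*K + 4)" using small2 by (simp add: algebra_simps)
  thus ?thesis using Kpos by (simp only: mult_less_cancel_right)
 qed
 hence k2: "112*et/sn^2 < ka/2" using T_facts(3) by (simp add: field_simps)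
 have "0 < (ka/2 - 112*et/sn^2)*(A*B)" using k2 AB by (intro mult_pos_pos) auto
 also have "... = 2*(ka/4)*(A*B) - 2*(56*et*(A*B)/sn^2)" by (simp add: algebra_simps)
 also have "... <= sn^2*(s^2 - rh^2)" proof -
  have "2*(ka/4)*(A*B) <= 2*(P - c*rh^2)*(A*B)" using main AB by (intro mult_right_mono mult_left_mono) auto
  moreover have "p - 2*u <= q + r + y" if "p <= y" "- u <= q" "- u <= r" for p q r u y :: real
   using that by linarith
  ultimately show ?thesis unfolding eq using t0 t1 by blast
 qed
 finally have "rh^2 < s^2" using T_facts(3) by (simp add: zero_less_mult_iff)
 hence "rh < s" using sx(2) by (rule power_less_imp_less_base)
 thus ?thesis unfolding sx(1) closure_D_eps_iff[OF sx(2)] by (simp add: rh_def)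
qed


lemma D_lt_pi: "abs (xi' - xi) < pi" using D delta by linarith

text \<open>The endpoints subtend an angle less than \<open>pi\<close>, so the quotient
  \<open>q\<close> of the arc by its starting point avoids the negative real axis, and the principal
  logarithm provides a lift that closes with winding number \<open>0\<close>.\<close>

lemma zz_outer_arc: "outer_arc om En f ep xi xi' Tm zz" proof -
 define q where "q t = of_real (sin (om*(Tm - t))/sn) + of_real (rad xi'/rad xi)*cis (xi' - xi) * of_real (sin (om*t)/sn)" for t
 have zq: "zz t = of_real (rad xi)*cis xi*q t" for t
  using rad_pos[of xi] by (simp add: zz_def q_def distrib_left cis_divide[symmetric] mult.assoc)
 have q_nonneg: "q t ~: \<real>\<^sub>\<le>\<^sub>0" if t: "t : {0..Tm}" for t proof (cases "t = 0 | t = Tm")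
  case True
  then consider "t = 0" | "t = Tm" by blast
  thus ?thesis proof cases
   case 1
   thus ?thesis using T_facts(2,3) by (simp add: q_def)
  next
   case 2
   hence "q t = of_real (rad xi'/rad xi)*cis (xi' - xi)" using T_facts(2,3) by (simp add: q_def)
   moreover have "of_real (rad xi'/rad xi)*cis (xi' - xi) ~: \<real>\<^sub>\<le>\<^sub>0" proof
    assume "of_real (rad xi'/rad xi)*cis (xi' - xi) : \<real>\<^sub>\<le>\<^sub>0"
    hence a: "rad xi'/rad xi*cos (xi' - xi) <= 0" "rad xi'/rad xi * sin (xi' - xi) = 0"
     by (auto simp: complex_nonpos_Reals_iff)
    hence "sin (xi' - xi) = 0" using rad_pos[of xi] rad_pos[of xi'] by simp
    hence "xi' - xi = 0" using D_lt_pi sin_eq_0_pi[of "xi' - xi"] by auto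
    thus False using a rad_pos[of xi] rad_pos[of xi'] by (simp add: field_simps)
   qed
   ultimately show ?thesis by simp
  qed
 next
  case False
  hence t': "0 < t" "t < Tm" using t by auto
  note sp = sines[OF t']
  show ?thesis proof
   assume "q t : \<real>\<^sub>\<le>\<^sub>0"
   hence a: "sin (om*(Tm - t))/sn + rad xi'/rad xi*cos (xi' - xi)*(sin (om*t)/sn) <= 0"
    "rad xi'/rad xi * sin (xi' - xi)*(sin (om*t)/sn) = 0" by (auto simp: complex_nonpos_Reals_iff q_def)
   hence "sin (xi' - xi) = 0" using rad_pos[of xi] rad_pos[of xi'] sp T_facts(3) by simp
   hence "xi' - xi = 0" using D_lt_pi sin_eq_0_pi[of "xi' - xi"] by auto
   moreover have "0 < sin (om*(Tm - t))/sn + rad xi'/rad xi*1*(sin (om*t)/sn)"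
    using rad_pos[of xi] rad_pos[of xi'] sp T_facts(3) by (intro add_pos_pos mult_pos_pos divide_pos_pos) auto
   ultimately show False using a(1) by simp
  qed
 qed
 define u where "u t = Complex (ln (rad xi)) xi + Ln (q t)" for t
 have uc: "continuous_on {0..Tm} u" unfolding u_def by (intro continuous_intros q_nonneg, unfold q_def)
   (use T_facts(3) in "auto intro!: continuous_intros simp: rad_pos[THEN less_imp_neq, symmetric]")
 have q_nz: "q t ~= 0" if "t : {0..Tm}" for t using q_nonneg[OF that] by auto
 have ue: "zz t = exp (u t)" if "t : {0..Tm}" for t
  using q_nz[OF that] by (simp add: u_def exp_add zq Complex_exp[OF rad_pos])
 have u0: "u 0 = Complex (ln (rad xi)) xi" using T_facts(2,3) by (simp add: u_def q_def)
 have uT: "u Tm = Complex (ln (rad xi')) (xi' + 0)" proof -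
  have "q Tm = exp (Complex (ln (rad xi'/rad xi)) (xi' - xi))"
   using T_facts(2,3) rad_pos[of xi] rad_pos[of xi'] by (simp add: q_def Complex_exp[symmetric])
  hence "Ln (q Tm) = Complex (ln (rad xi'/rad xi)) (xi' - xi)" using D_lt_pi by (simp add: Ln_exp)
  thus ?thesis using rad_pos[of xi] rad_pos[of xi'] by (simp add: u_def complex_eq_iff ln_div)
 qed
 have "winding_number (closed_arc f ep xi xi' Tm zz) 0 = of_real (0/(2*pi))"
  by (rule winding_closed_arc[OF T_facts(5) uc ue u0 uT]) auto
 moreover have "zz ` {0<..<Tm} \<inter> closure (D_eps f ep) = {}" using zz_outside by auto
 moreover have "solves_on (V_E om En) Tm {0..Tm} zz"
  unfolding solves_on_V_E using zz_deriv vv_deriv zz_energy by blast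
 ultimately show ?thesis unfolding outer_arc_def using T_facts(5) zz_ends by (simp add: bdry_rad)
qed

lemma sqrt_K: "2*En/om^2 = K" by (simp add: K_def)

text \<open>The swept angle is monotone by conservation of angular momentum and less than
  \<open>pi\<close>, so the arc lasts less than half a period and \<open>cos (om*T)\<close> is a
  root of the quadratic. With the positive root the arc would enter the domain in the bisecting
  direction.\<close>

lemma outer_arc_length:
 assumes arc: "outer_arc om En f ep xi xi' T z"
 shows "jacobi_length (V_E om En) T z = G_E om En R P" proof -
 have T: "T > 0" and ends: "z 0 = bdry f ep xi" "z T = bdry f ep xi'"
  and sol: "solves_on (V_E om En) T {0..T} z" and out': "z ` {0<..<T} \<inter> closure (D_eps f ep) = {}"
  and wind: "winding_number (closed_arc f ep xi xi' T z) 0 = 0" using arc by (simp_all add: outer_arc_def)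
 have out: "z t ~: closure (D_eps f ep)" if "0 < t" "t < T" for t proof -
  have "t : {0<..<T}" using that by simp
  hence "z t : z ` {0<..<T}" by (rule imageI)
  thus ?thesis using out' by blast
 qed
 obtain v where v: "!!t. t : {0..T} ==> (z has_vector_derivative v t) (at t within {0..T})"
  "!!t. t : {0..T} ==> (v has_vector_derivative - of_real (om^2)*z t) (at t within {0..T})"
  "!!t. t : {0..T} ==> (norm (v t))^2 = 2*En - om^2*(norm (z t))^2" using sol unfolding solves_on_V_E by blast
 have zc: "continuous_on {0..T} z" using v(1) by (intro continuous_on_vector_derivative) blast
 have nz: "z t ~= 0" if t: "t : {0..T}" for t proof (cases "t = 0 | t = T")
  case True
  thus ?thesis using ends bdry_nonzero by auto
 next
  case False
  hence "z t ~: closure (D_eps f ep)" using out t by auto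
  moreover have "of_real 0*cis 0 : closure (D_eps f ep)" using closure_D_eps_iff[of 0 0] rad_pos[of 0] by simp
  ultimately show ?thesis by auto
 qed
 obtain u si where u: "continuous_on {0..T} u" "!!t. t : {0..T} ==> z t = exp (u t)"
  "u 0 = Complex (ln (rad xi)) xi" "u T = Complex (ln (rad xi')) (xi' + si)"
  "cis si = 1" "winding_number (closed_arc f ep xi xi' T z) 0 = of_real (si/(2*pi))"
  by (rule arc_lift_exists[OF T zc nz ends]) (assumption | rule that)+
 have si: "si = 0" using u(6) wind by simp
 define ph where "ph t = Im (u t)" for t
 have ph0: "ph 0 = xi" and phT: "ph T = xi'" using u(3,4) si by (auto simp: ph_def)
 have z_polar: "of_real (norm (z t))*cis (ph t) = z t" if "t : {0..T}" for t
  using u(2)[OF that] by (simp add: exp_eq_polar ph_def exp_of_real norm_mult)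
 define L where "L t = Im (cnj (z t) * v t)" for t
 have Lconst: "L t = L 0" if t: "t : {0..T}" for t proof (rule vector_derivative_zero_const[OF _ t])
  fix t assume t: "t : {0..T}"
  have "((%t. cnj (z t) * v t) has_vector_derivative cnj (z t)*(- of_real (om^2)*z t) + cnj (v t) * v t) (at t within {0..T})"
   by (intro has_vector_derivative_mult has_vector_derivative_cnj v t)
  hence "((%t. Im (cnj (z t) * v t)) has_vector_derivative Im (cnj (z t)*(- of_real (om^2)*z t) + cnj (v t) * v t)) (at t within {0..T})"
   by (rule bounded_linear.has_vector_derivative[OF bounded_linear_Im])
  moreover have "Im (cnj (z t)*(- of_real (om^2)*z t) + cnj (v t) * v t) = 0"
   by (simp add: algebra_simps del: of_real_power)
  ultimately show "(L has_vector_derivative 0) (at t within {0..T})" unfolding L_def[abs_def] by simp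
 qed
 have ph_deriv: "(ph has_real_derivative L 0/(norm (z t))^2) (at t within {0..T})" if t: "t : {0..T}" for t
 proof -
  have "(u has_vector_derivative v t/z t) (at t within {0..T})"
   by (rule log_lift_derivative[OF u(1,2) v(1)[OF t] t])
  hence "((%t. Im (u t)) has_vector_derivative Im (v t/z t)) (at t within {0..T})"
   by (rule bounded_linear.has_vector_derivative[OF bounded_linear_Im])
  moreover have "Im (v t/z t) = L t/(norm (z t))^2"
   unfolding L_def Im_divide cmod_power2 by (simp add: algebra_simps)
  ultimately show ?thesis
   using Lconst[OF t] by (simp add: ph_def[abs_def] has_real_derivative_iff_has_vector_derivative)
 qed
 have monotone: "abs (ph s - xi) <= abs (ph T - xi)" if s: "s : {0..T}" for s proof -
  have "EX y:{0..T}. ph q - ph p = (q - p)*(L 0/(norm (z y))^2)" if "0 <= p" "p <= q" "q <= T" for p q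
  proof (cases "p = q")
   case False
   have "EX y:{p<..<q}. ph q - ph p = L 0/(norm (z y))^2*(q - p)" proof (rule mvt_simple)
    show "p < q" using False that by simp
    fix x assume "p <= x" "x <= q"
    thus "(ph has_derivative (*) (L 0/(norm (z x))^2)) (at x within {p..q})"
     using ph_deriv[of x] that has_derivative_subset[of ph _ x "{0..T}" "{p..q}"]
     by (auto simp: has_field_derivative_def)
   qed
   then obtain y where "y : {p<..<q}" "ph q - ph p = L 0/(norm (z y))^2*(q - p)" by blast
   thus ?thesis using that by (intro bexI[of _ y]) auto
  qed (use that in auto)
  from this[of 0 s] this[of s T] obtain y y' where
   y: "ph s - ph 0 = s*(L 0/(norm (z y))^2)" "ph T - ph s = (T - s)*(L 0/(norm (z y'))^2)" using s by auto
  show ?thesis proof (cases "L 0 >= 0")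
   case True
   hence "0 <= ph s - ph 0" "0 <= ph T - ph s" using y s by (auto intro!: mult_nonneg_nonneg divide_nonneg_nonneg)
   thus ?thesis using ph0 by simp
  next
   case False
   hence "ph s - ph 0 <= 0" "ph T - ph s <= 0" using y s by (auto intro!: mult_nonneg_nonpos divide_nonpos_nonneg)
   thus ?thesis using ph0 by simp
  qed
 qed
 \<comment> \<open>After half a period the solution is at the antipode of its start, for which it
   would have to sweep at least \<open>pi\<close>.\<close>
 have wT: "om*T < pi" proof (rule ccontr)
  assume "~ ?thesis"
  define s where "s = pi/om"
  have s: "s : {0..T}" "om * s = pi" using \<open>~ om*T < pi\<close> omega by (auto simp: s_def field_simps)
  have "z s = - z 0" using harmonic_solution(1)[OF _ v(1,2) s(1)] omega s(2) by simp
  hence "of_real (norm (z s))*cis (ph s) = - (of_real (norm (z 0))*cis xi)" "norm (z s) = norm (z 0)"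
   using z_polar[OF s(1)] z_polar[of 0] T ph0 by simp_all
  hence "of_real (norm (z 0))*cis (ph s) = of_real (norm (z 0))*(- cis xi)" by simp
  hence "cis (ph s) = - cis xi" using nz[of 0] T by (subst (asm) mult_left_cancel) auto
  hence "pi <= abs (ph s - xi)" by (rule cis_minus_one_dist)
  thus False using monotone[OF s(1)] phT D_lt_pi by simp
 qed
 have sT: "sin (om*T) > 0" using wT omega T by (intro sin_gt_zero) auto
 define C where "C = cos (om*T)"
 have wT0: "0 < om*T" using omega T by simp
 have "cos (om*T) < cos 0" by (rule cos_monotone_0_pi) (use wT wT0 in auto)
 moreover have "cos pi < cos (om*T)" by (rule cos_monotone_0_pi) (use wT wT0 in auto)
 ultimately have C1: "C < 1" "-1 < C" by (simp_all add: C_def)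
 note ha = harmonic_arc[OF omega T sT v(1,2,3) ends[unfolded bdry_rad], folded R_def P_def C_def, unfolded sqrt_K]
 have root: "K*C^2 - 2*P*C + R - K = 0" by (rule ha(1))
 have "C < 0" proof (rule ccontr)
  assume "~ C < 0"
  moreover have "C ~= 0" using root R_less by auto
  ultimately have C0: "0 < C" by simp
  \<comment> \<open>For coinciding endpoints the quadratic has the root \<open>1\<close>, excluded
    by \<open>C < 1\<close>, and its other root is negative.\<close>
  show False proof (cases "xi' = xi")
   case True
   have "R = 2*(rad xi)^2" "P = (rad xi)^2" unfolding R_def P_def by (simp_all add: True power2_eq_square)
   hence "(C - 1)*(K*C + K - R) = 0" using root by (simp add: square_simps)
   hence "K*C + K - R = 0" using C1 by simp
   moreover have "K*C > 0" using C0 Kpos by simp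
   ultimately show False using R_less by linarith
  next
   case False
   have "K*C^2 - 2*(rad xi*rad xi'*cos (xi' - xi))*C + ((rad xi)^2 + (rad xi')^2) - K = 0"
    using root unfolding R_def P_def .
   moreover have "xi' - xi ~= 0" using False by simp
   ultimately have gap: "cos (xi' - xi) + ka*(xi' - xi)^2 <= C"
    using gap_pos[OF rad_hyps D C0 less_imp_le[OF C1(1)]] by blast
   \<comment> \<open>In the bisecting direction both endpoints contribute equally, so the distance
     \<open>N\<close> has a closed form; the second-difference bound compares \<open>rad m\<close>
     with the radii of the endpoints.\<close>
   define m where "m = (xi + xi')/2"
   have "continuous_on {0..T} ph" unfolding ph_def[abs_def] by (intro continuous_intros u(1))
   moreover have "(ph 0 <= m & m <= ph T) | (ph T <= m & m <= ph 0)" by (auto simp: ph0 phT m_def)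
   ultimately obtain t where t: "0 <= t" "t <= T" "ph t = m"
    using IVT'[of ph 0 m T] IVT2'[of ph T m 0] T by force
   have "t ~= 0" "t ~= T" using t(3) ph0 phT False by (auto simp: m_def)
   hence t': "0 < t" "t < T" using t by auto
   define A B where "A = sin (om*(T - t))/sin (om*T)" and "B = sin (om*t)/sin (om*T)"
   define N where "N = norm (z t)"
   have ztm: "of_real N*cis m = z t" using z_polar[of t] t by (simp add: N_def)
   have zt: "of_real N*cis m = of_real (rad xi)*cis xi * of_real A + of_real (rad xi')*cis xi' * of_real B"
    unfolding ztm using ha(3)[of t] t by (simp add: A_def B_def)
   have "rad m < N" using out[OF t'] closure_D_eps_iff[of N m] unfolding ztm by (simp add: N_def not_le)
   define d where "d = (xi' - xi)/2"
   have xm: "xi = m - d" "xi' = m + d" "xi' - xi = 2*d" by (simp_all add: m_def d_def field_simps)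
   have dd: "d ~= 0" "abs d < pi/2" using False D_lt_pi by (auto simp: d_def)
   have cm: "cis xi = cis m*cis (- d)" "cis xi' = cis m*cis d"
    by (simp_all add: cis_mult) (simp_all add: xm(1,2))
   have "cis m * of_real N = cis m*(of_real (rad xi*A)*cis (- d) + of_real (rad xi'*B)*cis d)"
    using zt unfolding cm by (simp add: algebra_simps)
   hence "of_real N = of_real (rad xi*A)*cis (- d) + of_real (rad xi'*B)*cis d"
    by (subst (asm) mult_left_cancel) simp_all
   hence re: "N = rad xi*A*cos d + rad xi'*B*cos d" and im: "0 = - (rad xi*A * sin d) + rad xi'*B * sin d"
    by (auto simp: complex_eq_iff)
   have "- pi < d" "d < pi" using dd pi_gt_zero by linarith+
   hence "sin d ~= 0" using dd sin_eq_0_pi[of d] by blast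
   hence AB: "rad xi*A = rad xi'*B" using im by simp
   define l where "l = rad xi*A"
   have N: "N = 2*l*cos d" using re AB by (simp add: l_def)
   have A: "A = l/rad xi" using rad_pos[of xi] by (simp add: l_def)
   have B: "B = l/rad xi'" using rad_pos[of xi'] by (simp add: l_def AB)
   have "A^2 + B^2 + 2*C*A*B = 1" proof -
    have "(sin (om*(T - t)))^2 + (sin (om*t))^2 + 2*C * sin (om*(T - t)) * sin (om*t) = (sin (om*T))^2"
     using sin_combination_sq[of "om*(T - t)" "om*t"] by (simp add: C_def distrib_left[symmetric])
    hence "((sin (om*(T - t)))^2 + (sin (om*t))^2 + 2*C * sin (om*(T - t)) * sin (om*t))/(sin (om*T))^2 = 1"
     using sT by simp
    thus ?thesis by (simp add: A_def B_def add_divide_distrib power_divide power2_eq_square)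
   qed
   hence "l^2*(R + 2*C*(rad xi*rad xi')) = (rad xi*rad xi')^2"
    using rad_pos[of xi] rad_pos[of xi'] unfolding A B by (simp add: field_simps R_def power2_eq_square)
   moreover have "N^2 = 2*l^2*(1 + cos (2*d))" unfolding N cos_double_cos by (simp add: power2_eq_square)
   ultimately have NR: "N^2*(R + 2*C*(rad xi*rad xi')) = 2*(1 + cos (2*d))*(rad xi*rad xi')^2" by algebra
   have Nsq: "(rad m)^2 <= N^2" using \<open>rad m < N\<close> rad_pos[of m] by (intro power_mono) auto
   have Rge: "2*(1 + C)*(rad xi*rad xi') <= R + 2*C*(rad xi*rad xi')"
    using zero_le_power2[of "rad xi - rad xi'"] by (simp add: R_def power2_diff algebra_simps)
   have rr: "0 < rad xi*rad xi'" using rad_pos by simp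
   have "(rad m)^2*(2*(1 + C)*(rad xi*rad xi')) <= 2*(1 + cos (2*d))*(rad xi*rad xi')^2"
    unfolding NR[symmetric] by (intro mult_mono Nsq Rge) (use rr C1 in auto)
   hence "(rad m)^2*(1 + C)*(2*(rad xi*rad xi')) <= (1 + cos (2*d))*(rad xi*rad xi')*(2*(rad xi*rad xi'))"
    by (simp add: square_simps)
   hence key: "(rad m)^2*(1 + C) <= (1 + cos (2*d))*(rad xi*rad xi')"
    using rr by (simp only: mult_le_cancel_right)
   have "abs (rad xi + rad xi' - 2*rad m) <= et*(xi - xi')^2"
    using rad_mid[of xi xi'] by (simp add: rad_def m_def)
   hence sum: "rad xi + rad xi' <= 2*rad m + et*(2*d)^2" unfolding power2_commute[of xi xi'] xm(3) by linarith
   define e where "e = et*(2*d)^2"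
   have e0: "0 <= e" using eta_nonneg by (simp add: e_def)
   have e1: "e <= 4" proof -
    have "(2*d)^2 <= 16" using power_mono[of "abs (2*d)" 4 2] dd pi_less_4 by simp
    hence "e <= 1/4*16" unfolding e_def using eta_small eta_nonneg by (intro mult_mono) auto
    thus ?thesis by simp
   qed
   have "4*(rad xi*rad xi') <= (rad xi + rad xi')^2"
    using zero_le_power2[of "rad xi - rad xi'"] by (simp add: power2_sum power2_diff)
   also have "... <= (2*rad m + e)^2" using sum rad_pos[of xi] rad_pos[of xi'] by (intro power_mono) (auto simp: e_def)
   also have "... = 4*(rad m)^2 + (4*rad m + e)*e" by (simp add: square_simps)
   also have "... <= 4*(rad m)^2 + 9*e"
    using e0 e1 rad_bounds(4)[of m] by (intro add_left_mono mult_right_mono) auto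
   finally have r01: "rad xi*rad xi' <= (rad m)^2 + 9/4*e" by simp
   have c2: "0 <= 1 + cos (2*d)" "1 + cos (2*d) <= 2"
    using cos_ge_minus_one[of "2*d"] cos_le_one[of "2*d"] by linarith+
   \<comment> \<open>The gap and the second-difference error are both of order
     \<open>(2*d)^2\<close>. This factor cancels, and what remains is \<open>ka\<close> against
     \<open>et\<close>.\<close>
   have "(rad m)^2*(1 + (cos (2*d) + ka*(2*d)^2)) <= (rad m)^2*(1 + C)"
    using gap unfolding xm(3) by (intro mult_left_mono) auto
   also note key
   also have "(1 + cos (2*d))*(rad xi*rad xi') <= (1 + cos (2*d))*((rad m)^2 + 9/4*e)"
    using r01 c2 by (intro mult_left_mono)
   finally have "(rad m)^2*(ka*(2*d)^2) <= (1 + cos (2*d))*(9/4*e)" by (simp add: algebra_simps)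
   also have "... <= 2*(9/4*e)" using c2 e0 by (intro mult_right_mono) auto
   finally have "((rad m)^2 * ka)*(2*d)^2 <= (9/2*et)*(2*d)^2" by (simp add: e_def algebra_simps)
   hence "(rad m)^2 * ka <= 9/2*et" using dd(1) by (simp only: mult_le_cancel_right) simp
   moreover have "9/16 * ka <= (rad m)^2 * ka"
    using power_mono[OF rad_bounds(3)[of m], of 2] kappa by (intro mult_right_mono) (auto simp: power2_eq_square)
   ultimately show False using small1 kappa by linarith
  qed
 qed
 hence Cc: "C = c" by (rule c_E_unique[OF Kpos R_less root])
 have Teq: "T = arccos c/om" using arccos_cos[of "om*T"] wT omega T by (simp add: Cc[symmetric] C_def)
 have seq: "sin (om*T) = sqrt (1 - c^2)"
  unfolding Cc[symmetric] C_def by (rule sin_cos_sqrt[OF less_imp_le[OF sT]])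
 have "jacobi_length (V_E om En) T z = (om*(R*c - 2*P)/(2 * sqrt (1 - c^2)) + En*T)/sqrt 2"
  using ha(2) unfolding seq Cc .
 also have "... = G_E om En R P" unfolding G_E_def Let_def sqrt_K by (subst Teq) simp
 finally show ?thesis .
qed

theorem is_S_E_iff: "is_S_E om En f ep xi xi' l \<longleftrightarrow> l = G_E om En R P"
 unfolding is_S_E_def using zz_outer_arc outer_arc_length by metis

end
end

section \<open>Inner arcs\<close>

text \<open>The hyperbolic counterpart of \<open>c_E\<close>: the positive root is the hyperbolic
  cosine of \<open>sqrt (H/2)\<close> times the regularized duration, with \<open>R\<close> and
  \<open>P\<close> formed from complex square roots of the endpoints.\<close>

definition c_I :: "real => real => real => real => real" where
 "c_I H mu R P = (sqrt ((H*P)^2 + mu*(mu + H*R)) - H*P)/mu"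

definition G_I :: "real => real => real => real => real" where "G_I H mu R P = (let c = c_I H mu R P in
   (sqrt (2*H)*(R*c - 2*P)/sqrt (c^2 - 1) + mu*arcosh c/sqrt (H/2))/sqrt 2)"

context
 fixes H mu R P :: real
 assumes H: "H > 0" and mu: "mu > 0" and R: "R > 0"
begin

lemma c_I_disc: "abs (H*P) < sqrt ((H*P)^2 + mu*(mu + H*R))" proof -
 have "mu*(mu + H*R) > 0" using H mu R by (intro mult_pos_pos add_pos_pos)
 hence "abs (H*P)^2 < (H*P)^2 + mu*(mu + H*R)" by simp
 thus ?thesis by (rule real_less_rsqrt)
qed

lemma c_I_pos: "c_I H mu R P > 0" using c_I_disc mu by (simp add: c_I_def)

lemma c_I_root: "mu*(c_I H mu R P)^2 + 2*H*P*c_I H mu R P - (mu + H*R) = 0" proof -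
 have "mu*c_I H mu R P + H*P = sqrt ((H*P)^2 + mu*(mu + H*R))" using mu by (simp add: c_I_def)
 moreover have "0 <= (H*P)^2 + mu*(mu + H*R)" using H mu R by (intro add_nonneg_nonneg mult_nonneg_nonneg) auto
 ultimately have "(mu*c_I H mu R P + H*P)^2 = (H*P)^2 + mu*(mu + H*R)" by simp
 hence "mu*(mu*(c_I H mu R P)^2 + 2*H*P*c_I H mu R P - (mu + H*R)) = 0" by (simp add: square_simps)
 thus ?thesis using mu by simp
qed

lemma c_I_unique:
 assumes "mu*x^2 + 2*H*P*x - (mu + H*R) = 0" "x > 0"
 shows "x = c_I H mu R P" proof -
 let ?D = "(H*P)^2 + mu*(mu + H*R)"
 have "mu*(mu*x^2 + 2*H*P*x - (mu + H*R)) = 0" using assms by simp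
 hence "(mu*x + H*P)^2 = ?D" by (simp add: square_simps)
 hence "abs (mu*x + H*P) = sqrt ?D" by (metis real_sqrt_abs)
 moreover have "mu*x > 0" using mu assms by simp
 ultimately have "mu*x + H*P = sqrt ?D" using c_I_disc by linarith
 hence "mu*x = sqrt ?D - H*P" by simp
 thus ?thesis using mu by (simp add: c_I_def field_simps)
qed

text \<open>The quadratic takes the negative value \<open>H*(2*P - R)\<close> at \<open>1\<close>,
  so its positive root lies beyond.\<close>

lemma c_I_gt_1:
 assumes "2*P < R"
 shows "1 < c_I H mu R P" proof (rule ccontr)
 let ?c = "c_I H mu R P"
 assume "~ ?thesis"
 hence c: "?c <= 1" by simp
 have "H*(2*P) < H*R" using assms H by simp
 hence "mu + 2*H*P < mu + H*R" by simp
 also have "... = ?c*(mu*?c + 2*H*P)" using c_I_root by (simp add: square_simps)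
 also have "... <= 1*(mu*?c + 2*H*P)" proof (rule mult_right_mono[OF c])
  have "0 < ?c*(mu*?c + 2*H*P)" using c_I_root H mu R by (simp add: square_simps add_pos_pos)
  thus "0 <= mu*?c + 2*H*P" using c_I_pos by (simp add: zero_less_mult_iff)
 qed
 also have "... <= mu*1 + 2*H*P" using mult_left_mono[OF c, of mu] mu by simp
 finally show False by simp
qed

end

section \<open>Regularization of the Kepler equation\<close>

lemma solves_on_V_I:
 assumes "mu ~= 0"
 shows "solves_on (V_I En h mu) T A z \<longleftrightarrow> (EX v. ALL t:A. z t ~= 0 &
   (z has_vector_derivative v t) (at t within {0..T}) &
   (v has_vector_derivative - of_real (mu/norm (z t) ^ 3)*z t) (at t within {0..T}) &
   (norm (v t))\<^sup>2 = 2*(En + h + mu/norm (z t)))" proof -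
 have "(EX a. (GDERIV (V_I En h mu) (z t) :> a) & (v has_vector_derivative a) (at t within {0..T}))
  \<longleftrightarrow> z t ~= 0 & (v has_vector_derivative - of_real (mu/norm (z t) ^ 3)*z t) (at t within {0..T})"
  for t and v :: "real => complex" using GDERIV_V_I GDERIV_unique no_GDERIV_V_I_0[OF assms] by metis
 thus ?thesis unfolding solves_on_def by (simp add: V_I_def) (smt (verit) field_sum_of_halves)
qed

text \<open>Levi-Civita regularization: \<open>w\<close> is a square root of a Kepler arc, \<open>S\<close> the new time and
  \<open>Y\<close> the derivative of \<open>w\<close> with respect to \<open>S\<close>; the arc becomes a solution of a linear equation.\<close>

lemma levi_civita:
 fixes w v :: "real => complex"
 assumes H: "H > 0" and T: "T > 0" and nz: "!!t. t : {0..T} ==> w t ~= 0"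
  and w: "!!t. t : {0..T} ==> (w has_vector_derivative v t/(2*w t)) (at t within {0..T})"
  and v: "!!t. t : {0..T} ==> (v has_vector_derivative - of_real (mu/norm (w t) ^ 6)*(w t)^2) (at t within {0..T})"
  and en: "!!t. t : {0..T} ==> (norm (v t))^2 = 2*(H + mu/(norm (w t))^2)"
 defines "Og == sqrt (H/2)" and "Y == %t. cnj (w t) * v t/2"
 obtains S where "S 0 = 0" "S T > 0"
  "!!t. t : {0..T} ==> (S has_real_derivative 1/(norm (w t))^2) (at t within {0..T})"
  "!!t. t : {0..T} ==> (w has_vector_derivative of_real (1/(norm (w t))^2)*Y t) (at t within {0..T})"
  "!!t. t : {0..T} ==> (Y has_vector_derivative of_real (1/(norm (w t))^2)*(of_real (Og^2)*w t)) (at t within {0..T})"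
  "!!t. t : {0..T} ==> 2*(norm (Y t))^2 = H*(norm (w t))^2 + mu"
  "w T = of_real (cosh (Og*S T))*w 0 + of_real (sinh (Og*S T)/Og)*Y 0"
  "Y T = of_real (Og * sinh (Og*S T))*w 0 + of_real (cosh (Og*S T))*Y 0" proof -
 have Om: "Og > 0" "Og^2 = H/2" using H by (simp_all add: Og_def)
 have wc: "continuous_on {0..T} w" using w by (intro continuous_on_vector_derivative) blast
 \<comment> \<open>The new time runs at the rate \<open>1/(norm w)^2\<close>. By the energy relation
   the equation of \<open>w\<close> in this time is linear with coefficient
   \<open>Og^2 = H/2\<close>.\<close>
 define S where "S t = integral {0..t} (%t. 1/(norm (w t))^2)" for t
 have cint: "continuous_on {0..T} (%t. 1/(norm (w t))^2)" by (intro continuous_intros wc) (use nz in auto)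
 have S: "(S has_real_derivative 1/(norm (w t))^2) (at t within {0..T})" if "t : {0..T}" for t
  unfolding S_def[abs_def] by (rule integral_has_real_derivative[OF cint that])
 have S0: "S 0 = 0" by (simp add: S_def)
 have ST: "S T > 0" proof -
  have "EX y:{0<..<T}. S T - S 0 = 1/(norm (w y))^2*(T - 0)"
   by (rule mvt_simple[OF T, of S "%y. (*) (1/(norm (w y))^2)"])
    (use S in "simp add: has_field_derivative_def")
  then obtain y where "y : {0<..<T}" "S T - S 0 = 1/(norm (w y))^2*(T - 0)" by blast
  thus ?thesis using S0 T nz[of y] by simp
 qed
 have wcw: "cnj (w t)*w t = of_real ((norm (w t))^2)" for t
  unfolding complex_norm_square by (rule mult.commute)
 have wY: "(w has_vector_derivative of_real (1/(norm (w t))^2)*Y t) (at t within {0..T})" if t: "t : {0..T}" for t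
 proof -
  have "of_real (1/(norm (w t))^2)*Y t = v t/(2*w t)"
   using nz[OF t] wcw[of t] by (simp add: Y_def divide_simps)
  thus ?thesis using w[OF t] by simp
 qed
 have YE: "2*(norm (Y t))^2 = H*(norm (w t))^2 + mu" if t: "t : {0..T}" for t proof -
  have "2*(norm (Y t))^2 = (norm (w t))^2*(norm (v t))^2/2"
   by (simp add: Y_def norm_mult norm_divide power_mult_distrib power_divide)
  also have "... = H*(norm (w t))^2 + mu" unfolding en[OF t] using nz[OF t] by (simp add: field_simps)
  finally show ?thesis .
 qed
 have Yd: "(Y has_vector_derivative of_real (1/(norm (w t))^2)*(of_real (Og^2)*w t)) (at t within {0..T})" if t: "t : {0..T}" for t
 proof -
  let ?n = "of_real ((norm (w t))^2) :: complex"
  have n0: "?n ~= 0" "w t ~= 0" "cnj (w t) ~= 0" using nz[OF t] by auto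
  have "((%t. cnj (w t) * v t/2) has_vector_derivative
    (cnj (w t)*(- of_real (mu/norm (w t) ^ 6)*(w t)^2) + cnj (v t/(2*w t)) * v t)/2) (at t within {0..T})"
   by (intro has_vector_derivative_divide has_vector_derivative_mult has_vector_derivative_cnj v w t)
  moreover have "(cnj (w t)*(- of_real (mu/norm (w t) ^ 6)*(w t)^2) + cnj (v t/(2*w t)) * v t)/2
    = of_real (1/(norm (w t))^2)*(of_real (Og^2)*w t)" proof -
   have n6: "(of_real (norm (w t) ^ 6) :: complex) = ?n*?n*?n"
    by (simp add: power2_eq_square eval_nat_numeral mult.assoc)
   have "cnj (w t)*(- of_real (mu/norm (w t) ^ 6)*(w t)^2) = - (of_real mu*w t/(?n*?n))" proof -
    have "cnj (w t)*(- of_real (mu/norm (w t) ^ 6)*(w t)^2) = - (of_real mu*w t*(cnj (w t)*w t)/(?n*?n*?n))"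
     unfolding of_real_divide n6 by (simp add: power2_eq_square)
    also have "... = - (of_real mu*w t*?n/(?n*?n*?n))" unfolding wcw ..
    also have "... = - (of_real mu*w t/(?n*?n))" using n0 by (simp del: of_real_power)
    finally show ?thesis .
   qed
   moreover have "cnj (v t/(2*w t)) * v t = of_real (H + mu/(norm (w t))^2)*w t/?n" proof -
    have "cnj (v t) * v t = of_real ((norm (v t))^2)" unfolding complex_norm_square by (rule mult.commute)
    hence "cnj (v t/(2*w t)) * v t = of_real (2*(H + mu/(norm (w t))^2))/(2*cnj (w t))"
     unfolding en[OF t] by simp
    also have "... = of_real (H + mu/(norm (w t))^2)/cnj (w t)"
     by (simp only: of_real_mult of_real_numeral) (simp del: of_real_add of_real_divide)
    also have "1/cnj (w t) = w t/?n" using n0 wcw[of t, symmetric] by (simp add: field_simps)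
    hence "of_real (H + mu/(norm (w t))^2)/cnj (w t) = of_real (H + mu/(norm (w t))^2)*w t/?n"
     by (metis times_divide_eq_right mult.right_neutral)
    finally show ?thesis .
   qed
   ultimately have "(cnj (w t)*(- of_real (mu/norm (w t) ^ 6)*(w t)^2) + cnj (v t/(2*w t)) * v t)/2
    = (- (of_real mu*w t/(?n*?n)) + of_real (H + mu/(norm (w t))^2)*w t/?n)/2" by (simp only:)
   also have "... = of_real (1/(norm (w t))^2)*(of_real (H/2)*w t)" using n0 by (simp add: field_simps)
   finally show ?thesis unfolding Om .
  qed
  ultimately show ?thesis unfolding Y_def by simp
 qed
 let ?c = "%t. of_real (cosh (Og*S t)) :: complex" and ?s = "%t. of_real (sinh (Og*S t)) :: complex"
 have dc: "(?c has_vector_derivative of_real (Og*(1/(norm (w t))^2) * sinh (Og*S t))) (at t within {0..T})"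
  and ds: "(?s has_vector_derivative of_real (Og*(1/(norm (w t))^2)*cosh (Og*S t))) (at t within {0..T})"
  if t: "t : {0..T}" for t by (auto intro!: has_vector_derivative_of_real derivative_eq_intros S[OF t])
 have A: "?c T*w T - ?s T*Y T/of_real Og = ?c 0*w 0 - ?s 0*Y 0/of_real Og"
 proof (rule vector_derivative_zero_const[of 0 T "%t. ?c t*w t - ?s t*Y t/of_real Og"])
  fix t assume t: "t : {0..T}"
  show "((%t. ?c t*w t - ?s t*Y t/of_real Og) has_vector_derivative 0) (at t within {0..T})"
   by (rule derivative_eq_intros dc[OF t] ds[OF t] wY[OF t] Yd[OF t] refl)+
    (use Om(1) nz[OF t] in "simp add: field_simps power2_eq_square")
 qed (use T in simp)
 have B: "?c T*Y T - of_real Og*?s T*w T = ?c 0*Y 0 - of_real Og*?s 0*w 0"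
 proof (rule vector_derivative_zero_const[of 0 T "%t. ?c t*Y t - of_real Og*?s t*w t"])
  fix t assume t: "t : {0..T}"
  show "((%t. ?c t*Y t - of_real Og*?s t*w t) has_vector_derivative 0) (at t within {0..T})"
   by (rule derivative_eq_intros dc[OF t] ds[OF t] wY[OF t] Yd[OF t] refl)+
    (use Om(1) nz[OF t] in "simp add: field_simps power2_eq_square")
 qed (use T in simp)
 have cs: "?c T*?c T - ?s T*?s T = 1"
  using cosh_square_eq[of "Og*S T"] by (simp add: power2_eq_square flip: of_real_mult of_real_diff)
 have Oz: "of_real Og ~= (0::complex)" using Om by simp
 have w0: "w 0 = ?c T*w T - ?s T*Y T/of_real Og" and Y0: "Y 0 = ?c T*Y T - of_real Og*?s T*w T"
  using A B S0 by simp_all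
 have "?c T*w 0 + ?s T/of_real Og*Y 0 = (?c T*?c T - ?s T*?s T)*w T"
  unfolding w0 Y0 using Oz by (simp add: field_simps)
 hence wT: "w T = of_real (cosh (Og*S T))*w 0 + of_real (sinh (Og*S T)/Og)*Y 0" using cs by simp
 have "of_real Og*?s T*w 0 + ?c T*Y 0 = (?c T*?c T - ?s T*?s T)*Y T"
  unfolding w0 Y0 using Oz by (simp add: field_simps)
 hence YT: "Y T = of_real (Og * sinh (Og*S T))*w 0 + of_real (cosh (Og*S T))*Y 0" using cs by simp
 show thesis by (rule that[OF S0 ST S wY Yd YE wT YT])
qed

lemma exp_half: "r > 0 ==> exp (Complex (ln r) x/2) = of_real (sqrt r)*cis (x/2)"
 by (simp add: exp_eq_polar ln_sqrt[symmetric])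

lemma V_I_length_density:
 assumes "(norm v)^2 = 2*(En + h + mu/norm z)"
 shows "norm v * sqrt (V_I En h mu z) = sqrt 2*(En + h + mu/norm z)" proof -
 have V: "V_I En h mu z = (norm v)^2/2" using assms by (simp add: V_I_def)
 have "norm v * sqrt (V_I En h mu z) = (norm v)^2/sqrt 2" unfolding V by (simp add: real_sqrt_divide power2_eq_square)
 also have "... = sqrt 2*(En + h + mu/norm z)" proof -
  have "2*x/sqrt 2 = sqrt 2*x" for x :: real using real_div_sqrt[of 2] by (metis times_divide_eq_left zero_le_numeral)
  thus ?thesis unfolding assms .
 qed
 finally show ?thesis .
qed

text \<open>An antiderivative of the Jacobi length element \<open>sqrt (H + mu / r)\<close> of radial arcs.\<close>

definition radial_length :: "real => real => real => real" where
 "radial_length H mu r = sqrt (r*(H*r + mu)) + mu/sqrt H*ln (sqrt (H*r) + sqrt (H*r + mu))"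

lemma radial_length_deriv:
 assumes "H > 0" "mu > 0" "r > 0"
 shows "(radial_length H mu has_real_derivative sqrt (H + mu/r)) (at r)" proof -
 define p q where "p = sqrt (H*r)" and "q = sqrt (H*r + mu)"
 have pq: "p > 0" "q > 0" "p^2 = H*r" "q^2 = H*r + mu" using assms by (auto simp: p_def q_def add_pos_pos)
 have sr: "sqrt (r*(H*r + mu)) = sqrt r*q" by (simp add: q_def real_sqrt_mult)
 have sH: "p = sqrt H * sqrt r" by (simp add: p_def real_sqrt_mult)
 have pos: "0 < r*(H*r + mu)" "0 < H*r" "0 < H*r + mu" using assms by (auto intro: add_pos_pos mult_pos_pos)
 have d1: "((%r. sqrt (r*(H*r + mu))) has_real_derivative (2*H*r + mu)*(inverse (sqrt (r*(H*r + mu)))/2)) (at r)"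
  by (rule DERIV_chain2[where f = sqrt and g = "%r. r*(H*r + mu)", OF DERIV_real_sqrt[OF pos(1)], THEN DERIV_cong])
   (auto intro!: derivative_eq_intros)
 have dp: "((%r. sqrt (H*r)) has_real_derivative inverse p/2*H) (at r)"
  unfolding p_def by (rule DERIV_chain2[where f = sqrt and g = "%r. H*r", OF DERIV_real_sqrt[OF pos(2)]]) (auto intro!: derivative_eq_intros)
 have dq: "((%r. sqrt (H*r + mu)) has_real_derivative inverse q/2*H) (at r)"
  unfolding q_def by (rule DERIV_chain2[where f = sqrt and g = "%r. H*r + mu", OF DERIV_real_sqrt[OF pos(3)]]) (auto intro!: derivative_eq_intros)
 have "((%r. ln (sqrt (H*r) + sqrt (H*r + mu))) has_real_derivative 1/(p + q)*(inverse p/2*H + inverse q/2*H)) (at r)"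
  unfolding p_def q_def
  by (rule DERIV_chain2[where f = ln and g = "%r. sqrt (H*r) + sqrt (H*r + mu)", OF DERIV_ln_divide])
   (rule add_pos_pos[OF pq(1,2), unfolded p_def q_def], rule DERIV_add[OF dp dq, unfolded p_def q_def])
 hence d2: "((%r. mu/sqrt H*ln (sqrt (H*r) + sqrt (H*r + mu))) has_real_derivative
   mu/sqrt H*(1/(p + q)*(inverse p/2*H + inverse q/2*H))) (at r)" by (rule DERIV_cmult)
 have "inverse p/2*H + inverse q/2*H = (p + q)*(H/(2*p*q))" using pq(1,2) by (simp add: field_simps)
 hence "1/(p + q)*(inverse p/2*H + inverse q/2*H) = H/(2*p*q)" using pq(1,2) by simp
 moreover have "mu/sqrt H*(H/(2*p*q)) = mu/(2 * sqrt r*q)"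
  unfolding sH using assms pq by (simp add: field_simps)
 moreover have "(2*H*r + mu)*(inverse (sqrt (r*(H*r + mu)))/2) + mu/(2 * sqrt r*q) = q/sqrt r" proof -
  have "(2*H*r + mu)*(inverse (sqrt r*q)/2) + mu/(2 * sqrt r*q) = (H*r + mu)/(sqrt r*q)"
   using assms pq by (simp add: field_simps)
  also have "... = q*q/(sqrt r*q)" using pq(4) by (simp add: power2_eq_square)
  also have "... = q/sqrt r" using pq(2) by simp
  finally show ?thesis unfolding sr .
 qed
 moreover have "q/sqrt r = sqrt (H + mu/r)"
  unfolding q_def real_sqrt_divide[symmetric] using assms by (simp add: field_simps)
 ultimately show ?thesis using DERIV_add[OF d1 d2] unfolding radial_length_def[abs_def] by simp
qed

lemma radial_length_continuous:
 assumes "H > 0" "mu > 0"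
 shows "continuous_on {0..} (radial_length H mu)" unfolding radial_length_def
 by (intro continuous_intros) (use assms in "auto simp: add_nonneg_eq_0_iff real_sqrt_eq_zero_cancel_iff add_nonneg_pos less_imp_neq[symmetric]")

text \<open>The formula for ordinary arcs, evaluated at coinciding endpoints, is the length of the
  ejection-collision arc, so one expression covers the diagonal. With \<open>p^2 = H*r\<close> and
  \<open>q^2 = H*r + mu\<close> the quantity \<open>c^2 - 1\<close> becomes a perfect
  square.\<close>

lemma G_I_collision:
 assumes H: "H > 0" and mu: "mu > 0" and r: "r > 0"
 shows "G_I H mu (2*r) (- r) = 2*(radial_length H mu r - radial_length H mu 0)" proof -
 define c where "c = 1 + 2*H*r/mu"
 have c1: "c > 1" using assms by (simp add: c_def)
 have "mu*c^2 + 2*H*(- r)*c - (mu + H*(2*r)) = 0" using mu by (simp add: c_def power2_eq_square field_simps)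
 hence cc: "c = c_I H mu (2*r) (- r)" using c1 r by (intro c_I_unique[OF H mu]) auto
 define p q where "p = sqrt (H*r)" and "q = sqrt (H*r + mu)"
 have pq: "p > 0" "q > 0" "p^2 = H*r" "q^2 = H*r + mu" using assms by (auto simp: p_def q_def add_pos_pos)
 have qp: "q^2 - p^2 = mu" using pq by simp
 have c_pq: "c = (p^2 + q^2)/mu" unfolding pq c_def using mu by (simp add: field_simps)
 have "c^2 - 1 = (2*p*q/mu)^2" proof -
  have "(p^2 + q^2)^2 - (q^2 - p^2)^2 = (2*p*q)^2" by algebra
  hence "((p^2 + q^2)^2 - mu^2)/mu^2 = (2*p*q)^2/mu^2" unfolding qp by simp
  thus ?thesis unfolding c_pq using mu by (simp add: power_divide diff_divide_distrib)
 qed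
 hence s: "sqrt (c^2 - 1) = 2*p*q/mu" using pq mu by simp
 have arc: "arcosh c = 2*ln (p + q) - ln mu" proof -
  have "arcosh c = ln (c + sqrt (c^2 - 1))" using c1 by (simp add: arcosh_real_def)
  also have "c + sqrt (c^2 - 1) = (p + q)^2/mu" unfolding s unfolding c_pq by (simp add: power2_sum add_divide_distrib)
  also have "ln ... = 2*ln (p + q) - ln mu" using pq mu by (simp add: ln_div ln_realpow)
  finally show ?thesis .
 qed
 have t1: "sqrt (2*H)*(2*r*c - 2*(- r))/(2*p*q/mu)/sqrt 2 = 2 * sqrt (r*(H*r + mu))" proof -
  have "2*r*c - 2*(- r) = 4*r*q^2/mu" unfolding pq c_def using mu by (simp add: field_simps)
  hence "sqrt (2*H)*(2*r*c - 2*(- r))/(2*p*q/mu)/sqrt 2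
    = sqrt (2*H)*(4*r*q^2/mu)/(2*p*q/mu)/sqrt 2" by (simp only:)
  also have "... = sqrt H*(2*r*q)/p"
   using pq(1,2) mu by (simp add: real_sqrt_mult power2_eq_square field_simps)
  also have "... = 2*(r/sqrt r)*q" using H r by (simp add: p_def real_sqrt_mult)
  also have "... = 2 * sqrt (r*(H*r + mu))" using r by (simp add: real_div_sqrt q_def real_sqrt_mult)
  finally show ?thesis .
 qed
 have t2: "mu*(2*ln (p + q) - ln mu)/sqrt (H/2)/sqrt 2 = mu/sqrt H*(2*ln (p + q) - ln mu)"
  using H by (simp add: real_sqrt_divide)
 have t3: "radial_length H mu 0 = mu/sqrt H*(ln mu/2)" using mu by (simp add: radial_length_def ln_sqrt)
 show ?thesis unfolding G_I_def Let_def cc[symmetric] s arc add_divide_distrib t1 t2 t3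
  unfolding radial_length_def p_def[symmetric] q_def[symmetric] by (simp add: algebra_simps)
qed

text \<open>\<open>cos_gap\<close> expresses that the half angle stays away from \<open>pi\<close>.
  The factor \<open>60\<close> leaves room for the constant \<open>41\<close> of the containment
  estimate.\<close>

locale inner_curve = curve +
 fixes En h mu H ka de :: real
 assumes H_def: "H = En + h" and H_pos: "H > 0" and mu_pos: "mu > 0" and delta: "de > 0"
  and kappa: "0 < ka" "ka <= 1/4" "60*et < ka"
  and cos_gap: "!!De. abs De <= 2*pi - de ==> - cos (De/2) <= 1 - 2 * ka"
begin

context
 fixes xi xi' :: real
 assumes D: "abs (xi' - xi) <= 2*pi - de"
begin

definition "RI = rad xi + rad xi'"
definition "PI = - (sqrt (rad xi*rad xi')*cos ((xi' - xi)/2))"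
abbreviation "C == c_I H mu RI PI"
definition "Og = sqrt (H/2)"
definition "w0 = of_real (sqrt (rad xi))*cis (xi/2)"
text \<open>The minus sign selects the other branch of the square root: winding once around the
  origin negates \<open>w\<close>. For coinciding endpoints \<open>w1 = - w0\<close>, which forces a
  passage through \<open>0\<close>.\<close>

definition "w1 = of_real (- sqrt (rad xi'))*cis (xi'/2)"

lemma Om: "Og > 0" "Og^2 = H/2" "2*Og = sqrt (2*H)"
 using H_pos by (auto simp: Og_def real_sqrt_divide real_sqrt_mult real_div_sqrt field_simps)

lemma R_pos: "RI > 0" using rad_pos[of xi] rad_pos[of xi'] by (simp add: RI_def)

lemma RP_less: "2*PI < RI" proof -
 have s: "sqrt (rad xi*rad xi') > 0" using rad_pos[of xi] rad_pos[of xi'] by simp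
 have "2*PI = 2 * sqrt (rad xi*rad xi')*(- cos ((xi' - xi)/2))" by (simp add: PI_def)
 also have "... < 2 * sqrt (rad xi*rad xi')*1"
  using cos_gap[OF D] kappa s by (intro mult_strict_left_mono) auto
 also have "... <= RI"
  using arith_geo_mean_sqrt[of "rad xi" "rad xi'"] rad_pos[of xi] rad_pos[of xi'] by (simp add: RI_def)
 finally show ?thesis .
qed

lemma C_gt: "C > 1" by (rule c_I_gt_1[OF H_pos mu_pos R_pos RP_less])

lemma w_norms: "(norm w0)^2 = rad xi" "(norm w1)^2 = rad xi'" "inner w0 w1 = PI" proof -
 show "(norm w0)^2 = rad xi" "(norm w1)^2 = rad xi'"
  using rad_pos[of xi] rad_pos[of xi'] by (auto simp: w0_def w1_def norm_mult power_mult_distrib)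
 show "inner w0 w1 = PI"
  unfolding w0_def w1_def inner_polar PI_def by (simp add: real_sqrt_mult diff_divide_distrib)
qed

text \<open>Winding number plus or minus one adds \<open>2*pi\<close> or \<open>-2*pi\<close> to the
  lifted angle, so the continuous square root ends at \<open>w1\<close>. The linear regularized
  equation and the energy then determine the duration through \<open>c_I\<close>.\<close>

lemma noncollision_length:
 assumes arc: "inner_arc En h mu f ep xi xi' T z" and ne: "xi ~= xi'"
 shows "jacobi_length (V_I En h mu) T z = G_I H mu RI PI" proof -
 have T: "T > 0" and ends: "z 0 = bdry f ep xi" "z T = bdry f ep xi'"
  and sol: "solves_on (V_I En h mu) T {0..T} z"
  and wind: "winding_number (closed_arc f ep xi xi' T z) 0 : {1, -1}"
  using arc ne by (simp_all add: inner_arc_def)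
 have mu0: "mu ~= 0" using mu_pos by simp
 obtain v where v': "ALL t:{0..T}. z t ~= 0 & (z has_vector_derivative v t) (at t within {0..T}) &
   (v has_vector_derivative - of_real (mu/norm (z t) ^ 3)*z t) (at t within {0..T}) &
   (norm (v t))\<^sup>2 = 2*(En + h + mu/norm (z t))" using sol unfolding solves_on_V_I[OF mu0] by blast
 hence v: "!!t. t : {0..T} ==> z t ~= 0"
  "!!t. t : {0..T} ==> (z has_vector_derivative v t) (at t within {0..T})"
  "!!t. t : {0..T} ==> (v has_vector_derivative - of_real (mu/norm (z t) ^ 3)*z t) (at t within {0..T})"
  "!!t. t : {0..T} ==> (norm (v t))^2 = 2*(En + h + mu/norm (z t))" by blast+
 have zc: "continuous_on {0..T} z" using v(2) by (intro continuous_on_vector_derivative) blast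
 obtain u si where u: "continuous_on {0..T} u" "!!t. t : {0..T} ==> z t = exp (u t)"
  "u 0 = Complex (ln (rad xi)) xi" "u T = Complex (ln (rad xi')) (xi' + si)"
  "cis si = 1" "winding_number (closed_arc f ep xi xi' T z) 0 = of_real (si/(2*pi))"
  by (rule arc_lift_exists[OF T zc v(1) ends]) (assumption | rule that)+
 have "of_real (si/(2*pi)) : {of_real 1, of_real (-1) :: complex}" using wind u(6) by simp
 hence "si/(2*pi) = 1 | si/(2*pi) = -1" by (simp only: insert_iff empty_iff of_real_eq_iff simp_thms)
 hence "si = 2*pi | si = - (2*pi)" by (auto simp: field_simps)
 hence cs: "cis (si/2) = -1" by (auto simp: complex_eq_iff)
 define w where "w t = exp (u t/2)" for t
 have wnz: "w t ~= 0" for t by (simp add: w_def)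
 have wz: "(w t)^2 = z t" if "t : {0..T}" for t using u(2)[OF that] by (simp add: w_def exp_double[symmetric])
 have nwz: "norm (z t) = (norm (w t))^2" if "t : {0..T}" for t
  using wz[OF that, symmetric] by (simp add: norm_power)
 have w0: "w 0 = w0" using rad_pos[of xi] by (simp add: w_def u(3) exp_half w0_def)
 have w1: "w T = w1" using rad_pos[of xi'] cs by (simp add: w_def u(4) exp_half w1_def add_divide_distrib cis_mult[symmetric])
 have wd: "(w has_vector_derivative v t/(2*w t)) (at t within {0..T})" if t: "t : {0..T}" for t proof -
  have "(u has_vector_derivative v t/z t) (at t within {0..T})"
   by (rule log_lift_derivative[OF u(1,2) v(2)[OF t] t])
  hence "((%t. u t/2) has_vector_derivative v t/z t/2) (at t within {0..T})"
   by (rule has_vector_derivative_divide)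
  moreover have "(exp has_field_derivative exp (u t/2)) (at (u t/2) within (%t. u t/2) ` {0..T})"
   by (rule DERIV_subset[OF DERIV_exp]) simp
  ultimately have "(exp \<circ> (%t. u t/2) has_vector_derivative v t/z t/2*exp (u t/2)) (at t within {0..T})"
   by (rule field_vector_diff_chain_within)
  moreover have "v t/z t/2*exp (u t/2) = v t/(2*w t)"
   unfolding wz[OF t, symmetric] w_def[symmetric] using wnz by (simp add: power2_eq_square)
  ultimately show ?thesis by (simp add: o_def w_def[abs_def])
 qed
 have vd: "(v has_vector_derivative - of_real (mu/norm (w t) ^ 6)*(w t)^2) (at t within {0..T})" if t: "t : {0..T}" for t
  using v(3)[OF t] unfolding nwz[OF t] wz[OF t] by (simp add: power_mult[symmetric])
 have en: "(norm (v t))^2 = 2*(H + mu/(norm (w t))^2)" if t: "t : {0..T}" for t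
  using v(4)[OF t] unfolding nwz[OF t] by (simp add: H_def)
 define Y where "Y t = cnj (w t) * v t/2" for t
 obtain S where S: "S 0 = 0" "S T > 0"
  "!!t. t : {0..T} ==> (S has_real_derivative 1/(norm (w t))^2) (at t within {0..T})"
  "!!t. t : {0..T} ==> (w has_vector_derivative of_real (1/(norm (w t))^2)*Y t) (at t within {0..T})"
  "!!t. t : {0..T} ==> (Y has_vector_derivative of_real (1/(norm (w t))^2)*(of_real (Og^2)*w t)) (at t within {0..T})"
  "!!t. t : {0..T} ==> 2*(norm (Y t))^2 = H*(norm (w t))^2 + mu"
  "w T = of_real (cosh (Og*S T))*w 0 + of_real (sinh (Og*S T)/Og)*Y 0"
  "Y T = of_real (Og * sinh (Og*S T))*w 0 + of_real (cosh (Og*S T))*Y 0"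
  by (rule levi_civita[OF H_pos T wnz wd vd en, folded Y_def Og_def]) (assumption | rule that)+
 define c s where "c = cosh (Og*S T)" and "s = sinh (Og*S T)"
 have "Og*S T > 0" using Om S by simp
 hence cs: "s > 0" "c > 0" "c^2 - s^2 = 1" by (auto simp: c_def s_def cosh_square_eq)
 have "w1 = c *\<^sub>R w0 + (s/Og) *\<^sub>R Y 0" using S(7) unfolding w0 w1 by (simp add: c_def s_def scaleR_conv_of_real)
 hence "(s/Og) *\<^sub>R Y 0 = w1 - c *\<^sub>R w0" by simp
 hence "(Og/s) *\<^sub>R ((s/Og) *\<^sub>R Y 0) = (Og/s) *\<^sub>R (w1 - c *\<^sub>R w0)" by simp
 hence Y0: "Y 0 = (Og/s) *\<^sub>R (w1 - c *\<^sub>R w0)" using cs Om by simp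
 have YT: "Y T = (Og/s) *\<^sub>R (c *\<^sub>R w1 - w0)" proof -
  have "Y T = (Og * s) *\<^sub>R w0 + c *\<^sub>R Y 0" using S(8) unfolding w0 by (simp add: c_def s_def scaleR_conv_of_real)
  also have "... = (Og/s*c) *\<^sub>R w1 + (Og * s - Og/s*c^2) *\<^sub>R w0"
   unfolding Y0 by (simp add: square_simps)
  also have "Og * s - Og/s*c^2 = - (Og/s)" proof -
   have "c^2 = 1 + s^2" using cs by simp
   thus ?thesis using cs(1) by (simp add: field_simps power2_eq_square)
  qed
  finally show ?thesis by (simp add: algebra_simps)
 qed
 have "(norm (w1 - c *\<^sub>R w0))^2 = rad xi' + c^2*rad xi - 2*c*PI" proof -
  have "(norm (w1 - c *\<^sub>R w0))^2 = inner w1 w1 + c^2*inner w0 w0 - 2*c*inner w0 w1"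
   unfolding power2_norm_eq_inner
   by (simp add: inner_diff_left inner_diff_right inner_commute algebra_simps power2_eq_square[of c])
  thus ?thesis unfolding power2_norm_eq_inner[symmetric] w_norms .
 qed
 \<comment> \<open>The energy relation at the start, with the velocity expressed by the endpoints,
   is the quadratic equation for \<open>c\<close>.\<close>
 hence "2*(Og^2/s^2*(rad xi' + c^2*rad xi - 2*c*PI)) = H*rad xi + mu"
  using S(6)[of 0] T unfolding Y0 w0 w_norms by (simp add: power_mult_distrib power_divide)
 hence "H*(rad xi' + c^2*rad xi - 2*c*PI) = (H*rad xi + mu) * s^2"
  unfolding Om using cs by (simp add: field_simps)
 moreover have "s^2 = c^2 - 1" using cs by simp
 ultimately have "mu*c^2 + 2*H*PI*c - (mu + H*RI) = 0" by (simp add: RI_def algebra_simps)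
 hence cC: "c = C" by (rule c_I_unique[OF H_pos mu_pos R_pos _ cs(2)])
 have sC: "s = sqrt (C^2 - 1)" using cs cC by (metis add_diff_cancel_left' diff_add_cancel less_imp_le real_sqrt_unique power2_eq_iff diff_diff_eq2)
 have ST: "S T = arcosh C/Og"
  unfolding cC[symmetric] c_def using Om \<open>Og*S T > 0\<close> by (simp add: arcosh_cosh_real)
 have "((%t. (2*inner (w t) (Y t) + mu*S t)/sqrt 2) has_vector_derivative
   norm (vector_derivative z (at t within {0..T})) * sqrt (V_I En h mu (z t))) (at t within {0..T})" if t: "t : {0..T}" for t
 proof -
  define N where "N = (norm (w t))^2"
  have N: "N > 0" using wnz by (simp add: N_def)
  have "((%t. inner (w t) (Y t)) has_vector_derivative
    inner (w t) (of_real (1/N)*(of_real (Og^2)*w t)) + inner (of_real (1/N)*Y t) (Y t)) (at t within {0..T})"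
   unfolding N_def by (rule bounded_bilinear.has_vector_derivative[OF bounded_bilinear_inner S(4)[OF t] S(5)[OF t]])
  moreover have "inner (w t) (of_real (1/N)*(of_real (Og^2)*w t)) + inner (of_real (1/N)*Y t) (Y t) = (2*H*N + mu)/(2*N)"
  proof -
   have "inner (w t) (of_real (1/N)*(of_real (Og^2)*w t)) = 1/N*(Og^2*N)"
    unfolding scaleR_conv_of_real[symmetric] inner_scaleR_right power2_norm_eq_inner[symmetric] N_def ..
   moreover have "inner (of_real (1/N)*Y t) (Y t) = 1/N*((H*N + mu)/2)" proof -
    have nY: "(norm (Y t))^2 = (H*N + mu)/2" using S(6)[OF t] by (simp add: N_def)
    show ?thesis unfolding scaleR_conv_of_real[symmetric] inner_scaleR_left power2_norm_eq_inner[symmetric] nY ..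
   qed
   ultimately show ?thesis unfolding Om using N by (simp add: field_simps)
  qed
  ultimately have d: "((%t. inner (w t) (Y t)) has_real_derivative (2*H*N + mu)/(2*N)) (at t within {0..T})"
   by (simp add: has_real_derivative_iff_has_vector_derivative)
  have "((%t. (2*inner (w t) (Y t) + mu*S t)/sqrt 2) has_real_derivative
    (2*((2*H*N + mu)/(2*N)) + mu*(1/N))/sqrt 2) (at t within {0..T})"
   using S(3)[OF t] unfolding N_def[symmetric] by (intro DERIV_cdivide DERIV_add DERIV_cmult d)
  moreover have "(2*((2*H*N + mu)/(2*N)) + mu*(1/N))/sqrt 2 = sqrt 2*(H + mu/N)"
   using N by (simp add: field_simps)
  moreover have "vector_derivative z (at t within {0..T}) = v t"
   using T t v(2)[OF t] by (rule vector_derivative_within_closed_interval)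
  hence "norm (vector_derivative z (at t within {0..T})) * sqrt (V_I En h mu (z t)) = sqrt 2*(H + mu/N)"
   using V_I_length_density[OF v(4)[OF t]] by (simp add: H_def N_def nwz[OF t])
  ultimately show ?thesis by (simp add: has_real_derivative_iff_has_vector_derivative)
 qed
 hence "((%t. norm (vector_derivative z (at t within {0..T})) * sqrt (V_I En h mu (z t))) has_integral
   (2*inner (w T) (Y T) + mu*S T)/sqrt 2 - (2*inner (w 0) (Y 0) + mu*S 0)/sqrt 2) {0..T}"
  by (rule fundamental_theorem_of_calculus[OF less_imp_le[OF T]])
 hence "jacobi_length (V_I En h mu) T z
   = (2*inner (w T) (Y T) + mu*S T)/sqrt 2 - (2*inner (w 0) (Y 0) + mu*S 0)/sqrt 2"
  unfolding jacobi_length_def by (rule integral_unique)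
 also have "... = (2*(inner w1 (Y T) - inner w0 (Y 0)) + mu*S T)/sqrt 2"
  unfolding w0 w1 S(1) by (simp add: diff_divide_distrib add_divide_distrib)
 also have "inner w1 (Y T) - inner w0 (Y 0) = Og/s*(RI*c - 2*PI)" proof -
  have "inner w1 (Y T) = Og/s*(c*rad xi' - PI)"
   unfolding YT inner_scaleR_right inner_diff_right by (simp add: w_norms(2,3)[symmetric] power2_norm_eq_inner inner_commute)
  moreover have "inner w0 (Y 0) = Og/s*(PI - c*rad xi)"
   unfolding Y0 inner_scaleR_right inner_diff_right by (simp add: w_norms(1,3)[symmetric] power2_norm_eq_inner)
  ultimately show ?thesis by (simp only: right_diff_distrib[symmetric]) (simp add: RI_def algebra_simps)
 qed
 also have "(2*(Og/s*(RI*c - 2*PI)) + mu*S T)/sqrt 2 = G_I H mu RI PI"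
  unfolding G_I_def Let_def Om(3)[symmetric] ST Og_def[symmetric] cC sC by simp
 finally show ?thesis .
qed

end
end

section \<open>Ejection-collision arcs\<close>

lemma has_real_derivative_norm:
 fixes z :: "real => complex"
 assumes "(z has_vector_derivative v) (at t)" "z t ~= 0"
 shows "((%t. norm (z t)) has_real_derivative inner (z t) v/norm (z t)) (at t)" proof -
 have "(norm has_derivative (%h. inner h (sgn (z t)))) (at (z t))"
  using GDERIV_norm[OF assms(2)] by (simp add: gderiv_def)
 from has_derivative_compose[OF assms(1)[unfolded has_vector_derivative_def] this]
 have "((%t. norm (z t)) has_derivative (%x. inner (x *\<^sub>R v) (sgn (z t)))) (at t)" .
 moreover have "(%x. inner (x *\<^sub>R v) (sgn (z t))) = (*) (inner (z t) v/norm (z t))"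
  by (simp add: fun_eq_iff sgn_div_norm inner_commute divide_inverse)
 ultimately show ?thesis by (simp add: has_field_derivative_def)
qed

text \<open>The angular momentum of a Kepler arc running into the origin vanishes, and
  \<open>inner z v\<close> is increasing along the arc with limit \<open>0\<close> at the collision: the arc is radial
  and the distance to the origin is monotone.\<close>

lemma collision_half_length:
 fixes z v :: "real => complex"
 assumes H: "En + h > 0" and mu: "mu > 0" and pq: "p < q" and e: "e : {p, q}" "z e = 0"
  and zc: "continuous_on {p..q} z" and nz: "!!t. t : {p<..<q} ==> z t ~= 0"
  and z: "!!t. t : {p<..<q} ==> (z has_vector_derivative v t) (at t)"
  and v: "!!t. t : {p<..<q} ==> (v has_vector_derivative - of_real (mu/norm (z t) ^ 3)*z t) (at t)"
  and en: "!!t. t : {p<..<q} ==> (norm (v t))^2 = 2*(En + h + mu/norm (z t))"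
 defines "F == radial_length (En + h) mu"
 shows "((%t. norm (v t) * sqrt (V_I En h mu (z t))) has_integral (F (norm (z p)) + F (norm (z q)) - 2*F 0)) {p..q}"
proof -
 define H where "H = En + h"
 have Hp: "H > 0" using H by (simp add: H_def)
 \<comment> \<open>\<open>K\<close> is the square of \<open>norm z * norm v\<close> rewritten by the
   energy relation, hence continuous up to the collision, where the velocity blows up. It equals
   \<open>g^2 + L^2\<close>.\<close>
 define g L K where "g t = inner (z t) (v t)" and "L t = Im (cnj (z t) * v t)"
  and "K t = 2*(H*(norm (z t))^2 + mu*norm (z t))" for t
 have Kc: "continuous_on {p..q} K" unfolding K_def[abs_def] by (intro continuous_intros zc)
 have Ke: "K e = 0" using e by (simp add: K_def)
 have closure_bound: "x <= K e" if "a < b" "p <= a" "b <= q" "e : {a, b}" "!!t. a < t ==> t < b ==> x <= K t" for a b x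
 proof -
  have cl: "continuous_on (closure {a<..<b}) K" using that by (auto intro: continuous_on_subset[OF Kc])
  have "e : closure {a<..<b}" using that by auto
  thus ?thesis by (rule continuous_ge_on_closure[OF cl]) (use that in auto)
 qed
 have gLK: "(g t)^2 + (L t)^2 = K t" if t: "t : {p<..<q}" for t proof -
  have "(g t)^2 + (L t)^2 = (norm (cnj (z t) * v t))^2"
   unfolding cmod_power2 g_def L_def inner_complex_def by simp
  also have "... = (norm (z t))^2*(2*(H + mu/norm (z t)))"
   using en[OF t] by (simp add: norm_mult power_mult_distrib H_def)
  also have "... = K t" using nz[OF t] by (simp add: K_def field_simps power2_eq_square)
  finally show ?thesis .
 qed
 have gd: "(g has_real_derivative 2*H + mu/norm (z t)) (at t)" if t: "t : {p<..<q}" for t proof -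
  have "(g has_vector_derivative inner (z t) (- of_real (mu/norm (z t) ^ 3)*z t) + inner (v t) (v t)) (at t)"
   unfolding g_def[abs_def] by (rule bounded_bilinear.has_vector_derivative[OF bounded_bilinear_inner z[OF t] v[OF t]])
  moreover have "inner (z t) (- of_real (mu/norm (z t) ^ 3)*z t) = - (mu/norm (z t))" proof -
   have "inner (z t) (- of_real (mu/norm (z t) ^ 3)*z t) = - (mu/norm (z t) ^ 3*(norm (z t))^2)"
    unfolding of_real_minus[symmetric] scaleR_conv_of_real[symmetric] inner_scaleR_right power2_norm_eq_inner by simp
   thus ?thesis using nz[OF t] by (simp add: power2_eq_square power3_eq_cube)
  qed
  moreover have "inner (v t) (v t) = 2*H + 2*(mu/norm (z t))"
   using en[OF t] by (simp add: power2_norm_eq_inner[symmetric] H_def)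
  moreover have "- (mu/norm (z t)) + (2*H + 2*(mu/norm (z t))) = 2*H + mu/norm (z t)" by simp
  ultimately show ?thesis by (simp only: has_real_derivative_iff_has_vector_derivative)
 qed
 have g_inc: "g s < g t" if "p < s" "s < t" "t < q" for s t proof (rule DERIV_pos_imp_increasing[OF that(2)])
  fix x assume "s <= x" "x <= t"
  hence "x : {p<..<q}" using that by auto
  thus "EX y. (g has_real_derivative y) (at x) & 0 < y"
   using gd[of x] nz[of x] Hp mu by (intro exI[of _ "2*H + mu/norm (z x)"] conjI) (auto intro!: add_pos_pos divide_pos_pos)
 qed
 have Lc: "L s = L t" if "p < s" "s <= t" "t < q" for s t proof -
  have "L t = L s" proof (rule vector_derivative_zero_const[of s t L])
   fix x assume "x : {s..t}"
   hence x: "x : {p<..<q}" using that by auto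
   have "((%t. cnj (z t) * v t) has_vector_derivative cnj (z x)*(- of_real (mu/norm (z x) ^ 3)*z x) + cnj (v x) * v x) (at x)"
    by (intro has_vector_derivative_mult has_vector_derivative_cnj v z x)
   hence "(L has_vector_derivative Im (cnj (z x)*(- of_real (mu/norm (z x) ^ 3)*z x) + cnj (v x) * v x)) (at x)"
    unfolding L_def[abs_def] by (rule bounded_linear.has_vector_derivative[OF bounded_linear_Im])
   moreover have "Im (cnj (z x)*(- of_real (mu/norm (z x) ^ 3)*z x) + cnj (v x) * v x) = 0" proof -
    have "Im (cnj y*(- of_real c*y) + cnj u*u) = 0" for y u :: complex and c :: real
     by (simp add: algebra_simps)
    thus ?thesis .
   qed
   ultimately have "(L has_vector_derivative 0) (at x)" by (simp only:)
   thus "(L has_vector_derivative 0) (at x within {s..t})" by (rule has_vector_derivative_at_within)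
  next
   show "t : {s..t}" using that by simp
  qed
  thus ?thesis by simp
 qed
 have L0: "L s = 0" if s: "p < s" "s < q" for s proof -
  have "(L s)^2 <= K e" proof (rule closure_bound[of p q])
   fix t assume t: "p < t" "t < q"
   have "L t = L s" proof (cases "s <= t")
    case True
    from Lc[OF s(1) this t(2)] show ?thesis by (rule sym)
   next
    case False
    show ?thesis by (rule Lc) (use False s t in auto)
   qed
   hence "(L t)^2 = (L s)^2" by (simp only:)
   moreover have "(g t)^2 + (L t)^2 = K t" by (rule gLK) (use t in simp)
   ultimately show "(L s)^2 <= K t" using zero_le_power2[of "g t"] by linarith
  qed (use pq e in auto)
  thus ?thesis using Ke by simp
 qed
 have gK: "(g t)^2 = (norm (z t)*norm (v t))^2" if t: "t : {p<..<q}" for t proof -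
  have "(g t)^2 + (L t)^2 = (norm (cnj (z t) * v t))^2"
   unfolding cmod_power2 g_def L_def inner_complex_def by simp
  thus ?thesis using L0[of t] t by (simp add: norm_mult)
 qed
 \<comment> \<open>The sign is negative on the half running into the collision and positive on the
   half leaving it.\<close>
 define sg :: real where "sg = (if e = q then -1 else 1)"
 have sign: "0 < sg*g s" if s: "p < s" "s < q" for s proof (rule ccontr)
  assume neg: "~ 0 < sg*g s"
  show False proof (cases "e = q")
   case True
   define t where "t = (s + q)/2"
   have t: "s < t" "t < q" using s by (auto simp: t_def)
   have gt: "0 < g t" using neg True g_inc[of s t] s t by (simp add: sg_def)
   have "(g t)^2 <= K e" proof (rule closure_bound[of t q])
    fix x assume x: "t < x" "x < q"
    hence "g t < g x" using g_inc[of t x] s t by simp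
    hence "(g t)^2 <= (g x)^2" using gt by (intro power_mono) auto
    moreover have "(g x)^2 + (L x)^2 = K x" by (rule gLK) (use x s t in simp)
    ultimately show "(g t)^2 <= K x" using zero_le_power2[of "L x"] by linarith
   qed (use True s t in auto)
   thus False using Ke gt by simp
  next
   case False
   hence ep: "e = p" using e by simp
   define t where "t = (p + s)/2"
   have t: "p < t" "t < s" using s by (auto simp: t_def)
   have gt: "g t < 0" using neg False g_inc[of t s] s t by (simp add: sg_def)
   have "(g t)^2 <= K e" proof (rule closure_bound[of p t])
    fix x assume x: "p < x" "x < t"
    hence "g x < g t" using g_inc[of x t] s t by simp
    hence "(- g t)^2 <= (- g x)^2" using gt by (intro power_mono) auto
    hence "(g t)^2 <= (g x)^2" unfolding power2_minus .
    moreover have "(g x)^2 + (L x)^2 = K x" by (rule gLK) (use x s t in simp)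
    ultimately show "(g t)^2 <= K x" using zero_le_power2[of "L x"] by linarith
   qed (use ep s t in auto)
   thus False using Ke gt by simp
  qed
 qed
 have gv: "g t/norm (z t) = sg*norm (v t)" if t: "t : {p<..<q}" for t proof -
  have "(sg*g t)^2 = (g t)^2" by (simp add: sg_def)
  also note gK[OF t]
  finally have "sg*g t = norm (z t)*norm (v t)"
   by (rule power2_eq_imp_eq) (use sign[of t] t in "auto intro: less_imp_le")
  hence "g t = sg*(norm (z t)*norm (v t))" by (auto simp: sg_def split: if_splits)
  thus ?thesis using nz[OF t] by simp
 qed
 have "((%t. norm (v t) * sqrt (V_I En h mu (z t))) has_integral (sg*F (norm (z q)) - sg*F (norm (z p)))) {p..q}"
 proof (rule fundamental_theorem_of_calculus_interior[OF less_imp_le[OF pq]])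
  show "continuous_on {p..q} (%t. sg*F (norm (z t)))"
   unfolding F_def by (intro continuous_intros continuous_on_compose2[OF radial_length_continuous[OF H mu]] zc) auto
  fix t assume t: "t : {p<..<q}"
  have "(F has_real_derivative sqrt (H + mu/norm (z t))) (at (norm (z t)))"
   unfolding F_def H_def by (rule radial_length_deriv[OF H mu]) (use nz[OF t] in simp)
  moreover have "((%t. norm (z t)) has_real_derivative sg*norm (v t)) (at t)"
   using has_real_derivative_norm[OF z[OF t] nz[OF t]] gv[OF t] by (simp add: g_def)
  ultimately have "((%t. F (norm (z t))) has_real_derivative sqrt (H + mu/norm (z t))*(sg*norm (v t))) (at t)"
   by (rule DERIV_chain2)
  hence "((%t. sg*F (norm (z t))) has_real_derivative sg*(sqrt (H + mu/norm (z t))*(sg*norm (v t)))) (at t)"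
   by (rule DERIV_cmult)
  moreover have "sg*(sqrt (H + mu/norm (z t))*(sg*norm (v t))) = norm (v t) * sqrt (V_I En h mu (z t))"
   by (simp add: sg_def V_I_def H_def)
  ultimately show "((%t. sg*F (norm (z t))) has_vector_derivative norm (v t) * sqrt (V_I En h mu (z t))) (at t)"
   by (simp add: has_real_derivative_iff_has_vector_derivative)
 qed
 moreover have "sg*F (norm (z q)) - sg*F (norm (z p)) = F (norm (z p)) + F (norm (z q)) - 2*F 0"
  using e pq by (auto simp: sg_def)
 ultimately show ?thesis by simp
qed

context inner_curve begin

lemma collision_length:
 assumes arc: "inner_arc En h mu f ep xi xi T z"
 shows "jacobi_length (V_I En h mu) T z = 2*(radial_length H mu (rad xi) - radial_length H mu 0)" proof -
 have T: "T > 0" and ends: "z 0 = bdry f ep xi" "z T = bdry f ep xi"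
  and zc: "continuous_on {0..T} z" and z0: "z (T/2) = 0"
  and sol: "solves_on (V_I En h mu) T ({0..T} - {T/2}) z" using arc by (simp_all add: inner_arc_def)
 have mu0: "mu ~= 0" using mu_pos by simp
 obtain v where v': "ALL t:{0..T} - {T/2}. z t ~= 0 & (z has_vector_derivative v t) (at t within {0..T}) &
   (v has_vector_derivative - of_real (mu/norm (z t) ^ 3)*z t) (at t within {0..T}) &
   (norm (v t))\<^sup>2 = 2*(En + h + mu/norm (z t))" using sol unfolding solves_on_V_I[OF mu0] by blast
 have at: "at t within {0..T} = at t" if "0 < t" "t < T" for t using that by (simp add: at_within_Icc_at)
 let ?F = "radial_length (En + h) mu"
 have Hp: "En + h > 0" using H_pos by (simp add: H_def)
 have half: "((%t. norm (vector_derivative z (at t within {0..T})) * sqrt (V_I En h mu (z t))) has_integral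
    (?F (norm (z p)) + ?F (norm (z q)) - 2*?F 0)) {p..q}"
  if pq: "0 <= p" "p < q" "q <= T" "T/2 : {p, q}" for p q proof -
  have mem: "t : {0..T} - {T/2}" "0 < t" "t < T" if "t : {p<..<q}" for t using that pq by auto
  have "((%t. norm (v t) * sqrt (V_I En h mu (z t))) has_integral (?F (norm (z p)) + ?F (norm (z q)) - 2*?F 0)) {p..q}"
  proof (rule collision_half_length[where e = "T/2" and z = z and v = v, OF Hp mu_pos pq(2,4) z0])
   show "continuous_on {p..q} z" using pq by (auto intro: continuous_on_subset[OF zc])
   fix t assume t: "t : {p<..<q}"
   note vt = bspec[OF v' mem(1)[OF t], unfolded at[OF mem(2,3)[OF t]]]
   show "z t ~= 0" using vt by blast
   show "(z has_vector_derivative v t) (at t)" using vt by blast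
   show "(v has_vector_derivative - of_real (mu/norm (z t) ^ 3)*z t) (at t)" using vt by blast
   show "(norm (v t))^2 = 2*(En + h + mu/norm (z t))" using vt by blast
  qed
  thus ?thesis proof (rule has_integral_spike_interior[of _ _ p q, unfolded cbox_interval box_real])
   fix t assume t: "t : {p<..<q}"
   have "vector_derivative z (at t within {0..T}) = v t"
    by (rule vector_derivative_within_closed_interval[OF T]) (use v' mem[OF t] in auto)
   thus "norm (vector_derivative z (at t within {0..T})) * sqrt (V_I En h mu (z t)) = norm (v t) * sqrt (V_I En h mu (z t))"
    by simp
  qed
 qed
 have "((%t. norm (vector_derivative z (at t within {0..T})) * sqrt (V_I En h mu (z t))) has_integral
   ((?F (norm (z 0)) + ?F (norm (z (T/2))) - 2*?F 0) + (?F (norm (z (T/2))) + ?F (norm (z T)) - 2*?F 0))) {0..T}"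
  by (rule has_integral_combine[OF _ _ half half]) (use T in auto)
 hence "jacobi_length (V_I En h mu) T z
   = (?F (norm (z 0)) + ?F (norm (z (T/2))) - 2*?F 0) + (?F (norm (z (T/2))) + ?F (norm (z T)) - 2*?F 0)"
  unfolding jacobi_length_def by (rule integral_unique)
 thus ?thesis using rad_pos[of xi] by (simp add: z0 ends bdry_rad norm_mult H_def)
qed

end

section \<open>Construction of the inner arcs\<close>

context inner_curve begin

context
 fixes xi xi' :: real
 assumes D: "abs (xi' - xi) <= 2*pi - de"
begin

abbreviation "cc == c_I H mu (RI xi xi') (PI xi xi')"
definition "ta = arcosh cc/Og"
definition "Sh = sinh (Og*ta)"
definition "ww s = w0 xi * of_real (sinh (Og*(ta - s))/Sh) + w1 xi' * of_real (sinh (Og * s)/Sh)"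
definition "wd s = w0 xi * of_real (- (Og*cosh (Og*(ta - s))/Sh)) + w1 xi' * of_real (Og*cosh (Og * s)/Sh)"
definition "pp s = inner (ww s) (wd s)"
text \<open>Physical time as a function of regularized time: by the energy relation this is a closed
  form of the integral of \<open>(norm (ww s))^2\<close>.\<close>

definition "tt s = (pp s - pp 0 - mu * s/2)/H"

lemmas Om' = Om[OF D]
lemmas Cg = C_gt[OF D]

lemma cosh_tau: "cosh (Og*ta) = cc" using Om' Cg by (simp add: ta_def)

lemma tau_pos: "ta > 0" proof -
 have "arcosh cc ~= 0" "arcosh cc >= 0" using Cg by (auto simp: arcosh_eq_0_iff_real)
 thus ?thesis using Om' by (simp add: ta_def)
qed

lemma Sh_pos: "Sh > 0" using Om' tau_pos by (simp add: Sh_def)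

lemma Sh_sq: "Sh^2 = cc^2 - 1" unfolding Sh_def cosh_tau[symmetric] by (simp add: cosh_square_eq)

lemma split_tau: "Og*ta = Og*(ta - s) + Og * s" by (simp add: algebra_simps)

lemma Sh_add: "Sh = sinh (Og*(ta - s))*cosh (Og * s) + cosh (Og*(ta - s)) * sinh (Og * s)"
 unfolding Sh_def sinh_add[symmetric] split_tau[of s, symmetric] ..

lemma C_add: "cc = cosh (Og*(ta - s))*cosh (Og * s) + sinh (Og*(ta - s)) * sinh (Og * s)"
 unfolding cosh_tau[symmetric] cosh_add[symmetric] split_tau[of s, symmetric] ..

lemma ww_ends: "ww 0 = w0 xi" "ww ta = w1 xi'" using Sh_pos by (auto simp: ww_def Sh_def)

lemma ww_deriv: "(ww has_vector_derivative wd s) (at s)" proof -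
 have "((%s. sinh (Og*(ta - s))/Sh) has_real_derivative - (Og*cosh (Og*(ta - s))/Sh)) (at s)"
  by (auto intro!: derivative_eq_intros simp: Sh_pos[THEN less_imp_neq, symmetric])
 moreover have "((%s. sinh (Og * s)/Sh) has_real_derivative Og*cosh (Og * s)/Sh) (at s)"
  by (auto intro!: derivative_eq_intros simp: Sh_pos[THEN less_imp_neq, symmetric])
 ultimately show ?thesis unfolding ww_def[abs_def] wd_def
  by (intro has_vector_derivative_add has_vector_derivative_mult_right has_vector_derivative_of_real)
qed

lemma wd_deriv: "(wd has_vector_derivative of_real (Og^2)*ww s) (at s)" proof -
 have "((%s. - (Og*cosh (Og*(ta - s))/Sh)) has_real_derivative Og\<^sup>2*(sinh (Og*(ta - s))/Sh)) (at s)"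
  by (auto intro!: derivative_eq_intros simp: power2_eq_square Sh_pos[THEN less_imp_neq, symmetric])
 moreover have "((%s. Og*cosh (Og * s)/Sh) has_real_derivative Og\<^sup>2*(sinh (Og * s)/Sh)) (at s)"
  by (auto intro!: derivative_eq_intros simp: power2_eq_square Sh_pos[THEN less_imp_neq, symmetric])
 ultimately have "(wd has_vector_derivative w0 xi * of_real (Og^2*(sinh (Og*(ta - s))/Sh)) + w1 xi' * of_real (Og^2*(sinh (Og * s)/Sh))) (at s)"
  unfolding wd_def[abs_def]
  by (intro has_vector_derivative_add has_vector_derivative_mult_right has_vector_derivative_of_real)
 also have "w0 xi * of_real (Og^2*(sinh (Og*(ta - s))/Sh)) + w1 xi' * of_real (Og^2*(sinh (Og * s)/Sh)) = of_real (Og^2)*ww s"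
  unfolding ww_def of_real_mult by (simp only: algebra_simps)
 finally show ?thesis .
qed

lemma norm_combination: "(norm (w0 xi * of_real a + w1 xi' * of_real b))^2 = rad xi*a^2 + rad xi'*b^2 + 2*PI xi xi'*a*b"
proof -
 have "(norm (w0 xi * of_real a + w1 xi' * of_real b))^2 = inner (a *\<^sub>R w0 xi + b *\<^sub>R w1 xi') (a *\<^sub>R w0 xi + b *\<^sub>R w1 xi')"
  by (simp add: power2_norm_eq_inner scaleR_conv_of_real mult.commute)
 also have "... = inner (w0 xi) (w0 xi)*a^2 + inner (w1 xi') (w1 xi')*b^2 + 2*inner (w0 xi) (w1 xi')*a*b"
  by (simp add: inner_add_left inner_add_right inner_commute square_simps)
 finally show ?thesis unfolding power2_norm_eq_inner[symmetric] w_norms[OF D] .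
qed

lemma ww_norm: "Sh^2*(norm (ww s))^2 = rad xi*(sinh (Og*(ta - s)))^2 + rad xi'*(sinh (Og * s))^2
  + 2*PI xi xi' * sinh (Og*(ta - s)) * sinh (Og * s)" unfolding ww_def norm_combination using Sh_pos
 by (simp add: field_simps power2_eq_square)

lemma wd_norm: "Sh^2*(norm (wd s))^2 = Og^2*(rad xi*(cosh (Og*(ta - s)))^2 + rad xi'*(cosh (Og * s))^2
  - 2*PI xi xi'*cosh (Og*(ta - s))*cosh (Og * s))" unfolding wd_def norm_combination using Sh_pos
 by (simp add: field_simps power2_eq_square)

lemma energy: "2*(norm (wd s))^2 = H*(norm (ww s))^2 + mu" proof -
 define a b a' b' where "a = sinh (Og*(ta - s))" and "b = sinh (Og * s)"
  and "a' = cosh (Og*(ta - s))" and "b' = cosh (Og * s)"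
 have sq: "a'^2 = 1 + a^2" "b'^2 = 1 + b^2" by (auto simp: a_def b_def a'_def b'_def cosh_square_eq)
 have Cab: "cc = a'*b' + a*b" using C_add[of s] by (simp add: a_def b_def a'_def b'_def)
 have "Sh^2*(2*(norm (wd s))^2 - H*(norm (ww s))^2)
   = 2*(Sh^2*(norm (wd s))^2) - H*(Sh^2*(norm (ww s))^2)" by (simp add: algebra_simps)
 also have "... = 2*(Og^2*(rad xi*a'^2 + rad xi'*b'^2 - 2*PI xi xi'*a'*b'))
   - H*(rad xi*a^2 + rad xi'*b^2 + 2*PI xi xi'*a*b)" unfolding ww_norm wd_norm a_def b_def a'_def b'_def ..
 also have "... = H*((rad xi + rad xi') - 2*PI xi xi'*(a'*b' + a*b))"
  unfolding Om' sq by (simp add: algebra_simps)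
 also have "... = H*(RI xi xi' - 2*PI xi xi'*cc)" by (simp only: Cab[symmetric] RI_def[OF D])
 also have "... = mu*(cc^2 - 1)"
  using c_I_root[OF H_pos mu_pos R_pos[OF D], of "PI xi xi'"] by (simp add: algebra_simps)
 also have "... = Sh^2*mu" unfolding Sh_sq by simp
 finally have "2*(norm (wd s))^2 - H*(norm (ww s))^2 = mu" using Sh_pos by simp
 thus ?thesis by simp
qed

lemma tt_deriv: "(tt has_real_derivative (norm (ww s))\<^sup>2) (at s)" proof -
 have "(pp has_vector_derivative inner (ww s) (of_real (Og^2)*ww s) + inner (wd s) (wd s)) (at s)"
  unfolding pp_def[abs_def] by (rule bounded_bilinear.has_vector_derivative[OF bounded_bilinear_inner ww_deriv wd_deriv])
 moreover have "inner (ww s) (of_real (Og^2)*ww s) = H/2*(norm (ww s))^2"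
  unfolding scaleR_conv_of_real[symmetric] inner_scaleR_right power2_norm_eq_inner Om' ..
 moreover have "inner (wd s) (wd s) = (H*(norm (ww s))^2 + mu)/2"
  using energy[of s] by (simp add: power2_norm_eq_inner)
 ultimately have p: "(pp has_real_derivative H/2*(norm (ww s))^2 + (H*(norm (ww s))^2 + mu)/2) (at s)"
  by (simp only: has_real_derivative_iff_has_vector_derivative)
 have "(tt has_real_derivative (H/2*(norm (ww s))^2 + (H*(norm (ww s))^2 + mu)/2 - 0 - mu*1/2)/H) (at s)"
  unfolding tt_def[abs_def] by (intro DERIV_cdivide DERIV_diff DERIV_const p DERIV_cmult DERIV_ident)
 thus ?thesis using H_pos by (simp add: field_simps)
qed

lemma tt_mono: "x <= y ==> tt x <= tt y" by (rule DERIV_nonneg_imp_nondecreasing) (auto intro!: exI tt_deriv)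

text \<open>The derivative \<open>(norm (ww s))^2\<close> may vanish at a collision, but not on an
  interval: there \<open>wd\<close> would vanish as well, against the energy relation.\<close>

lemma tt_less: assumes "x < y" shows "tt x < tt y" proof (rule ccontr)
 assume "~ ?thesis"
 hence eq: "tt x = tt y" using tt_mono[of x y] assms by simp
 have const: "tt s = tt x" if "x < s" "s < y" for s using tt_mono[of x s] tt_mono[of s y] that eq by simp
 have wz: "ww s = 0" if s: "x < s" "s < y" for s proof -
  have "(tt has_real_derivative 0) (at s)"
   by (rule has_field_derivative_transform_within_open[of "%_. tt x" _ _ "{x<..<y}"]) (use s const in auto)
  from DERIV_unique[OF this tt_deriv] show ?thesis by simp
 qed
 define s where "s = (x + y)/2"
 have s: "x < s" "s < y" using assms by (auto simp: s_def)
 have "(ww has_vector_derivative 0) (at s)"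
  by (rule has_vector_derivative_transform_within_open[of "%_. 0" _ _ "{x<..<y}"]) (use s wz in auto)
 from vector_derivative_unique_at[OF this ww_deriv] have "wd s = 0" by simp
 thus False using energy[of s] wz[OF s] mu_pos by simp
qed

text \<open>The interval exceeds \<open>{0..ta}\<close> on both sides so that the inverse has
  two-sided derivatives at the ends of the arc.\<close>

definition "gg = inv_into {-1..ta + 1} tt"
definition "Tt = tt ta"

lemma tt_inj: "inj_on tt A" by (rule linorder_inj_onI') (metis tt_less order.irrefl)

lemma gg_tt: "s : {-1..ta + 1} ==> gg (tt s) = s" unfolding gg_def by (rule inv_into_f_f[OF tt_inj])

lemma tt_isCont: "isCont tt s" by (rule DERIV_isCont[OF tt_deriv])

lemma tt_continuous: "continuous_on A tt" by (intro continuous_at_imp_continuous_on ballI tt_isCont)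

lemma tt_image: "tt ` {-1..ta + 1} = {tt (-1)..tt (ta + 1)}" proof (intro equalityI subsetI)
 fix t assume "t : {tt (-1)..tt (ta + 1)}"
 hence "EX s>=-1. s <= ta + 1 & tt s = t" by (intro IVT') (use tau_pos tt_continuous in auto)
 thus "t : tt ` {-1..ta + 1}" by auto
qed (auto intro: tt_mono)

lemma gg_continuous: "continuous_on {tt (-1)..tt (ta + 1)} gg"
 unfolding tt_image[symmetric] by (rule continuous_on_inv[OF tt_continuous compact_Icc]) (use gg_tt in blast)

lemma tt_zero: "tt 0 = 0" by (simp add: tt_def)

lemma Tt_pos: "Tt > 0" using tt_less[OF tau_pos] by (simp add: Tt_def tt_zero)

lemma tt_range: "t : {0..Tt} ==> tt (-1) < t" "t : {0..Tt} ==> t < tt (ta + 1)"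
 using tt_less[of "-1" 0] tt_less[of ta "ta + 1"] by (auto simp: Tt_def tt_zero)

lemma gg_mem: "t : {0..Tt} ==> gg t : {0..ta} & tt (gg t) = t" proof -
 assume t: "t : {0..Tt}"
 have "EX s>=0. s <= ta & tt s = t" by (rule IVT') (use tau_pos tt_continuous t tt_zero in "auto simp: Tt_def")
 then obtain s where s: "0 <= s" "s <= ta" "tt s = t" by blast
 hence "gg t = s" using gg_tt[of s] by simp
 thus ?thesis using s by simp
qed

lemma gg_ends: "gg 0 = 0" "gg Tt = ta" using gg_tt[of 0] gg_tt[of ta] tau_pos by (auto simp: tt_zero Tt_def)

lemma gg_interior: assumes "0 < t" "t < Tt" shows "0 < gg t" "gg t < ta" proof -
 have g: "gg t : {0..ta}" "tt (gg t) = t" using gg_mem[of t] assms by auto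
 have "gg t ~= 0" "gg t ~= ta" using g(2) assms tt_zero by (auto simp: Tt_def)
 thus "0 < gg t" "gg t < ta" using g by auto
qed

lemma gg_isCont: assumes "t : {0..Tt}" shows "isCont gg t"
 by (rule continuous_on_interior[OF gg_continuous]) (use tt_range[OF assms] in simp)

lemma gg_deriv: assumes t: "t : {0..Tt}" and nz: "ww (gg t) ~= 0"
 shows "(gg has_real_derivative inverse ((norm (ww (gg t)))^2)) (at t)"
proof (rule DERIV_inverse_function[where f = tt and a = "tt (-1)" and b = "tt (ta + 1)"])
 fix y assume "tt (-1) < y" "y < tt (ta + 1)"
 hence "y : tt ` {-1..ta + 1}" unfolding tt_image by simp
 thus "tt (gg y) = y" unfolding gg_def by (rule f_inv_into_f)
qed (use nz tt_range[OF t] tt_deriv gg_isCont[OF t] in auto)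

definition "zz t = (ww (gg t))^2"
definition "vv t = 2*wd (gg t)/cnj (ww (gg t))"

lemma zz_continuous: "continuous_on {0..Tt} zz" proof -
 have "isCont ww s" for s by (rule has_vector_derivative_continuous[OF ww_deriv])
 thus ?thesis unfolding zz_def
  by (intro continuous_at_imp_continuous_on ballI isCont_power isCont_o2[OF gg_isCont]) auto
qed

lemma zz_ends: "zz 0 = bdry f ep xi" "zz Tt = bdry f ep xi'" using rad_pos[of xi] rad_pos[of xi']
 by (auto simp: zz_def gg_ends ww_ends w0_def[OF D] w1_def[OF D] bdry_rad power_mult_distrib of_real_power[symmetric] Complex.DeMoivre simp del: of_real_power)

text \<open>Undoes the regularization: \<open>zz\<close> is the square of \<open>ww\<close>, and the
  change of time contributes the factor \<open>1/(norm ww)^2\<close>, finite away from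
  collisions.\<close>

lemma zz_solves:
 assumes t: "t : {0..Tt}" and nz: "ww (gg t) ~= 0"
 shows "zz t ~= 0 & (zz has_vector_derivative vv t) (at t within {0..Tt}) &
   (vv has_vector_derivative - of_real (mu/norm (zz t) ^ 3)*zz t) (at t within {0..Tt}) &
   (norm (vv t))\<^sup>2 = 2*(En + h + mu/norm (zz t))" proof -
 define w d where "w = ww (gg t)" and "d = wd (gg t)"
 define q where "q = inverse ((norm w)^2)"
 have w: "w ~= 0" using nz by (simp add: w_def)
 have cw: "w*cnj w = of_real ((norm w)^2)" by (rule complex_norm_square[symmetric])
 have q: "of_real q = 1/(w*cnj w)" unfolding q_def cw by (simp add: inverse_eq_divide)
 have g: "(gg has_vector_derivative q) (at t)"
  using gg_deriv[OF t nz] by (simp add: has_real_derivative_iff_has_vector_derivative q_def w_def)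
 have wg: "((%t. ww (gg t)) has_vector_derivative q *\<^sub>R d) (at t)"
  using vector_diff_chain_at[OF g ww_deriv] by (simp add: o_def d_def)
 have dg: "((%t. wd (gg t)) has_vector_derivative q *\<^sub>R (of_real (Og^2)*w)) (at t)"
  using vector_diff_chain_at[OF g wd_deriv] by (simp add: o_def w_def)
 have "((%t. ww (gg t)*ww (gg t)) has_vector_derivative w*(q *\<^sub>R d) + (q *\<^sub>R d)*w) (at t)"
  using has_vector_derivative_mult[OF wg wg] by (simp add: w_def)
 moreover have "w*(q *\<^sub>R d) + (q *\<^sub>R d)*w = vv t"
  unfolding scaleR_conv_of_real q vv_def w_def[symmetric] d_def[symmetric] using w by (simp add: field_simps)
 ultimately have z: "(zz has_vector_derivative vv t) (at t)" by (simp add: zz_def[abs_def] power2_eq_square)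
 have c: "((%t. cnj (ww (gg t))) has_vector_derivative cnj (q *\<^sub>R d)) (at t)"
  by (rule has_vector_derivative_cnj[OF wg])
 have "((%t. 1/cnj (ww (gg t))) has_vector_derivative - cnj (q *\<^sub>R d)/(cnj w)^2) (at t)" proof -
  have "((%x. 1/x) has_field_derivative - 1/(cnj w)^2) (at (cnj w))"
   using w by (auto intro!: derivative_eq_intros simp: power2_eq_square)
  hence "((%x. 1/x) has_field_derivative - 1/(cnj w)^2) (at (cnj (ww (gg t))))" by (simp add: w_def)
  from field_vector_diff_chain_at[OF c this] show ?thesis by (simp add: o_def)
 qed
 from has_vector_derivative_mult[OF dg this]
 have "((%t. wd (gg t)*(1/cnj (ww (gg t)))) has_vector_derivative
   d*(- cnj (q *\<^sub>R d)/(cnj w)^2) + q *\<^sub>R (of_real (Og^2)*w)*(1/cnj w)) (at t)"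
  by (simp only: d_def[symmetric] w_def[symmetric])
 from has_vector_derivative_mult_right[OF this, of 2]
 have "(vv has_vector_derivative 2*(d*(- cnj (q *\<^sub>R d)/(cnj w)^2) + q *\<^sub>R (of_real (Og^2)*w)*(1/cnj w))) (at t)"
  by (simp add: vv_def[abs_def])
 moreover have "2*(d*(- cnj (q *\<^sub>R d)/(cnj w)^2) + q *\<^sub>R (of_real (Og^2)*w)*(1/cnj w))
   = - of_real (mu/norm (zz t) ^ 3)*zz t" proof -
  have dd: "d*cnj d = of_real ((norm d)^2)" by (rule complex_norm_square[symmetric])
  have e: "2*(norm d)^2 = H*(norm w)^2 + mu" using energy[of "gg t"] by (simp add: w_def d_def)
  have "2*(d*(- cnj (q *\<^sub>R d)/(cnj w)^2) + q *\<^sub>R (of_real (Og^2)*w)*(1/cnj w))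
   = of_real q*(2 * of_real (Og^2)*(w*cnj w) - 2*(d*cnj d))/(cnj w)^2"
   using w by (simp add: scaleR_conv_of_real field_simps power2_eq_square)
  also have "2 * of_real (Og^2)*(w*cnj w) - 2*(d*cnj d) = of_real (2*Og^2*(norm w)^2 - 2*(norm d)^2)"
   unfolding cw dd by simp
  also have "2*Og^2*(norm w)^2 - 2*(norm d)^2 = - mu" unfolding e Om' by simp
  also have "of_real q * of_real (- mu)/(cnj w)^2 = - of_real mu*w^2/(w*cnj w) ^ 3"
   unfolding q using w by (simp add: field_simps power2_eq_square power3_eq_cube)
  also have "... = - of_real (mu/norm (zz t) ^ 3)*zz t"
   unfolding cw zz_def w_def[symmetric] by (simp add: norm_power)
  finally show ?thesis .
 qed
 ultimately have v: "(vv has_vector_derivative - of_real (mu/norm (zz t) ^ 3)*zz t) (at t)" by simp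
 have "(norm (vv t))^2 = 2*(2*(norm d)^2)/(norm w)^2"
  by (simp add: vv_def w_def d_def norm_divide norm_mult power_divide power_mult_distrib)
 also have "2*(norm d)^2 = H*(norm w)^2 + mu" using energy[of "gg t"] by (simp add: w_def d_def)
 also have "2*(H*(norm w)^2 + mu)/(norm w)^2 = 2*(En + h + mu/norm (zz t))" proof -
  have "norm (zz t) = (norm w)^2" by (simp add: zz_def w_def norm_power)
  thus ?thesis unfolding H_def[symmetric] using w by (simp add: field_simps)
 qed
 finally show ?thesis using z v w by (auto simp: zz_def w_def intro: has_vector_derivative_at_within)
qed

text \<open>Near the endpoints of the arc the gain over the boundary degenerates, but both error terms are
  bounded by \<open>et\<close> times \<open>cc * sinh (Og * (ta - s)) * sinh (Og * s)\<close>, the order of that gain.\<close>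

lemma zz_inside: assumes s: "0 < s" "s < ta" shows "(ww s)^2 : inside" proof (cases "ww s = 0")
 case True
 thus ?thesis using inside_iff[of 0 0] rad_pos[of 0] by simp
next
 case False
 define w where "w = ww s"
 have w: "w ~= 0" using False by (simp add: w_def)
 define rh where "rh = rad (2*Arg w)"
 have wsq: "w^2 = of_real ((norm w)^2)*cis (2*Arg w)" proof -
  have "w = of_real (norm w)*cis (Arg w)" using rcis_cmod_Arg[of w] by (simp add: rcis_def)
  hence "w^2 = (of_real (norm w)*cis (Arg w))^2" by simp
  thus ?thesis by (simp add: power_mult_distrib Complex.DeMoivre)
 qed
 define a b a' b' where "a = sinh (Og*(ta - s))" and "b = sinh (Og * s)"
  and "a' = cosh (Og*(ta - s))" and "b' = cosh (Og * s)"
 have ab: "a > 0" "b > 0" using s Om' by (auto simp: a_def b_def)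
 have ab': "a' >= 1" "b' >= 1" by (auto simp: a'_def b'_def cosh_real_ge_1)
 have sq: "a'^2 = 1 + a^2" "b'^2 = 1 + b^2" by (auto simp: a_def b_def a'_def b'_def cosh_square_eq)
 have Cab: "cc = a'*b' + a*b" using C_add[of s] by (simp add: a_def b_def a'_def b'_def)
 have Sab: "Sh = a*b' + a'*b" using Sh_add[of s] by (simp add: a_def b_def a'_def b'_def)
 have aS: "a <= Sh" "b <= Sh" unfolding Sab using ab ab'
  by (auto intro: order_trans[OF _ add_increasing2] simp: mult_le_cancel_left1 add_increasing add_increasing2)
 \<comment> \<open>The deficit in the weight of the near endpoint is controlled by the weight of the
   far one.\<close>
 have Sb: "Sh - a <= cc*b" proof -
  have "b*b = (b' - 1)*(b' + 1)" using sq(2) by (simp add: square_simps)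
  moreover have "(b' - 1)*1 <= (b' - 1)*(b' + 1)" using ab' by (intro mult_left_mono) auto
  ultimately have "b' - 1 <= b*b" by simp
  hence "a*(b' - 1) <= a*(b*b)" using ab by (intro mult_left_mono) auto
  moreover have "a'*b*1 <= a'*b*b'" using ab ab' by (intro mult_left_mono) auto
  ultimately show ?thesis unfolding Sab Cab by (simp add: algebra_simps)
 qed
 have Sa: "Sh - b <= cc*a" proof -
  have "a*a = (a' - 1)*(a' + 1)" using sq(1) by (simp add: square_simps)
  moreover have "(a' - 1)*1 <= (a' - 1)*(a' + 1)" using ab' by (intro mult_left_mono) auto
  ultimately have "a' - 1 <= a*a" by simp
  hence "b*(a' - 1) <= b*(a*a)" using ab by (intro mult_left_mono) auto
  moreover have "b'*a*1 <= b'*a*a'" using ab ab' by (intro mult_left_mono) auto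
  ultimately show ?thesis unfolding Sab Cab by (simp add: algebra_simps)
 qed
 have n98: "norm (w0 xi) <= 9/8" "norm (w1 xi') <= 9/8" proof -
  have "(norm (w0 xi))^2 <= (9/8)^2" "(norm (w1 xi'))^2 <= (9/8)^2"
   unfolding w_norms(1,2)[OF D] using rad_bounds(4)[of xi] rad_bounds(4)[of xi'] by (auto simp: power2_eq_square)
  from this[THEN power2_le_imp_le] show "norm (w0 xi) <= 9/8" "norm (w1 xi') <= 9/8" by simp_all
 qed
 have ww: "w = (a/Sh) *\<^sub>R w0 xi + (b/Sh) *\<^sub>R w1 xi'"
  by (simp add: w_def ww_def a_def b_def scaleR_conv_of_real mult.commute)
 \<comment> \<open>\<open>w^2 - e^2\<close> factors as \<open>(w - e)*(w + e)\<close>: the first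
   factor is small near the endpoint, the second is bounded. The constant \<open>41\<close> rounds
   up \<open>16/3*243/32\<close>.\<close>
 have close: "abs (rad x - rh) <= et*(41*cc*(q/Sh))"
  if e: "e^2 = of_real (rad x)*cis x" "norm e <= 9/8" "norm e' <= 9/8"
   "w = (p/Sh) *\<^sub>R e + (q/Sh) *\<^sub>R e'" "p > 0" "q > 0" "p <= Sh" "q <= Sh" "Sh - p <= cc*q" for x e e' p q
 proof -
  have "w - e = (p/Sh - 1) *\<^sub>R e + (q/Sh) *\<^sub>R e'" unfolding e(4) by (simp add: algebra_simps)
  hence "norm (w - e) <= norm ((p/Sh - 1) *\<^sub>R e) + norm ((q/Sh) *\<^sub>R e')"
   by (simp only: norm_triangle_ineq)
  also have "... = abs (p/Sh - 1)*norm e + q/Sh*norm e'" using Sh_pos e by simp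
  also have "... <= (cc*(q/Sh))*(9/8) + q/Sh*(9/8)" proof (intro add_mono mult_mono)
   have "p/Sh - 1 <= 0" using e Sh_pos by simp
   hence "abs (p/Sh - 1) = (Sh - p)/Sh" using Sh_pos by (simp add: field_simps)
   also have "... <= cc*q/Sh" using e(9) Sh_pos by (intro divide_right_mono) auto
   finally show "abs (p/Sh - 1) <= cc*(q/Sh)" by simp
  qed (use e Sh_pos Cg in auto)
  also have "... <= 9/4*(cc*(q/Sh))" proof -
   have "1*(q/Sh) <= cc*(q/Sh)" using Cg e Sh_pos by (intro mult_right_mono) auto
   thus ?thesis by simp
  qed
  finally have m: "norm (w - e) <= 9/4*(cc*(q/Sh))" .
  have "w + e = (p/Sh + 1) *\<^sub>R e + (q/Sh) *\<^sub>R e'" unfolding e(4) by (simp add: algebra_simps)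
  hence "norm (w + e) <= norm ((p/Sh + 1) *\<^sub>R e) + norm ((q/Sh) *\<^sub>R e')"
   by (simp only: norm_triangle_ineq)
  also have "... = abs (p/Sh + 1)*norm e + q/Sh*norm e'" using Sh_pos e by simp
  also have "... <= 2*(9/8) + 1*(9/8)" using e Sh_pos by (intro add_mono mult_mono) (auto simp: field_simps)
  finally have p: "norm (w + e) <= 27/8" by simp
  have cq: "cc*(q/Sh) >= 0" using Cg e Sh_pos by simp
  have "norm (w^2 - e^2) = norm (w - e)*norm (w + e)" by (simp add: norm_mult[symmetric] square_simps)
  also have "... <= 9/4*(cc*(q/Sh))*(27/8)" using m p cq by (intro mult_mono) auto
  finally have n: "norm (w^2 - e^2) <= 243/32*(cc*(q/Sh))" by simp
  have "abs (rh - rad x) <= 4*et*norm (w^2 - e^2)/rad x"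
   unfolding wsq e(1) rh_def by (rule rad_lipschitz_plane) (use w rad_pos in auto)
  also have "... <= 4*et*norm (w^2 - e^2)/(3/4)"
   using rad_bounds(3)[of x] eta_nonneg by (intro divide_left_mono mult_nonneg_nonneg) auto
  also have "... = et*(16/3*norm (w^2 - e^2))" by simp
  also have "... <= et*(16/3*(243/32*(cc*(q/Sh))))" using n eta_nonneg by (intro mult_left_mono) auto
  also have "... <= et*(41*cc*(q/Sh))" proof (rule mult_left_mono[OF _ eta_nonneg])
   have "16/3*(243/32*X) <= 41*X" if "X >= 0" for X :: real using that by simp
   from this[OF cq] show "16/3*(243/32*(cc*(q/Sh))) <= 41*cc*(q/Sh)" by simp
  qed
  finally show ?thesis by (simp add: abs_minus_commute)
 qed
 have c0: "abs (rad xi - rh) <= et*(41*cc*(b/Sh))" by (rule close[OF _ n98 ww ab aS Sb])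
   (use rad_pos[of xi] in "simp add: w0_def[OF D] power_mult_distrib of_real_power[symmetric] Complex.DeMoivre del: of_real_power")
 have c1: "abs (rad xi' - rh) <= et*(41*cc*(a/Sh))" by (rule close[OF _ n98(2,1) _ ab(2,1) aS(2,1) Sa])
   (use rad_pos[of xi'] ww in "simp_all add: w1_def[OF D] power_mult_distrib of_real_power[symmetric] Complex.DeMoivre del: of_real_power")
 have step: "(r - rh)*x^2 <= 41*(et*(cc*(x*y)))"
  if "abs (r - rh) <= et*(41*cc*(y/Sh))" "x > 0" "y > 0" "x <= Sh" for r x y proof -
  have "(r - rh)*x^2 <= et*(41*cc*(y/Sh))*x^2" using that(1) by (intro mult_right_mono) auto
  also have "... = et*(41*cc*y)*x*(x/Sh)" by (simp add: power2_eq_square)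
  also have "... <= et*(41*cc*y)*x*1"
   using that Sh_pos eta_nonneg Cg by (intro mult_left_mono mult_nonneg_nonneg) auto
  finally show ?thesis by (simp add: mult_ac)
 qed
 have e0: "(rad xi - rh)*a^2 <= 41*(et*(cc*(a*b)))" by (rule step[OF c0 ab aS(1)])
 have e1: "(rad xi' - rh)*b^2 <= 41*(et*(cc*(a*b)))"
  using step[OF c1 ab(2,1) aS(2)] by (simp add: mult.commute[of b a])
 have P: "PI xi xi' - rh*cc <= - (ka*cc)" proof -
  have "sqrt (rad xi*rad xi') <= 1 + et"
   by (rule real_le_lsqrt) (use rad_bounds(2)[of xi] rad_bounds(2)[of xi'] rad_pos[of xi] rad_pos[of xi'] eta_nonneg in "auto simp: power2_eq_square intro!: mult_mono")
  moreover have "PI xi xi' = sqrt (rad xi*rad xi')*(- cos ((xi' - xi)/2))" by (simp add: PI_def[OF D])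
  moreover have "sqrt (rad xi*rad xi')*(- cos ((xi' - xi)/2)) <= sqrt (rad xi*rad xi')*(1 - 2 * ka)"
   using cos_gap[OF D] rad_pos[of xi] rad_pos[of xi'] by (intro mult_left_mono) auto
  moreover have "sqrt (rad xi*rad xi')*(1 - 2 * ka) <= (1 + et)*(1 - 2 * ka)"
   using calculation(1) kappa by (intro mult_right_mono) auto
  ultimately have 1: "PI xi xi' <= (1 + et)*(1 - 2 * ka)" by linarith
  have "(1 + et)*(1 - 2 * ka)*1 <= (1 + et)*(1 - 2 * ka)*cc"
   using Cg kappa eta_nonneg by (intro mult_left_mono mult_nonneg_nonneg) auto
  with 1 have 2: "PI xi xi' <= (1 + et)*(1 - 2 * ka)*cc" by linarith
  have 3: "(1 - et)*cc <= rh*cc" using rad_bounds(1)[of "2*Arg w"] Cg by (intro mult_right_mono) (auto simp: rh_def)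
  have "(1 + et)*(1 - 2 * ka) - (1 - et) <= - ka" proof -
   have "et * ka >= 0" using eta_nonneg kappa by simp
   hence "(1 + et)*(1 - 2 * ka) - (1 - et) <= 2*et - 2 * ka" by (simp add: algebra_simps)
   thus ?thesis using kappa eta_nonneg by linarith
  qed
  hence "((1 + et)*(1 - 2 * ka) - (1 - et))*cc <= - ka*cc" using Cg by (intro mult_right_mono) auto
  with 2 3 show ?thesis by (simp add: algebra_simps)
 qed
 have Ssq: "Sh^2 = a^2 + b^2 + 2*cc*a*b" proof -
  have "(a*b' + a'*b)^2 = a^2*b'^2 + a'^2*b^2 + 2*(a'*b')*a*b" by (simp add: square_simps)
  also have "... = a^2 + b^2 + 2*(a'*b' + a*b)*a*b" unfolding sq by (simp add: square_simps)
  finally show ?thesis unfolding Sab Cab .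
 qed
 have Cabp: "cc*(a*b) > 0" using Cg ab by simp
 have "Sh^2*((norm w)^2 - rh) = (rad xi - rh)*a^2 + (rad xi' - rh)*b^2 + 2*(PI xi xi' - rh*cc)*(a*b)" proof -
  have "Sh^2*(norm w)^2 = rad xi*a^2 + rad xi'*b^2 + 2*PI xi xi'*a*b" unfolding w_def ww_norm a_def b_def ..
  moreover have "Sh^2*rh = (a^2 + b^2 + 2*cc*a*b)*rh" unfolding Ssq ..
  ultimately show ?thesis by (simp add: algebra_simps)
 qed
 also have "... <= 41*(et*(cc*(a*b))) + 41*(et*(cc*(a*b))) + 2*(- (ka*cc))*(a*b)"
  using e0 e1 P ab by (intro add_mono mult_right_mono mult_left_mono) auto
 also have "... = (82*et - 2 * ka)*(cc*(a*b))" by (simp add: algebra_simps)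
 also have "... < 0" using kappa eta_nonneg Cabp by (intro mult_neg_pos) auto
 finally have "(norm w)^2 < rh" using Sh_pos by (simp add: mult_less_0_iff)
 thus ?thesis unfolding w_def[symmetric] wsq using inside_iff[of "(norm w)^2" "2*Arg w"] by (simp add: rh_def)
qed

lemma zz_in_D: "zz ` {0<..<Tt} <= D_eps f ep"
 unfolding D_eps_inside using zz_inside gg_interior by (auto simp: zz_def)

end
end

context inner_curve begin

context
 fixes xi xi' :: real
 assumes D: "abs (xi' - xi) <= 2*pi - de"
begin

lemma w_ratio: "w1 xi'/w0 xi = - (of_real (sqrt (rad xi'/rad xi))*cis ((xi' - xi)/2))"
 unfolding w0_def[OF D] w1_def[OF D] diff_divide_distrib cis_divide[symmetric] using rad_pos[of xi]
 by (simp add: real_sqrt_divide)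

lemma w0_nz: "w0 xi ~= 0" using rad_pos[of xi] by (simp add: w0_def[OF D])

text \<open>For different endpoints \<open>w1/w0\<close> is not real, so a combination of
  \<open>1\<close> and \<open>w1/w0\<close> is real only if the second weight vanishes. That happens
  only at the start, where the first weight is positive.\<close>

lemma noncollision_slit:
 assumes ne: "xi ~= xi'" and s: "0 <= s" "s <= ta xi xi'"
 shows "ww xi xi' s/w0 xi ~: \<real>\<^sub>\<le>\<^sub>0" proof -
 define a b where "a = sinh (Og*(ta xi xi' - s))/Sh xi xi'" and "b = sinh (Og * s)/Sh xi xi'"
 have S: "Sh xi xi' > 0" by (rule Sh_pos[OF D])
 have Om: "Og > 0" by (rule Om(1)[OF D])
 have eq: "ww xi xi' s/w0 xi = of_real a + of_real b*(w1 xi'/w0 xi)"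
  using w0_nz by (simp add: ww_def[OF D] a_def b_def field_simps)
 have "sin ((xi' - xi)/2) ~= 0" proof -
  have D': "xi' - xi < 2*pi" "xi - xi' < 2*pi" using D delta by (auto simp: abs_le_iff)
  hence b: "(xi' - xi)/2 < pi" and b': "- ((xi' - xi)/2) < pi" by (simp_all add: field_simps)
  show ?thesis proof (cases "xi < xi'")
   case True
   thus ?thesis using sin_gt_zero[OF _ b] by simp
  next
   case False
   hence "sin (- ((xi' - xi)/2)) > 0" using ne by (intro sin_gt_zero b') simp
   thus ?thesis unfolding sin_minus by simp
  qed
 qed
 hence I: "Im (w1 xi'/w0 xi) ~= 0" unfolding w_ratio using rad_pos[of xi] rad_pos[of xi'] by simp
 show ?thesis proof
  assume "ww xi xi' s/w0 xi : \<real>\<^sub>\<le>\<^sub>0"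
  hence n: "Re (of_real a + of_real b*(w1 xi'/w0 xi)) <= 0" "Im (of_real a + of_real b*(w1 xi'/w0 xi)) = 0"
   unfolding eq complex_nonpos_Reals_iff by auto
  hence "b*Im (w1 xi'/w0 xi) = 0" by (simp del: times_divide_eq_right)
  hence b: "b = 0" using I by simp
  hence "s = 0" using S Om by (simp add: b_def)
  hence "a > 0" using S Om tau_pos[OF D] by (simp add: a_def)
  thus False using n(1) b by simp
 qed
qed

lemma noncollision_nonzero:
 assumes ne: "xi ~= xi'" and s: "0 <= s" "s <= ta xi xi'"
 shows "ww xi xi' s ~= 0" using noncollision_slit[OF assms] by auto

lemma noncollision_winding:
 assumes ne: "xi ~= xi'"
 shows "winding_number (closed_arc f ep xi xi' (Tt xi xi') (zz xi xi')) 0 : {1, -1}" proof -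
 define T where "T = Tt xi xi'"
 define u where "u t = Complex (ln (rad xi)) xi + 2*Ln (ww xi xi' (gg xi xi' t)/w0 xi)" for t
 \<comment> \<open>The half angle \<open>(xi' - xi)/2 + si/2\<close> must lie in the range of the
   principal logarithm; this fixes the sense of rotation by the order of the lifts.\<close>
 define si where "si = (if xi < xi' then - (2*pi) else 2*pi)"
 have T: "T > 0" unfolding T_def by (rule Tt_pos[OF D])
 have g: "gg xi xi' t : {0..ta xi xi'}" if "t : {0..T}" for t using gg_mem[OF D] that by (simp add: T_def)
 have uc: "continuous_on {0..T} u" proof -
  have "isCont (ww xi xi') s" for s by (rule has_vector_derivative_continuous[OF ww_deriv[OF D]])
  hence "continuous_on {0..T} (%t. ww xi xi' (gg xi xi' t))"
   by (intro continuous_at_imp_continuous_on ballI isCont_o2[OF gg_isCont[OF D]]) (auto simp: T_def)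
  hence c: "continuous_on {0..T} (%t. ww xi xi' (gg xi xi' t)/w0 xi)"
   by (rule continuous_on_divide[OF _ continuous_on_const]) (use w0_nz in simp)
  have "continuous_on {0..T} (%t. Ln (ww xi xi' (gg xi xi' t)/w0 xi))"
   by (rule continuous_on_Ln'[OF c]) (use g noncollision_slit[OF ne] in auto)
  thus ?thesis unfolding u_def by (intro continuous_on_add continuous_on_mult continuous_on_const)
 qed
 have ez: "zz xi xi' t = exp (u t)" if t: "t : {0..T}" for t proof -
  have nz: "ww xi xi' (gg xi xi' t)/w0 xi ~= 0" using noncollision_nonzero[OF ne] g[OF t] w0_nz by auto
  have "exp (u t) = exp (Complex (ln (rad xi)) xi)*(exp (Ln (ww xi xi' (gg xi xi' t)/w0 xi)))^2"
   unfolding u_def exp_add exp_double ..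
  also have "exp (Complex (ln (rad xi)) xi) = (w0 xi)^2" using rad_pos[of xi] Complex_exp[of "rad xi" xi]
   by (simp add: w0_def[OF D] power_mult_distrib of_real_power[symmetric] Complex.DeMoivre del: of_real_power)
  finally show ?thesis using nz w0_nz by (simp add: power_divide zz_def[OF D])
 qed
 have u0: "u 0 = Complex (ln (rad xi)) xi" using w0_nz by (simp add: u_def gg_ends[OF D] ww_ends[OF D])
 have uT: "u T = Complex (ln (rad xi')) (xi' + si)" proof -
  define q where "q = sqrt (rad xi'/rad xi)"
  have q: "q > 0" using rad_pos[of xi] rad_pos[of xi'] by (simp add: q_def)
  have "ww xi xi' (gg xi xi' T)/w0 xi = of_real q*cis ((xi' - xi)/2 + si/2)"
   unfolding T_def gg_ends[OF D] ww_ends[OF D] w_ratio q_def[symmetric] si_def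
   by (auto simp: cis_mult[symmetric] complex_eq_iff)
  also have "... = exp (Complex (ln q) ((xi' - xi)/2 + si/2))" by (rule Complex_exp[OF q])
  finally have "Ln (ww xi xi' (gg xi xi' T)/w0 xi) = Ln (exp (Complex (ln q) ((xi' - xi)/2 + si/2)))" by simp
  also have "... = Complex (ln q) ((xi' - xi)/2 + si/2)" proof (rule Ln_exp)
   have "- pi < (xi' - xi)/2 + si/2 & (xi' - xi)/2 + si/2 <= pi" proof (cases "xi < xi'")
    case True
    hence "si/2 = - pi" by (simp add: si_def)
    thus ?thesis using True D delta by (simp add: abs_le_iff field_simps)
   next
    case False
    hence "si/2 = pi" "xi' < xi" using ne by (auto simp: si_def)
    thus ?thesis using D delta by (simp add: abs_le_iff field_simps)
   qed
   thus "- pi < Im (Complex (ln q) ((xi' - xi)/2 + si/2))" "Im (Complex (ln q) ((xi' - xi)/2 + si/2)) <= pi"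
    by simp_all
  qed
  finally have "u T = Complex (ln (rad xi) + 2*ln q) (xi' + si)"
   by (simp add: u_def complex_eq_iff add_divide_distrib field_simps)
  also have "ln (rad xi) + 2*ln q = ln (rad xi')"
   using rad_pos[of xi] rad_pos[of xi'] by (simp add: q_def ln_sqrt ln_div field_simps)
  finally show ?thesis .
 qed
 have "winding_number (closed_arc f ep xi xi' T (zz xi xi')) 0 = of_real (si/(2*pi))"
  by (rule winding_closed_arc[OF T uc ez u0 uT]) (auto simp: si_def complex_eq_iff)
 thus ?thesis unfolding T_def by (auto simp: si_def)
qed

lemma noncollision_arc:
 assumes ne: "xi ~= xi'"
 shows "inner_arc En h mu f ep xi xi' (Tt xi xi') (zz xi xi')" proof -
 have mu0: "mu ~= 0" using mu_pos by simp
 have "solves_on (V_I En h mu) (Tt xi xi') {0..Tt xi xi'} (zz xi xi')" unfolding solves_on_V_I[OF mu0]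
  by (intro exI[of _ "vv xi xi'"] ballI zz_solves[OF D] noncollision_nonzero[OF ne]) (use gg_mem[OF D] in auto)
 thus ?thesis unfolding inner_arc_def
  using noncollision_winding[OF ne] ne D delta Tt_pos[OF D] zz_in_D[OF D] zz_ends[OF D] by simp
qed

end

context
 fixes xi :: real
begin

lemma diag: "abs (xi - xi) <= 2*pi - de" if "de <= 2*pi" using that by simp

text \<open>For equal endpoints \<open>ww\<close> is odd about half of the regularized duration. It
  vanishes there and nowhere else on the arc, and its square is symmetric in time.\<close>

lemma collision_arc:
 assumes d: "de <= 2*pi"
 shows "inner_arc En h mu f ep xi xi (Tt xi xi) (zz xi xi)" proof -
 note D = diag[OF d]
 define T ta0 where "T = Tt xi xi" and "ta0 = ta xi xi"
 have Om: "Og > 0" by (rule Om(1)[OF D])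
 have mu0: "mu ~= 0" using mu_pos by simp
 have w1: "w1 xi = - w0 xi" by (simp add: w0_def[OF D] w1_def[OF D])
 have ww: "ww xi xi s = w0 xi * of_real ((sinh (Og*(ta0 - s)) - sinh (Og * s))/Sh xi xi)" for s
  by (simp add: ww_def[OF D] w1 ta0_def algebra_simps diff_divide_distrib)
 have wd: "wd xi xi s = - (w0 xi * of_real (Og*(cosh (Og*(ta0 - s)) + cosh (Og * s))/Sh xi xi))" for s
  by (simp add: wd_def[OF D] w1 ta0_def algebra_simps add_divide_distrib)
 have wr: "ww xi xi (ta0 - s) = - ww xi xi s" "wd xi xi (ta0 - s) = wd xi xi s" for s
  unfolding ww wd by (simp_all add: diff_divide_distrib algebra_simps)
 have pr: "pp xi xi (ta0 - s) = - pp xi xi s" for s by (simp add: pp_def[OF D] wr)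
 have T: "T = (- 2*pp xi xi 0 - mu*ta0/2)/H"
  using pr[of 0] by (simp add: T_def Tt_def[OF D] tt_def[OF D] ta0_def)
 have tr: "tt xi xi (ta0 - s) = T - tt xi xi s" for s
  unfolding T unfolding tt_def[OF D] pr diff_divide_distrib[symmetric] by (rule arg_cong[where f = "%x. x/H"]) (simp add: field_simps)
 have gg: "gg xi xi t : {0..ta0}" "tt xi xi (gg xi xi t) = t" if "t : {0..T}" for t
  using gg_mem[OF D, of t] that by (auto simp: T_def ta0_def)
 have gt: "gg xi xi (tt xi xi s) = s" if "s : {0..ta0}" for s
  by (rule gg_tt[OF D]) (use that in "auto simp: ta0_def")
 have gr: "gg xi xi (T - t) = ta0 - gg xi xi t" if t: "t : {0..T}" for t
  using gt[of "ta0 - gg xi xi t"] gg[OF t] tr[of "gg xi xi t"] by simp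
 have Tp: "T > 0" unfolding T_def by (rule Tt_pos[OF D])
 have half: "gg xi xi (T/2) = ta0/2" using gr[of "T/2"] Tp by simp
 have T2: "T/2 : {0..T}" using Tp by simp
 have nz: "ww xi xi (gg xi xi t) ~= 0" if t: "t : {0..T}" "t ~= T/2" for t proof
  assume "ww xi xi (gg xi xi t) = 0"
  hence "sinh (Og*(ta0 - gg xi xi t)) = sinh (Og*gg xi xi t)"
   unfolding ww using w0_nz[OF D] Sh_pos[OF D] by (simp del: of_real_diff of_real_mult)
  from arg_cong[OF this, of arsinh] have "Og*(ta0 - gg xi xi t) = Og*gg xi xi t" unfolding arsinh_sinh_real .
  hence "gg xi xi t = gg xi xi (T/2)" using Om half by simp
  from arg_cong[OF this, of "tt xi xi"] have "t = T/2" unfolding gg(2)[OF t(1)] gg(2)[OF T2] .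
  thus False using t by simp
 qed
 have "solves_on (V_I En h mu) T ({0..T} - {T/2}) (zz xi xi)" unfolding solves_on_V_I[OF mu0] T_def
  by (intro exI[of _ "vv xi xi"] ballI zz_solves[OF D] nz[unfolded T_def]) auto
 moreover have "zz xi xi (T/2) = 0" using Sh_pos[OF D] by (simp add: zz_def[OF D] half ww)
 moreover have "ALL t:{0..T}. zz xi xi (T - t) = zz xi xi t" by (auto simp: zz_def[OF D] gr wr)
 ultimately show ?thesis unfolding inner_arc_def T_def
  using Tt_pos[OF D] zz_in_D[OF D] zz_ends[OF D] zz_continuous[OF D] by simp
qed

end

theorem is_S_I_iff:
 assumes D: "abs (xi' - xi) <= 2*pi - de"
 shows "is_S_I En h mu f ep xi xi' l \<longleftrightarrow> l = G_I H mu (RI xi xi') (PI xi xi')"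
proof (cases "xi = xi'")
 case True
 have d: "de <= 2*pi" using D by linarith
 have "RI xi xi' = 2*rad xi" "PI xi xi' = - rad xi" using True rad_pos[of xi] unfolding RI_def[OF D] PI_def[OF D] by auto
 hence "G_I H mu (RI xi xi') (PI xi xi') = 2*(radial_length H mu (rad xi) - radial_length H mu 0)"
  using G_I_collision[OF H_pos mu_pos rad_pos[of xi]] by simp
 hence "jacobi_length (V_I En h mu) T z = G_I H mu (RI xi xi') (PI xi xi')" if "inner_arc En h mu f ep xi xi' T z" for T z
  using collision_length[of xi T z] True that by simp
 moreover have "inner_arc En h mu f ep xi xi' (Tt xi xi) (zz xi xi)" using collision_arc[OF d, of xi] True by simp
 ultimately show ?thesis unfolding is_S_I_def by metis
next
 case False
 note arc = noncollision_arc[OF D False] and len = noncollision_length[OF D _ False]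
 show ?thesis unfolding is_S_I_def proof
  assume "EX T z. inner_arc En h mu f ep xi xi' T z & l = jacobi_length (V_I En h mu) T z"
  thus "l = G_I H mu (RI xi xi') (PI xi xi')" using len by auto
 next
  assume "l = G_I H mu (RI xi xi') (PI xi xi')"
  hence "l = jacobi_length (V_I En h mu) (Tt xi xi') (zz xi xi')" using len[OF arc] by simp
  thus "EX T z. inner_arc En h mu f ep xi xi' T z & l = jacobi_length (V_I En h mu) T z" using arc by blast
 qed
qed

end

section \<open>The generating function\<close>

text \<open>Differentiability concerns the state \<open>z\<close> alone, while value and derivative
  are jointly continuous in parameter and state. Derivatives are two-sided even at the edge of
  \<open>W\<close>.\<close>

definition C1_on :: "(real \<times> 'z::real_normed_vector) set => (real => 'z => real) => bool" where
 "C1_on W F \<longleftrightarrow> (EX F'. (ALL (e, z):W. (F e has_derivative F' e z) (at z)) &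
   (ALL h. continuous_on W (%(e, z). F' e z h)) & continuous_on W (%(e, z). F e z))"

lemma C1_onI:
 assumes "!!e z. (e, z) : W ==> (F e has_derivative F' e z) (at z)"
  and "!!h. continuous_on W (%(e, z). F' e z h)" and "continuous_on W (%(e, z). F e z)"
 shows "C1_on W F" unfolding C1_on_def using assms by (intro exI[of _ F']) auto

lemma C1_onD:
 assumes "C1_on W F"
 shows "EX F'. (ALL e z. (e, z) : W --> (F e has_derivative F' e z) (at z)) &
  (ALL h. continuous_on W (%(e, z). F' e z h)) & continuous_on W (%(e, z). F e z)" proof -
 obtain F' where F: "ALL (e, z):W. (F e has_derivative F' e z) (at z)"
  "ALL h. continuous_on W (%(e, z). F' e z h)" "continuous_on W (%(e, z). F e z)" using assms unfolding C1_on_def by blast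
 show ?thesis by (rule exI[of _ F'], intro conjI F(2,3)) (use F(1) in auto)
qed

lemma C1_on_subset: "C1_on W F ==> V <= W ==> C1_on V F"
 unfolding C1_on_def by (meson continuous_on_subset subsetD)

lemma C1_on_linear:
 assumes "bounded_linear L"
 shows "C1_on W (%e. L)" proof (rule C1_onI[where F' = "%_ _. L"])
 show "(L has_derivative L) (at z)" for z by (rule bounded_linear_imp_has_derivative[OF assms])
 show "continuous_on W (%(e, z). L h)" for h by (simp add: case_prod_unfold)
 show "continuous_on W (%(e, z). L z)"
  unfolding case_prod_unfold by (rule bounded_linear.continuous_on[OF assms continuous_on_snd[OF continuous_on_id]])
qed

lemma C1_on_const: "C1_on W (%e z. c)" by (rule C1_onI[where F' = "%_ _ _. 0"]) (auto simp: case_prod_unfold)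

lemma C1_on_add:
 assumes "C1_on W F" "C1_on W G"
 shows "C1_on W (%e z. F e z + G e z)" proof -
 obtain F' where F: "!!e z. (e, z) : W ==> (F e has_derivative F' e z) (at z)"
  "!!h. continuous_on W (%(e, z). F' e z h)" "continuous_on W (%(e, z). F e z)" using C1_onD[OF assms(1)] by blast
 obtain G' where G: "!!e z. (e, z) : W ==> (G e has_derivative G' e z) (at z)"
  "!!h. continuous_on W (%(e, z). G' e z h)" "continuous_on W (%(e, z). G e z)" using C1_onD[OF assms(2)] by blast
 show ?thesis by (rule C1_onI[where F' = "%e z h. F' e z h + G' e z h"])
   (use F G in "auto simp: case_prod_unfold intro!: continuous_intros has_derivative_add")
qed

lemma C1_on_mult:
 assumes "C1_on W F" "C1_on W G"
 shows "C1_on W (%e z. F e z*G e z)" proof -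
 obtain F' where F: "!!e z. (e, z) : W ==> (F e has_derivative F' e z) (at z)"
  "!!h. continuous_on W (%(e, z). F' e z h)" "continuous_on W (%(e, z). F e z)" using C1_onD[OF assms(1)] by blast
 obtain G' where G: "!!e z. (e, z) : W ==> (G e has_derivative G' e z) (at z)"
  "!!h. continuous_on W (%(e, z). G' e z h)" "continuous_on W (%(e, z). G e z)" using C1_onD[OF assms(2)] by blast
 show ?thesis by (rule C1_onI[where F' = "%e z h. F e z*G' e z h + F' e z h*G e z"])
   (use F G in "auto simp: case_prod_unfold intro!: continuous_intros has_derivative_mult")
qed

lemma C1_on_minus: "C1_on W F ==> C1_on W (%e z. - F e z)" using C1_on_mult[OF C1_on_const[of W "-1"]] by simp

lemma C1_on_diff: "C1_on W F ==> C1_on W G ==> C1_on W (%e z. F e z - G e z)"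
 using C1_on_add[OF _ C1_on_minus] by simp

lemma C1_on_compose_family:
 assumes F: "C1_on W F"
  and ph: "!!e z. (e, z) : W ==> (e, F e z) : T" "!!e t. (e, t) : T ==> (ph e has_real_derivative ph' e t) (at t)"
   "continuous_on T (%(e, t). ph e t)" "continuous_on T (%(e, t). ph' e t)"
 shows "C1_on W (%e z. ph e (F e z))" proof -
 obtain F' where F: "!!e z. (e, z) : W ==> (F e has_derivative F' e z) (at z)"
  "!!h. continuous_on W (%(e, z). F' e z h)" "continuous_on W (%(e, z). F e z)" using C1_onD[OF F] by blast
 have c: "continuous_on W (%p. (fst p, F (fst p) (snd p)))"
  using F(3) by (auto intro!: continuous_intros simp: case_prod_unfold)
 have c': "continuous_on W (%p. ph (fst p) (F (fst p) (snd p)))" "continuous_on W (%p. ph' (fst p) (F (fst p) (snd p)))"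
  using continuous_on_compose2[OF ph(3) c] continuous_on_compose2[OF ph(4) c] ph(1) by (auto simp: image_subset_iff)
 show ?thesis proof (rule C1_onI[where F' = "%e z h. F' e z h*ph' e (F e z)"])
  fix e z assume "(e, z) : W"
  from has_derivative_compose[OF F(1)[OF this] ph(2)[OF ph(1)[OF this], unfolded has_field_derivative_def]]
  show "((%z. ph e (F e z)) has_derivative (%h. F' e z h*ph' e (F e z))) (at z)" by (simp add: mult.commute)
 qed (use c' F(2) in "auto simp: case_prod_unfold intro!: continuous_intros")
qed

lemma C1_on_compose:
 assumes "C1_on W F" "!!e z. (e, z) : W ==> F e z : T"
  "!!t. t : T ==> (ph has_real_derivative ph' t) (at t)" "continuous_on T ph'"
 shows "C1_on W (%e z. ph (F e z))"
proof (rule C1_on_compose_family[OF assms(1), of "UNIV \<times> T" "%_. ph" "%_. ph'"])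
 have "continuous_on T ph" using assms(3) by (intro continuous_at_imp_continuous_on ballI) (auto intro: DERIV_isCont)
 from continuous_on_compose2[OF this continuous_on_snd[OF continuous_on_id], of "UNIV \<times> T"]
 show "continuous_on (UNIV \<times> T) (%(e, t). ph t)" by (auto simp: case_prod_unfold)
 from continuous_on_compose2[OF assms(4) continuous_on_snd[OF continuous_on_id], of "UNIV \<times> T"]
 show "continuous_on (UNIV \<times> T) (%(e, t). ph' t)" by (auto simp: case_prod_unfold)
qed (use assms in auto)

lemma C1_on_sqrt:
 assumes "C1_on W F" "!!e z. (e, z) : W ==> F e z > 0"
 shows "C1_on W (%e z. sqrt (F e z))"
 by (rule C1_on_compose[OF assms(1), where T = "{0<..}" and ph' = "%t. inverse (sqrt t)/2"])
  (use assms(2) in "auto intro!: DERIV_real_sqrt continuous_intros")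

lemma C1_on_inverse:
 assumes "C1_on W F" "!!e z. (e, z) : W ==> F e z ~= 0"
 shows "C1_on W (%e z. inverse (F e z))"
 by (rule C1_on_compose[OF assms(1), where T = "- {0}" and ph' = "%t. - (inverse t*inverse t)"])
  (use assms(2) in "auto intro!: derivative_eq_intros continuous_intros")

lemma C1_on_divide:
 "C1_on W F ==> C1_on W G ==> (!!e z. (e, z) : W ==> G e z ~= 0) ==> C1_on W (%e z. F e z/G e z)"
 unfolding divide_inverse by (intro C1_on_mult C1_on_inverse)

lemma C1_on_sin: "C1_on W F ==> C1_on W (%e z. sin (F e z))"
 by (rule C1_on_compose[where T = UNIV and ph' = cos]) (auto intro!: continuous_intros derivative_eq_intros)

lemma C1_on_cos: "C1_on W F ==> C1_on W (%e z. cos (F e z))"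
 by (rule C1_on_compose[where T = UNIV and ph' = "%t. - sin t"]) (auto intro!: continuous_intros derivative_eq_intros)

lemma has_derivative_pair_expand:
 assumes "((F :: real \<times> real => real) has_derivative F') (at z)"
 shows "F' h = fst h*F' (1, 0) + snd h*F' (0, 1)" proof -
 have "bounded_linear F'" using assms by (rule has_derivative_bounded_linear)
 then interpret bounded_linear F' .
 have "F' h = F' (fst h *\<^sub>R (1, 0) + snd h *\<^sub>R (0, 1))" by simp
 thus ?thesis unfolding add scaleR by simp
qed

lemma C1_on_compose_pair:
 assumes F: "C1_on W F" and X: "C1_on V X" and Y: "C1_on V Y"
  and VW: "!!e z. (e, z) : V ==> (e, (X e z, Y e z)) : W"
 shows "C1_on V (%e z. F e (X e z, Y e z))" proof -
 obtain F' where F: "!!e z. (e, z) : W ==> (F e has_derivative F' e z) (at z)"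
  "!!h. continuous_on W (%(e, z). F' e z h)" "continuous_on W (%(e, z). F e z)" using C1_onD[OF F] by blast
 obtain X' where X: "!!e z. (e, z) : V ==> (X e has_derivative X' e z) (at z)"
  "!!h. continuous_on V (%(e, z). X' e z h)" "continuous_on V (%(e, z). X e z)" using C1_onD[OF X] by blast
 obtain Y' where Y: "!!e z. (e, z) : V ==> (Y e has_derivative Y' e z) (at z)"
  "!!h. continuous_on V (%(e, z). Y' e z h)" "continuous_on V (%(e, z). Y e z)" using C1_onD[OF Y] by blast
 let ?Z = "%p. (fst p, (X (fst p) (snd p), Y (fst p) (snd p)))"
 have c: "continuous_on V ?Z" using X(3) Y(3) by (auto intro!: continuous_intros simp: case_prod_unfold)
 have im: "?Z ` V <= W" using VW by auto
 note cc = continuous_on_compose2[OF F(3) c im] continuous_on_compose2[OF F(2) c im]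
 show ?thesis
 proof (rule C1_onI[where F' = "%e z h. X' e z h*F' e (X e z, Y e z) (1, 0) + Y' e z h*F' e (X e z, Y e z) (0, 1)"])
  fix e z assume z: "(e, z) : V"
  have "((%z. F e (X e z, Y e z)) has_derivative (%h. F' e (X e z, Y e z) (X' e z h, Y' e z h))) (at z)"
   by (rule has_derivative_compose[OF has_derivative_Pair[OF X(1)[OF z] Y(1)[OF z]] F(1)[OF VW[OF z]]])
  thus "((%z. F e (X e z, Y e z)) has_derivative
    (%h. X' e z h*F' e (X e z, Y e z) (1, 0) + Y' e z h*F' e (X e z, Y e z) (0, 1))) (at z)"
   by (subst (asm) has_derivative_pair_expand[OF F(1)[OF VW[OF z]]]) simp
 qed (use cc X(2) Y(2) in "auto simp: case_prod_unfold intro!: continuous_intros")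
qed

section \<open>Uniform estimates on periodic strips\<close>

lemma continuous_near_parameter:
 fixes F :: "'p::metric_space \<times> 'k::metric_space => real"
 assumes "compact P" "compact K" "p0 : P" "continuous_on (P \<times> K) F" "et > 0"
 obtains d where "d > 0" "!!p k. p : P ==> dist p p0 < d ==> k : K ==> abs (F (p, k) - F (p0, k)) < et"
proof -
 have "uniformly_continuous_on (P \<times> K) F"
  using assms by (intro compact_uniformly_continuous compact_Times) auto
 then obtain d where d: "d > 0" "!!a b. a : P \<times> K ==> b : P \<times> K ==> dist b a < d ==> dist (F b) (F a) < et"
  unfolding uniformly_continuous_on_def using assms(5) by blast
 show ?thesis proof (rule that[OF d(1)])
  fix p k assume "p : P" "dist p p0 < d" "k : K"
  thus "abs (F (p, k) - F (p0, k)) < et"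
   using d(2)[of "(p0, k)" "(p, k)"] assms(3) by (simp add: dist_Pair_Pair dist_real_def)
 qed
qed

definition strip :: "real => real => (real \<times> real) set" where
 "strip aa bb = {z. aa <= snd z - fst z & snd z - fst z <= bb}"

lemma convex_strip: "convex (strip aa bb)" proof -
 have "bounded_linear (%z::real \<times> real. snd z - fst z)" by (intro bounded_linear_intros)
 hence "convex ((%z::real \<times> real. snd z - fst z) -` {aa..bb})"
  by (intro convex_linear_vimage bounded_linear.linear) auto
 moreover have "(%z::real \<times> real. snd z - fst z) -` {aa..bb} = strip aa bb" by (auto simp: strip_def)
 ultimately show ?thesis by simp
qed

lemma shift_to_period:
 obtains n :: int where "x + 2*pi * of_int n : {0..2*pi}" proof
 show "x + 2*pi * of_int (- \<lfloor>x/(2*pi)\<rfloor>) : {0..2*pi}" proof -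
  define q where "q = x/(2*pi)"
  have x: "x = q*(2*pi)" by (simp add: q_def)
  have "of_int \<lfloor>q\<rfloor> * (2*pi) <= q*(2*pi)" "q*(2*pi) <= (of_int \<lfloor>q\<rfloor> + 1)*(2*pi)"
   by (intro mult_right_mono; simp; linarith)+
  hence "of_int \<lfloor>x/(2*pi)\<rfloor> * (2*pi) <= x" "x <= (of_int \<lfloor>x/(2*pi)\<rfloor> + 1)*(2*pi)"
   unfolding x[symmetric] unfolding q_def .
  thus ?thesis by (simp add: algebra_simps)
 qed
qed

lemma periodic_int:
 fixes A :: "real \<times> real => 'a"
 assumes "!!x y. A (x + 2*pi, y + 2*pi) = A (x, y)"
 shows "A (x + 2*pi * of_int n, y + 2*pi * of_int n) = A (x, y)"
proof (induction n rule: int_induct[where k = 0])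
 case (step1 i)
 thus ?case using assms[of "x + 2*pi * of_int i" "y + 2*pi * of_int i"] by (simp add: algebra_simps)
next
 case (step2 i)
 thus ?case using assms[of "x + 2*pi * of_int (i - 1)" "y + 2*pi * of_int (i - 1)"] by (simp add: algebra_simps)
qed simp

text \<open>The strip is not compact, but modulo simultaneous translation of both angles by
  \<open>2*pi\<close> it is covered by the compact set \<open>K\<close>.\<close>

lemma periodic_near_parameter:
 fixes A :: "real => real \<times> real => real"
 assumes c: "continuous_on ({- e0..e0} \<times> strip aa bb) (%(e, z). A e z)" and e0: "e0 > 0" and et: "et > 0"
  and per: "!!e x y. e : {- e0..e0} ==> (x, y) : strip aa bb ==> A e (x + 2*pi, y + 2*pi) = A e (x, y)"
 shows "EX e1>0. ALL e z. e : {- e0..e0} & abs e < e1 & z : strip aa bb --> abs (A e z - A 0 z) <= et" proof -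
 define K where "K = strip aa bb \<inter> ({0..2*pi} \<times> {aa..bb + 2*pi})"
 have "closed (strip aa bb)" unfolding strip_def
  by (intro closed_Collect_conj closed_Collect_le continuous_intros)
 hence K: "compact K" unfolding K_def by (intro closed_Int_compact compact_Times compact_Icc)
 have KS: "K <= strip aa bb" by (auto simp: K_def)
 have "continuous_on ({- e0..e0} \<times> K) (%(e, z). A e z)"
  by (rule continuous_on_subset[OF c]) (use KS in auto)
 then obtain d where d: "d > 0"
  "!!e k. e : {- e0..e0} ==> dist e 0 < d ==> k : K ==> abs ((%(e, z). A e z) (e, k) - (%(e, z). A e z) (0, k)) < et"
  using continuous_near_parameter[OF compact_Icc K _ _ et, of 0 "- e0" e0 "%(e, z). A e z"] e0 by auto
 show ?thesis proof (intro exI[of _ d] conjI allI impI)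
  fix e z assume H: "e : {- e0..e0} & abs e < d & z : strip aa bb"
  obtain x y where z: "z = (x, y)" by (cases z)
  obtain n :: int where n: "x + 2*pi * of_int n : {0..2*pi}" by (rule shift_to_period)
  \<comment> \<open>Extended by \<open>0\<close> off the strip to be periodic everywhere, as
    \<open>periodic_int\<close> demands.\<close>
  let ?A = "%e z. if z : strip aa bb then A e z else 0"
  have p: "?A e' (x + 2*pi * of_int n, y + 2*pi * of_int n) = ?A e' (x, y)" if "e' : {- e0..e0}" for e'
   by (rule periodic_int) (use per[OF that] in "auto simp: strip_def")
  have S: "(x + 2*pi * of_int n, y + 2*pi * of_int n) : K" using H n by (auto simp: z K_def strip_def)
  have S': "(x + 2*pi * of_int n, y + 2*pi * of_int n) : strip aa bb" "(x, y) : strip aa bb" using S KS H z by auto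
  have "A e' (x + 2*pi * of_int n, y + 2*pi * of_int n) = A e' (x, y)" if "e' : {- e0..e0}" for e'
   using p[OF that] S' by simp
  thus "abs (A e z - A 0 z) <= et" using d(2)[OF _ _ S, of e] H e0 by (simp add: z dist_real_def)
 qed (rule d(1))
qed

text \<open>Applied to the partial derivatives of the generating function, this supplies the
  closeness and Lipschitz conditions of \<open>near_integrable\<close>. The Lipschitz part is the
  mean value inequality on the convex strip.\<close>

lemma C1_uniform:
 assumes A: "C1_on ({- e0..e0} \<times> strip aa bb) A" and e0: "e0 > 0" and et: "et > 0"
  and per: "!!e x y. e : {- e0..e0} ==> A e (x + 2*pi, y + 2*pi) = A e (x, y)"
 shows "EX e1>0. ALL e. e : {- e0..e0} & abs e < e1 --> (ALL z:strip aa bb. abs (A e z - A 0 z) <= et) &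
   (ALL z:strip aa bb. ALL z':strip aa bb. abs ((A e z' - A 0 z') - (A e z - A 0 z)) <= et*(abs (fst z' - fst z) + abs (snd z' - snd z)))"
proof -
 let ?W = "{- e0..e0} \<times> strip aa bb"
 obtain A' where A': "!!e z. (e, z) : ?W ==> (A e has_derivative A' e z) (at z)"
  "!!h. continuous_on ?W (%(e, z). A' e z h)" "continuous_on ?W (%(e, z). A e z)" using C1_onD[OF A] by blast
 have per': "A' e (x + 2*pi, y + 2*pi) h = A' e (x, y) h" if e: "e : {- e0..e0}" and z: "(x, y) : strip aa bb" for e x y h
 proof -
  have "(x + 2*pi, y + 2*pi) : strip aa bb" using z by (simp add: strip_def)
  hence d: "(A e has_derivative A' e ((x, y) + (2*pi, 2*pi))) (at ((x, y) + (2*pi, 2*pi)))" using A'(1) e by simp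
  have "((%z. z + (2*pi, 2*pi)) has_derivative (%h. h)) (at (x, y))" by (auto intro!: derivative_eq_intros)
  from has_derivative_compose[OF this d]
  have "((%z. A e (z + (2*pi, 2*pi))) has_derivative A' e (x + 2*pi, y + 2*pi)) (at (x, y))" by simp
  moreover have "(%z. A e (z + (2*pi, 2*pi))) = A e" using per[OF e] by (auto simp: fun_eq_iff)
  ultimately have "(A e has_derivative A' e (x + 2*pi, y + 2*pi)) (at (x, y))" by simp
  from has_derivative_unique[OF this A'(1)] e z show ?thesis by simp
 qed
 have et2: "et/2 > 0" using et by simp
 obtain d0 where d0: "d0 > 0" "!!e z. e : {- e0..e0} ==> abs e < d0 ==> z : strip aa bb ==> abs (A e z - A 0 z) <= et"
  using periodic_near_parameter[OF A'(3) e0 et per] by blast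
 have close: "EX d>0. ALL e z. e : {- e0..e0} & abs e < d & z : strip aa bb --> abs (A' e z h - A' 0 z h) <= et/2" for h
  by (rule periodic_near_parameter[OF A'(2) e0 et2 per'])
 obtain d1 where d1: "d1 > 0" "!!e z. e : {- e0..e0} ==> abs e < d1 ==> z : strip aa bb ==> abs (A' e z (1, 0) - A' 0 z (1, 0)) <= et/2"
  using close[of "(1, 0)"] by blast
 obtain d2 where d2: "d2 > 0" "!!e z. e : {- e0..e0} ==> abs e < d2 ==> z : strip aa bb ==> abs (A' e z (0, 1) - A' 0 z (0, 1)) <= et/2"
  using close[of "(0, 1)"] by blast
 show ?thesis proof (intro exI[of _ "min d0 (min d1 d2)"] conjI allI impI ballI)
  fix e z z' assume e: "e : {- e0..e0} & abs e < min d0 (min d1 d2)" and z: "z : strip aa bb" "z' : strip aa bb"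
  have "norm ((A e z' - A 0 z') - (A e z - A 0 z)) <= et*norm (z' - z)"
  proof (rule differentiable_bound[OF convex_strip _ _ z(2,1)])
   fix w assume w: "w : strip aa bb"
   have D: "(A e has_derivative A' e w) (at w)" "(A 0 has_derivative A' 0 w) (at w)" using A'(1) e e0 w by auto
   from has_derivative_diff[OF this]
   show "((%z. A e z - A 0 z) has_derivative (%h. A' e w h - A' 0 w h)) (at w within strip aa bb)"
    by (rule has_derivative_at_withinI)
   show "onorm (%h. A' e w h - A' 0 w h) <= et" proof (rule onorm_le)
    fix h :: "real \<times> real"
    have "A' e w h - A' 0 w h = fst h*(A' e w (1, 0) - A' 0 w (1, 0)) + snd h*(A' e w (0, 1) - A' 0 w (0, 1))"
     unfolding has_derivative_pair_expand[OF D(1), of h] has_derivative_pair_expand[OF D(2), of h] by (simp add: algebra_simps)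
    also have "\<bar>...\<bar> <= \<bar>fst h\<bar> * \<bar>A' e w (1, 0) - A' 0 w (1, 0)\<bar> + \<bar>snd h\<bar> * \<bar>A' e w (0, 1) - A' 0 w (0, 1)\<bar>"
     by (rule order_trans[OF abs_triangle_ineq]) (simp add: abs_mult)
    also have "... <= norm h*(et/2) + norm h*(et/2)"
     using d1(2)[of e w] d2(2)[of e w] e w norm_fst_le[of "fst h" "snd h"] norm_snd_le[of "snd h" "fst h"]
     by (intro add_mono mult_mono) auto
    finally show "norm (A' e w h - A' 0 w h) <= et*norm h" by (simp add: mult.commute)
   qed
  qed
  also have "... <= et*(abs (fst z' - fst z) + abs (snd z' - snd z))"
   using et norm_Pair_le[of "fst (z' - z)" "snd (z' - z)"] unfolding prod.collapse by (intro mult_left_mono) auto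
  finally show "abs ((A e z' - A 0 z') - (A e z - A 0 z)) <= et*(abs (fst z' - fst z) + abs (snd z' - snd z))" by simp
 qed (use d0 d1(1) d2(1) in auto)
qed

text \<open>The continuous zero \<open>Y\<close> is given beforehand, so the first-order expansion
  of \<open>G\<close> at one point suffices: with error rate \<open>q\<close> at most half of
  \<open>abs B\<close> it gives \<open>abs k <= norm h*L\<close>, and then the expansion of
  \<open>Y\<close> with error governed by \<open>q*(1 + L) <= e*abs B\<close>.\<close>

lemma implicit_derivative:
 fixes Y :: "'a::real_normed_vector => real" and G :: "'a \<times> real => real"
 assumes G: "(G has_derivative (%h. A (fst h) + B * snd h)) (at (z0, Y z0))" and B: "B ~= 0" and A: "bounded_linear A"
  and Y: "isCont Y z0" and zero: "\<forall>\<^sub>F z in nhds z0. G (z, Y z) = 0"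
 shows "(Y has_derivative (%h. - A h/B)) (at z0)" proof -
 obtain M where M: "M > 0" "!!h. abs (A h) <= norm h*M" using bounded_linear.pos_bounded[OF A] by auto
 have G0: "G (z0, Y z0) = 0" using eventually_nhds_x_imp_x[OF zero] .
 have bB: "abs B > 0" using B by simp
 show ?thesis unfolding has_derivative_at_alt proof (intro conjI allI impI)
  show "bounded_linear (%h. - A h/B)"
   unfolding divide_inverse by (intro bounded_linear_mult_const bounded_linear_minus A)
  fix e :: real assume e: "e > 0"
  define L where "L = 2*M/abs B + 2"
  define q where "q = min (abs B/2) (e*abs B/(1 + L))"
  have L: "L > 0" using M bB by (auto simp: L_def intro!: add_nonneg_pos)
  have q1: "q > 0" unfolding q_def using e bB L by (auto intro!: divide_pos_pos mult_pos_pos)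
  have q2: "q <= abs B/2" unfolding q_def by (rule min.cobounded1)
  note q = q1 q2
  have "q <= e*abs B/(1 + L)" by (simp add: q_def)
  hence q3: "q*(1 + L) <= e*abs B" using L by (simp add: pos_le_divide_eq)
  obtain d where d: "d > 0" "!!w. norm (w - (z0, Y z0)) < d ==>
    abs (G w - (A (fst (w - (z0, Y z0))) + B * snd (w - (z0, Y z0)))) <= q*norm (w - (z0, Y z0))"
   using G q(1) unfolding has_derivative_at_alt by (auto simp: G0)
  have "\<forall>\<^sub>F z in nhds z0. dist (Y z) (Y z0) < d/2"
   by (rule tendstoD) (use Y d in "auto simp: isCont_def tendsto_at_iff_tendsto_nhds")
  moreover have "\<forall>\<^sub>F z in nhds z0. dist z z0 < d/2" unfolding eventually_nhds_metric using d(1) by (intro exI[of _ "d/2"]) auto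
  ultimately have "\<forall>\<^sub>F z in nhds z0. norm (Y z - Y z0 - - A (z - z0)/B) <= e*norm (z - z0)"
   using zero proof eventually_elim
   case (elim z)
   define h k where "h = z - z0" and "k = Y z - Y z0"
   have w: "(z, Y z) - (z0, Y z0) = (h, k)" by (simp add: h_def k_def)
   have n: "norm (h, k) <= norm h + abs k" using norm_Pair_le[of h k] by simp
   have "norm h < d/2" "abs k < d/2" using elim by (auto simp: h_def k_def dist_norm)
   hence "abs (A h + B * k) <= q*norm (h, k)" using d(2)[of "(z, Y z)"] n elim(3) unfolding w by simp
   also have "... <= q*(norm h + abs k)" using n q by (intro mult_left_mono) auto
   finally have 1: "abs (A h + B * k) <= q*(norm h + abs k)" .
   have "abs B*abs k <= abs (A h + B * k) + abs (A h)" unfolding abs_mult[symmetric] by linarith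
   also have "... <= q*(norm h + abs k) + norm h*M" using 1 M(2)[of h] by linarith
   also have "... <= abs B/2*(norm h + abs k) + norm h*M" using q by (intro add_mono mult_right_mono order_refl) auto
   finally have "abs B*abs k <= abs B/2*(norm h + abs k) + norm h*M" .
   hence "abs B/2*abs k <= abs B/2*(norm h*(1 + 2*M/abs B))" proof -
    assume a: "abs B*abs k <= abs B/2*(norm h + abs k) + norm h*M"
    have "abs B/2*(norm h*(1 + 2*M/abs B)) = abs B/2*norm h + norm h*M" using bB by (simp add: distrib_left)
    thus ?thesis using a by (simp add: distrib_left)
   qed
   hence "abs k <= norm h*(1 + 2*M/abs B)" using bB by (simp only: mult_le_cancel_left_pos half_gt_zero)
   also have "... <= norm h*L" by (intro mult_left_mono) (auto simp: L_def)
   finally have k: "abs k <= norm h*L" .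
   have "q*(norm h + abs k) <= q*(norm h + norm h*L)" using k q by (intro mult_left_mono) auto
   also have "... = q*(1 + L)*norm h" by (simp add: algebra_simps)
   also have "... <= e*abs B*norm h" using q3 by (intro mult_right_mono) auto
   finally have "abs (A h + B * k) <= e*norm h*abs B" using 1 by (simp add: mult_ac)
   hence "abs (A h + B * k)/abs B <= e*norm h" using bB by (simp add: pos_divide_le_eq)
   moreover have "k - - A h/B = (A h + B * k)/B" using B by (simp add: field_simps)
   ultimately show ?case by (simp add: h_def k_def)
  qed
  thus "EX d>0. ALL z. norm (z - z0) < d --> norm (Y z - Y z0 - - A (z - z0)/B) <= e*norm (z - z0)"
   unfolding eventually_nhds_metric dist_norm by simp
 qed
qed

text \<open>For positive order \<open>C_class\<close> asserts continuity only of the highest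
  derivatives. By induction \<open>gx\<close> is continuous, hence locally bounded, so
  \<open>g\<close> is Lipschitz in \<open>x\<close> uniformly in \<open>e\<close>; differentiability
  in \<open>e\<close> at fixed \<open>x0\<close> gives the rest.\<close>

lemma C_class_continuous: "C_class k C g ==> continuous_on (UNIV \<times> {-C..C}) (%(x, e). g x e)"
proof (induction k arbitrary: g)
 case (Suc k)
 obtain gx ge where g0: "ALL x. ALL e:{-C..C}. ((%y. g y e) has_real_derivative gx x e) (at x) &
   ((%d. g x d) has_real_derivative ge x e) (at e within {-C..C})" "C_class k C gx"
  using Suc.prems by (subst (asm) C_class.simps) blast
 have g: "!!x e. e : {-C..C} ==> ((%y. g y e) has_real_derivative gx x e) (at x)"
  "!!x e. e : {-C..C} ==> ((%d. g x d) has_real_derivative ge x e) (at e within {-C..C})" using g0(1) by blast+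
 note gx = Suc.IH[OF g0(2)]
 show ?case proof (clarsimp simp: continuous_on_eq_continuous_within)
  fix x0 e0 :: real assume e0: "- C <= e0" "e0 <= C"
  define K where "K = {x0 - 1..x0 + 1} \<times> {-C..C}"
  have "compact ((%(x, e). gx x e) ` K)"
   unfolding K_def by (intro compact_continuous_image continuous_on_subset[OF gx] compact_Times) auto
  hence "bounded ((%(x, e). gx x e) ` K)" by (rule compact_imp_bounded)
  then obtain B where "ALL y:(%(x, e). gx x e) ` K. norm y <= B" unfolding bounded_iff by blast
  hence B: "!!x e. (x, e) : K ==> abs (gx x e) <= B" by (auto simp: K_def)
  have lip: "abs (g x e - g x0 e) <= B*abs (x - x0)" if "abs (x - x0) < 1" "e : {-C..C}" for x e proof -
   have "norm (g x e - g x0 e) <= B*norm (x - x0)"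
   proof (rule field_differentiable_bound[of "{x0 - 1..x0 + 1}"])
    fix y assume "y : {x0 - 1..x0 + 1}"
    thus "((%y. g y e) has_field_derivative gx y e) (at y within {x0 - 1..x0 + 1})" "norm (gx y e) <= B"
     using g(1)[OF that(2)] B[of y e] that by (auto simp: K_def intro: has_field_derivative_at_within)
   qed (use that in auto)
   thus ?thesis by simp
  qed
  have "continuous (at e0 within {-C..C}) (g x0)" using g(2)[of e0 x0] e0 by (intro DERIV_continuous) auto
  hence c: "((%e. g x0 e) \<longlongrightarrow> g x0 e0) (at e0 within {-C..C})" by (simp add: continuous_within)
  show "continuous (at (x0, e0) within UNIV \<times> {-C..C}) (%(x, e). g x e)"
   unfolding continuous_within_eps_delta proof (intro allI impI)
   fix d :: real assume d: "d > 0"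
   have "\<forall>\<^sub>F e in at e0 within {-C..C}. dist (g x0 e) (g x0 e0) < d/2" by (rule tendstoD[OF c]) (use d in simp)
   then obtain d1 where d0: "d1 > 0" "ALL e:{-C..C}. e ~= e0 & dist e e0 < d1 --> dist (g x0 e) (g x0 e0) < d/2"
    unfolding eventually_at by blast
   have d1: "d1 > 0" "abs (g x0 e - g x0 e0) < d/2" if "e : {-C..C}" "dist e e0 < d1" for e proof -
    show "d1 > 0" by (rule d0(1))
    show "abs (g x0 e - g x0 e0) < d/2" proof (cases "e = e0")
     case True
     thus ?thesis using d by simp
    next
     case False
     thus ?thesis using bspec[OF d0(2) that(1)] that(2) by (simp add: dist_real_def)
    qed
   qed
   define d2 where "d2 = min d1 (min 1 (d/(2*(abs B + 1))))"
   show "EX s>0. ALL p':UNIV \<times> {-C..C}. dist p' (x0, e0) < s --> dist (case p' of (x, e) => g x e) (case (x0, e0) of (x, e) => g x e) < d"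
   proof (intro exI[of _ d2] conjI ballI impI)
    show "d2 > 0" using d d0(1) by (auto simp: d2_def intro!: divide_pos_pos add_nonneg_pos)
    fix p' assume p: "p' : UNIV \<times> {-C..C}" "dist p' (x0, e0) < d2"
    obtain x e where xe: "p' = (x, e)" "e : {-C..C}" using p by auto
    have 1: "abs (x - x0) < d2" "abs (e - e0) < d2"
     using p dist_fst_le[of p' "(x0, e0)"] dist_snd_le[of p' "(x0, e0)"] by (auto simp: xe dist_real_def)
    have "abs (g x e - g x0 e) <= B*abs (x - x0)" using lip 1 xe by (simp add: d2_def)
    also have "... <= (abs B + 1)*abs (x - x0)" by (intro mult_right_mono) auto
    also have "... <= (abs B + 1)*(d/(2*(abs B + 1)))" using 1 by (intro mult_left_mono) (auto simp: d2_def)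
    also have "... = d/2" by (simp add: field_simps add_nonneg_eq_0_iff)
    finally have "abs (g x e - g x0 e) <= d/2" .
    moreover have "abs (g x0 e - g x0 e0) < d/2" using d1(2)[of e] 1 xe by (simp add: d2_def dist_real_def)
    ultimately show "dist (case p' of (x, e) => g x e) (case (x0, e0) of (x, e) => g x e) < d"
     unfolding xe prod.case dist_real_def by linarith
   qed
  qed
 qed
qed simp

lemma bounded_periodic_family:
 fixes g :: "real => real => real" and C :: real
 assumes c: "continuous_on (UNIV \<times> {-C..C}) (%(x, e). g x e)"
  and per: "!!x e. e : {-C..C} ==> g (x + 2*pi) e = g x e"
 obtains M where "!!x e. e : {-C..C} ==> abs (g x e) <= M" proof -
 have "compact ((%(x, e). g x e) ` ({0..2*pi} \<times> {-C..C}))"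
  by (intro compact_continuous_image continuous_on_subset[OF c] compact_Times) auto
 hence "bounded ((%(x, e). g x e) ` ({0..2*pi} \<times> {-C..C}))" by (rule compact_imp_bounded)
 then obtain M where "ALL y:(%(x, e). g x e) ` ({0..2*pi} \<times> {-C..C}). norm y <= M"
  unfolding bounded_iff by blast
 hence M: "!!x e. x : {0..2*pi} ==> e : {-C..C} ==> abs (g x e) <= M" by simp
 show ?thesis proof (rule that)
  fix x e assume e: "e : {-C..C}"
  obtain n :: int where n: "x + 2*pi * of_int n : {0..2*pi}" by (rule shift_to_period)
  have "g (x + 2*pi * of_int n) e = g x e" using periodic_int[of "%p. g (fst p) e" x n 0] per[OF e] by simp
  thus "abs (g x e) <= M" using M[OF n e] by simp
 qed
qed

text \<open>\<open>f1\<close> and \<open>f2\<close> are the first two derivatives of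
  \<open>f\<close> in the angle. Two are wanted because the first derivatives of the generating
  function must themselves be continuously differentiable.\<close>

locale boundary_family =
 fixes f f1 f2 :: "real => real => real" and C M :: real
 assumes C_pos: "C > 0"
  and per: "e : {-C..C} ==> f (x + 2*pi) e = f x e" "e : {-C..C} ==> f1 (x + 2*pi) e = f1 x e"
  and d1: "e : {-C..C} ==> ((%y. f y e) has_real_derivative f1 x e) (at x)"
  and d2: "e : {-C..C} ==> ((%y. f1 y e) has_real_derivative f2 x e) (at x)"
  and cont: "continuous_on (UNIV \<times> {-C..C}) (%(x, e). f x e)" "continuous_on (UNIV \<times> {-C..C}) (%(x, e). f1 x e)"
   "continuous_on (UNIV \<times> {-C..C}) (%(x, e). f2 x e)"
  and bound: "e : {-C..C} ==> abs (f x e) <= M" "e : {-C..C} ==> abs (f1 x e) <= M" "e : {-C..C} ==> abs (f2 x e) <= M"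

lemma derivative_periodic:
 assumes "!!x. g (x + p) = g x" "!!x. (g has_real_derivative g' x) (at x)"
 shows "g' (x + p) = g' (x :: real)" proof -
 have "((%x. g (x + p)) has_real_derivative g' (x + p)) (at x)"
  using assms(2)[of "x + p"] by (simp add: DERIV_shift)
 thus ?thesis using assms(2)[of x] DERIV_unique unfolding assms(1) by blast
qed

lemma boundary_family_exists:
 assumes "C > 0" "k > 5" "C_class k C f" "!!xi e. e : {-C..C} ==> f (xi + 2*pi) e = f xi e"
 obtains f1 f2 M where "boundary_family f f1 f2 C M" proof -
 define j where "j = k - 2"
 have k: "k = Suc (Suc j)" using assms(2) by (simp add: j_def)
 obtain f1 fe where f1: "!!x e. e : {-C..C} ==> ((%y. f y e) has_real_derivative f1 x e) (at x)" "C_class (Suc j) C f1"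
  using assms(3) unfolding k by (subst (asm) C_class.simps) blast
 obtain f2 fe where f2: "!!x e. e : {-C..C} ==> ((%y. f1 y e) has_real_derivative f2 x e) (at x)" "C_class j C f2"
  using f1(2) by (subst (asm) C_class.simps) blast
 note c = C_class_continuous[OF assms(3)] C_class_continuous[OF f1(2)] C_class_continuous[OF f2(2)]
 have p1: "f1 (x + 2*pi) e = f1 x e" if e: "e : {-C..C}" for x e
  by (rule derivative_periodic[of "%x. f x e" "2*pi" "%x. f1 x e"]) (use f1(1)[OF e] assms(4)[OF e] in auto)
 have p2: "f2 (x + 2*pi) e = f2 x e" if e: "e : {-C..C}" for x e
  by (rule derivative_periodic[of "%x. f1 x e" "2*pi" "%x. f2 x e"]) (use f2(1)[OF e] p1[OF e] in auto)
 obtain M0 where M0: "!!x e. e : {-C..C} ==> abs (f x e) <= M0" using bounded_periodic_family[OF c(1) assms(4)] by blast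
 obtain M1 where M1: "!!x e. e : {-C..C} ==> abs (f1 x e) <= M1" using bounded_periodic_family[OF c(2) p1] by blast
 obtain M2 where M2: "!!x e. e : {-C..C} ==> abs (f2 x e) <= M2" using bounded_periodic_family[OF c(3) p2] by blast
 have "boundary_family f f1 f2 C (max M0 (max M1 M2))"
  by (intro boundary_family.intro assms(1,4) p1 f1(1) f2(1) c)
   (simp_all only: le_max_iff_disj M0 M1 M2 simp_thms)
 thus ?thesis by (rule that)
qed

context boundary_family begin

lemma M_nonneg: "M >= 0" using bound(1)[of 0 0] C_pos by auto

lemma curve_small:
 assumes e: "e : {-C..C}" "abs e*M <= 1/4"
 shows "curve f e (abs e*M)" proof
 fix x y
 show "f (x + 2*pi) e = f x e" by (rule per(1)[OF e(1)])
 show "abs (e*f x e) <= abs e*M" unfolding abs_mult using bound(1)[OF e(1)] by (intro mult_left_mono) auto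
 have lip: "abs (g x - g y) <= M*abs (x - y)" if "!!x. (g has_real_derivative g' x) (at x)" "!!x. abs (g' x) <= M" for g g' :: "real => real" and x y
  using field_differentiable_bound[of UNIV g g' M x y] that by simp
 have "abs (f x e - f y e) <= M*abs (x - y)" by (rule lip[OF d1[OF e(1)] bound(2)[OF e(1)]])
 from mult_left_mono[OF this abs_ge_zero[of e]]
 show "abs (e*f x e - e*f y e) <= abs e*M*abs (x - y)" by (simp add: abs_mult[symmetric] algebra_simps)
 show "abs (e*f x e + e*f y e - 2*(e*f ((x + y)/2) e)) <= abs e*M*(x - y)^2" proof -
  \<comment> \<open>The mean value theorem on both halves expresses the second difference by two
    values of \<open>f1\<close>, whose difference is again linear in the length of the
    interval.\<close>
  have main: "abs (f x e + f y e - 2*f ((x + y)/2) e) <= M*(x - y)^2" if xy: "x < y" for x y proof -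
   define m where "m = (x + y)/2"
   have m: "x < m" "m < y" "m - x = (y - x)/2" "y - m = (y - x)/2" using xy by (auto simp: m_def field_simps)
   obtain p where p: "x < p" "p < m" "f m e - f x e = (m - x)*f1 p e"
    using MVT2[OF m(1), of "%x. f x e" "%x. f1 x e"] d1[OF e(1)] by blast
   obtain q where q: "m < q" "q < y" "f y e - f m e = (y - m)*f1 q e"
    using MVT2[OF m(2), of "%x. f x e" "%x. f1 x e"] d1[OF e(1)] by blast
   have "f x e + f y e - 2*f m e = (f y e - f m e) - (f m e - f x e)" by simp
   also have "... = (y - x)/2*(f1 q e - f1 p e)" unfolding p(3) q(3) m by (simp only: right_diff_distrib)
   finally have "abs (f x e + f y e - 2*f m e) = abs ((y - x)/2*(f1 q e - f1 p e))" by (rule arg_cong)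
   also have "... = (y - x)/2*abs (f1 q e - f1 p e)" unfolding abs_mult using xy by simp
   also have "... <= (y - x)/2*(M*abs (q - p))"
    using xy by (intro mult_left_mono lip[OF d2[OF e(1)] bound(3)[OF e(1)]]) auto
   also have "... <= (y - x)*(M*(y - x))" using xy p q m M_nonneg by (intro mult_mono) auto
   finally show ?thesis by (simp add: m_def square_simps)
  qed
  have "abs (f x e + f y e - 2*f ((x + y)/2) e) <= M*(x - y)^2" proof (cases x y rule: linorder_cases)
   case greater
   thus ?thesis using main[of y x] by (simp add: add.commute power2_commute)
  qed (use main in auto)
  from mult_left_mono[OF this abs_ge_zero[of e]] show ?thesis by (simp add: abs_mult[symmetric] algebra_simps)
 qed
qed (use e in auto)

definition r :: "real => real => real" where "r e x = 1 + e*f x e"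
definition r1 :: "real => real => real" where "r1 e x = e*f1 x e"

end

text \<open>The interface to the geometry: for small parameters and with a margin \<open>de\<close>
  from the extreme angles, the lengths are the explicit formulas, and the inequalities are those
  under which these formulas are differentiable.\<close>

locale billiard = boundary_family +
 fixes om En h mu K H de e0 :: real
 assumes pos: "om > 0" "En > om^2" "h > 0" "mu > 0" and K_def: "K = 2*En/om^2" and H_def: "H = En + h"
  and de: "0 < de" "de < pi" and e0: "0 < e0" "e0 <= C" and r_pos: "abs e <= e0 ==> r e x > 0"
  and outer: "abs e <= e0 ==> abs (u - x) <= pi - de ==>
   (r e x)\<^sup>2 + (r e u)^2 < K & 0 < (r e x)^2 + (r e u)^2 + 2*(r e x*r e u*cos (u - x)) &
   (is_S_E om En f e x u l \<longleftrightarrow> l = G_E om En ((r e x)^2 + (r e u)^2) (r e x*r e u*cos (u - x)))"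
  and inner: "abs e <= e0 ==> abs (u - x) <= 2*pi - de ==>
   2*(- (sqrt (r e x*r e u)*cos ((u - x)/2))) < r e x + r e u &
   (is_S_I En h mu f e x u l \<longleftrightarrow> l = G_I H mu (r e x + r e u) (- (sqrt (r e x*r e u)*cos ((u - x)/2))))"

lemma (in boundary_family) billiard_exists:
 assumes pos: "om > 0" "En > om^2" "h > 0" "mu > 0" and de: "0 < de" "de < pi"
 obtains e0 where "billiard f f1 f2 C M om En h mu (2*En/om^2) (En + h) de e0" proof -
 define K where "K = 2*En/om^2"
 have "2 * om^2 < 2*En" using pos by simp
 hence K: "K > 2" using pos by (simp add: K_def pos_less_divide_eq)
 obtain ka et0 where ka: "ka > 0" "et0 > 0" "et0 <= 1/4" "2 + 6*et0 <= (K + 2)/2"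
  and gn: "!!r0 r1 De. abs (r0 - 1) <= et0 ==> abs (r1 - 1) <= et0 ==> abs (r0 - r1) <= et0*abs De ==> abs De <= pi - de ==>
   c_E K (r0^2 + r1^2) (r0*r1*cos De) + ka <= cos De"
  and gp: "!!r0 r1 De c. abs (r0 - 1) <= et0 ==> abs (r1 - 1) <= et0 ==> abs (r0 - r1) <= et0*abs De ==> abs De <= pi - de ==>
   0 < c ==> c <= 1 ==> De ~= 0 ==> K*c^2 - 2*(r0*r1*cos De)*c + (r0^2 + r1^2) - K = 0 ==>
   cos De + ka*De^2 <= c" by (rule c_E_gap[OF K de(1)]) blast
 have cd: "cos de < 1" "cos (de/2) < 1" using cos_monotone_0_pi[of 0 de] cos_monotone_0_pi[of 0 "de/2"] de by auto
 define ka' where "ka' = min (1/4) ((1 - cos (de/2))/2)"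
 have ka': "ka' > 0" "ka' <= 1/4" "2 * ka' <= 1 - cos (de/2)" using cd by (auto simp: ka'_def min_def)
 \<comment> \<open>\<open>225\<close> and \<open>61\<close> exceed the \<open>224\<close> and
   \<open>60\<close> demanded by the two locales, so that weak bounds yield strict ones.\<close>
 define b where "b = min (min et0 (ka/16)) (min (ka*(1 - cos de)/(225*(2*K + 4))) (ka'/61))"
 have b: "b > 0" using ka ka' cd K by (auto simp: b_def intro!: divide_pos_pos mult_pos_pos)
 have b_le: "b <= et0" "b <= ka/16" "b <= ka*(1 - cos de)/(225*(2*K + 4))" "b <= ka'/61"
  using order_refl[of b] unfolding b_def min.bounded_iff by blast+
 define e1 where "e1 = min C (b/(M + 1))"
 have e1: "0 < e1" "e1 <= C" using C_pos b M_nonneg by (auto simp: e1_def)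
 have eta: "abs e*M <= b" if "abs e <= e1" for e proof -
  have "abs e*M <= b/(M + 1)*(M + 1)" using that M_nonneg b by (intro mult_mono) (auto simp: e1_def)
  thus ?thesis using M_nonneg by simp
 qed
 have mem: "e : {-C..C}" if "abs e <= e1" for e using that e1 by auto
 have cur: "curve f e (abs e*M)" if "abs e <= e1" for e
  by (rule curve_small[OF mem[OF that]]) (use eta[OF that] b_le ka in linarith)
 have rad: "curve.rad f e x = r e x" if "abs e <= e1" for e x
  unfolding curve.rad_def[OF cur[OF that]] r_def ..
 have outer: "outer_curve f e (abs e*M) om En K de ka et0" if "abs e <= e1" for e proof -
  interpret curve f e "abs e*M" by (rule cur[OF that])
  have n: "abs e*M <= b" by (rule eta[OF that])
  show ?thesis proof (unfold_locales, goal_cases)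
   case 6
   show ?case using n b_le(1) by linarith
  next
   case 10
   show ?case using n b_le(2) ka(1) b by linarith
  next
   case 11
   have "224*(abs e*M)*(2*K + 4) <= 224*b*(2*K + 4)" using n K by (intro mult_right_mono) auto
   also have "... < 225*b*(2*K + 4)" using b K by (intro mult_strict_right_mono) auto
   also have "... <= ka*(1 - cos de)" using b_le(3) K by (simp add: pos_le_divide_eq mult_ac)
   finally show ?case .
  next
   case 12
   show ?case using n b_le(2) by linarith
  qed (use pos K ka de gn gp in "auto simp: K_def")
 qed
 have inner: "inner_curve f e (abs e*M) En h mu (En + h) ka' de" if "abs e <= e1" for e proof -
  interpret curve f e "abs e*M" by (rule cur[OF that])
  have n: "abs e*M <= b" by (rule eta[OF that])
  have E: "En > 0" using pos zero_le_power2[of om] by linarith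
  have gap: "- cos (De/2) <= 1 - 2 * ka'" if "abs De <= 2*pi - de" for De proof -
   have "cos (pi - de/2) <= cos \<bar>De/2\<bar>" by (rule cos_monotone_0_pi_le) (use that de in auto)
   hence "- cos (de/2) <= cos (De/2)" unfolding cos_abs_real by simp
   thus ?thesis using ka'(3) by linarith
  qed
  show ?thesis proof (unfold_locales, goal_cases)
   case 7
   show ?case using n b_le(4) b by linarith
  qed (use pos E ka' de gap in auto)
 qed
 have "billiard f f1 f2 C M om En h mu K (En + h) de e1"
 proof (intro billiard.intro billiard_axioms.intro boundary_family_axioms pos de e1 K_def refl)
  fix e x u l assume e: "abs e <= e1"
  interpret O: outer_curve f e "abs e*M" om En K de ka et0 by (rule outer[OF e])
  interpret I: inner_curve f e "abs e*M" En h mu "En + h" ka' de by (rule inner[OF e])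
  have "O.rad x > 0" by (rule O.rad_pos)
  thus rp: "r e x > 0" by (simp add: rad[OF e])
  {
   assume D: "abs (u - x) <= pi - de"
   have "0 < 9/8*(1 - cos de)" using cd by simp
   thus "(r e x)^2 + (r e u)^2 < K & 0 < (r e x)^2 + (r e u)^2 + 2*(r e x*r e u*cos (u - x)) &
    (is_S_E om En f e x u l \<longleftrightarrow> l = G_E om En ((r e x)^2 + (r e u)^2) (r e x*r e u*cos (u - x)))"
    by (intro conjI O.is_S_E_iff[OF D, of l, unfolded O.R_def[OF D] O.P_def[OF D] rad[OF e]]
     O.R_less[OF D, unfolded O.R_def[OF D] rad[OF e]]
     less_le_trans[OF _ O.RP_pos[OF D, unfolded O.R_def[OF D] O.P_def[OF D] rad[OF e]]])
  next
   assume D: "abs (u - x) <= 2*pi - de"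
   show "2*(- (sqrt (r e x*r e u)*cos ((u - x)/2))) < r e x + r e u &
    (is_S_I En h mu f e x u l \<longleftrightarrow> l = G_I (En + h) mu (r e x + r e u) (- (sqrt (r e x*r e u)*cos ((u - x)/2))))"
    by (intro conjI I.is_S_I_iff[OF D, of l, unfolded I.RI_def[OF D] I.PI_def[OF D] rad[OF e]]
     I.RP_less[OF D, unfolded I.RI_def[OF D] I.PI_def[OF D] rad[OF e]])
  }
 qed
 thus ?thesis unfolding K_def by (rule that)
qed

text \<open>The explicit lengths are stationary with respect to the auxiliary root \<open>c\<close>, so that its
  derivative does not contribute.\<close>

lemma G_E_derivative:
 fixes R P :: "'z::real_normed_vector => real"
 assumes R: "(R has_derivative R') (at z)" and P: "(P has_derivative P') (at z)"
  and w: "om > 0" and K: "K = 2*En/om^2" "K > 0" and RK: "R z < K" and RP: "0 < R z + 2*P z"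
 defines "c == c_E K (R z) (P z)"
 shows "((%z. G_E om En (R z) (P z)) has_derivative (%h. om/(sqrt 2 * sqrt (1 - c^2))*(c/2*R' h - P' h))) (at z)"
proof -
 define cf where "cf z = c_E K (R z) (P z)" for z
 define s where "s = sqrt (1 - c^2)"
 have c: "-1 < c" "c < 0" using c_E_gt[OF K(2) RK RP] c_E_neg[OF K(2) RK] by (simp_all add: c_def)
 hence "abs c < 1" by linarith
 hence c1: "c^2 < 1" unfolding abs_square_less_1 .
 have s: "s > 0" "s^2 = 1 - c^2" using c1 by (simp_all add: s_def)
 have q: "0 < (P z)^2 - K*(R z - K)" proof -
  have "K*(K - R z) > 0" using K(2) RK by (intro mult_pos_pos) simp_all
  moreover have "K*(R z - K) = - (K*(K - R z))" by (simp add: algebra_simps)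
  ultimately show ?thesis using zero_le_power2[of "P z"] by linarith
 qed
 have dq: "((%z. (P z)^2 - K*(R z - K)) has_derivative (%h. 2*P z*P' h - K*R' h)) (at z)"
  by (rule has_derivative_eq_rhs, (rule derivative_intros R P)+) (auto simp: fun_eq_iff)
 have "EX c'. (cf has_derivative c') (at z)" unfolding cf_def c_E_def divide_inverse
  by (intro exI) (rule has_derivative_mult_left[OF has_derivative_diff[OF P DERIV_compose_FDERIV[OF DERIV_real_sqrt[OF q] dq]]])
 then obtain c' where c': "(cf has_derivative c') (at z)" by blast
 have d1: "((%t. 1/sqrt (1 - t^2)) has_real_derivative c/s ^ 3) (at (cf z))"
  unfolding cf_def c_def[symmetric] s_def
  using c1 s by (auto intro!: derivative_eq_intros simp: power3_eq_cube power2_eq_square field_simps)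
 have d2: "(arccos has_real_derivative - 1/s) (at (cf z))"
  using DERIV_arccos[OF c(1) less_trans[OF c(2) zero_less_one]] unfolding cf_def c_def[symmetric] s_def by (simp add: inverse_eq_divide)
 have cz: "cf z = c" by (simp add: cf_def c_def)
 have G: "G_E om En (R z) (P z) = (om/2*((R z*cf z - 2*P z)*(1/sqrt (1 - (cf z)^2))) + En/om*arccos (cf z))*inverse (sqrt 2)" for z
 proof -
  have "w*n/(2 * s) = w/2*(n*(1/s))" "E*a/w = E/w*a" for w n s E a :: real by simp_all
  thus ?thesis unfolding G_E_def Let_def K(1)[symmetric] cf_def[symmetric] divide_inverse[of _ "sqrt 2"] by (simp only:)
 qed
 have "((%z. G_E om En (R z) (P z)) has_derivative
   (%h. (om/2*((R z*cf z - 2*P z)*(c' h*(c/s ^ 3)) + (R z*c' h + R' h*cf z - 2*P' h)*(1/sqrt (1 - (cf z)^2)))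
    + En/om*(c' h*(- 1/s)))*inverse (sqrt 2))) (at z)" unfolding G
  by (intro has_derivative_mult_left has_derivative_add has_derivative_mult_right has_derivative_mult has_derivative_diff
    DERIV_compose_FDERIV[OF d1 c'] DERIV_compose_FDERIV[OF d2 c'] R P c')
 moreover have "(om/2*((R z*cf z - 2*P z)*(c' h*(c/s ^ 3)) + (R z*c' h + R' h*cf z - 2*P' h)*(1/sqrt (1 - (cf z)^2)))
    + En/om*(c' h*(- 1/s)))*inverse (sqrt 2) = om/(sqrt 2 * s)*(c/2*R' h - P' h)" for h proof -
  have root: "K*c^2 - 2*P z*c + R z - K = 0" unfolding c_def by (rule c_E_root[OF K(2) RK])
  have E: "En/om = om/2*K" using w K(1) by (simp add: field_simps power2_eq_square)
  \<comment> \<open>All terms containing \<open>c'\<close> collect to a multiple of the quadratic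
    expression of which \<open>c\<close> is a root.\<close>
  have "(R z*c - 2*P z)*(c' h*(c/s ^ 3)) + R z*c' h*(1/s) - K*(c' h*(1/s))
    = c' h/s ^ 3*((R z*c - 2*P z)*c + (R z - K) * s^2)"
   using s by (simp add: field_simps power2_eq_square power3_eq_cube)
  also have "(R z*c - 2*P z)*c + (R z - K) * s^2 = K*c^2 - 2*P z*c + R z - K"
   unfolding s(2) by (simp add: square_simps)
  finally have 0: "(R z*c - 2*P z)*(c' h*(c/s ^ 3)) + R z*c' h*(1/s) - K*(c' h*(1/s)) = 0"
   unfolding root by simp
  have "om/2*((R z*cf z - 2*P z)*(c' h*(c/s ^ 3)) + (R z*c' h + R' h*cf z - 2*P' h)*(1/sqrt (1 - (cf z)^2)))
    + En/om*(c' h*(- 1/s))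
   = om/2*((R z*c - 2*P z)*(c' h*(c/s ^ 3)) + R z*c' h*(1/s) - K*(c' h*(1/s))) + om/s*(c/2*R' h - P' h)"
   unfolding E cz s_def[symmetric] using s(1) by (simp add: field_simps)
  moreover have "(om/2*0 + om/s*X)*inverse q = om/(q * s)*X" for X q :: real by (simp add: inverse_eq_divide)
  ultimately show ?thesis unfolding 0 by (simp only:)
 qed
 ultimately show ?thesis by (simp add: s_def)
qed

lemma G_I_derivative:
 fixes R P :: "'z::real_normed_vector => real"
 assumes R: "(R has_derivative R') (at z)" and P: "(P has_derivative P') (at z)"
  and H: "H > 0" and mu: "mu > 0" and Rp: "R z > 0" and RP: "2*P z < R z"
 defines "c == c_I H mu (R z) (P z)"
 shows "((%z. G_I H mu (R z) (P z)) has_derivative (%h. sqrt H/sqrt (c^2 - 1)*(c*R' h - 2*P' h))) (at z)"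
proof -
 define cf where "cf z = c_I H mu (R z) (P z)" for z
 define s where "s = sqrt (c^2 - 1)"
 have c: "1 < c" using c_I_gt_1[OF H mu Rp RP] by (simp add: c_def)
 hence c1: "1 < c^2" by (simp add: one_less_power)
 have s: "s > 0" "s^2 = c^2 - 1" using c1 by (simp_all add: s_def)
 have q: "0 < (H*P z)^2 + mu*(mu + H*R z)"
  using H mu Rp by (intro add_nonneg_pos mult_pos_pos add_pos_pos) auto
 have dq: "((%z. (H*P z)^2 + mu*(mu + H*R z)) has_derivative (%h. 2*(H*P z)*(H*P' h) + mu*(H*R' h))) (at z)"
  by (rule has_derivative_eq_rhs, (rule derivative_intros R P)+) (auto simp: fun_eq_iff)
 have "EX c'. (cf has_derivative c') (at z)" unfolding cf_def c_I_def divide_inverse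
  by (intro exI) (rule has_derivative_mult_left[OF has_derivative_diff[OF DERIV_compose_FDERIV[OF DERIV_real_sqrt[OF q] dq] has_derivative_mult_right[OF P]]])
 then obtain c' where c': "(cf has_derivative c') (at z)" by blast
 have d1: "((%t. 1/sqrt (t^2 - 1)) has_real_derivative - c/s ^ 3) (at (cf z))"
  unfolding cf_def c_def[symmetric] s_def
  using c1 s by (auto intro!: derivative_eq_intros simp: power3_eq_cube power2_eq_square field_simps)
 have d2: "(arcosh has_real_derivative 1/s) (at (cf z))"
  unfolding cf_def c_def[symmetric] s_def by (rule arcosh_real_has_field_derivative[OF c])
 have cz: "cf z = c" by (simp add: cf_def c_def)
 have sH: "sqrt (2*H)*inverse (sqrt 2) = sqrt H" "inverse (sqrt (H/2))*inverse (sqrt 2) = inverse (sqrt H)"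
  by (simp_all add: real_sqrt_mult real_sqrt_divide field_simps)
 have G: "G_I H mu (R z) (P z) = sqrt H*((R z*cf z - 2*P z)*(1/sqrt ((cf z)^2 - 1))) + mu*inverse (sqrt H)*arcosh (cf z)" for z
 proof -
  have "G_I H mu (R z) (P z) = (sqrt (2*H)*inverse (sqrt 2))*((R z*cf z - 2*P z)*(1/sqrt ((cf z)^2 - 1)))
    + mu*(inverse (sqrt (H/2))*inverse (sqrt 2))*arcosh (cf z)" proof -
   have "(w*n/s + mu*a/y)/q = (w*inverse q)*(n*(1/s)) + mu*(inverse y*inverse q)*a" for w n s y a q :: real
    by (simp add: add_divide_distrib inverse_eq_divide)
   thus ?thesis unfolding G_I_def Let_def cf_def[symmetric] .
  qed
  thus ?thesis unfolding sH .
 qed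
 have "((%z. G_I H mu (R z) (P z)) has_derivative
   (%h. sqrt H*((R z*cf z - 2*P z)*(c' h*(- c/s ^ 3)) + (R z*c' h + R' h*cf z - 2*P' h)*(1/sqrt ((cf z)^2 - 1)))
    + mu*inverse (sqrt H)*(c' h*(1/s)))) (at z)" unfolding G
  by (intro has_derivative_add has_derivative_mult_right has_derivative_mult has_derivative_diff
    DERIV_compose_FDERIV[OF d1 c'] DERIV_compose_FDERIV[OF d2 c'] R P c')
 moreover have "sqrt H*((R z*cf z - 2*P z)*(c' h*(- c/s ^ 3)) + (R z*c' h + R' h*cf z - 2*P' h)*(1/sqrt ((cf z)^2 - 1)))
    + mu*inverse (sqrt H)*(c' h*(1/s)) = sqrt H/s*(c*R' h - 2*P' h)" for h proof -
  have root: "mu*c^2 + 2*H*P z*c - (mu + H*R z) = 0" unfolding c_def by (rule c_I_root[OF H mu Rp])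
  have E: "mu*inverse (sqrt H) = sqrt H*(mu/H)" using H real_sqrt_mult_self[of H] by (simp add: field_simps)
  have "(R z*c - 2*P z)*(c' h*(- c/s ^ 3)) + R z*c' h*(1/s) + mu/H*(c' h*(1/s))
    = c' h/s ^ 3/H*(H*(- (R z*c - 2*P z)*c + R z * s^2) + mu * s^2)"
   using s H by (simp add: field_simps power2_eq_square power3_eq_cube)
  also have "H*(- (R z*c - 2*P z)*c + R z * s^2) + mu * s^2 = mu*c^2 + 2*H*P z*c - (mu + H*R z)"
   unfolding s(2) by (simp add: square_simps)
  finally have 0: "(R z*c - 2*P z)*(c' h*(- c/s ^ 3)) + R z*c' h*(1/s) + mu/H*(c' h*(1/s)) = 0"
   unfolding root by simp
  have "sqrt H*((R z*cf z - 2*P z)*(c' h*(- c/s ^ 3)) + (R z*c' h + R' h*cf z - 2*P' h)*(1/sqrt ((cf z)^2 - 1)))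
    + mu*inverse (sqrt H)*(c' h*(1/s))
   = sqrt H*((R z*c - 2*P z)*(c' h*(- c/s ^ 3)) + R z*c' h*(1/s) + mu/H*(c' h*(1/s))) + sqrt H/s*(c*R' h - 2*P' h)"
   unfolding E cz s_def[symmetric] by (simp add: distrib_left right_diff_distrib diff_divide_distrib add_divide_distrib mult_ac)
  thus ?thesis unfolding 0 by simp
 qed
 ultimately show ?thesis by (simp add: s_def)
qed

text \<open>For the unit circle, \<open>gE\<close> and \<open>gI\<close> are the derivatives of the
  outer and inner lengths in the swept angle, that is, the action as a function of that
  angle.\<close>

definition gE :: "real => real => real => real" where
 "gE om K De = om * sin De/(sqrt 2 * sqrt (1 - (c_E K 2 (cos De))^2))"
definition gI :: "real => real => real => real" where
 "gI H mu De = - (sqrt H * sin (De/2)/sqrt ((c_I H mu 2 (- cos (De/2)))^2 - 1))"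

section \<open>Partial derivatives of the lengths\<close>

context billiard begin

lemma H_pos: "H > 0" using pos zero_le_power2[of om] unfolding H_def by linarith

lemma K_gt: "K > 2" proof -
 have "2 * om^2 < 2*En" using pos by simp
 thus ?thesis using pos by (simp add: K_def pos_less_divide_eq)
qed

definition "WE = {- e0..e0} \<times> strip (- (pi - de)) (pi - de)"
definition "WI = {- e0..e0} \<times> strip (- (2*pi - de)) (2*pi - de)"

lemma WE_iff: "(e, z) : WE \<longleftrightarrow> abs e <= e0 & abs (snd z - fst z) <= pi - de"
 by (auto simp: WE_def strip_def abs_le_iff)

lemma WI_iff: "(e, z) : WI \<longleftrightarrow> abs e <= e0 & abs (snd z - fst z) <= 2*pi - de"
 by (auto simp: WI_def strip_def abs_le_iff)

definition "RE e z = (r e (fst z))^2 + (r e (snd z))^2"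
definition "PE e z = r e (fst z)*r e (snd z)*cos (snd z - fst z)"
definition "cE e z = c_E K (RE e z) (PE e z)"
definition "sE e z = sqrt (1 - (cE e z)^2)"
text \<open>\<open>p1\<close> and \<open>p2\<close> are the partial derivatives of the outer length
  in its two angles, as \<open>q1\<close> and \<open>q2\<close> are for the inner one; derivatives
  of \<open>c_E\<close> and \<open>c_I\<close> have dropped out.\<close>

definition "p1 e z = om/(sqrt 2 * sE e z)*(cE e z*(r e (fst z)*r1 e (fst z)) -
  (r1 e (fst z)*r e (snd z)*cos (snd z - fst z) + r e (fst z)*r e (snd z) * sin (snd z - fst z)))"
definition "p2 e z = om/(sqrt 2 * sE e z)*(cE e z*(r e (snd z)*r1 e (snd z)) -
  (r e (fst z)*r1 e (snd z)*cos (snd z - fst z) - r e (fst z)*r e (snd z) * sin (snd z - fst z)))"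

definition "RI e z = r e (fst z) + r e (snd z)"
definition "sq e z = sqrt (r e (fst z)*r e (snd z))"
definition "PI e z = - (sq e z*cos ((snd z - fst z)/2))"
definition "cI e z = c_I H mu (RI e z) (PI e z)"
definition "sI e z = sqrt ((cI e z)^2 - 1)"
definition "q1 e z = sqrt H/sI e z*(cI e z*r1 e (fst z) +
  2*(r1 e (fst z)*r e (snd z)*inverse (2 * sq e z)*cos ((snd z - fst z)/2) + sq e z*(sin ((snd z - fst z)/2)/2)))"
definition "q2 e z = sqrt H/sI e z*(cI e z*r1 e (snd z) +
  2*(r e (fst z)*r1 e (snd z)*inverse (2 * sq e z)*cos ((snd z - fst z)/2) - sq e z*(sin ((snd z - fst z)/2)/2)))"

lemma S_E_eq: "(e, z) : WE ==> S_E om En f e (fst z) (snd z) = G_E om En (RE e z) (PE e z)"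
 using outer[of e "snd z" "fst z"] unfolding WE_iff S_E_def RE_def PE_def by auto

lemma S_I_eq: "(e, z) : WI ==> S_I En h mu f e (fst z) (snd z) = G_I H mu (RI e z) (PI e z)"
 using inner[of e "snd z" "fst z"] unfolding WI_iff S_I_def RI_def PI_def sq_def by auto

lemma ex1_S_E: "abs e <= e0 ==> abs (u - x) <= pi - de ==> EX! l. is_S_E om En f e x u l"
 using outer[of e u x] by auto

lemma ex1_S_I: "abs e <= e0 ==> abs (u - x) <= 2*pi - de ==> EX! l. is_S_I En h mu f e x u l"
 using inner[of e u x] by auto

lemma r_deriv: "abs e <= e0 ==> (r e has_real_derivative r1 e x) (at x)" proof -
 assume "abs e <= e0"
 hence "((%y. f y e) has_real_derivative f1 x e) (at x)" using e0 by (intro d1) auto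
 from DERIV_add[OF DERIV_const[of 1] DERIV_cmult[OF this, of e]]
 show ?thesis unfolding r_def[abs_def] r1_def by simp
qed

lemma continuous_swap:
 assumes "continuous_on (UNIV \<times> {-C..C}) (%(x, e). g x e)"
 shows "continuous_on ({-e0..e0} \<times> UNIV) (%(e, x). g x e)" proof -
 have "continuous_on ({-e0..e0} \<times> UNIV) (%p. (%(x, e). g x e) (prod.swap p))"
  by (rule continuous_on_compose2[OF assms continuous_on_swap]) (use e0 in auto)
 thus ?thesis by (simp add: case_prod_unfold)
qed

lemma C1_r:
 assumes "C1_on W F" "!!e z. (e, z) : W ==> abs e <= e0"
 shows "C1_on W (%e z. r e (F e z))"
proof (rule C1_on_compose_family[OF assms(1), where T = "{-e0..e0} \<times> UNIV" and ph' = r1])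
 show "continuous_on ({- e0..e0} \<times> UNIV) (%(e, t). r e t)" "continuous_on ({- e0..e0} \<times> UNIV) (%(e, t). r1 e t)"
  using continuous_swap[OF cont(1)] continuous_swap[OF cont(2)]
  unfolding r_def r1_def by (auto intro!: continuous_intros simp: case_prod_unfold)
next
 fix e z assume "(e, z) : W"
 from assms(2)[OF this] show "(e, F e z) : {- e0..e0} \<times> UNIV" by auto
next
 fix e t assume "(e, t :: real) : {- e0..e0} \<times> UNIV"
 thus "(r e has_real_derivative r1 e t) (at t)" by (intro r_deriv) auto
qed

lemma C1_r1:
 assumes "C1_on W F" "!!e z. (e, z) : W ==> abs e <= e0"
 shows "C1_on W (%e z. r1 e (F e z))"
proof (rule C1_on_compose_family[OF assms(1), where T = "{-e0..e0} \<times> UNIV" and ph' = "%e x. e*f2 x e"])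
 show "continuous_on ({- e0..e0} \<times> UNIV) (%(e, t). r1 e t)" "continuous_on ({- e0..e0} \<times> UNIV) (%(e, t). e*f2 t e)"
  using continuous_swap[OF cont(2)] continuous_swap[OF cont(3)]
  unfolding r1_def by (auto intro!: continuous_intros simp: case_prod_unfold)
 fix e t assume "(e, t :: real) : {- e0..e0} \<times> UNIV"
 hence "((%y. f1 y e) has_real_derivative f2 t e) (at t)" using d2[of e t] e0 by auto
 thus "(r1 e has_real_derivative e*f2 t e) (at t)" unfolding r1_def[abs_def] by (rule DERIV_cmult)
next
 fix e z assume "(e, z) : W"
 from assms(2)[OF this] show "(e, F e z) : {- e0..e0} \<times> UNIV" by auto
qed

lemma C1_fst: "C1_on W (%e. fst)" and C1_snd: "C1_on W (%e. snd)"
 by (rule C1_on_linear, rule bounded_linear_fst, rule C1_on_linear, rule bounded_linear_snd)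

lemma sE_facts:
 assumes "(e, z) : WE"
 shows "RE e z < K" "0 < RE e z + 2*PE e z" "-1 < cE e z" "cE e z < 0" "0 < 1 - (cE e z)^2" "sE e z > 0"
  "0 < (PE e z)^2 - K*(RE e z - K)" proof -
 show a: "RE e z < K" "0 < RE e z + 2*PE e z"
  using outer[of e "snd z" "fst z"] assms by (auto simp: WE_iff RE_def PE_def)
 show b: "-1 < cE e z" "cE e z < 0" unfolding cE_def using c_E_gt[OF _ a] c_E_neg[OF _ a(1)] K_gt by auto
 have "abs (cE e z) < 1" using b by linarith
 thus c: "0 < 1 - (cE e z)^2" unfolding abs_square_less_1[symmetric] by simp
 thus "sE e z > 0" by (simp add: sE_def)
 have "K*(K - RE e z) > 0" using K_gt a by (intro mult_pos_pos) simp_all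
 moreover have "K*(RE e z - K) = - (K*(K - RE e z))" by (simp add: algebra_simps)
 ultimately show "0 < (PE e z)^2 - K*(RE e z - K)" using zero_le_power2[of "PE e z"] by linarith
qed

lemma sI_facts:
 assumes "(e, z) : WI"
 shows "RI e z > 0" "2*PI e z < RI e z" "1 < cI e z" "0 < (cI e z)^2 - 1" "sI e z > 0" "sq e z > 0"
  "0 < r e (fst z)*r e (snd z)" "0 < (H*PI e z)^2 + mu*(mu + H*RI e z)" proof -
 have e: "abs e <= e0" using assms by (simp add: WI_iff)
 show a: "RI e z > 0" using r_pos[OF e] by (simp add: RI_def add_pos_pos)
 show b: "2*PI e z < RI e z" using inner[of e "snd z" "fst z"] assms by (auto simp: WI_iff RI_def PI_def sq_def)
 show c: "1 < cI e z" unfolding cI_def by (rule c_I_gt_1[OF H_pos pos(4) a b])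
 thus d: "0 < (cI e z)^2 - 1" by (simp add: one_less_power)
 thus "sI e z > 0" by (simp add: sI_def)
 show "0 < r e (fst z)*r e (snd z)" using r_pos[OF e] by simp
 thus "sq e z > 0" by (simp add: sq_def)
 show "0 < (H*PI e z)^2 + mu*(mu + H*RI e z)"
  using H_pos pos a by (intro add_nonneg_pos mult_pos_pos add_pos_pos) auto
qed

lemma C1_cE: "C1_on WE cE" and C1_sE: "C1_on WE sE" proof -
 have e: "(e, z) : WE ==> abs e <= e0" for e z by (simp add: WE_iff)
 note C = C1_on_add C1_on_diff C1_on_mult C1_on_const C1_on_cos C1_fst C1_snd C1_r[OF _ e]
 have R: "C1_on WE RE" unfolding RE_def[abs_def] power2_eq_square by (intro C)
 have P: "C1_on WE PE" unfolding PE_def[abs_def] by (intro C)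
 have "C1_on WE (%e z. PE e z*PE e z - K*(RE e z - K))" by (intro C R P)
 hence "C1_on WE (%e z. sqrt (PE e z*PE e z - K*(RE e z - K)))"
  by (rule C1_on_sqrt) (use sE_facts(7) in "simp add: power2_eq_square")
 hence "C1_on WE (%e z. (PE e z - sqrt (PE e z*PE e z - K*(RE e z - K)))*inverse K)" by (intro C P)
 thus c: "C1_on WE cE" unfolding cE_def[abs_def] c_E_def divide_inverse power2_eq_square .
 have "C1_on WE (%e z. 1 - cE e z*cE e z)" by (intro C c)
 thus "C1_on WE sE" unfolding sE_def[abs_def] power2_eq_square
  by (rule C1_on_sqrt) (use sE_facts(5) in "simp add: power2_eq_square")
qed

text \<open>The formulas contain \<open>r1\<close>, so this is where the second angular derivative
  of the boundary enters.\<close>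

lemma C1_p1: "C1_on WE p1" and C1_p2: "C1_on WE p2" proof -
 have e: "(e, z) : WE ==> abs e <= e0" for e z by (simp add: WE_iff)
 have nz: "sqrt 2 * sE e z ~= 0" if "(e, z) : WE" for e z using sE_facts(6)[OF that] by simp
 note C = C1_on_add C1_on_diff C1_on_mult C1_on_const C1_on_cos C1_on_sin C1_fst C1_snd C1_r[OF _ e] C1_r1[OF _ e] C1_cE C1_sE
 have "C1_on WE (%e z. sqrt 2 * sE e z)" by (intro C)
 hence D: "C1_on WE (%e z. om/(sqrt 2 * sE e z))" by (rule C1_on_divide[OF C1_on_const _ nz])
 show "C1_on WE p1" unfolding p1_def[abs_def] by (rule C1_on_mult[OF D]) (intro C)
 show "C1_on WE p2" unfolding p2_def[abs_def] by (rule C1_on_mult[OF D]) (intro C)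
qed

lemma C1_cI: "C1_on WI cI" and C1_sI: "C1_on WI sI" and C1_sq: "C1_on WI sq" proof -
 have e: "(e, z) : WI ==> abs e <= e0" for e z by (simp add: WI_iff)
 note C = C1_on_add C1_on_diff C1_on_minus C1_on_mult C1_on_const C1_on_cos C1_fst C1_snd C1_r[OF _ e]
 have "C1_on WI (%e z. r e (fst z)*r e (snd z))" by (intro C)
 thus sq: "C1_on WI sq" unfolding sq_def[abs_def] by (rule C1_on_sqrt) (rule sI_facts(7))
 have R: "C1_on WI RI" unfolding RI_def[abs_def] by (intro C)
 have P: "C1_on WI PI" unfolding PI_def[abs_def] divide_inverse by (intro C sq)
 have "C1_on WI (%e z. H*PI e z*(H*PI e z) + mu*(mu + H*RI e z))" by (intro C R P)
 hence "C1_on WI (%e z. sqrt (H*PI e z*(H*PI e z) + mu*(mu + H*RI e z)))"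
  by (rule C1_on_sqrt) (use sI_facts(8) in "simp add: power2_eq_square")
 hence "C1_on WI (%e z. (sqrt (H*PI e z*(H*PI e z) + mu*(mu + H*RI e z)) - H*PI e z)*inverse mu)"
  by (intro C P)
 thus c: "C1_on WI cI" unfolding cI_def[abs_def] c_I_def divide_inverse power2_eq_square .
 have "C1_on WI (%e z. cI e z*cI e z - 1)" by (intro C c)
 thus "C1_on WI sI" unfolding sI_def[abs_def] power2_eq_square
  by (rule C1_on_sqrt) (use sI_facts(4) in "simp add: power2_eq_square")
qed

lemma C1_q1: "C1_on WI q1" and C1_q2: "C1_on WI q2" proof -
 have e: "(e, z) : WI ==> abs e <= e0" for e z by (simp add: WI_iff)
 have nz: "sI e z ~= 0" "2 * sq e z ~= 0" if "(e, z) : WI" for e z using sI_facts[OF that] by simp_all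
 note C = C1_on_add C1_on_diff C1_on_mult C1_on_const C1_on_cos C1_on_sin C1_fst C1_snd C1_r[OF _ e] C1_r1[OF _ e] C1_cI C1_sI C1_sq
 have D: "C1_on WI (%e z. inverse (sI e z))" by (rule C1_on_inverse[OF C1_sI nz(1)])
 have "C1_on WI (%e z. 2 * sq e z)" by (intro C)
 hence D': "C1_on WI (%e z. inverse (2 * sq e z))" by (rule C1_on_inverse[OF _ nz(2)])
 show "C1_on WI q1" unfolding q1_def[abs_def] divide_inverse by (intro C D D')
 show "C1_on WI q2" unfolding q2_def[abs_def] divide_inverse by (intro C D D')
qed

lemma r_fst_deriv: "abs e <= e0 ==> ((%z. r e (fst z)) has_derivative (%h. fst h*r1 e (fst z))) (at z)"
 by (rule DERIV_compose_FDERIV[OF r_deriv]) (auto intro!: has_derivative_fst has_derivative_snd)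

lemma r_snd_deriv: "abs e <= e0 ==> ((%z. r e (snd z)) has_derivative (%h. snd h*r1 e (snd z))) (at z)"
 by (rule DERIV_compose_FDERIV[OF r_deriv]) (auto intro!: has_derivative_fst has_derivative_snd)

lemma S_E_deriv:
 assumes z: "(e, z) : WE"
 shows "((%z. G_E om En (RE e z) (PE e z)) has_derivative (%h. p1 e z*fst h + p2 e z * snd h)) (at z)" proof -
 have e: "abs e <= e0" using z by (simp add: WE_iff)
 note r = r_fst_deriv[OF e, of z] r_snd_deriv[OF e, of z]
 have R: "(RE e has_derivative (%h. 2*(r e (fst z)*r1 e (fst z))*fst h + 2*(r e (snd z)*r1 e (snd z)) * snd h)) (at z)"
  unfolding RE_def[abs_def]
  by (rule has_derivative_eq_rhs, (rule derivative_intros r)+) (auto simp: fun_eq_iff)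
 have c: "((%z. cos (snd z - fst z)) has_derivative (%h. (snd h - fst h) * - sin (snd z - fst z))) (at z)"
  by (rule DERIV_compose_FDERIV[OF DERIV_cos]) (intro bounded_linear_imp_has_derivative bounded_linear_intros)
 have P: "(PE e has_derivative (%h. (r1 e (fst z)*r e (snd z)*cos (snd z - fst z) + r e (fst z)*r e (snd z) * sin (snd z - fst z))*fst h
   + (r e (fst z)*r1 e (snd z)*cos (snd z - fst z) - r e (fst z)*r e (snd z) * sin (snd z - fst z)) * snd h)) (at z)"
  unfolding PE_def[abs_def]
  by (rule has_derivative_eq_rhs[OF has_derivative_mult[OF has_derivative_mult[OF r] c]]) (auto simp: fun_eq_iff algebra_simps)
 have K0: "K > 0" using K_gt by simp
 show ?thesis by (rule has_derivative_eq_rhs[OF G_E_derivative[OF R P pos(1) K_def K0 sE_facts(1,2)[OF z]]])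
   (simp add: fun_eq_iff p1_def p2_def cE_def sE_def algebra_simps)
qed

lemma S_I_deriv:
 assumes z: "(e, z) : WI"
 shows "((%z. G_I H mu (RI e z) (PI e z)) has_derivative (%h. q1 e z*fst h + q2 e z * snd h)) (at z)" proof -
 have e: "abs e <= e0" using z by (simp add: WI_iff)
 note r = r_fst_deriv[OF e, of z] r_snd_deriv[OF e, of z]
 have R: "(RI e has_derivative (%h. r1 e (fst z)*fst h + r1 e (snd z) * snd h)) (at z)"
  unfolding RI_def[abs_def] by (rule has_derivative_eq_rhs[OF has_derivative_add[OF r]]) (simp add: fun_eq_iff)
 have c: "((%z. cos ((snd z - fst z)/2)) has_derivative (%h. (snd h - fst h)/2 * - sin ((snd z - fst z)/2))) (at z)"
  by (rule DERIV_compose_FDERIV[OF DERIV_cos], rule bounded_linear_imp_has_derivative,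
    rule bounded_linear_compose[OF bounded_linear_divide bounded_linear_sub[OF bounded_linear_snd bounded_linear_fst]])
 have s: "(sq e has_derivative (%h. (r e (fst z)*(snd h*r1 e (snd z)) + fst h*r1 e (fst z)*r e (snd z))*(inverse (sq e z)/2))) (at z)"
  unfolding sq_def[abs_def]
  by (rule DERIV_compose_FDERIV[OF DERIV_real_sqrt[OF sI_facts(7)[OF z]] has_derivative_mult[OF r]])
 have P: "(PI e has_derivative (%h. - (r1 e (fst z)*r e (snd z)*inverse (2 * sq e z)*cos ((snd z - fst z)/2) + sq e z*(sin ((snd z - fst z)/2)/2))*fst h
   - (r e (fst z)*r1 e (snd z)*inverse (2 * sq e z)*cos ((snd z - fst z)/2) - sq e z*(sin ((snd z - fst z)/2)/2)) * snd h)) (at z)"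
  unfolding PI_def[abs_def]
 proof (rule has_derivative_eq_rhs[OF has_derivative_minus[OF has_derivative_mult[OF s c]]])
  have "- (S*((b - a)/2 * - sn) + (rx*(b*u') + a*x'*ru)*(i/2)*c)
    = - (x'*ru*(i/2)*c + S*(sn/2))*a - (rx*u'*(i/2)*c - S*(sn/2))*b"
   for S a b sn rx u' x' ru i c :: real by (simp add: field_simps)
  moreover have "inverse (2 * sq e z) = inverse (sq e z)/2" by simp
  ultimately show "(%h. - (sq e z*((snd h - fst h)/2 * - sin ((snd z - fst z)/2))
    + (r e (fst z)*(snd h*r1 e (snd z)) + fst h*r1 e (fst z)*r e (snd z))*(inverse (sq e z)/2)*cos ((snd z - fst z)/2)))
   = (%h. - (r1 e (fst z)*r e (snd z)*inverse (2 * sq e z)*cos ((snd z - fst z)/2) + sq e z*(sin ((snd z - fst z)/2)/2))*fst h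
   - (r e (fst z)*r1 e (snd z)*inverse (2 * sq e z)*cos ((snd z - fst z)/2) - sq e z*(sin ((snd z - fst z)/2)/2)) * snd h)"
   by (simp only:)
 qed
 show ?thesis by (rule has_derivative_eq_rhs[OF G_I_derivative[OF R P H_pos pos(4) sI_facts(1,2)[OF z]]])
   (simp add: fun_eq_iff q1_def q2_def cI_def sI_def algebra_simps)
qed

lemma r_per: "abs e <= e0 ==> r e (x + 2*pi) = r e x" "abs e <= e0 ==> r1 e (x + 2*pi) = r1 e x" proof -
 assume "abs e <= e0"
 hence "e : {-C..C}" using e0 by auto
 thus "r e (x + 2*pi) = r e x" "r1 e (x + 2*pi) = r1 e x" by (simp_all add: r_def r1_def per)
qed

lemma pq_per:
 assumes "abs e <= e0"
 shows "p1 e (x + 2*pi, u + 2*pi) = p1 e (x, u)" "p2 e (x + 2*pi, u + 2*pi) = p2 e (x, u)"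
  "q1 e (x + 2*pi, u + 2*pi) = q1 e (x, u)" "q2 e (x + 2*pi, u + 2*pi) = q2 e (x, u)"
  "G_E om En (RE e (x + 2*pi, u + 2*pi)) (PE e (x + 2*pi, u + 2*pi)) = G_E om En (RE e (x, u)) (PE e (x, u))"
  "G_I H mu (RI e (x + 2*pi, u + 2*pi)) (PI e (x + 2*pi, u + 2*pi)) = G_I H mu (RI e (x, u)) (PI e (x, u))"
 by (simp_all add: p1_def p2_def q1_def q2_def cE_def sE_def cI_def sI_def RE_def PE_def RI_def PI_def sq_def r_per[OF assms])

lemma unperturbed: "p1 0 z = - gE om K (snd z - fst z)" "p2 0 z = gE om K (snd z - fst z)"
 "q1 0 z = - gI H mu (snd z - fst z)" "q2 0 z = gI H mu (snd z - fst z)"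
 by (simp_all add: p1_def p2_def q1_def q2_def cE_def sE_def cI_def sI_def RE_def PE_def RI_def PI_def sq_def
   r_def r1_def gE_def gI_def)

end

text \<open>Made for \<open>phi_E\<close> and \<open>phi_I\<close> as inverses of \<open>gE\<close>
  and \<open>gI\<close>: their defining formulas are glued with a sign at \<open>I = 0\<close>,
  where differentiating them directly would be awkward.\<close>

lemma inverse_branch_deriv:
 fixes g ph :: "real => real"
 assumes g: "!!t. abs t < L ==> (g has_real_derivative g' t) (at t)" "!!t. abs t < L ==> g' t ~= 0"
  and ph: "!!I. abs I < A ==> abs (ph I) < L & g (ph I) = I" and I: "abs I < A"
 shows "(ph has_real_derivative 1/g' (ph I)) (at I)" proof -
 have inj: "s = t" if "abs s < L" "abs t < L" "g s = g t" for s t proof (rule ccontr)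
  have aux: False if st: "s < t" "abs s < L" "abs t < L" "g s = g t" for s t proof -
   have "!!x. s <= x ==> x <= t ==> (g has_real_derivative g' x) (at x)" using st by (intro g(1)) auto
   from MVT2[OF st(1) this] obtain z where "s < z" "z < t" "g t - g s = (t - s)*g' z" by blast
   thus False using st g(2)[of z] by auto
  qed
  assume "s ~= t"
  thus False using aux[of s t] aux[of t s] that by (cases "s < t") auto
 qed
 define t where "t = ph I"
 have t: "abs t < L" "g t = I" using ph[OF I] by (simp_all add: t_def)
 have "isCont g t" using g(1)[OF t(1)] by (rule DERIV_isCont)
 hence "(g \<longlongrightarrow> g t) (nhds t)" unfolding isCont_def tendsto_at_iff_tendsto_nhds .
 hence "\<forall>\<^sub>F s in nhds t. abs (g s) < A"
  by (rule order_tendstoD(2)[OF tendsto_rabs]) (use I t in simp)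
 moreover have "\<forall>\<^sub>F s in nhds t. abs s < L"
  by (rule order_tendstoD(2)[OF tendsto_rabs[OF filterlim_ident]]) (use t in simp)
 ultimately have "\<forall>\<^sub>F s in nhds t. abs s < L & abs (g s) < A" by eventually_elim simp
 then obtain d where d: "d > 0" "!!s. dist s t < d ==> abs s < L & abs (g s) < A"
  unfolding eventually_nhds_metric by blast
 have "isCont ph (g t)" proof (rule isCont_inverse_function[where d = "d/2" and x = t and f = g and g = ph])
  fix z assume "abs (z - t) <= d/2"
  hence z: "abs z < L" "abs (g z) < A" using d by (auto simp: dist_real_def)
  show "ph (g z) = z" by (rule inj) (use ph[OF z(2)] z in auto)
  show "isCont g z" using g(1)[OF z(1)] by (rule DERIV_isCont)
 qed (use d in simp)
 hence c: "isCont ph I" using t by simp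
 have "(ph has_real_derivative inverse (g' (ph I))) (at I)"
 proof (rule DERIV_inverse_function[where f = g and a = "-A" and b = A])
  show "(g has_real_derivative g' (ph I)) (at (ph I))" using g(1) t by (simp add: t_def)
  show "g' (ph I) ~= 0" using g(2) t by (simp add: t_def)
  fix y assume "- A < y" "y < A"
  thus "g (ph y) = y" using ph[of y] by (simp add: abs_less_iff)
 qed (use I c in "auto simp: abs_less_iff")
 thus ?thesis by (simp add: inverse_eq_divide)
qed

section \<open>The unperturbed shift and its critical points\<close>

context
 fixes om En h mu K H :: real
 assumes pos: "om > 0" "En > om^2" "h > 0" "mu > 0" and K_def: "K = 2*En/om^2" and H_def: "H = En + h"
begin

lemma K_gt: "K > 2" and H_pos: "H > 0" proof -
 have "2 * om^2 < 2*En" using pos by simp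
 thus "K > 2" using pos by (simp add: K_def pos_less_divide_eq)
 show "H > 0" using pos zero_le_power2[of om] unfolding H_def by linarith
qed

definition "cE0 De = c_E K 2 (cos De)"
definition "SE0 De = sqrt ((cos De)^2 - K*(2 - K))"
definition "gE' De = om*(cos De - cE0 De)^2/(sqrt 2*SE0 De*(sqrt (1 - (cE0 De)^2)) ^ 3)"

lemma cE0_facts:
 assumes "abs De < pi"
 shows "-1 < cE0 De" "cE0 De < 0" "0 < 1 - (cE0 De)^2" "SE0 De > 0" "SE0 De = cos De - K*cE0 De" "cos De - cE0 De > 0"
  "K*(1 - (cE0 De)^2) = 2 - 2*cos De*cE0 De" proof -
 have K0: "K > 0" and R: "2 < K" using K_gt by simp_all
 have x: "-1 < cos De" proof -
  have "cos pi < cos \<bar>De\<bar>" by (rule cos_monotone_0_pi) (use assms in auto)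
  thus ?thesis by (simp add: cos_abs_real)
 qed
 hence RP: "0 < 2 + 2*cos De" by simp
 show a: "-1 < cE0 De" "cE0 De < 0" unfolding cE0_def by (rule c_E_gt[OF K0 R RP], rule c_E_neg[OF K0 R])
 hence "abs (cE0 De) < 1" by linarith
 thus "0 < 1 - (cE0 De)^2" unfolding abs_square_less_1[symmetric] by simp
 have "abs (cos De) < SE0 De" unfolding SE0_def by (rule c_E_disc[OF K0 R])
 thus "SE0 De > 0" by linarith
 show "SE0 De = cos De - K*cE0 De" using K0 by (simp add: cE0_def c_E_def SE0_def)
 have root: "K*(cE0 De)^2 - 2*cos De*cE0 De + 2 - K = 0" unfolding cE0_def by (rule c_E_root[OF K0 R])
 thus "K*(1 - (cE0 De)^2) = 2 - 2*cos De*cE0 De" by (simp add: algebra_simps)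
 show "cos De - cE0 De > 0" proof (rule ccontr)
  assume "~ ?thesis"
  hence le: "cos De <= cE0 De" by simp
  hence "cE0 De*cE0 De <= cos De*cE0 De" using a by (intro mult_right_mono_neg) auto
  hence "2 - 2*cos De*cE0 De <= 2*(1 - (cE0 De)^2)" by (simp add: power2_eq_square)
  moreover have "2*(1 - (cE0 De)^2) < K*(1 - (cE0 De)^2)"
   using K_gt \<open>0 < 1 - (cE0 De)^2\<close> by (intro mult_strict_right_mono)
  ultimately show False using root by (simp add: algebra_simps)
 qed
qed

text \<open>Over the common denominator the numerator collapses, by the quadratic equation for
  \<open>c\<close>, to the square \<open>(x - c)^2\<close>, which gives the sign.\<close>

lemma gE_deriv:
 assumes D: "abs De < pi"
 shows "(gE om K has_real_derivative gE' De) (at De)" "gE' De > 0" proof -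
 note f = cE0_facts[OF D]
 define x c S s where "x = cos De" and "c = cE0 De" and "S = SE0 De" and "s = sqrt (1 - c^2)"
 have s: "s > 0" "s^2 = 1 - c^2" using f(3) by (simp_all add: s_def c_def)
 have S: "S > 0" "S = x - K*c" using f by (simp_all add: S_def x_def c_def)
 have K0: "K ~= 0" using K_gt by simp
 have "0 < (cos De)^2 - K*(2 - K)" using f(4) by (simp add: SE0_def)
 hence dS: "((%t. sqrt ((cos t)^2 - K*(2 - K))) has_real_derivative (2*x * - sin De)*(inverse S/2)) (at De)"
  unfolding S_def SE0_def x_def
  by (auto intro!: derivative_eq_intros DERIV_real_sqrt[THEN DERIV_chain2, THEN DERIV_cong])
 have "(cE0 has_real_derivative (- sin De - (2*x * - sin De)*(inverse S/2))/K) (at De)"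
  unfolding cE0_def[abs_def] c_E_def by (intro DERIV_cdivide DERIV_diff DERIV_cos dS)
 moreover have "(- sin De - (2*x * - sin De)*(inverse S/2))/K = c * sin De/S" proof -
  have "(x - S)/K = c" unfolding S(2) using K0 by simp
  moreover have "(- sin De - (2*x * - sin De)*(inverse S/2))/K = (x - S)/K * sin De/S"
   using S(1) K0 by (simp add: field_simps)
  ultimately show ?thesis by (simp only:)
 qed
 ultimately have dc: "(cE0 has_real_derivative c * sin De/S) (at De)" by simp
 have d1: "((%t. 1/sqrt (1 - t^2)) has_real_derivative c/s ^ 3) (at (cE0 De))"
  unfolding c_def[symmetric] s_def using f(3)
  by (auto intro!: derivative_eq_intros simp: c_def power3_eq_cube power2_eq_square field_simps)
 have "((%t. om/sqrt 2*(sin t*(1/sqrt (1 - (cE0 t)^2)))) has_real_derivative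
   om/sqrt 2*(cos De*(1/sqrt (1 - (cE0 De)^2)) + (c/s ^ 3*(c * sin De/S)) * sin De)) (at De)"
  by (intro DERIV_cmult DERIV_mult DERIV_sin DERIV_chain2[OF d1 dc])
 moreover have "(%t. om/sqrt 2*(sin t*(1/sqrt (1 - (cE0 t)^2)))) = gE om K"
  by (simp add: fun_eq_iff gE_def cE0_def)
 moreover have "om/sqrt 2*(cos De*(1/sqrt (1 - (cE0 De)^2)) + (c/s ^ 3*(c * sin De/S)) * sin De) = gE' De"
 proof -
  have sn: "(sin De)^2 = 1 - x^2" by (simp add: x_def sin_squared_eq)
  have "x*(1/s) + (c/s ^ 3*(c * sin De/S)) * sin De = (x * s^2*S + c^2*(sin De)^2)/(S * s ^ 3)"
   using s(1) S(1) by (simp add: field_simps power2_eq_square power3_eq_cube)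
  also have "x * s^2*S + c^2*(sin De)^2 = x^2 * s^2 - x*c*(K * s^2) + c^2*(1 - x^2)"
   unfolding sn S(2) by (simp add: square_simps)
  also have "K * s^2 = 2 - 2*x*c" using f(7) unfolding s(2) by (simp add: c_def x_def)
  also have "x^2 * s^2 - x*c*(2 - 2*x*c) + c^2*(1 - x^2) = (x - c)^2"
   unfolding s(2) by (simp add: square_simps)
  finally show ?thesis unfolding gE'_def c_def[symmetric] x_def[symmetric] S_def[symmetric] s_def[symmetric] by (simp add: mult_ac)
 qed
 ultimately show "(gE om K has_real_derivative gE' De) (at De)" by simp
 show "gE' De > 0" unfolding gE'_def using pos f by (intro divide_pos_pos mult_pos_pos zero_less_power) auto
qed

lemma gE'_continuous: "continuous_on {- pi<..<pi} gE'" proof -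
 have S: "continuous_on {- pi<..<pi} SE0" unfolding SE0_def by (intro continuous_intros)
 have c: "continuous_on {- pi<..<pi} cE0" unfolding cE0_def c_E_def using K_gt by (intro continuous_intros) auto
 show ?thesis unfolding gE'_def proof (intro continuous_intros c S ballI)
  fix De assume "De : {- pi<..<pi}"
  hence "abs De < pi" by auto
  from cE0_facts[OF this] show "sqrt 2*SE0 De * sqrt (1 - (cE0 De)^2) ^ 3 ~= 0" by simp
 qed
qed

definition "cI0 De = c_I H mu 2 (- cos (De/2))"
definition "SI0 De = sqrt ((H * - cos (De/2))^2 + mu*(mu + H*2))"
definition "gI' De = - (sqrt H*(H*(cos (De/2) + cI0 De)^2)/(2*SI0 De*(sqrt ((cI0 De)^2 - 1)) ^ 3))"

lemma cI0_facts:
 assumes "abs De < 2*pi"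
 shows "1 < cI0 De" "0 < (cI0 De)^2 - 1" "SI0 De > 0" "SI0 De = mu*cI0 De - H*cos (De/2)" "cos (De/2) + cI0 De > 0"
  "mu*((cI0 De)^2 - 1) = 2*H*(1 + cos (De/2)*cI0 De)" proof -
 have x: "-1 < cos (De/2)" proof -
  have "cos pi < cos \<bar>De/2\<bar>" by (rule cos_monotone_0_pi) (use assms in auto)
  thus ?thesis by (simp only: cos_abs_real cos_pi)
 qed
 have two: "(0::real) < 2" by simp
 show a: "1 < cI0 De" unfolding cI0_def by (rule c_I_gt_1[OF H_pos pos(4) two]) (use x in simp)
 thus "0 < (cI0 De)^2 - 1" by (simp add: one_less_power)
 have "abs (H * - cos (De/2)) < SI0 De" unfolding SI0_def by (rule c_I_disc[OF H_pos pos(4) two])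
 thus "SI0 De > 0" by linarith
 show "SI0 De = mu*cI0 De - H*cos (De/2)" using pos by (simp add: cI0_def c_I_def SI0_def)
 have "mu*(cI0 De)^2 + 2*H*(- cos (De/2))*cI0 De - (mu + H*2) = 0"
  unfolding cI0_def by (rule c_I_root[OF H_pos pos(4) two])
 thus "mu*((cI0 De)^2 - 1) = 2*H*(1 + cos (De/2)*cI0 De)" by (simp add: algebra_simps)
 show "cos (De/2) + cI0 De > 0" using a x by simp
qed

text \<open>The same collapse, now to \<open>H*(y + c)^2\<close> with a negative sign in front.
  Outer and inner arcs thus contribute to the derivative of the shift with opposite signs, which is
  how critical values can arise.\<close>

lemma gI_deriv:
 assumes D: "abs De < 2*pi"
 shows "(gI H mu has_real_derivative gI' De) (at De)" "gI' De < 0" proof -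
 note f = cI0_facts[OF D]
 define y c S s where "y = cos (De/2)" and "c = cI0 De" and "S = SI0 De" and "s = sqrt (c^2 - 1)"
 have s: "s > 0" "s^2 = c^2 - 1" using f(2) by (simp_all add: s_def c_def)
 have S: "S > 0" "S = mu*c - H*y" using f by (simp_all add: S_def y_def c_def)
 have m0: "mu ~= 0" using pos by simp
 have "0 < (H * - cos (De/2))^2 + mu*(mu + H*2)" using f(3) by (simp add: SI0_def)
 hence dS: "((%t. sqrt ((H * - cos (t/2))^2 + mu*(mu + H*2))) has_real_derivative
   (inverse S/2)*(2*(H * - y)*(H*(sin (De/2)/2)))) (at De)" unfolding S_def SI0_def y_def
  by (intro DERIV_chain2[where f = sqrt, OF DERIV_real_sqrt]) (auto intro!: derivative_eq_intros)
 have dHy: "((%t. H * - cos (t/2)) has_real_derivative H*(sin (De/2)/2)) (at De)" by (auto intro!: derivative_eq_intros)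
 have "(cI0 has_real_derivative ((inverse S/2)*(2*(H * - y)*(H*(sin (De/2)/2))) - H*(sin (De/2)/2))/mu) (at De)"
  unfolding cI0_def[abs_def] c_I_def by (intro DERIV_cdivide DERIV_diff dHy dS)
 moreover have "((inverse S/2)*(2*(H * - y)*(H*(sin (De/2)/2))) - H*(sin (De/2)/2))/mu = - (H * sin (De/2)*c/(2*S))"
 proof -
  have m: "mu*c = S + H*y" using S by simp
  have "((inverse S/2)*(2*(H * - y)*(H*(sin (De/2)/2))) - H*(sin (De/2)/2))/mu = - (H * sin (De/2)*((S + H*y)/mu)/(2*S))"
   using S(1) m0 by (simp add: field_simps)
  thus ?thesis using m0 unfolding m[symmetric] by simp
 qed
 ultimately have dc: "(cI0 has_real_derivative - (H * sin (De/2)*c/(2*S))) (at De)" by simp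
 have d1: "((%t. 1/sqrt (t^2 - 1)) has_real_derivative - c/s ^ 3) (at (cI0 De))"
  unfolding c_def[symmetric] s_def using f(2)
  by (auto intro!: derivative_eq_intros simp: c_def power3_eq_cube power2_eq_square field_simps)
 have ds: "((%t. sin (t/2)) has_real_derivative cos (De/2)/2) (at De)" by (auto intro!: derivative_eq_intros)
 have "((%t. - sqrt H*(sin (t/2)*(1/sqrt ((cI0 t)^2 - 1)))) has_real_derivative
   - sqrt H*(cos (De/2)/2*(1/sqrt ((cI0 De)^2 - 1)) + (- c/s ^ 3 * - (H * sin (De/2)*c/(2*S))) * sin (De/2))) (at De)"
  by (intro DERIV_cmult DERIV_mult ds DERIV_chain2[OF d1 dc])
 moreover have "(%t. - sqrt H*(sin (t/2)*(1/sqrt ((cI0 t)^2 - 1)))) = gI H mu"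
  by (simp add: fun_eq_iff gI_def cI0_def)
 moreover have "- sqrt H*(cos (De/2)/2*(1/sqrt ((cI0 De)^2 - 1)) + (- c/s ^ 3 * - (H * sin (De/2)*c/(2*S))) * sin (De/2)) = gI' De"
 proof -
  have sn: "(sin (De/2))^2 = 1 - y^2" by (simp add: y_def sin_squared_eq)
  have "y/2*(1/s) + (- c/s ^ 3 * - (H * sin (De/2)*c/(2*S))) * sin (De/2)
    = (y * s^2*S + H*c^2*(sin (De/2))^2)/(2*S * s ^ 3)"
   using s(1) S(1) by (simp add: field_simps power2_eq_square power3_eq_cube)
  also have "y * s^2*S + H*c^2*(sin (De/2))^2 = y*c*(mu * s^2) - H*y^2 * s^2 + H*c^2*(1 - y^2)"
   unfolding sn S(2) by (simp add: square_simps)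
  also have "mu * s^2 = 2*H*(1 + y*c)" using f(6) unfolding s(2) by (simp add: c_def y_def)
  also have "y*c*(2*H*(1 + y*c)) - H*y^2 * s^2 + H*c^2*(1 - y^2) = H*(y + c)^2"
   unfolding s(2) by (simp add: square_simps)
  finally show ?thesis unfolding gI'_def c_def[symmetric] y_def[symmetric] S_def[symmetric] s_def[symmetric] by simp
 qed
 ultimately show "(gI H mu has_real_derivative gI' De) (at De)" by simp
 have "0 < sqrt H*(H*(cos (De/2) + cI0 De)^2)/(2*SI0 De*(sqrt ((cI0 De)^2 - 1)) ^ 3)"
  using H_pos f by (intro divide_pos_pos mult_pos_pos zero_less_power) auto
 thus "gI' De < 0" by (simp add: gI'_def)
qed

lemma gI'_continuous: "continuous_on {- (2*pi)<..<2*pi} gI'" proof -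
 have S: "continuous_on {- (2*pi)<..<2*pi} SI0" unfolding SI0_def by (intro continuous_intros) auto
 have c: "continuous_on {- (2*pi)<..<2*pi} cI0" unfolding cI0_def c_I_def using pos by (intro continuous_intros) auto
 show ?thesis unfolding gI'_def proof (intro continuous_intros c S ballI)
  fix De assume "De : {- (2*pi)<..<2*pi}"
  hence "abs De < 2*pi" by auto
  note f = cI0_facts[OF this]
  have "0 < 2*SI0 De * sqrt ((cI0 De)^2 - 1) ^ 3"
   using f(2,3) by (intro mult_pos_pos zero_less_power) (simp_all only: real_sqrt_gt_0_iff zero_less_numeral)
  thus "2*SI0 De * sqrt ((cI0 De)^2 - 1) ^ 3 ~= 0" by linarith
 qed simp
qed

lemma I_crit_sq: "abs I < I_crit om En ==> I^2 < En - om^2/2" proof -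
 assume I: "abs I < I_crit om En"
 have p: "0 <= En - om^2/2" using pos zero_le_power2[of om] by linarith
 have "abs I^2 < (I_crit om En)^2" using I by (intro power_strict_mono) auto
 thus ?thesis using p by (simp add: I_crit_def)
qed

lemma arccot_cot:
 assumes "0 < t" "t < pi"
 shows "arccot (cot t) = t" unfolding arccot_def proof (rule the_equality)
 fix x assume x: "0 < x & x < pi & cot x = cot t"
 have "sin x > 0" "sin t > 0" using x assms by (auto intro: sin_gt_zero)
 hence "sin (x - t) = 0" using x unfolding cot_def sin_diff by (simp add: field_simps)
 hence z: "sin (x - t) = 0" "sin (t - x) = 0" using sin_minus[of "x - t"] by simp_all
 show "x = t" proof (cases x t rule: linorder_cases)
  case less
  hence "sin (t - x) > 0" using x assms by (intro sin_gt_zero) auto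
  thus ?thesis using z by simp
 next
  case greater
  hence "sin (x - t) > 0" using x assms by (intro sin_gt_zero) auto
  thus ?thesis using z by simp
 qed
qed (use assms in auto)

text \<open>Verifies that the arccotangent formula inverts \<open>gE\<close>. Dividing by
  \<open>Q\<close> turns numerator and denominator of the cotangent into a cosine and a sine, and
  \<open>c = (om^2 - En)/Q\<close> is the negative root belonging to that cosine.\<close>

lemma phi_E_pos:
 assumes I: "0 < I" "I < I_crit om En"
 shows "0 < phi_E om En I" "phi_E om En I < pi" "gE om K (phi_E om En I) = I" proof -
 have I2: "I^2 < En - om^2/2" by (rule I_crit_sq) (use I in auto)
 define b where "b = 2*En - 2*I^2 - om^2"
 have b: "b > 0" using I2 by (simp add: b_def)
 define Q where "Q = sqrt (En^2 - 2 * om^2*I^2)"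
 have w2: "om^2 > 0" using pos by simp
 \<comment> \<open>Positivity under the root defining \<open>Q\<close>: the bound on
   \<open>I\<close> reduces it to \<open>(En - om^2)^2 >= 0\<close>.\<close>
 have "2 * om^2*I^2 < 2 * om^2*(En - om^2/2)" using I2 w2 by (intro mult_strict_left_mono) auto
 also have "... <= En^2" using zero_le_power2[of "En - om^2"] by (simp add: square_simps)
 finally have Q: "Q > 0" "Q^2 = En^2 - 2 * om^2*I^2" by (simp_all add: Q_def)
 define sn x where "sn = I * sqrt (2*b)/Q" and "x = (En - 2*I^2)/Q"
 have sn: "sn > 0" using I b Q by (simp add: sn_def)
 have "sn^2 + x^2 = (I^2*(2*b) + (En - 2*I^2)^2)/Q^2"
  using b by (simp add: sn_def x_def power_divide power_mult_distrib add_divide_distrib)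
 also have "I^2*(2*b) + (En - 2*I^2)^2 = Q^2" unfolding Q(2) b_def by (simp add: square_simps)
 finally have one: "sn^2 + x^2 = 1" using Q(1) by simp
 hence x1: "x^2 < 1" using zero_less_power[OF sn, of 2] by linarith
 hence x2: "-1 < x" "x < 1" unfolding abs_square_less_1 by auto
 define t where "t = arccos x"
 have t: "0 < t" "t < pi" "cos t = x" using arccos_lt_bounded[OF x2] x2 by (auto simp: t_def)
 have st: "sin t = sn" proof -
  have "(sin t)^2 = sn^2" using one t(3) by (simp add: sin_squared_eq)
  moreover have "sin t >= 0" using t by (intro sin_ge_zero) auto
  ultimately show ?thesis using sn by (simp add: power2_eq_iff_nonneg)
 qed
 have "4*En - 2*(2*I^2 + om^2) = 2*b" by (simp add: b_def)
 hence "cot t = (En - 2*I^2)/(abs I * sqrt (4*En - 2*(2*I^2 + om^2)))"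
  unfolding cot_def t(3) st using I Q(1) by (simp add: x_def sn_def)
 hence ph: "phi_E om En I = t" using arccot_cot[OF t(1,2)] I by (simp add: phi_E_def)
 show "0 < phi_E om En I" "phi_E om En I < pi" using t ph by auto
 define c where "c = (om^2 - En)/Q"
 have c: "c < 0" unfolding c_def using pos Q by (intro divide_neg_pos) auto
 have c3: "1 - c^2 = om^2*b/Q^2" proof -
  have "1 - c^2 = (Q^2 - (om^2 - En)^2)/Q^2" unfolding c_def power_divide using Q(1) by (simp add: field_simps)
  also have "Q^2 - (om^2 - En)^2 = om^2*b" unfolding Q(2) b_def by (simp add: square_simps)
  finally show ?thesis .
 qed
 have "K*c^2 - 2*x*c + 2 - K = 2 - 2*x*c - K*(1 - c^2)" by (simp add: algebra_simps)
 also have "K*(1 - c^2) = 2*En*b/Q^2" unfolding c3 K_def using w2 by simp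
 also have "2 - 2*x*c = (2*Q^2 - 2*(En - 2*I^2)*(om^2 - En))/Q^2"
  using Q(1) by (simp add: x_def c_def field_simps power2_eq_square)
 also have "2*Q^2 - 2*(En - 2*I^2)*(om^2 - En) = 2*En*b" unfolding Q(2) b_def by (simp add: square_simps)
 finally have "K*c^2 - 2*x*c + 2 - K = 0" by simp
 hence cc: "c = c_E K 2 (cos t)" unfolding t(3) using c K_gt by (intro c_E_unique) auto
 have "sqrt (1 - c^2) = om * sqrt b/Q" unfolding c3 using pos Q(1) by (simp add: real_sqrt_divide real_sqrt_mult)
 hence "gE om K t = om * sn/(sqrt 2*(om * sqrt b/Q))" by (simp add: gE_def cc[symmetric] st)
 also have "... = I" using pos Q(1) b by (simp add: sn_def real_sqrt_mult)
 finally show "gE om K (phi_E om En I) = I" by (simp add: ph)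
qed

text \<open>The analogous check for \<open>gI\<close>, in terms of the half angle
  \<open>t - pi\<close> with \<open>t\<close> the arccosine in the formula, and with the root
  \<open>c = (mu + 2*H)/Q\<close>.\<close>

lemma phi_I_pos:
 assumes I: "0 < I" "I < I_crit om En"
 shows "- (2*pi) < phi_I En h mu I" "phi_I En h mu I < 0" "gI H mu (phi_I En h mu I) = I" proof -
 have I2: "I^2 < En - om^2/2" by (rule I_crit_sq) (use I in auto)
 define b where "b = H + mu - I^2"
 have b: "b > 0" using I2 pos zero_le_power2[of om] unfolding b_def H_def by linarith
 define Q where "Q = sqrt (4*H*I^2 + mu^2)"
 have "0 < 4*H*I^2 + mu^2" using H_pos pos by (intro add_nonneg_pos mult_nonneg_nonneg) auto
 hence Q: "Q > 0" "Q^2 = 4*H*I^2 + mu^2" by (simp_all add: Q_def)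
 define q sn where "q = (2*I^2 - mu)/Q" and "sn = 2*I * sqrt b/Q"
 have sn: "sn > 0" using I b Q by (simp add: sn_def)
 have "sn^2 + q^2 = (4*I^2*b + (2*I^2 - mu)^2)/Q^2"
  using b by (simp add: sn_def q_def power_divide power_mult_distrib add_divide_distrib)
 also have "4*I^2*b + (2*I^2 - mu)^2 = Q^2" unfolding Q(2) b_def by (simp add: square_simps)
 finally have one: "sn^2 + q^2 = 1" using Q(1) by simp
 hence "q^2 < 1" using zero_less_power[OF sn, of 2] by linarith
 hence q2: "-1 < q" "q < 1" unfolding abs_square_less_1 by auto
 define t where "t = arccos q"
 have t: "0 < t" "t < pi" "cos t = q" using arccos_lt_bounded[OF q2] q2 by (auto simp: t_def)
 have st: "sin t = sn" proof -
  have "(sin t)^2 = sn^2" using one t(3) by (simp add: sin_squared_eq)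
  moreover have "sin t >= 0" using t by (intro sin_ge_zero) auto
  ultimately show ?thesis using sn by (simp add: power2_eq_iff_nonneg)
 qed
 have ph: "phi_I En h mu I = 2*t - 2*pi" using I by (simp add: phi_I_def t_def q_def Q_def H_def)
 show "- (2*pi) < phi_I En h mu I" "phi_I En h mu I < 0" using t ph by auto
 have half: "phi_I En h mu I/2 = t - pi" unfolding ph by simp
 have cs: "cos (phi_I En h mu I/2) = - q" "sin (phi_I En h mu I/2) = - sn"
  unfolding half by (simp_all add: cos_diff sin_diff t(3) st)
 define c where "c = (mu + 2*H)/Q"
 have c: "c > 0" using pos H_pos Q by (simp add: c_def)
 have "mu*c^2 + 2*H*q*c - (mu + H*2) = (mu + 2*H)*((mu*(mu + 2*H) + 2*H*(2*I^2 - mu))/Q^2) - (mu + H*2)"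
  using Q(1) by (simp add: c_def q_def field_simps power2_eq_square)
 also have "mu*(mu + 2*H) + 2*H*(2*I^2 - mu) = Q^2" unfolding Q(2) by (simp add: square_simps)
 also have "(mu + 2*H)*(Q^2/Q^2) - (mu + H*2) = 0" using Q(1) by simp
 finally have cc: "c = c_I H mu 2 (- cos (phi_I En h mu I/2))"
  unfolding cs using c H_pos pos by (intro c_I_unique) auto
 have "c^2 - 1 = ((mu + 2*H)^2 - Q^2)/Q^2" using Q(1) by (simp add: c_def power_divide diff_divide_distrib)
 also have "(mu + 2*H)^2 - Q^2 = 4*H*b" unfolding Q(2) b_def by (simp add: square_simps)
 finally have "sqrt (c^2 - 1) = 2 * sqrt H * sqrt b/Q" using Q(1) by (simp add: real_sqrt_divide real_sqrt_mult)
 hence "gI H mu (phi_I En h mu I) = sqrt H * sn/(2 * sqrt H * sqrt b/Q)"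
  unfolding gI_def cs by (simp add: cc[unfolded cs, simplified, symmetric])
 also have "... = I" using H_pos Q(1) b by (simp add: sn_def)
 finally show "gI H mu (phi_I En h mu I) = I" .
qed

lemma phi_odd: "phi_E om En (- I) = - phi_E om En I" "phi_I En h mu (- I) = - phi_I En h mu I"
 by (simp_all add: phi_E_def phi_I_def sgn_minus)

lemma g_odd: "gE om K (- t) = - gE om K t" "gI H mu (- t) = - gI H mu t" by (simp_all add: gE_def gI_def)

lemma phi_inverse:
 assumes I: "abs I < I_crit om En"
 shows "abs (phi_E om En I) < pi & gE om K (phi_E om En I) = I" "abs (phi_I En h mu I) < 2*pi & gI H mu (phi_I En h mu I) = I"
proof -
 have "(abs (phi_E om En I) < pi & gE om K (phi_E om En I) = I) & (abs (phi_I En h mu I) < 2*pi & gI H mu (phi_I En h mu I) = I)"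
 proof (cases I "0 :: real" rule: linorder_cases)
  case less
  hence J: "0 < - I" "- I < I_crit om En" using I by auto
  show ?thesis using phi_E_pos[OF J] phi_I_pos[OF J] unfolding phi_odd g_odd by (auto simp: abs_less_iff)
 next
  case equal
  thus ?thesis by (simp add: phi_E_def phi_I_def gE_def gI_def)
 next
  case greater
  hence J: "0 < I" "I < I_crit om En" using I by auto
  show ?thesis using phi_E_pos[OF J] phi_I_pos[OF J] by (auto simp: abs_less_iff)
 qed
 thus "abs (phi_E om En I) < pi & gE om K (phi_E om En I) = I" "abs (phi_I En h mu I) < 2*pi & gI H mu (phi_I En h mu I) = I" by blast+
qed

lemma phi_E_deriv: "abs I < I_crit om En ==> (phi_E om En has_real_derivative 1/gE' (phi_E om En I)) (at I)"
 by (rule inverse_branch_deriv[where L = pi and A = "I_crit om En" and g = "gE om K"])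
  (use gE_deriv phi_inverse in "auto simp: less_imp_neq[symmetric]")

lemma phi_I_deriv: "abs I < I_crit om En ==> (phi_I En h mu has_real_derivative 1/gI' (phi_I En h mu I)) (at I)"
 by (rule inverse_branch_deriv[where L = "2*pi" and A = "I_crit om En" and g = "gI H mu"])
  (use gI_deriv phi_inverse in "auto simp: less_imp_neq")

definition "theta' I = 1/gE' (phi_E om En I) + 1/gI' (phi_I En h mu I)"

lemma theta_deriv: "abs I < I_crit om En ==> (theta_bar om En h mu has_real_derivative theta' I) (at I)"
 unfolding theta_bar_def[abs_def] theta'_def by (intro DERIV_add phi_E_deriv phi_I_deriv)

lemma critical_iff: "abs I < I_crit om En ==> critical_action om En h mu I \<longleftrightarrow> theta' I = 0"
 unfolding critical_action_def using theta_deriv DERIV_unique by metis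

lemma phi_continuous:
 "continuous_on {- I_crit om En <..< I_crit om En} (phi_E om En)" "continuous_on {- I_crit om En <..< I_crit om En} (phi_I En h mu)"
 by (intro continuous_at_imp_continuous_on ballI DERIV_isCont[OF phi_E_deriv] DERIV_isCont[OF phi_I_deriv]; auto simp: abs_less_iff)+

lemma theta'_continuous: "continuous_on {- I_crit om En <..< I_crit om En} theta'" proof -
 have rng: "phi_E om En I : {- pi<..<pi} & phi_I En h mu I : {- (2*pi)<..<2*pi}" if "I : {- I_crit om En <..< I_crit om En}" for I
 proof -
  have "abs I < I_crit om En" using that by (auto simp: abs_less_iff)
  from phi_inverse[OF this] show ?thesis by auto
 qed
 show ?thesis unfolding theta'_def
proof (intro continuous_on_add continuous_on_divide continuous_on_const ballI)
 show "continuous_on {- I_crit om En <..< I_crit om En} (%I. gE' (phi_E om En I))"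
  by (rule continuous_on_compose2[OF gE'_continuous phi_continuous(1)]) (use rng in blast)
 show "continuous_on {- I_crit om En <..< I_crit om En} (%I. gI' (phi_I En h mu I))"
  by (rule continuous_on_compose2[OF gI'_continuous phi_continuous(2)]) (use rng in blast)
 fix I assume "I : {- I_crit om En <..< I_crit om En}"
 hence "abs I < I_crit om En" by (auto simp: abs_less_iff)
 thus "gE' (phi_E om En I) ~= 0" "gI' (phi_I En h mu I) ~= 0"
  using gE_deriv(2) gI_deriv(2) phi_inverse[of I] by (simp_all add: less_imp_neq less_imp_neq[symmetric])
qed
qed

end

text \<open>\<open>p\<close> is the last visit to the value at \<open>s\<close> and \<open>q\<close>
  the first later visit to the value at \<open>t\<close>; a value outside the range in between would
  force a further visit. This isolates a stretch with values between the two rotation numbers even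
  if the shift oscillates elsewhere.\<close>

lemma last_first_passage_less:
 fixes th :: "real => real"
 assumes st: "s < t" and c: "continuous_on {s..t} th" and AB: "th s < th t"
 obtains p q where "s <= p" "p < q" "q <= t" "th p = th s" "th q = th t" "!!x. p <= x ==> x <= q ==> th s <= th x & th x <= th t"
proof -
 have cs: "continuous_on {x..y} th" if "s <= x" "y <= t" for x y using that by (auto intro: continuous_on_subset[OF c])
 have level: "compact {x : {x0..t}. th x = L}" if "s <= x0" for x0 L proof -
  have "closed ({x0..t} \<inter> th -` {L})" using that by (intro continuous_closed_preimage cs) auto
  moreover have "{x0..t} \<inter> th -` {L} = {x : {x0..t}. th x = L}" by auto
  ultimately show ?thesis by (auto simp: compact_eq_bounded_closed intro: bounded_subset[of "{x0..t}"])
 qed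
 obtain p where p: "p : {x : {s..t}. th x = th s}" "!!x. x : {x : {s..t}. th x = th s} ==> x <= p"
  using compact_attains_sup[OF level[of s "th s"]] st by fastforce
 hence sp: "s <= p" "p <= t" "th p = th s" by auto
 obtain q where q: "q : {x : {p..t}. th x = th t}" "!!x. x : {x : {p..t}. th x = th t} ==> q <= x"
  using compact_attains_inf[OF level[of p "th t"]] sp by fastforce
 hence pq: "p <= q" "q <= t" "th q = th t" by auto
 have "p ~= q" using sp pq AB by auto
 show ?thesis proof (rule that[of p q])
  fix x assume x: "p <= x" "x <= q"
  show "th s <= th x & th x <= th t" proof (rule conjI; rule ccontr)
   assume n: "~ th s <= th x"
   have "EX y>=x. y <= t & th y = th s" by (rule IVT') (use n AB x sp pq cs[of x t] in auto)
   then obtain y where y: "x <= y" "y <= t" "th y = th s" by blast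
   hence "y <= p" using p(2)[of y] x sp by auto
   hence "y = x" using y x by simp
   thus False using y n by simp
  next
   assume n: "~ th x <= th t"
   have "EX y>=p. y <= x & th y = th t" by (rule IVT') (use n AB x sp pq cs[of p x] in auto)
   then obtain y where y: "p <= y" "y <= x" "th y = th t" by blast
   hence "q <= y" using q(2)[of y] x pq by auto
   hence "y = x" using y x by simp
   thus False using y n by simp
  qed
 qed (use sp pq \<open>p ~= q\<close> in auto)
qed

lemma last_first_passage:
 fixes th :: "real => real"
 assumes st: "s < t" and c: "continuous_on {s..t} th" and AB: "th s ~= th t"
 obtains p q where "s <= p" "p < q" "q <= t" "th p = th s" "th q = th t"
  "!!x. p <= x ==> x <= q ==> min (th s) (th t) <= th x & th x <= max (th s) (th t)"
proof (cases "th s < th t")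
 case True
 obtain p q where pq: "s <= p" "p < q" "q <= t" "th p = th s" "th q = th t" "!!x. p <= x ==> x <= q ==> th s <= th x & th x <= th t"
  using last_first_passage_less[OF st c True] by metis
 show ?thesis by (rule that[of p q]) (use pq True in auto)
next
 case False
 hence T: "- th s < - th t" using AB by simp
 obtain p q where pq: "s <= p" "p < q" "q <= t" "- th p = - th s" "- th q = - th t" "!!x. p <= x ==> x <= q ==> - th s <= - th x & - th x <= - th t"
  using last_first_passage_less[OF st continuous_on_minus[OF c] T] by metis
 show ?thesis by (rule that[of p q]) (use pq T in auto)
qed

text \<open>On the stretch \<open>[p, q]\<close> the derivative has no zero, hence one sign
  \<open>si\<close>, which persists slightly beyond. Of the two enlargements, \<open>[a, b]\<close>
  puts the rotation numbers into the interior and \<open>[a', b']\<close> leaves room for two-sided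
  derivatives at the edge of \<open>[a, b]\<close>.\<close>

lemma annulus_exists:
 fixes th th' :: "real => real"
 assumes d: "!!I. abs I < A ==> (th has_real_derivative th' I) (at I)" and c': "continuous_on {- A<..<A} th'"
  and rh: "rhm < rhp" "rhm : th ` {- A<..<A}" "rhp : th ` {- A<..<A}"
  and nz: "!!I. abs I < A ==> th I : {rhm..rhp} ==> th' I ~= 0"
 obtains a' a b b' si :: real where "- A < a'" "a' < a" "a < b" "b < b'" "b' < A" "si = 1 | si = -1"
  "!!I. a' <= I ==> I <= b' ==> 0 < si*th' I"
  "!!rh. rhm <= rh ==> rh <= rhp ==> si*th a < si*rh & si*rh < si*th b" proof -
 obtain Im Ip where I: "abs Im < A" "th Im = rhm" "abs Ip < A" "th Ip = rhp" using rh by (auto simp: abs_less_iff) (metis minus_less_iff)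
 define s t where "s = min Im Ip" and "t = max Im Ip"
 have "Im ~= Ip" using I rh(1) by auto
 hence st: "s < t" "- A < s" "t < A" "min (th s) (th t) = rhm" "max (th s) (th t) = rhp" "th s ~= th t"
  using I rh(1) by (auto simp: s_def t_def min_def max_def abs_less_iff)
 have cont: "continuous_on {s..t} th"
  using st by (intro continuous_at_imp_continuous_on ballI DERIV_isCont[OF d]) (auto simp: abs_less_iff)
 obtain p q where pq: "s <= p" "p < q" "q <= t" "th p = th s" "th q = th t"
  "!!x. p <= x ==> x <= q ==> min (th s) (th t) <= th x & th x <= max (th s) (th t)"
  using last_first_passage[OF st(1) cont st(6)] by metis
 have nz': "th' x ~= 0" if "p <= x" "x <= q" for x
  by (rule nz) (use pq(1,3) pq(6)[OF that] that st in "auto simp: abs_less_iff")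
 define si where "si = sgn (th' p)"
 have si: "si = 1 | si = -1" using nz'[of p] pq(2) by (auto simp: si_def sgn_if)
 have cpq: "continuous_on {x..y} (%x. si*th' x)" if "- A < x" "y < A" for x y
  by (intro continuous_intros continuous_on_subset[OF c']) (use that in auto)
 have pos: "0 < si*th' x" if x: "p <= x" "x <= q" for x proof (rule ccontr)
  assume "~ ?thesis"
  moreover have "0 < si*th' p" using nz'[of p] pq(2) by (simp add: si_def sgn_if)
  ultimately have "EX y>=p. y <= x & si*th' y = 0" using x pq st by (intro IVT2' cpq) auto
  thus False using nz' x si by auto
 qed
 have near: "EX d>0. ALL y. abs (y - x) < d --> abs y < A & 0 < si*th' y" if x: "p <= x" "x <= q" for x
 proof -
  have xA: "x : {- A<..<A}" using x pq st by auto
  have "open ({- A<..<A} \<inter> (%x. si*th' x) -` {0<..})"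
   by (intro continuous_open_preimage continuous_intros c')
  moreover have "x : {- A<..<A} \<inter> (%x. si*th' x) -` {0<..}" using xA pos[OF x] by auto
  ultimately show ?thesis unfolding open_dist by (fastforce simp: dist_real_def abs_less_iff)
 qed
 obtain d1 where d1: "d1 > 0" "!!y. abs (y - p) < d1 ==> abs y < A & 0 < si*th' y" using near[of p] pq(2) by auto
 obtain d2 where d2: "d2 > 0" "!!y. abs (y - q) < d2 ==> abs y < A & 0 < si*th' y" using near[of q] pq(2) by auto
 define a' a b b' where "a' = p - d1/2" and "a = p - d1/3" and "b = q + d2/3" and "b' = q + d2/2"
 have ord: "a' < a" "a < p" "q < b" "b < b'" using d1(1) d2(1) by (auto simp: a'_def a_def b_def b'_def)
 have A: "- A < a'" "b' < A" using d1(2)[of a'] d2(2)[of b'] d1(1) d2(1) by (auto simp: a'_def b'_def abs_less_iff)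
 have pos': "0 < si*th' I" if "a' <= I" "I <= b'" for I proof -
  consider "I < p" | "p <= I & I <= q" | "q < I" by linarith
  thus ?thesis proof cases
   case 1
   hence "abs (I - p) < d1" using that d1(1) by (auto simp: a'_def)
   thus ?thesis using d1(2) by blast
  next
   case 3
   hence "abs (I - q) < d2" using that d2(1) by (auto simp: b'_def)
   thus ?thesis using d2(2) by blast
  qed (use pos in auto)
 qed
 have inc: "si*th x < si*th y" if "a' <= x" "x < y" "y <= b'" for x y
 proof (rule DERIV_pos_imp_increasing[OF that(2)])
  fix z assume z: "x <= z" "z <= y"
  hence "abs z < A" using that A by (auto simp: abs_less_iff)
  from DERIV_cmult[OF d[OF this], of si] show "EX D. ((%z. si*th z) has_real_derivative D) (at z) & 0 < D"
   using pos'[of z] z that by auto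
 qed
 show ?thesis proof (rule that[OF A(1) ord(1) _ ord(4) A(2) si pos'])
  show "a < b" using ord pq(2) by simp
  fix rh assume r: "rhm <= rh" "rh <= rhp"
  have i: "si*th a < si*th p" "si*th p < si*th q" "si*th q < si*th b" using inc ord pq(2) by auto
  have "th p = rhm & th q = rhp | th p = rhp & th q = rhm" using pq(4,5) st(4,5) by (auto simp: min_def max_def split: if_splits)
  thus "si*th a < si*rh & si*rh < si*th b" using si i r by auto
 qed
qed

text \<open>The margin \<open>3*de\<close> is spent in three portions: one for the window around the
  unperturbed crossing angle, one for a neighborhood of each crossing, and one as the margin under
  which the length formulas hold.\<close>

locale annulus = billiard +
 fixes a' a b b' si :: real
 assumes ord: "- I_crit om En < a'" "a' < a" "a < b" "b < b'" "b' < I_crit om En" and si: "si = 1 | si = -1"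
  and theta'_pos: "a' <= I ==> I <= b' ==> 0 < si*theta' om En h mu K H I"
  and phi_bound: "a' <= I ==> I <= b' ==> abs (phi_E om En I) <= pi - 3*de & abs (phi_I En h mu I) <= 2*pi - 3*de"
begin

abbreviation "th == theta_bar om En h mu"
abbreviation "phE == phi_E om En"
abbreviation "phI == phi_I En h mu"
abbreviation "dE == gE' om K"
abbreviation "dI == gI' mu H"

lemmas K4 = pos K_def H_def

lemma J_crit: "I : {a'..b'} ==> abs I < I_crit om En" using ord by auto

lemma th_split: "th I = phE I + phI I" by (simp add: theta_bar_def)

lemma th_deriv: "I : {a'..b'} ==> (th has_real_derivative theta' om En h mu K H I) (at I)"
 by (rule theta_deriv[OF K4 J_crit])

lemma th_inc: assumes "a' <= x" "x < y" "y <= b'" shows "si*th x < si*th y"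
proof (rule DERIV_pos_imp_increasing[OF assms(2)])
 fix z assume z: "x <= z" "z <= y"
 hence J: "z : {a'..b'}" using assms by simp
 from DERIV_cmult[OF th_deriv[OF this], of si] show "EX D. ((%z. si*th z) has_real_derivative D) (at z) & 0 < D"
  using theta'_pos[of z] J by auto
qed

lemma th_inj: "inj_on th {a'..b'}" proof (rule linorder_inj_onI')
 fix x y assume "x : {a'..b'}" "y : {a'..b'}" "x < y"
 thus "th x ~= th y" using th_inc[of x y] by auto
qed

lemma th_cont: "continuous_on {a'..b'} th"
 by (intro continuous_at_imp_continuous_on ballI DERIV_isCont[OF th_deriv])

definition "lo = min (th a') (th b')"
definition "hi = max (th a') (th b')"
definition "ps = inv_into {a'..b'} th"

lemma th_image: "th ` {a'..b'} = {lo..hi}" proof (intro equalityI subsetI)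
 fix D assume "D : th ` {a'..b'}"
 then obtain I where I: "I : {a'..b'}" "D = th I" by auto
 hence "si*th a' <= si*D" "si*D <= si*th b'"
  using th_inc[of a' I] th_inc[of I b'] by (cases "I = a'"; cases "I = b'"; force)+
 thus "D : {lo..hi}" using si by (auto simp: lo_def hi_def)
next
 fix D assume D: "D : {lo..hi}"
 have ab: "a' <= b'" using ord by simp
 have "D : closed_segment (th a') (th b')" using D by (auto simp: lo_def hi_def closed_segment_eq_real_ivl min_def max_def split: if_splits)
 then obtain x where "x : closed_segment a' b'" "th x = D"
  using IVT'_closed_segment_real[of D th a' b'] th_cont ab by (auto simp: closed_segment_eq_real_ivl)
 thus "D : th ` {a'..b'}" using ab by (auto simp: closed_segment_eq_real_ivl)
qed

lemma ps_th: "I : {a'..b'} ==> ps (th I) = I" unfolding ps_def by (rule inv_into_f_f[OF th_inj])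
lemma ps_mem: "D : {lo..hi} ==> ps D : {a'..b'}" unfolding ps_def th_image[symmetric] by (rule inv_into_into)
lemma th_ps: "D : {lo..hi} ==> th (ps D) = D" unfolding ps_def th_image[symmetric] by (rule f_inv_into_f)
lemma ps_cont: "continuous_on {lo..hi} ps"
 unfolding th_image[symmetric] by (rule continuous_on_inv[OF th_cont compact_Icc]) (use ps_th in blast)

lemma ph_cont: "continuous_on {a'..b'} phE" "continuous_on {a'..b'} phI"
 using ord by (auto intro!: continuous_on_subset[OF phi_continuous(1)[OF K4]] continuous_on_subset[OF phi_continuous(2)[OF K4]])

text \<open>The derivative of the total length in the crossing angle; \<open>w\<close> consists of
  the two endpoints and that angle.\<close>

definition "G e w = p2 e (fst (fst w), snd w) + q1 e (snd w, snd (fst w))"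
definition "WG = {(e, w). (e, (fst (fst w), snd w)) : WE & (e, (snd w, snd (fst w))) : WI}"

lemma C1_G: "C1_on WG G" proof -
 have L: "bounded_linear (%w::(real \<times> real) \<times> real. fst (fst w))" "bounded_linear (%w::(real \<times> real) \<times> real. snd (fst w))"
  by (intro bounded_linear_compose[OF bounded_linear_fst] bounded_linear_compose[OF bounded_linear_snd] bounded_linear_fst)+
 have "C1_on WG (%e w. p2 e (fst (fst w), snd w))"
  by (rule C1_on_compose_pair[OF C1_p2 C1_on_linear[OF L(1)] C1_on_linear[OF bounded_linear_snd]]) (simp add: WG_def)
 moreover have "C1_on WG (%e w. q1 e (snd w, snd (fst w)))"
  by (rule C1_on_compose_pair[OF C1_q1 C1_on_linear[OF bounded_linear_snd] C1_on_linear[OF L(2)]]) (simp add: WG_def)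
 ultimately show ?thesis unfolding G_def[abs_def] by (rule C1_on_add)
qed

definition DG where "DG = (SOME F'. (ALL e z. (e, z) : WG --> (G e has_derivative F' e z) (at z)) &
  (ALL k. continuous_on WG (%(e, z). F' e z k)) & continuous_on WG (%(e, z). G e z))"

lemma G'_props: "(ALL e z. (e, z) : WG --> (G e has_derivative DG e z) (at z)) &
  (ALL k. continuous_on WG (%(e, z). DG e z k)) & continuous_on WG (%(e, z). G e z)"
 unfolding DG_def by (rule someI_ex[OF C1_onD[OF C1_G]])

lemma G_deriv: "(e, z) : WG ==> (G e has_derivative DG e z) (at z)"
 and DG_cont: "continuous_on WG (%(e, z). DG e z k)" and G_cont: "continuous_on WG (%(e, z). G e z)"
 using G'_props by blast+

lemma G_DERIV:
 assumes "(e, (z, u)) : WG"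
 shows "((%u. G e (z, u)) has_real_derivative DG e (z, u) (0, 1)) (at u)" proof -
 have "((%u. (z, u)) has_derivative (%h. (0, h))) (at u)" by (auto intro!: derivative_eq_intros)
 from has_derivative_compose[OF this G_deriv[OF assms]]
 have "((%u. G e (z, u)) has_derivative (%h. DG e (z, u) (0, h))) (at u)" .
 moreover have "(%h. DG e (z, u) (0, h)) = (*) (DG e (z, u) (0, 1))" proof
  fix h :: real
  have "DG e (z, u) (h *\<^sub>R (0, 1)) = h *\<^sub>R DG e (z, u) (0, 1)"
   by (rule linear_scale[OF has_derivative_linear[OF G_deriv[OF assms]]])
  thus "DG e (z, u) (0, h) = DG e (z, u) (0, 1)*h" by simp
 qed
 ultimately show ?thesis by (simp add: has_field_derivative_def)
qed

lemma G_per: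
 assumes "abs e <= e0"
 shows "G e ((x + 2*pi, y + 2*pi), u + 2*pi) = G e ((x, y), u)" by (simp add: G_def pq_per[OF assms])

lemma DG_per:
 assumes "(e, ((x, y), u)) : WG"
 shows "DG e ((x + 2*pi, y + 2*pi), u + 2*pi) (0, 1) = DG e ((x, y), u) (0, 1)" proof -
 have e: "abs e <= e0" using assms by (auto simp: WG_def WE_iff)
 have "(e, ((x + 2*pi, y + 2*pi), u + 2*pi)) : WG" using assms by (simp add: WG_def WE_iff WI_iff)
 from G_DERIV[OF this] have "((%u. G e ((x + 2*pi, y + 2*pi), u + 2*pi)) has_real_derivative
   DG e ((x + 2*pi, y + 2*pi), u + 2*pi) (0, 1)) (at u)" by (simp add: DERIV_shift)
 thus ?thesis unfolding G_per[OF e] using G_DERIV[OF assms] DERIV_unique by blast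
qed

definition "pt x I v = ((x, x + th I), x + phE I + v)"

lemma pt_WG: "abs e <= e0 ==> I : {a'..b'} ==> abs v <= de ==> (e, pt x I v) : WG"
 using phi_bound[of I] de by (auto simp: WG_def pt_def WE_iff WI_iff th_split)

lemma G_zero:
 assumes "I : {a'..b'}"
 shows "G 0 (pt x I 0) = 0"
 using phi_inverse[OF K4 J_crit[OF assms]] by (simp add: G_def pt_def unperturbed th_split)

text \<open>The second derivative of the length at an unperturbed crossing is
  \<open>dE + dI\<close>, while \<open>theta'\<close> is \<open>(dE + dI)/(dE*dI)\<close> with
  \<open>dE*dI < 0\<close>. So the crossing is nondegenerate exactly where the shift is regular,
  with the opposite sign.\<close>

lemma DG_zero:
 assumes I: "I : {a'..b'}"
 shows "DG 0 (pt x I 0) (0, 1) = dE (phE I) + dI (phI I)" "si*(dE (phE I) + dI (phI I)) < 0" proof -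
 note ph = phi_inverse[OF K4 J_crit[OF I]]
 note E = gE_deriv[OF K4 conjunct1[OF ph(1)]] and I' = gI_deriv[OF K4 conjunct1[OF ph(2)]]
 have "(0, pt x I 0) : WG" using pt_WG[OF _ I, of 0 0 x] e0 de by simp
 hence "((%u. G 0 ((x, x + th I), u)) has_real_derivative DG 0 (pt x I 0) (0, 1)) (at (x + phE I))"
  using G_DERIV[of 0 "(x, x + th I)" "x + phE I"] by (simp add: pt_def)
 moreover have "((%u. G 0 ((x, x + th I), u)) has_real_derivative dE (phE I) + dI (phI I)) (at (x + phE I))"
 proof -
  have "((%u. gE om K (u - x)) has_real_derivative dE (phE I)*(1 - 0)) (at (x + phE I))"
   by (rule DERIV_chain2[where f = "gE om K"]) (use E in "auto intro!: derivative_eq_intros")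
  moreover have "((%u. gI H mu (x + th I - u)) has_real_derivative dI (phI I)*(0 - 1)) (at (x + phE I))"
   by (rule DERIV_chain2[where f = "gI H mu"]) (use I' in "auto intro!: derivative_eq_intros simp: th_split")
  ultimately have "((%u. gE om K (u - x) - gI H mu (x + th I - u)) has_real_derivative dE (phE I)*(1 - 0) - dI (phI I)*(0 - 1)) (at (x + phE I))"
   by (rule DERIV_diff)
  thus ?thesis by (simp add: G_def unperturbed)
 qed
 ultimately show "DG 0 (pt x I 0) (0, 1) = dE (phE I) + dI (phI I)" by (rule DERIV_unique)
 have "theta' om En h mu K H I = (dE (phE I) + dI (phI I))/(dE (phE I)*dI (phI I))"
  unfolding theta'_def[OF K4] using E(2) I'(2) by (simp add: field_simps)
 hence "0 < si*(dE (phE I) + dI (phI I))/(dE (phE I)*dI (phI I))" using theta'_pos[of I] I by simp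
 moreover have "dE (phE I)*dI (phI I) < 0" using E(2) I'(2) by (simp add: mult_pos_neg)
 ultimately show "si*(dE (phE I) + dI (phI I)) < 0" by (simp add: zero_less_divide_iff)
qed

lemma near_param:
 fixes F :: "'p::metric_space => real \<times> real => real"
 assumes "compact P" "p0 : P" "et > 0" and c: "continuous_on (P \<times> (UNIV \<times> {a'..b'})) (%(p, k). F p k)"
  and per: "!!p x I. p : P ==> I : {a'..b'} ==> F p (x + 2*pi, I) = F p (x, I)"
 shows "EX d>0. ALL p:P. dist p p0 < d --> (ALL x. ALL I:{a'..b'}. abs (F p (x, I) - F p0 (x, I)) < et)"
proof -
 have "continuous_on (P \<times> ({0..2*pi} \<times> {a'..b'})) (%(p, k). F p k)" by (rule continuous_on_subset[OF c]) auto
 from continuous_near_parameter[OF assms(1) compact_Times[OF compact_Icc compact_Icc] assms(2) this assms(3)]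
 obtain d where d: "d > 0" "!!p k. p : P ==> dist p p0 < d ==> k : {0..2*pi} \<times> {a'..b'} ==> abs (F p k - F p0 k) < et"
  by auto
 show ?thesis proof (intro exI[of _ d] conjI ballI impI allI)
  fix p x I assume p: "p : P" "dist p p0 < d" and I: "I : {a'..b'}"
  obtain n :: int where n: "x + 2*pi * of_int n : {0..2*pi}" by (rule shift_to_period)
  have "F q (x + 2*pi * of_int n, I) = F q (x, I)" if "q : P" for q
   using periodic_int[of "%z. F q (fst z, I)" x n 0] per[OF that I] by simp
  thus "abs (F p (x, I) - F p0 (x, I)) < et" using d(2)[OF p, of "(x + 2*pi * of_int n, I)"] n I p(1) assms(2) by simp
 qed (rule d(1))
qed

lemma pt_continuous: "continuous_on (P \<times> (UNIV \<times> {a'..b'})) (%p. (fst (fst p), pt (fst (snd p)) (snd (snd p)) (snd (fst p))))"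
 unfolding pt_def
 by (intro continuous_intros continuous_on_compose2[OF ph_cont(1)] continuous_on_compose2[OF th_cont]) auto

text \<open>\<open>m\<close> is half of the smallest unperturbed slope; by compactness the slope
  stays above it on windows of radius \<open>rr\<close> for small parameters. The bound
  \<open>m*rr/4\<close> at the center then guarantees a zero within \<open>rr/2\<close>.\<close>

lemma slope_exists:
 obtains m rr e1 where "m > 0" "0 < rr" "rr <= de" "0 < e1" "e1 <= e0"
  "!!e x I v. abs e <= e1 ==> I : {a'..b'} ==> abs v <= rr ==> m <= - si*DG e (pt x I v) (0, 1)"
  "!!e x I. abs e <= e1 ==> I : {a'..b'} ==> abs (G e (pt x I 0)) <= m*rr/4" proof -
 have "continuous_on {a'..b'} (%I. - si*(dE (phE I) + dI (phI I)))" proof (intro continuous_intros)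
  have rr: "phE I : {- pi<..<pi}" "phI I : {- (2*pi)<..<2*pi}" if "I : {a'..b'}" for I
   using phi_inverse[OF K4 J_crit[OF that]] by auto
  show "continuous_on {a'..b'} (%I. dE (phE I))"
   by (rule continuous_on_compose2[OF gE'_continuous[OF K4] ph_cont(1)]) (use rr in blast)
  show "continuous_on {a'..b'} (%I. dI (phI I))"
   by (rule continuous_on_compose2[OF gI'_continuous[OF K4] ph_cont(2)]) (use rr in blast)
 qed
 from continuous_attains_inf[OF compact_Icc _ this] ord
 obtain I0 where I0: "I0 : {a'..b'}" "!!I. I : {a'..b'} ==> - si*(dE (phE I0) + dI (phI I0)) <= - si*(dE (phE I) + dI (phI I))"
  by auto
 define m where "m = - si*(dE (phE I0) + dI (phI I0))/2"
 have m: "m > 0" using DG_zero(2)[OF I0(1)] by (simp add: m_def)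
 let ?P = "{- e0..e0} \<times> {- de..de}"
 have sub: "(%p. (fst (fst p), pt (fst (snd p)) (snd (snd p)) (snd (fst p)))) ` (?P \<times> (UNIV \<times> {a'..b'})) <= WG"
  using pt_WG by (auto simp: abs_le_iff)
 have c1: "continuous_on (?P \<times> (UNIV \<times> {a'..b'})) (%(p, k). - si*DG (fst p) (pt (fst k) (snd k) (snd p)) (0, 1))"
  using continuous_on_compose2[OF DG_cont pt_continuous sub, of "(0, 1)"] by (auto intro!: continuous_intros simp: case_prod_unfold)
 have c2: "continuous_on (?P \<times> (UNIV \<times> {a'..b'})) (%(p, k). G (fst p) (pt (fst k) (snd k) (snd p)))"
  using continuous_on_compose2[OF G_cont pt_continuous sub] by (auto simp: case_prod_unfold)
 have P: "compact ?P" "(0, 0) : ?P" using e0 de by (auto intro: compact_Times)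
 have per: "pt (x + 2*pi) I v = ((fst (fst (pt x I v)) + 2*pi, snd (fst (pt x I v)) + 2*pi), snd (pt x I v) + 2*pi)" for x I v
  by (simp add: pt_def)
 have per1: "- si*DG (fst p) (pt (fst (x + 2*pi, I)) (snd (x + 2*pi, I)) (snd p)) (0, 1)
    = - si*DG (fst p) (pt (fst (x, I)) (snd (x, I)) (snd p)) (0, 1)" if p: "p : ?P" "I : {a'..b'}" for p x I
 proof -
  have "(fst p, pt x I (snd p)) : WG" using p by (intro pt_WG) auto
  thus ?thesis
   using DG_per[of "fst p" "fst (fst (pt x I (snd p)))" "snd (fst (pt x I (snd p)))" "snd (pt x I (snd p))"] by (simp add: per)
 qed
 from near_param[where F = "%p k. - si*DG (fst p) (pt (fst k) (snd k) (snd p)) (0, 1)", OF P m c1 per1]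
 obtain d1 where d1: "d1 > 0" "!!e v x I. abs e <= e0 ==> abs v <= de ==> dist (e, v) (0, 0) < d1 ==> I : {a'..b'} ==>
   abs (- si*DG e (pt x I v) (0, 1) - - si*DG 0 (pt x I 0) (0, 1)) < m" by (force simp: abs_le_iff)
 define rr where "rr = min de (d1/3)"
 have rr: "0 < rr" "rr <= de" "rr <= d1/3" using de d1(1) by (auto simp: rr_def)
 have mr: "m*rr/4 > 0" using m rr by simp
 have per2: "G (fst p) (pt (fst (x + 2*pi, I)) (snd (x + 2*pi, I)) (snd p)) = G (fst p) (pt (fst (x, I)) (snd (x, I)) (snd p))"
  if p: "p : ?P" "I : {a'..b'}" for p x I proof -
  have "abs (fst p) <= e0" using p by auto
  from G_per[OF this, of "fst (fst (pt x I (snd p)))" "snd (fst (pt x I (snd p)))" "snd (pt x I (snd p))"]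
  show ?thesis by (simp add: per)
 qed
 from near_param[where F = "%p k. G (fst p) (pt (fst k) (snd k) (snd p))", OF P mr c2 per2]
 obtain d2 where d2: "d2 > 0" "!!e x I. abs e <= e0 ==> abs e < d2 ==> I : {a'..b'} ==> abs (G e (pt x I 0)) < m*rr/4"
  using G_zero de by (force simp: abs_le_iff dist_Pair_Pair)
 define e1 where "e1 = min e0 (min (d1/3) (d2/2))"
 show ?thesis proof (rule that[of m rr e1])
  show "0 < e1" "e1 <= e0" using e0 d1(1) d2(1) by (auto simp: e1_def)
  fix e x I assume e: "abs e <= e1" and I: "I : {a'..b'}"
  have ee: "abs e <= e0" "abs e < d2" "abs e <= d1/3" using e d2(1) by (auto simp: e1_def)
  show "abs (G e (pt x I 0)) <= m*rr/4" using d2(2)[OF ee(1,2) I, of x] by simp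
  fix v assume v: "abs v <= rr"
  have "dist (e, v) (0, 0) <= abs e + abs v" using norm_Pair_le[of e v] by (simp add: dist_norm)
  hence "dist (e, v) (0, 0) < d1" using ee v rr d1(1) by linarith
  from d1(2)[OF ee(1) _ this I, of x] v rr
  have "abs (- si*DG e (pt x I v) (0, 1) - - si*DG 0 (pt x I 0) (0, 1)) < m" by simp
  moreover have "2*m <= - si*DG 0 (pt x I 0) (0, 1)"
   unfolding DG_zero(1)[OF I] using I0(2)[OF I] by (simp add: m_def)
  ultimately show "m <= - si*DG e (pt x I v) (0, 1)" by linarith
 qed (use m rr in auto)
qed

end

section \<open>The crossing angle as an implicit function\<close>

locale slope = annulus +
 fixes m rr e1 :: real
 assumes m_pos: "m > 0" and rr: "0 < rr" "rr <= de" and e1: "0 < e1" "e1 <= e0"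
  and slope: "abs e <= e1 ==> I : {a'..b'} ==> abs v <= rr ==> m <= - si*DG e (pt x I v) (0, 1)"
  and near_zero: "abs e <= e1 ==> I : {a'..b'} ==> abs (G e (pt x I 0)) <= m*rr/4"
begin

definition u0 :: "real \<times> real => real" where "u0 z = fst z + phE (ps (snd z - fst z))"

lemma pt_z:
 assumes "z : strip lo hi"
 shows "(z, u0 z + v) = pt (fst z) (ps (snd z - fst z)) v" "ps (snd z - fst z) : {a'..b'}" proof -
 have "snd z - fst z : {lo..hi}" using assms by (simp add: strip_def)
 thus "(z, u0 z + v) = pt (fst z) (ps (snd z - fst z)) v" "ps (snd z - fst z) : {a'..b'}"
  using th_ps ps_mem by (simp_all add: pt_def u0_def prod_eq_iff)
qed

lemma window_WG: "abs e <= e1 ==> z : strip lo hi ==> abs (u - u0 z) <= rr ==> (e, (z, u)) : WG"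
 using pt_z(1)[of z "u - u0 z"] pt_z(2)[of z] pt_WG[of e "ps (snd z - fst z)" "u - u0 z" "fst z"] rr e1 by simp

lemma window_slope: "abs e <= e1 ==> z : strip lo hi ==> abs (u - u0 z) <= rr ==> m <= - si*DG e (z, u) (0, 1)"
 using pt_z(1)[of z "u - u0 z"] pt_z(2)[of z] slope[of e "ps (snd z - fst z)" "u - u0 z" "fst z"] by simp

lemma window_near_zero: "abs e <= e1 ==> z : strip lo hi ==> abs (G e (z, u0 z)) <= m*rr/4"
 using pt_z(1)[of z 0] pt_z(2)[of z] near_zero[of e "ps (snd z - fst z)" "fst z"] by simp

lemma window_increase:
 assumes e: "abs e <= e1" and z: "z : strip lo hi" and u: "abs (u - u0 z) <= rr" "abs (u' - u0 z) <= rr" "u < u'"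
 shows "m*(u' - u) <= - si*G e (z, u') - - si*G e (z, u)" proof -
 have "((%u. - si*G e (z, u)) has_real_derivative - si*DG e (z, x) (0, 1)) (at x)" if "u <= x" "x <= u'" for x
  by (rule DERIV_cmult[OF G_DERIV[OF window_WG[OF e z]]]) (use that u in auto)
 from MVT2[OF u(3) this] obtain x where x: "u < x" "x < u'" "- si*G e (z, u') - - si*G e (z, u) = (u' - u)*(- si*DG e (z, x) (0, 1))"
  by blast
 have "m <= - si*DG e (z, x) (0, 1)" by (rule window_slope[OF e z]) (use x u in auto)
 hence "(u' - u)*m <= (u' - u)*(- si*DG e (z, x) (0, 1))" using u by (intro mult_left_mono) auto
 thus ?thesis unfolding x(3) by (simp add: mult.commute)
qed

lemma window_expand:
 assumes e: "abs e <= e1" and z: "z : strip lo hi" and u: "abs (u - u0 z) <= rr" "abs (u' - u0 z) <= rr"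
 shows "m*abs (u' - u) <= abs (G e (z, u') - G e (z, u))" proof -
 have main: "m*abs (u' - u) <= abs (G e (z, u') - G e (z, u))" if "abs (u - u0 z) <= rr" "abs (u' - u0 z) <= rr" "u < u'" for u u'
  using window_increase[OF e z that] that si by auto
 show ?thesis proof (cases u u' rule: linorder_cases)
  case greater
  thus ?thesis using main[OF u(2,1)] by (simp add: abs_minus_commute)
 qed (use main u in auto)
qed

lemma zero_exists:
 assumes e: "abs e <= e1" and z: "z : strip lo hi"
 shows "EX u. abs (u - u0 z) <= rr/2 & G e (z, u) = 0" proof -
 let ?k = "%u. - si*G e (z, u)"
 have n: "abs (?k (u0 z)) <= m*rr/4" using window_near_zero[OF e z] si by auto
 have up: "m*(rr/2) <= ?k (u0 z + rr/2) - ?k (u0 z)" using window_increase[OF e z, of "u0 z" "u0 z + rr/2"] rr by simp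
 have dn: "m*(rr/2) <= ?k (u0 z) - ?k (u0 z - rr/2)" using window_increase[OF e z, of "u0 z - rr/2" "u0 z"] rr by simp
 have mr: "m*rr > 0" using m_pos rr by simp
 have "EX u>=u0 z - rr/2. u <= u0 z + rr/2 & ?k u = 0" proof (rule IVT')
  show "continuous_on {u0 z - rr/2..u0 z + rr/2} ?k"
   by (intro continuous_at_imp_continuous_on ballI DERIV_isCont[OF DERIV_cmult[OF G_DERIV[OF window_WG[OF e z]]]])
    (use rr in "auto simp: abs_le_iff")
 qed (use n up dn mr rr in "auto simp: field_simps abs_le_iff")
 then obtain u where u: "u0 z - rr/2 <= u" "u <= u0 z + rr/2" "?k u = 0" by blast
 have "abs (u - u0 z) <= rr/2" using u(1,2) by (simp only: abs_le_iff) linarith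
 moreover have "G e (z, u) = 0" using u(3) si by auto
 ultimately show ?thesis by blast
qed

text \<open>Described by the displacement from \<open>u0\<close>, so that translation by
  \<open>2*pi\<close> leaves the defining condition literally unchanged.\<close>

definition Y :: "real => real \<times> real => real" where
 "Y e z = u0 z + (THE v. abs v <= rr & G e (z, u0 z + v) = 0)"

lemma Y_unique:
 assumes e: "abs e <= e1" and z: "z : strip lo hi" and u: "abs (u - u0 z) <= rr" "G e (z, u) = 0"
 shows "Y e z = u" proof -
 have "(THE v. abs v <= rr & G e (z, u0 z + v) = 0) = u - u0 z" proof (rule the_equality)
  fix v assume v: "abs v <= rr & G e (z, u0 z + v) = 0"
  have "m*abs ((u0 z + v) - u) <= abs (G e (z, u0 z + v) - G e (z, u))"
   by (rule window_expand[OF e z]) (use u v in auto)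
  thus "v = u - u0 z" using v u m_pos by (simp add: mult_le_0_iff)
 qed (use u in auto)
 thus ?thesis by (simp add: Y_def)
qed

lemma Y_props:
 assumes e: "abs e <= e1" and z: "z : strip lo hi"
 shows "abs (Y e z - u0 z) <= rr/2" "G e (z, Y e z) = 0" proof -
 obtain u where u: "abs (u - u0 z) <= rr/2" "G e (z, u) = 0" using zero_exists[OF e z] by blast
 have "Y e z = u" by (rule Y_unique[OF e z _ u(2)]) (use u(1) rr in linarith)
 thus "abs (Y e z - u0 z) <= rr/2" "G e (z, Y e z) = 0" using u by simp_all
qed

lemma Y_window: "abs e <= e1 ==> z : strip lo hi ==> abs (Y e z - u0 z) <= rr"
 using Y_props(1)[of e z] rr by linarith

lemma Y_zero: "z : strip lo hi ==> Y 0 z = u0 z"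
 using Y_unique[of 0 z "u0 z"] pt_z(1)[of z 0] pt_z(2)[of z] G_zero[of "ps (snd z - fst z)" "fst z"] e1 rr by simp

lemma Y_per: assumes "abs e <= e1" shows "Y e (x + 2*pi, y + 2*pi) = Y e (x, y) + 2*pi" proof -
 have u: "u0 (x + 2*pi, y + 2*pi) = u0 (x, y) + 2*pi" by (simp add: u0_def)
 have e: "abs e <= e0" using assms e1 by simp
 have "G e ((x + 2*pi, y + 2*pi), u0 (x + 2*pi, y + 2*pi) + v) = G e ((x, y), u0 (x, y) + v)" for v proof -
  have "u0 (x, y) + 2*pi + v = (u0 (x, y) + v) + 2*pi" by simp
  thus ?thesis by (simp only: u G_per[OF e])
 qed
 thus ?thesis by (simp add: Y_def u)
qed

lemma u0_cont: "continuous_on (strip lo hi) u0" unfolding u0_def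
 by (intro continuous_intros continuous_on_compose2[OF ph_cont(1)] continuous_on_compose2[OF ps_cont])
  (use ps_mem in "auto simp: strip_def")

text \<open>For \<open>z\<close> close to \<open>zs\<close> the angle \<open>Y es zs\<close> still
  lies in the window of \<open>z\<close>, being within \<open>rr/2\<close> of the old center, and
  nearly solves the equation there; \<open>window_expand\<close> converts the residue into a
  distance.\<close>

lemma Y_cont: "continuous_on ({- e1..e1} \<times> strip lo hi) (%(e, z). Y e z)" unfolding continuous_on_iff
proof (intro ballI allI impI)
 fix p and ep :: real assume p: "p : {- e1..e1} \<times> strip lo hi" and ep: "ep > 0"
 obtain es zs where ps: "p = (es, zs)" "abs es <= e1" "zs : strip lo hi" using p by (auto simp: abs_le_iff)
 define y where "y = Y es zs"
 have y: "abs (y - u0 zs) <= rr/2" "G es (zs, y) = 0" unfolding y_def by (rule Y_props[OF ps(2,3)])+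
 have w: "(es, (zs, y)) : WG" by (rule window_WG[OF ps(2,3)]) (use y(1) rr in linarith)
 have "m*ep > 0" using m_pos ep by simp
 then obtain d1 where d10: "d1 > 0" "ALL w':WG. dist w' (es, (zs, y)) < d1 -->
   dist ((%(e, z). G e z) w') ((%(e, z). G e z) (es, (zs, y))) < m*ep"
  using G_cont[unfolded continuous_on_iff, rule_format, OF w, of "m*ep"] by blast
 have d1: "d1 > 0" "!!w'. w' : WG ==> dist w' (es, (zs, y)) < d1 ==> abs ((%(e, z). G e z) w') < m*ep"
  using d10 y(2) by (simp_all add: dist_real_def)
 have "rr/2 > 0" using rr by simp
 then obtain d2 where d2: "d2 > 0" "!!z. z : strip lo hi ==> dist z zs < d2 ==> abs (u0 z - u0 zs) < rr/2"
  using u0_cont[unfolded continuous_on_iff, rule_format, OF ps(3), of "rr/2"] by (auto simp: dist_real_def)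
 show "EX d>0. ALL q:{- e1..e1} \<times> strip lo hi. dist q p < d --> dist (case q of (e, z) => Y e z) (case p of (e, z) => Y e z) < ep"
 proof (intro exI[of _ "min d1 d2"] conjI ballI impI)
  fix q assume q: "q : {- e1..e1} \<times> strip lo hi" "dist q p < min d1 d2"
  obtain e z where ez: "q = (e, z)" "abs e <= e1" "z : strip lo hi" using q by (auto simp: abs_le_iff)
  have "dist z zs < d2" using q(2) dist_snd_le[of q p] by (simp add: ez ps)
  hence uw: "abs (y - u0 z) <= rr" using d2(2)[OF ez(3)] y(1) by linarith
  have "dist (e, (z, y)) (es, (zs, y)) = dist q p" by (simp add: ez ps dist_Pair_Pair)
  hence "abs (G e (z, y)) < m*ep" using d1(2)[OF window_WG[OF ez(2,3) uw]] q(2) by simp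
  moreover have "m*abs (y - Y e z) <= abs (G e (z, y) - G e (z, Y e z))"
   by (rule window_expand[OF ez(2,3) Y_window[OF ez(2,3)] uw])
  ultimately have "m*abs (y - Y e z) < m*ep" using Y_props(2)[OF ez(2,3)] by simp
  hence "abs (y - Y e z) < ep" using m_pos by simp
  thus "dist (case q of (e, z) => Y e z) (case p of (e, z) => Y e z) < ep"
   by (simp add: ez ps y_def[symmetric] dist_real_def abs_minus_commute)
 qed (use d1 d2 in simp)
qed

definition "Om = {z::real \<times> real. lo < snd z - fst z & snd z - fst z < hi}"

lemma open_Om: "open Om" unfolding Om_def by (intro open_Collect_conj open_Collect_less continuous_intros)

lemma Om_strip: "Om <= strip lo hi" by (auto simp: Om_def strip_def)

lemma DG_nz: "abs e <= e1 ==> z : strip lo hi ==> DG e (z, Y e z) (0, 1) ~= 0" proof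
 assume a: "abs e <= e1" "z : strip lo hi" and 0: "DG e (z, Y e z) (0, 1) = 0"
 have "m <= - si*DG e (z, Y e z) (0, 1)" by (rule window_slope[OF a Y_window[OF a]])
 thus False using m_pos by (simp add: 0)
qed

lemma Y_deriv:
 assumes e: "abs e <= e1" and z: "z : Om"
 shows "(Y e has_derivative (%k. - DG e (z, Y e z) (k, 0)/DG e (z, Y e z) (0, 1))) (at z)"
proof (rule implicit_derivative[where G = "G e"])
 have zs: "z : strip lo hi" using z Om_strip by auto
 have w: "(e, (z, Y e z)) : WG" by (rule window_WG[OF e zs Y_window[OF e zs]])
 note D = G_deriv[OF w]
 interpret bounded_linear "DG e (z, Y e z)" by (rule has_derivative_bounded_linear[OF D])
 have "DG e (z, Y e z) k = DG e (z, Y e z) (fst k, 0) + DG e (z, Y e z) (0, 1) * snd k" for k proof -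
  have "k = (fst k, 0) + snd k *\<^sub>R (0, 1)" by (simp add: prod_eq_iff)
  hence "DG e (z, Y e z) k = DG e (z, Y e z) ((fst k, 0) + snd k *\<^sub>R (0, 1))" by simp
  thus ?thesis unfolding add scaleR by simp
 qed
 hence "DG e (z, Y e z) = (%k. DG e (z, Y e z) (fst k, 0) + DG e (z, Y e z) (0, 1) * snd k)" by blast
 thus "(G e has_derivative (%k. DG e (z, Y e z) (fst k, 0) + DG e (z, Y e z) (0, 1) * snd k)) (at (z, Y e z))"
  using D by simp
 show "DG e (z, Y e z) (0, 1) ~= 0" by (rule DG_nz[OF e zs])
 show "bounded_linear (%k. DG e (z, Y e z) (k, 0))"
  by (rule bounded_linear_compose[OF bounded_linear_axioms]) (intro bounded_linear_Pair bounded_linear_ident bounded_linear_zero)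
 have "continuous_on Om (%z. (%(e, z). Y e z) (e, z))"
  by (rule continuous_on_compose2[OF Y_cont]) (use e Om_strip in "auto intro!: continuous_intros simp: abs_le_iff")
 thus "isCont (Y e) z" using z by (simp add: continuous_on_eq_continuous_at[OF open_Om])
 have "\<forall>\<^sub>F z in nhds z. z : Om" using open_Om z by (rule eventually_nhds_in_open)
 thus "\<forall>\<^sub>F z in nhds z. G e (z, Y e z) = 0" by eventually_elim (use Y_props(2)[OF e] Om_strip in auto)
qed

lemma C1_Y: "C1_on ({- e1..e1} \<times> Om) Y"
proof (rule C1_onI[where F' = "%e z k. - DG e (z, Y e z) (k, 0)/DG e (z, Y e z) (0, 1)"])
 let ?W = "{- e1..e1} \<times> Om"
 have W: "abs e <= e1 & z : Om & z : strip lo hi" if "(e, z) : ?W" for e z using that Om_strip by (auto simp: abs_le_iff)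
 show "(Y e has_derivative (%k. - DG e (z, Y e z) (k, 0)/DG e (z, Y e z) (0, 1))) (at z)" if "(e, z) : ?W" for e z
  using Y_deriv W[OF that] by blast
 show c: "continuous_on ?W (%(e, z). Y e z)" by (rule continuous_on_subset[OF Y_cont]) (use Om_strip in auto)
 have cp: "continuous_on ?W (%p. (fst p, (snd p, Y (fst p) (snd p))))"
  using c by (auto intro!: continuous_intros simp: case_prod_unfold)
 have im: "(%p. (fst p, (snd p, Y (fst p) (snd p)))) ` ?W <= WG" using W window_WG[OF _ _ Y_window] by auto
 have cd: "continuous_on ?W (%p. DG (fst p) (snd p, Y (fst p) (snd p)) k)" for k
  using continuous_on_compose2[OF DG_cont[of k] cp im] by simp
 show "continuous_on ?W (%(e, z). - DG e (z, Y e z) (k, 0)/DG e (z, Y e z) (0, 1))" for k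
  unfolding case_prod_unfold by (intro continuous_on_divide continuous_on_minus cd ballI) (use W DG_nz in force)
qed

definition "Aa e z = p1 e (fst z, Y e z)"
definition "Bb e z = q2 e (Y e z, snd z)"
definition "Sg e z = G_E om En (RE e (fst z, Y e z)) (PE e (fst z, Y e z)) + G_I H mu (RI e (Y e z, snd z)) (PI e (Y e z, snd z))"

lemma Y_WE: "abs e <= e1 ==> z : strip lo hi ==> (e, (fst z, Y e z)) : WE"
 and Y_WI: "abs e <= e1 ==> z : strip lo hi ==> (e, (Y e z, snd z)) : WI"
 using window_WG[OF _ _ Y_window, of e z] by (simp_all add: WG_def)

lemma C1_Aa: "C1_on ({- e1..e1} \<times> Om) Aa" and C1_Bb: "C1_on ({- e1..e1} \<times> Om) Bb" proof -
 have "C1_on ({- e1..e1} \<times> Om) (%e z. p1 e (fst z, Y e z))"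
  by (rule C1_on_compose_pair[OF C1_p1 C1_fst C1_Y]) (rule Y_WE, use Om_strip in "auto simp: abs_le_iff")
 thus "C1_on ({- e1..e1} \<times> Om) Aa" unfolding Aa_def[abs_def] .
 have "C1_on ({- e1..e1} \<times> Om) (%e z. q2 e (Y e z, snd z))"
  by (rule C1_on_compose_pair[OF C1_q2 C1_Y C1_snd]) (rule Y_WI, use Om_strip in "auto simp: abs_le_iff")
 thus "C1_on ({- e1..e1} \<times> Om) Bb" unfolding Bb_def[abs_def] .
qed

text \<open>The derivative of \<open>Y\<close> enters only multiplied by \<open>G\<close>, which
  vanishes at the crossing.\<close>

lemma Sg_deriv:
 assumes e: "abs e <= e1" and z: "z : Om"
 shows "(Sg e has_derivative (%k. Aa e z*fst k + Bb e z * snd k)) (at z)" proof -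
 have zs: "z : strip lo hi" using z Om_strip by auto
 obtain Y' where Y': "(Y e has_derivative Y') (at z)" using Y_deriv[OF e z] by blast
 have "((%z. G_E om En (RE e (fst z, Y e z)) (PE e (fst z, Y e z))) has_derivative
   (%k. p1 e (fst z, Y e z)*fst (fst k, Y' k) + p2 e (fst z, Y e z) * snd (fst k, Y' k))) (at z)"
  by (rule has_derivative_compose[OF has_derivative_Pair[OF has_derivative_fst[OF has_derivative_ident] Y'] S_E_deriv[OF Y_WE[OF e zs]]])
 moreover have "((%z. G_I H mu (RI e (Y e z, snd z)) (PI e (Y e z, snd z))) has_derivative
   (%k. q1 e (Y e z, snd z)*fst (Y' k, snd k) + q2 e (Y e z, snd z) * snd (Y' k, snd k))) (at z)"
  by (rule has_derivative_compose[OF has_derivative_Pair[OF Y' has_derivative_snd[OF has_derivative_ident]] S_I_deriv[OF Y_WI[OF e zs]]])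
 ultimately have "(Sg e has_derivative (%k. (p1 e (fst z, Y e z)*fst k + p2 e (fst z, Y e z)*Y' k) + (q1 e (Y e z, snd z)*Y' k + q2 e (Y e z, snd z) * snd k))) (at z)"
  unfolding Sg_def[abs_def] by (auto dest: has_derivative_add)
 moreover have "(p1 e (fst z, Y e z)*fst k + p2 e (fst z, Y e z)*Y' k) + (q1 e (Y e z, snd z)*Y' k + q2 e (Y e z, snd z) * snd k)
   = Aa e z*fst k + Bb e z * snd k + G e (z, Y e z)*Y' k" for k
  by (simp add: Aa_def Bb_def G_def algebra_simps)
 ultimately show ?thesis by (simp add: Y_props(2)[OF e zs])
qed

lemma family_per:
 assumes "abs e <= e1"
 shows "Aa e (x + 2*pi, y + 2*pi) = Aa e (x, y)" "Bb e (x + 2*pi, y + 2*pi) = Bb e (x, y)"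
  "Sg e (x + 2*pi, y + 2*pi) = Sg e (x, y)" proof -
 have e: "abs e <= e0" using assms e1 by simp
 show "Aa e (x + 2*pi, y + 2*pi) = Aa e (x, y)" "Bb e (x + 2*pi, y + 2*pi) = Bb e (x, y)"
  "Sg e (x + 2*pi, y + 2*pi) = Sg e (x, y)"
  by (simp_all add: Aa_def Bb_def Sg_def Y_per[OF assms] pq_per[OF e])
qed

text \<open>For the circle both partial derivatives are, up to sign, the action belonging to the
  given shift; this is the source of the model \<open>g\<close> in
  \<open>near_integrable\<close>.\<close>

lemma AB_zero:
 assumes z: "z : strip lo hi"
 shows "Aa 0 z = - ps (snd z - fst z)" "Bb 0 z = ps (snd z - fst z)" proof -
 define I where "I = ps (snd z - fst z)"
 have D: "snd z - fst z : {lo..hi}" using z by (simp add: strip_def)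
 have I: "I : {a'..b'}" "th I = snd z - fst z" unfolding I_def by (rule ps_mem[OF D], rule th_ps[OF D])
 note ph = phi_inverse[OF K4 J_crit[OF I(1)]]
 have Y: "Y 0 z - fst z = phE I" "snd z - Y 0 z = phI I"
  using I(2) th_split[of I] by (simp_all add: Y_zero[OF z] u0_def I_def)
 show "Aa 0 z = - ps (snd z - fst z)" "Bb 0 z = ps (snd z - fst z)"
  using ph by (simp_all add: Aa_def Bb_def unperturbed Y I_def[symmetric])
qed

end

section \<open>Identification of the return map\<close>

context slope begin

definition "al = min (th a) (th b)"
definition "be = max (th a) (th b)"


lemma al_be: "lo < al" "al < be" "be < hi"
 using th_inc[of a' a] th_inc[of a b] th_inc[of b b'] ord si by (auto simp: al_def be_def lo_def hi_def)

lemma action_iff: "al < D & D < be \<longleftrightarrow> D : {lo..hi} & a < ps D & ps D < b" proof -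
 have mono: "si*th x < si*th y \<longleftrightarrow> x < y" if "x : {a'..b'}" "y : {a'..b'}" for x y
  using th_inc[of x y] th_inc[of y x] that by (cases x y rule: linorder_cases) auto
 have "al < D & D < be \<longleftrightarrow> a < ps D & ps D < b" if D: "D : {lo..hi}" proof -
  have m: "ps D : {a'..b'}" "a : {a'..b'}" "b : {a'..b'}" using ps_mem[OF D] ord by auto
  have "a < ps D & ps D < b \<longleftrightarrow> si*th a < si*D & si*D < si*th b"
   using mono[OF m(2,1)] mono[OF m(1,3)] th_ps[OF D] by simp
  moreover have "si*th a < si*th b" using th_inc[of a b] ord by simp
  ultimately show ?thesis using si by (auto simp: al_def be_def)
 qed
 moreover have "D : {lo..hi}" if "al < D" "D < be" using that al_be by auto
 ultimately show ?thesis by blast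
qed

lemma action_unique: "I : {a<..<b} ==> th I = D ==> al < D & D < be & I = ps D" proof -
 assume I: "I : {a<..<b}" "th I = D"
 hence J: "I : {a'..b'}" using ord by auto
 have "D : {lo..hi}" using th_image J I(2) by blast
 moreover have "I = ps D" using ps_th[OF J] I(2) by simp
 ultimately show ?thesis using action_iff I(1) by auto
qed

lemma window_strict:
 assumes "z : strip lo hi" "abs (u - u0 z) <= rr"
 shows "abs (u - fst z) <= pi - 2*de" "abs (snd z - u) <= 2*pi - 2*de" proof -
 define I where "I = ps (snd z - fst z)"
 have D: "snd z - fst z : {lo..hi}" using assms(1) by (simp add: strip_def)
 have I: "I : {a'..b'}" "th I = snd z - fst z" unfolding I_def by (rule ps_mem[OF D], rule th_ps[OF D])
 have "u0 z = fst z + phE I" "snd z = u0 z + phI I" using I(2) th_split[of I] by (simp_all add: u0_def I_def)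
 thus "abs (u - fst z) <= pi - 2*de" "abs (snd z - u) <= 2*pi - 2*de"
  using phi_bound[of I] I(1) assms(2) rr by auto
qed

lemma near_window:
 assumes "abs e <= e1" "z : strip lo hi" "abs (u - u0 z) <= rr" "x : ball u de"
 shows "(e, (fst z, x)) : WE" "(e, (x, snd z)) : WI"
 using window_strict[OF assms(2,3)] assms(1,4) e1 by (auto simp: WE_iff WI_iff dist_real_def)

lemma length_DERIV:
 assumes e: "abs e <= e1" and z: "z : strip lo hi" and u: "abs (u - u0 z) <= rr"
 shows "((%x. S_E om En f e (fst z) x + S_I En h mu f e x (snd z)) has_real_derivative G e (z, u)) (at u)"
proof -
 have ub: "u : ball u de" using de by simp
 note W = near_window[OF e z u]
 have dE: "((%x. (fst z, x)) has_derivative (%k. (0, k))) (at u)" by (auto intro!: derivative_eq_intros)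
 have dI: "((%x. (x, snd z)) has_derivative (%k. (k, 0))) (at u)" by (auto intro!: derivative_eq_intros)
 have "((%x. G_E om En (RE e (fst z, x)) (PE e (fst z, x)) + G_I H mu (RI e (x, snd z)) (PI e (x, snd z))) has_derivative
   (%k. (p1 e (fst z, u)*fst (0, k) + p2 e (fst z, u) * snd (0 :: real, k)) + (q1 e (u, snd z)*fst (k, 0 :: real) + q2 e (u, snd z) * snd (k, 0)))) (at u)"
  by (rule has_derivative_add[OF has_derivative_compose[OF dE S_E_deriv[OF W(1)[OF ub]]] has_derivative_compose[OF dI S_I_deriv[OF W(2)[OF ub]]]])
 hence "((%x. G_E om En (RE e (fst z, x)) (PE e (fst z, x)) + G_I H mu (RI e (x, snd z)) (PI e (x, snd z))) has_real_derivative G e (z, u)) (at u)"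
  unfolding has_field_derivative_def by (rule has_derivative_eq_rhs) (simp add: fun_eq_iff G_def algebra_simps)
 thus ?thesis proof (rule has_field_derivative_transform_within_open[of _ _ _ "ball u de"])
  fix x assume "x : ball u de"
  from S_E_eq[OF W(1)[OF this]] S_I_eq[OF W(2)[OF this]]
  show "G_E om En (RE e (fst z, x)) (PE e (fst z, x)) + G_I H mu (RI e (x, snd z)) (PI e (x, snd z))
    = S_E om En f e (fst z) x + S_I En h mu f e x (snd z)" by simp
 qed (use ub in auto)
qed

lemma stationary_iff:
 assumes e: "abs e <= e1" and z: "z : strip lo hi" and u: "abs (u - u0 z) <= rr"
 shows "stationary om En h mu f e (fst z) (snd z) u \<longleftrightarrow> u = Y e z" proof -
 have "\<forall>\<^sub>F x in nhds u. x : ball u de" using de by (intro eventually_nhds_in_open) auto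
 hence ev: "\<forall>\<^sub>F x in nhds u. (EX! l. is_S_E om En f e (fst z) x l) & (EX! l. is_S_I En h mu f e x (snd z) l)"
 proof eventually_elim
  case (elim x)
  from near_window[OF e z u elim] show ?case by (auto simp: WE_iff WI_iff intro!: ex1_S_E ex1_S_I)
 qed
 have "stationary om En h mu f e (fst z) (snd z) u \<longleftrightarrow> G e (z, u) = 0"
  unfolding stationary_def using ev length_DERIV[OF e z u] DERIV_unique by metis
 also have "... \<longleftrightarrow> u = Y e z" using Y_unique[OF e z u] Y_props(2)[OF e z] by auto
 finally show ?thesis .
qed

text \<open>A continuation starts at \<open>u0\<close> and, while in the window, coincides with
  \<open>Y\<close>, which stays within \<open>rr/2\<close> of \<open>u0\<close>. By continuity it
  can never reach the distance \<open>rr\<close> and leave the window.\<close>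

lemma is_crossing_iff:
 assumes e: "abs e <= e1"
 shows "is_crossing om En h mu a b f e x0 x1 y \<longleftrightarrow> al < x1 - x0 & x1 - x0 < be & y = Y e (x0, x1)"
proof
 assume R: "al < x1 - x0 & x1 - x0 < be & y = Y e (x0, x1)"
 define I where "I = ps (x1 - x0)"
 have D: "x1 - x0 : {lo..hi}" "a < I" "I < b" using action_iff[of "x1 - x0"] R by (auto simp: I_def)
 have z: "(x0, x1) : strip lo hi" using D(1) by (simp add: strip_def)
 have seg: "abs t <= e1" if "t : closed_segment 0 e" for t
  using that e by (auto simp: closed_segment_eq_real_ivl split: if_splits)
 show "is_crossing om En h mu a b f e x0 x1 y" unfolding is_crossing_def
 proof (intro exI[of _ I] exI[of _ "%t. Y t (x0, x1)"] conjI ballI)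
  show "I : {a<..<b}" using D by simp
  show "th I = x1 - x0" unfolding I_def by (rule th_ps[OF D(1)])
  show "Y e (x0, x1) = y" using R by simp
  show "Y 0 (x0, x1) = x0 + phE I" unfolding Y_zero[OF z] by (simp add: u0_def I_def)
  have "continuous_on (closed_segment 0 e) (%t. (%(e, z). Y e z) (t, (x0, x1)))"
  proof (rule continuous_on_compose2[OF Y_cont])
   show "(%t. (t, (x0, x1))) ` closed_segment 0 e <= {- e1..e1} \<times> strip lo hi"
   proof (rule image_subsetI)
    fix t assume "t : closed_segment 0 e"
    from seg[OF this] show "(t, (x0, x1)) : {- e1..e1} \<times> strip lo hi" using z by auto
   qed
  qed (intro continuous_intros)
  thus "continuous_on (closed_segment 0 e) (%t. Y t (x0, x1))" by simp
  fix t assume "t : closed_segment 0 e"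
  thus "stationary om En h mu f t x0 x1 (Y t (x0, x1))"
   using stationary_iff[OF seg z Y_window[OF seg z], of t t] by simp
 qed
next
 assume "is_crossing om En h mu a b f e x0 x1 y"
 then obtain I c where I: "I : {a<..<b}" "th I = x1 - x0" and c: "continuous_on (closed_segment 0 e) c"
  "c 0 = x0 + phE I" "c e = y" "!!t. t : closed_segment 0 e ==> stationary om En h mu f t x0 x1 (c t)"
  unfolding is_crossing_def by blast
 note a = action_unique[OF I]
 have z: "(x0, x1) : strip lo hi" using a action_iff[of "x1 - x0"] by (simp add: strip_def)
 have u: "u0 (x0, x1) = x0 + phE I" using a by (simp add: u0_def)
 have seg: "abs t <= e1" if "t : closed_segment 0 e" for t
  using that e by (auto simp: closed_segment_eq_real_ivl split: if_splits)
 let ?d = "%t. abs (c t - u0 (x0, x1))"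
 have "?d e < rr" proof (rule ccontr)
  assume "~ ?d e < rr"
  moreover have "connected (?d ` closed_segment 0 e)"
   by (intro connected_continuous_image continuous_intros c(1) connected_segment)
  moreover have "?d 0 : ?d ` closed_segment 0 e" "?d e : ?d ` closed_segment 0 e" by auto
  moreover have "?d 0 = 0" using c(2) u by simp
  ultimately have "rr : ?d ` closed_segment 0 e"
   using connected_contains_Icc[of "?d ` closed_segment 0 e" "?d 0" "?d e"] rr by (auto simp: subset_iff)
  then obtain t where t: "t : closed_segment 0 e" "rr = ?d t" by auto
  hence "c t = Y t (x0, x1)" using stationary_iff[OF seg[OF t(1)] z, of "c t"] c(4)[OF t(1)] by simp
  thus False using Y_props(1)[OF seg[OF t(1)] z] t(2) rr by simp
 qed
 hence "y = Y e (x0, x1)" using stationary_iff[OF e z, of "c e"] c(3) c(4)[OF ends_in_segment(2)] by simp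
 thus "al < x1 - x0 & x1 - x0 < be & y = Y e (x0, x1)" using a by simp
qed

lemma S_gen_eq:
 assumes e: "abs e <= e1" and D: "al < x1 - x0" "x1 - x0 < be"
 shows "S_gen om En h mu a b f e x0 x1 = Sg e (x0, x1)" proof -
 have c: "crossing om En h mu a b f e x0 x1 = Y e (x0, x1)"
  unfolding crossing_def is_crossing_iff[OF e] using D by (intro the_equality) auto
 have z: "(x0, x1) : strip lo hi" using D al_be by (simp add: strip_def)
 show ?thesis unfolding S_gen_def c Sg_def using S_E_eq[OF Y_WE[OF e z]] S_I_eq[OF Y_WI[OF e z]] by simp
qed

text \<open>Existence of crossings for all nearby endpoints confines the step to the open interval
  \<open>(al, be)\<close>; there \<open>S_gen\<close> agrees with \<open>Sg\<close> nearby and can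
  be differentiated.\<close>

lemma generates_iff:
 assumes e: "abs e <= e1"
 shows "generates om En h mu a b f e p q \<longleftrightarrow> al < fst q - fst p & fst q - fst p < be &
  snd p = - Aa e (fst p, fst q) & snd q = Bb e (fst p, fst q)" proof -
 let ?O = "{z::real \<times> real. al < snd z - fst z & snd z - fst z < be}"
 have opn: "open ?O" by (intro open_Collect_conj open_Collect_less continuous_intros)
 have ex1: "(EX! y. is_crossing om En h mu a b f e x0 x1 y) \<longleftrightarrow> (x0, x1) : ?O" for x0 x1
  unfolding is_crossing_iff[OF e] by auto
 have ev: "(\<forall>\<^sub>F r in nhds (fst p, fst q). EX! y. is_crossing om En h mu a b f e (fst r) (snd r) y) \<longleftrightarrow> (fst p, fst q) : ?O"
 proof
  assume "\<forall>\<^sub>F r in nhds (fst p, fst q). EX! y. is_crossing om En h mu a b f e (fst r) (snd r) y"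
  from eventually_nhds_x_imp_x[OF this] show "(fst p, fst q) : ?O" unfolding ex1 by simp
 next
  assume "(fst p, fst q) : ?O"
  with opn have "\<forall>\<^sub>F r in nhds (fst p, fst q). r : ?O" by (rule eventually_nhds_in_open)
  thus "\<forall>\<^sub>F r in nhds (fst p, fst q). EX! y. is_crossing om En h mu a b f e (fst r) (snd r) y"
   unfolding ex1 by simp
 qed
 have der: "((%x. S_gen om En h mu a b f e x (fst q)) has_real_derivative Aa e (fst p, fst q)) (at (fst p))"
  "((%x. S_gen om En h mu a b f e (fst p) x) has_real_derivative Bb e (fst p, fst q)) (at (fst q))"
  if D: "(fst p, fst q) : ?O" proof -
  have z: "(fst p, fst q) : Om" using D al_be by (auto simp: Om_def)
  have d1: "((%x. (x, fst q)) has_derivative (%k. (k, 0))) (at (fst p))"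
   and d2: "((%x. (fst p, x)) has_derivative (%k. (0, k))) (at (fst q))" by (auto intro!: derivative_eq_intros)
  have "((%x. Sg e (x, fst q)) has_real_derivative Aa e (fst p, fst q)) (at (fst p))"
   unfolding has_field_derivative_def
   by (rule has_derivative_eq_rhs[OF has_derivative_compose[OF d1 Sg_deriv[OF e z]]]) (simp add: fun_eq_iff)
  thus "((%x. S_gen om En h mu a b f e x (fst q)) has_real_derivative Aa e (fst p, fst q)) (at (fst p))"
   by (rule has_field_derivative_transform_within_open[of _ _ _ "{fst q - be<..<fst q - al}"])
    (use D in "auto simp: S_gen_eq[OF e]")
  have "((%x. Sg e (fst p, x)) has_real_derivative Bb e (fst p, fst q)) (at (fst q))"
   unfolding has_field_derivative_def
   by (rule has_derivative_eq_rhs[OF has_derivative_compose[OF d2 Sg_deriv[OF e z]]]) (simp add: fun_eq_iff)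
  thus "((%x. S_gen om En h mu a b f e (fst p) x) has_real_derivative Bb e (fst p, fst q)) (at (fst q))"
   by (rule has_field_derivative_transform_within_open[of _ _ _ "{fst p + al<..<fst p + be}"])
    (use D in "auto simp: S_gen_eq[OF e]")
 qed
 show ?thesis proof (cases "(fst p, fst q) : ?O")
  case True
  have "((%x. S_gen om En h mu a b f e x (fst q)) has_real_derivative - snd p) (at (fst p)) \<longleftrightarrow> snd p = - Aa e (fst p, fst q)"
  proof
   assume "((%x. S_gen om En h mu a b f e x (fst q)) has_real_derivative - snd p) (at (fst p))"
   from DERIV_unique[OF this der(1)[OF True]] show "snd p = - Aa e (fst p, fst q)" by linarith
  next
   assume "snd p = - Aa e (fst p, fst q)"
   hence "- snd p = Aa e (fst p, fst q)" by linarith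
   with der(1)[OF True] show "((%x. S_gen om En h mu a b f e x (fst q)) has_real_derivative - snd p) (at (fst p))"
    by (simp only:)
  qed
  moreover have "((%x. S_gen om En h mu a b f e (fst p) x) has_real_derivative snd q) (at (fst q)) \<longleftrightarrow> snd q = Bb e (fst p, fst q)"
  proof
   assume "((%x. S_gen om En h mu a b f e (fst p) x) has_real_derivative snd q) (at (fst q))"
   from DERIV_unique[OF this der(2)[OF True]] show "snd q = Bb e (fst p, fst q)" .
  next
   assume "snd q = Bb e (fst p, fst q)"
   with der(2)[OF True] show "((%x. S_gen om En h mu a b f e (fst p) x) has_real_derivative snd q) (at (fst q))"
    by (simp only:)
  qed
  ultimately show ?thesis unfolding generates_def ev using True by simp
 next
  case False
  thus ?thesis unfolding generates_def ev by auto
 qed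
qed

end

section \<open>Orbits of the return map\<close>

context slope begin

text \<open>Multiplication by \<open>si\<close> makes the model \<open>si*ps\<close> increasing
  whatever the direction of the twist.\<close>

abbreviation "twist_generator e == near_integrable (%x y. si*Sg e (x, y)) (%x y. si*Aa e (x, y))
 (%x y. si*Bb e (x, y)) (%d. si*ps d) al be"
abbreviation "stationary_path e == near_integrable.stationary_at (%x y. si*Aa e (x, y)) (%x y. si*Bb e (x, y))"

text \<open>The inverse of \<open>th\<close> grows at least at the rate \<open>1/L\<close>, with
  \<open>L\<close> the maximum of \<open>si*theta'\<close> on \<open>[a', b']\<close>.\<close>

lemma ps_expanding:
 obtains cc where "cc > 0" "!!d d'. lo <= d ==> d <= d' ==> d' <= hi ==> cc*(d' - d) <= si*ps d' - si*ps d"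
proof -
 have "continuous_on {a'..b'} (theta' om En h mu K H)"
  by (rule continuous_on_subset[OF theta'_continuous[OF K4]]) (use ord in auto)
 from continuous_attains_sup[OF compact_Icc _ continuous_on_mult[OF continuous_on_const[of _ si] this]] ord
 obtain x where x: "x : {a'..b'}" "!!y. y : {a'..b'} ==> si*theta' om En h mu K H y <= si*theta' om En h mu K H x" by auto
 define L where "L = si*theta' om En h mu K H x"
 have L: "L > 0" using theta'_pos x(1) by (simp add: L_def)
 have main: "d' - d <= L*(si*ps d' - si*ps d)" if d: "lo <= d" "d <= d'" "d' <= hi" for d d' proof -
  have J: "ps d : {a'..b'}" "ps d' : {a'..b'}" "th (ps d) = d" "th (ps d') = d'" using d ps_mem th_ps by auto
  have mv: "si*th v - si*th u <= L*(v - u)" if u: "u : {a'..b'}" "v : {a'..b'}" "u <= v" for u v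
  proof (cases "u = v")
   case False
   hence uv: "u < v" using u by simp
   have "((%t. si*th t) has_real_derivative si*theta' om En h mu K H t) (at t)" if "u <= t" "t <= v" for t
    by (rule DERIV_cmult[OF th_deriv]) (use that u in auto)
   from MVT2[OF uv this] obtain t where t: "u < t" "t < v" "si*th v - si*th u = (v - u)*(si*theta' om En h mu K H t)" by blast
   have "si*theta' om En h mu K H t <= L" unfolding L_def by (rule x(2)) (use t u in auto)
   hence "(v - u)*(si*theta' om En h mu K H t) <= (v - u)*L" using uv by (intro mult_left_mono) auto
   thus ?thesis unfolding t(3) by (simp add: mult.commute)
  qed simp
  have inc: "u < v ==> u : {a'..b'} ==> v : {a'..b'} ==> si*th u < si*th v" for u v using th_inc[of u v] by auto
  show ?thesis proof (cases "si = 1")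
   case True
   have "ps d <= ps d'" using inc[OF _ J(2,1)] J(3,4) d(2) True by (metis linorder_not_less mult_1)
   from mv[OF J(1,2) this] show ?thesis using J True by simp
  next
   case False
   hence s: "si = -1" using si by simp
   have "ps d' <= ps d" proof (rule ccontr)
    assume "~ ?thesis"
    thus False using inc[OF _ J(1,2)] J(3,4) d(2) s by simp
   qed
   from mv[OF J(2,1) this] show ?thesis using J s by simp
  qed
 qed
 show ?thesis proof (rule that[of "1/L"])
  show "1/L > 0" using L by simp
  fix d d' assume "lo <= d" "d <= d'" "d' <= hi"
  from main[OF this] show "1/L*(d' - d) <= si*ps d' - si*ps d" using L by (simp add: pos_divide_le_eq mult.commute)
 qed
qed

text \<open>The initial action of a step is minus the derivative of the generating function in its
  first angle.\<close>

definition "orbit e x k = (x k, - Aa e (x k, x (Suc k)))"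

lemma Aa_inj:
 assumes ni: "twist_generator e cc et"
  and y: "al <= y - x" "y - x <= be" "al <= y' - x" "y' - x <= be" "Aa e (x, y) = Aa e (x, y')"
 shows "y = y'" proof (cases y y' rule: linorder_cases)
 case less
 thus ?thesis using near_integrable.a_decreasing[OF ni, of y x y'] y by simp
next
 case greater
 thus ?thesis using near_integrable.a_decreasing[OF ni, of y' x y] y by simp
qed

context
 fixes cc :: real
 assumes cc: "cc > 0" "!!d d'. lo <= d ==> d <= d' ==> d' <= hi ==> cc*(d' - d) <= si*ps d' - si*ps d"
begin

lemma near_integrable_small:
 assumes et: "0 < et" "et < cc"
 shows "EX e2>0. e2 <= e1 & (ALL e. abs e < e2 --> twist_generator e cc et)" proof -
 have sub: "strip al be <= Om" using al_be by (auto simp: strip_def Om_def)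
 have CA: "C1_on ({- e1..e1} \<times> strip al be) Aa" and CB: "C1_on ({- e1..e1} \<times> strip al be) Bb"
  using sub by (auto intro: C1_on_subset[OF C1_Aa] C1_on_subset[OF C1_Bb])
 have perA: "Aa e (x + 2*pi, y + 2*pi) = Aa e (x, y)" "Bb e (x + 2*pi, y + 2*pi) = Bb e (x, y)" if "e : {- e1..e1}" for e x y
  using family_per[of e x y] that by (auto simp: abs_le_iff)
 obtain d1 where d1: "d1 > 0" "ALL e. e : {- e1..e1} & abs e < d1 -->
   (ALL z:strip al be. abs (Aa e z - Aa 0 z) <= et) &
   (ALL z:strip al be. ALL z':strip al be. abs ((Aa e z' - Aa 0 z') - (Aa e z - Aa 0 z)) <= et*(abs (fst z' - fst z) + abs (snd z' - snd z)))"
  using C1_uniform[OF CA e1(1) et(1) perA(1)] by blast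
 obtain d2 where d2: "d2 > 0" "ALL e. e : {- e1..e1} & abs e < d2 -->
   (ALL z:strip al be. abs (Bb e z - Bb 0 z) <= et) &
   (ALL z:strip al be. ALL z':strip al be. abs ((Bb e z' - Bb 0 z') - (Bb e z - Bb 0 z)) <= et*(abs (fst z' - fst z) + abs (snd z' - snd z)))"
  using C1_uniform[OF CB e1(1) et(1) perA(2)] by blast
 have abssi: "abs (si*t) = abs t" for t using si by auto
 show ?thesis proof (intro exI[of _ "min e1 (min d1 d2)"] conjI allI impI)
  show "0 < min e1 (min d1 d2)" "min e1 (min d1 d2) <= e1" using e1 d1(1) d2(1) by auto
  fix e assume e: "abs e < min e1 (min d1 d2)"
  hence ee: "abs e <= e1" "e : {- e1..e1}" "abs e < d1" "abs e < d2" by auto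
  have A: "abs (Aa e z - Aa 0 z) <= et" if "z : strip al be" for z using d1(2) ee that by blast
  have AL: "abs ((Aa e z' - Aa 0 z') - (Aa e z - Aa 0 z)) <= et*(abs (fst z' - fst z) + abs (snd z' - snd z))"
   if "z : strip al be" "z' : strip al be" for z z' using d1(2) ee that by blast
  have B: "abs (Bb e z - Bb 0 z) <= et" if "z : strip al be" for z using d2(2) ee that by blast
  have BL: "abs ((Bb e z' - Bb 0 z') - (Bb e z - Bb 0 z)) <= et*(abs (fst z' - fst z) + abs (snd z' - snd z))"
   if "z : strip al be" "z' : strip al be" for z z' using d2(2) ee that by blast
  have st: "(x, y) : strip al be" if "al <= y - x" "y - x <= be" for x y using that by (simp add: strip_def)
  have zero: "Aa 0 (x, y) = - ps (y - x)" "Bb 0 (x, y) = ps (y - x)" if "al <= y - x" "y - x <= be" for x y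
   using AB_zero[of "(x, y)"] sub Om_strip st[OF that] by auto
  show "twist_generator e cc et" proof
   show "0 < cc" "0 <= et" "et < cc" using cc et by auto
   show "continuous_on {al..be} (%d. si*ps d)"
    by (intro continuous_intros continuous_on_subset[OF ps_cont]) (use al_be in auto)
   show "cc*(d' - d) <= si*ps d' - si*ps d" if "al <= d" "d <= d'" "d' <= be" for d d'
    using cc(2)[of d d'] that al_be by simp
   fix x y assume xy: "al <= y - x" "y - x <= be"
   note z = st[OF xy]
   show "si*Sg e (x + 2*pi, y + 2*pi) = si*Sg e (x, y)" using family_per(3)[OF ee(1)] by simp
   have "(Sg e has_derivative (%k. Aa e (x, y)*fst k + Bb e (x, y) * snd k)) (at (x, y))"
    using Sg_deriv[OF ee(1)] z sub by auto
   from has_derivative_mult_right[OF this, of si]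
   show "((%(x, y). si*Sg e (x, y)) has_derivative (%(u, v). si*Aa e (x, y)*u + si*Bb e (x, y) * v)) (at (x, y))"
    by (simp add: case_prod_unfold algebra_simps)
   have "si*Aa e (x, y) + si*ps (y - x) = si*(Aa e (x, y) - Aa 0 (x, y))" by (simp add: zero[OF xy] algebra_simps)
   thus "abs (si*Aa e (x, y) + si*ps (y - x)) <= et" using A[OF z] by (simp only: abssi)
   have "si*Bb e (x, y) - si*ps (y - x) = si*(Bb e (x, y) - Bb 0 (x, y))" by (simp add: zero[OF xy] algebra_simps)
   thus "abs (si*Bb e (x, y) - si*ps (y - x)) <= et" using B[OF z] by (simp only: abssi)
   fix x' y' assume xy': "al <= y' - x'" "y' - x' <= be"
   note z' = st[OF xy']
   have "(si*Aa e (x', y') + si*ps (y' - x')) - (si*Aa e (x, y) + si*ps (y - x))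
     = si*((Aa e (x', y') - Aa 0 (x', y')) - (Aa e (x, y) - Aa 0 (x, y)))" by (simp add: zero[OF xy] zero[OF xy'] algebra_simps)
   thus "abs ((si*Aa e (x', y') + si*ps (y' - x')) - (si*Aa e (x, y) + si*ps (y - x))) <= et*(abs (x' - x) + abs (y' - y))"
    using AL[OF z z'] by (simp only: abssi fst_conv snd_conv)
   have "(si*Bb e (x', y') - si*ps (y' - x')) - (si*Bb e (x, y) - si*ps (y - x))
     = si*((Bb e (x', y') - Bb 0 (x', y')) - (Bb e (x, y) - Bb 0 (x, y)))" by (simp add: zero[OF xy] zero[OF xy'] algebra_simps)
   thus "abs ((si*Bb e (x', y') - si*ps (y' - x')) - (si*Bb e (x, y) - si*ps (y - x))) <= et*(abs (x' - x) + abs (y' - y))"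
    using BL[OF z z'] by (simp only: abssi fst_conv snd_conv)
  qed
 qed
qed

text \<open>A margin \<open>mg\<close> for the step becomes a margin \<open>cc*mg\<close> for the
  action, which absorbs the error \<open>et\<close> and keeps orbits in
  \<open>[a, b]\<close>.\<close>

lemma action_margin:
 assumes D: "al + mg <= D" "D <= be - mg" "mg >= 0"
 shows "a + cc*mg <= ps D" "ps D <= b - cc*mg" proof -
 have J: "a : {a'..b'}" "b : {a'..b'}" using ord by auto
 have ab: "si*th a < si*th b" using th_inc[of a b] ord by simp
 have 1: "cc*(D - al) <= si*ps D - si*ps al" "cc*(be - D) <= si*ps be - si*ps D"
  using D al_be by (auto intro!: cc(2))
 have 2: "cc*mg <= cc*(D - al)" "cc*mg <= cc*(be - D)" using D cc(1) by (auto intro!: mult_left_mono)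
 have "si = 1 & al = th a & be = th b | si = -1 & al = th b & be = th a" using si ab by (auto simp: al_def be_def)
 thus "a + cc*mg <= ps D" "ps D <= b - cc*mg" using 1 2 ps_th[OF J(1)] ps_th[OF J(2)] by auto
qed

text \<open>Stationarity matches the final action of each step with the initial action of the next;
  uniqueness of the image point is injectivity of \<open>Aa\<close> in the second angle.\<close>

lemma orbit_is_orbit:
 assumes ni: "twist_generator e cc et" and e: "abs e <= e1" and mg: "mg > 0" "et <= cc*mg"
  and st: "!!k. stationary_path e x k" and inc: "!!k. al + mg <= x (Suc k) - x k & x (Suc k) - x k <= be - mg"
 shows "is_orbit om En h mu a b f e (orbit e x)" unfolding is_orbit_def proof (intro allI conjI)
 fix k
 let ?D = "x (Suc k) - x k"
 have o: "al < ?D" "?D < be" using inc[of k] mg by simp_all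
 have "abs (si*Aa e (x k, x (Suc k)) + si*ps ?D) <= et"
  using near_integrable.a_close[OF ni, where y = "x (Suc k)" and x = "x k"] inc[of k] mg by simp
 hence "abs (Aa e (x k, x (Suc k)) + ps ?D) <= et" using si by auto
 thus "snd (orbit e x k) : {a..b}" using action_margin[of mg ?D] inc[of k] mg by (auto simp: orbit_def)
 have st': "Bb e (x k, x (Suc k)) = - Aa e (x (Suc k), x (Suc (Suc k)))"
  using st[of k] si unfolding near_integrable.stationary_at_def[OF ni] by auto
 have gen: "generates om En h mu a b f e (orbit e x k) q \<longleftrightarrow> q = orbit e x (Suc k)" for q
 proof
  assume "q = orbit e x (Suc k)"
  thus "generates om En h mu a b f e (orbit e x k) q"
   unfolding generates_iff[OF e] using o st' by (simp add: orbit_def)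
 next
  assume "generates om En h mu a b f e (orbit e x k) q"
  hence q: "al < fst q - x k" "fst q - x k < be" "Aa e (x k, x (Suc k)) = Aa e (x k, fst q)" "snd q = Bb e (x k, fst q)"
   unfolding generates_iff[OF e] by (auto simp: orbit_def)
  have "x (Suc k) = fst q" by (rule Aa_inj[OF ni _ _ _ _ q(3)]) (use q o in auto)
  thus "q = orbit e x (Suc k)" using q(4) st' by (simp add: orbit_def prod_eq_iff)
 qed
 show "return_defined om En h mu a b f e (orbit e x k)" unfolding return_defined_def gen by simp
 show "orbit e x (Suc k) = return_map om En h mu a b f e (orbit e x k)" unfolding return_map_def gen by simp
qed

end

lemma bounded_deviation_rotation:
 assumes "!!i. abs (x i - x 0 - real i*rh) <= 2*pi"
 shows "has_rotation_number (orbit e x) rh" proof -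
 have "(%k. (x k - x 0)/real k - rh) \<longlonglongrightarrow> 0" proof (rule Lim_null_comparison)
  show "(%k. 2*pi/real k) \<longlonglongrightarrow> 0" by (rule lim_const_over_n)
  show "\<forall>\<^sub>F k in sequentially. norm ((x k - x 0)/real k - rh) <= 2*pi/real k"
   using eventually_gt_at_top[of 0] proof eventually_elim
   case (elim k)
   hence "(x k - x 0)/real k - rh = (x k - x 0 - real k*rh)/real k" by (simp add: diff_divide_distrib)
   thus ?case using assms[of k] elim by (simp add: divide_right_mono)
  qed
 qed
 thus ?thesis unfolding has_rotation_number_def orbit_def fst_conv by (rule LIM_zero_cancel)
qed

theorem orbits:
 assumes rh: "!!rh. rhm <= rh ==> rh <= rhp ==> al < rh & rh < be" and le: "rhm <= rhp"
 shows "EX epbar>0. ALL ep. abs ep < epbar -->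
    (ALL rh:{rhm..rhp}. EX x. is_orbit om En h mu a b f ep x & has_rotation_number x rh)"
  and "ALL (m::int) (n::nat). n > 0 & 2*pi * of_int m/of_nat n : {rhm..rhp} -->
    (EX ep0>0. ALL ep. abs ep < ep0 -->
     (EX x y. is_mn_orbit om En h mu a b f ep m n x & is_mn_orbit om En h mu a b f ep m n y &
         disjoint_orbits x y))" proof -
 obtain cc where cc: "cc > 0" "!!d d'. lo <= d ==> d <= d' ==> d' <= hi ==> cc*(d' - d) <= si*ps d' - si*ps d"
  by (rule ps_expanding) blast
 define mg where "mg = min (rhm - al) (be - rhp)/2"
 have mg: "mg > 0" "2*mg <= rhm - al" "2*mg <= be - rhp" using rh[of rhm] rh[of rhp] le by (auto simp: mg_def)
 have inc: "al + mg <= x (Suc k) - x k & x (Suc k) - x k <= be - mg"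
  if "abs (x (Suc k) - x k - rh) <= mg" "rh : {rhm..rhp}" for x :: "nat => real" and k rh
  using that mg by auto
 have win: "al < rh - mg" "rh + mg < be" if "rh : {rhm..rhp}" for rh using that mg by auto
 show "EX epbar>0. ALL ep. abs ep < epbar -->
    (ALL rh:{rhm..rhp}. EX x. is_orbit om En h mu a b f ep x & has_rotation_number x rh)" proof -
  obtain N :: nat where N: "4*pi/mg < real N" using reals_Archimedean2 by blast
  have "4*pi/mg > 0" using mg by simp
  hence Np: "real N > 0" using N by linarith
  have N': "4*pi < real N*mg" using N mg by (simp add: pos_divide_less_eq)
  \<comment> \<open>The terms ensure, in turn, \<open>et < cc\<close>, actions within
    \<open>[a, b]\<close>, and slow variation over \<open>N\<close> steps. \<open>N\<close> depends
    only on \<open>mg\<close>, so one \<open>et\<close> serves all rotation numbers.\<close>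
  define et where "et = min (cc/2) (min (cc*mg) (cc*mg/(4*real N)))"
  have et: "0 < et" "et < cc" "et <= cc*mg" "et <= cc*mg/(4*real N)" using cc(1) mg Np by (auto simp: et_def)
  have etN: "4*et*real N <= cc*mg" using et(4) Np by (simp add: pos_le_divide_eq mult_ac)
  obtain e2 where e2: "e2 > 0" "e2 <= e1" "!!e. abs e < e2 ==> twist_generator e cc et"
   using near_integrable_small[OF cc et(1,2)] by blast
  show ?thesis proof (intro exI[of _ e2] conjI allI impI ballI e2(1))
   fix e rh assume e: "abs e < e2" and r: "rh : {rhm..rhp}"
   note ni = e2(3)[OF e]
   obtain x where x: "!!k. stationary_path e x k"
    "!!k. abs (x (Suc k) - x k - rh) <= mg" "!!i. abs (x i - x 0 - real i*rh) <= 2*pi"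
    using near_integrable.stationary_exists[OF ni win[OF r] mg(1) N' etN] by blast
   have "is_orbit om En h mu a b f e (orbit e x)"
    by (rule orbit_is_orbit[OF cc ni _ mg(1) et(3) x(1) inc[of x _ rh, OF x(2) r]]) (use e e2 in auto)
   moreover have "has_rotation_number (orbit e x) rh" by (rule bounded_deviation_rotation[OF x(3)])
   ultimately show "EX x. is_orbit om En h mu a b f e x & has_rotation_number x rh" by blast
  qed
 qed
 show "ALL (m::int) (n::nat). n > 0 & 2*pi * of_int m/of_nat n : {rhm..rhp} -->
    (EX ep0>0. ALL ep. abs ep < ep0 -->
     (EX x y. is_mn_orbit om En h mu a b f ep m n x & is_mn_orbit om En h mu a b f ep m n y &
         disjoint_orbits x y))" proof (intro allI impI)
  fix mm :: int and n :: nat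
  assume H: "n > 0 & 2*pi * of_int mm/of_nat n : {rhm..rhp}"
  define rh where "rh = 2*pi * of_int mm/real n"
  have n: "n > 0" and r: "rh : {rhm..rhp}" using H by (auto simp: rh_def)
  \<comment> \<open>The two terms with \<open>n\<close> are the smallness conditions of
    \<open>min_from_close\<close> and \<open>stationary_unique\<close>, with \<open>3\<close> and
    \<open>5\<close> in place of \<open>2\<close> and \<open>4\<close> to make them strict.\<close>
  define et where "et = min (min (cc/2) (cc*mg)) (min (cc*mg/(3*real n)) (cc/(5*(real (Suc n)*real n))))"
  have npos: "0 < real n" "0 < real (Suc n)*real n" using n by (auto intro!: mult_pos_pos)
  have et: "0 < et" "et < cc" "et <= cc*mg" proof -
   have "0 < cc*mg/(3*real n)" "0 < cc/(5*(real (Suc n)*real n))" "0 < cc/2" "0 < cc*mg"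
    using cc(1) mg(1) npos by (intro divide_pos_pos mult_pos_pos; simp)+
   thus "0 < et" by (simp add: et_def)
   have "et <= cc/2" unfolding et_def by (rule min.coboundedI1[OF min.cobounded1])
   thus "et < cc" using cc(1) by simp
   show "et <= cc*mg" unfolding et_def by (rule min.coboundedI1[OF min.cobounded2])
  qed
  have "et <= cc*mg/(3*real n)" unfolding et_def by (rule min.coboundedI2[OF min.cobounded1])
  hence "3*(et*real n) <= cc*mg" using npos(1) by (simp add: pos_le_divide_eq mult_ac)
  moreover have "et*real n > 0" using et(1) npos(1) by simp
  ultimately have s1: "2*et*real n < cc*mg" by linarith
  have "et <= cc/(5*(real (Suc n)*real n))" unfolding et_def by (rule min.coboundedI2[OF min.cobounded2])
  moreover have "5*(et*X) <= cc" if "et <= cc/(5*X)" "0 < X" for X using that by (simp add: field_simps)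
  ultimately have "5*(et*(real (Suc n)*real n)) <= cc" using npos(2) by blast
  moreover have "et*(real (Suc n)*real n) > 0" using et(1) npos(2) by (rule mult_pos_pos)
  ultimately have s2: "4*et*(real (Suc n)*real n) < cc" by linarith
  obtain e2 where e2: "e2 > 0" "e2 <= e1" "!!e. abs e < e2 ==> twist_generator e cc et"
   using near_integrable_small[OF cc et(1,2)] by blast
  show "EX ep0>0. ALL ep. abs ep < ep0 -->
     (EX x y. is_mn_orbit om En h mu a b f ep mm n x & is_mn_orbit om En h mu a b f ep mm n y & disjoint_orbits x y)"
  proof (intro exI[of _ e2] conjI allI impI e2(1))
   fix e assume e: "abs e < e2"
   note ni = e2(3)[OF e]
   have ee: "abs e <= e1" using e e2 by simp
   obtain x y where xy: "near_integrable.conf al be n mm x" "!!k. stationary_path e x k"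
    "!!k. abs (x (Suc k) - x k - rh) <= mg" "near_integrable.conf al be n mm y" "!!k. stationary_path e y k"
    "!!k. abs (y (Suc k) - y k - rh) <= mg"
    "!!i j l. ~ (y j = x i + 2*pi * of_int l & y (Suc j) = x (Suc i) + 2*pi * of_int l)"
    by (rule near_integrable.two_periodic_stationary[OF ni n rh_def win[OF r] mg(1) s1 s2]) (rule that; assumption)
   have shift: "Aa e (u + 2*pi * of_int l, v + 2*pi * of_int l) = Aa e (u, v)" for u v and l :: int
    by (rule periodic_int) (rule family_per(1)[OF ee])
   have mn: "is_mn_orbit om En h mu a b f e mm n (orbit e w)"
    if w: "near_integrable.conf al be n mm w" "!!k. stationary_path e w k"
     "!!k. abs (w (Suc k) - w k - rh) <= mg" for w unfolding is_mn_orbit_def proof (intro conjI allI)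
    show "is_orbit om En h mu a b f e (orbit e w)"
     by (rule orbit_is_orbit[OF cc ni ee mg(1) et(3) w(2) inc[of w _ rh, OF w(3) r]])
    fix k
    have wn: "w (k + n) = w k + 2*pi * of_int mm" for k using w(1) unfolding near_integrable.conf_def[OF ni] by blast
    have "w (Suc (k + n)) = w (Suc k) + 2*pi * of_int mm" using wn[of "Suc k"] by simp
    thus "orbit e w (k + n) = (fst (orbit e w k) + 2*pi * of_int mm, snd (orbit e w k))"
     by (simp add: orbit_def wn shift)
   qed
   have "disjoint_orbits (orbit e x) (orbit e y)" unfolding disjoint_orbits_def proof
    assume "EX j k. EX l::int. orbit e y j = (fst (orbit e x k) + 2*pi * of_int l, snd (orbit e x k))"
    then obtain j k and l :: int where jk: "y j = x k + 2*pi * of_int l" "Aa e (y j, y (Suc j)) = Aa e (x k, x (Suc k))"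
     by (auto simp: orbit_def)
    have iy: "al + mg <= y (Suc j) - y j & y (Suc j) - y j <= be - mg" by (rule inc[of y _ rh, OF xy(6) r])
    have ix: "al + mg <= x (Suc k) - x k & x (Suc k) - x k <= be - mg" by (rule inc[of x _ rh, OF xy(3) r])
    \<comment> \<open>Equal angle and action force equal next angles up to the same translation,
      which \<open>two_periodic_stationary\<close> excludes.\<close>
    have "Aa e (y j, y (Suc j)) = Aa e (y j, x (Suc k) + 2*pi * of_int l)"
     unfolding jk(2) unfolding jk(1) shift ..
    hence "y (Suc j) = x (Suc k) + 2*pi * of_int l"
     by (rule Aa_inj[OF ni, rotated 4]) (use ix iy jk(1) mg(1) in linarith)+
    thus False using xy(7) jk(1) by blast
   qed
   thus "EX x y. is_mn_orbit om En h mu a b f e mm n x & is_mn_orbit om En h mu a b f e mm n y & disjoint_orbits x y"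
    using mn[OF xy(1-3)] mn[OF xy(4-6)] by blast
  qed
 qed
qed

end

theorem theorem1p3:
  fixes \<omega> \<E> h \<mu> C \<rho>m \<rho>p :: real
    and k :: nat
    and f :: "real \<Rightarrow> real \<Rightarrow> real"
  assumes "\<omega> > 0" and "\<E> > \<omega>\<^sup>2" and "h > 0" and "\<mu> > 0"
    and "C > 0" and "k > 5" and "C_class k C f"
    and "\<And>\<xi> e. e \<in> {-C..C} \<Longrightarrow> f (\<xi> + 2 * pi) e = f \<xi> e"
    and "\<rho>m < \<rho>p"
    and "\<rho>m \<in> Diophantine \<inter> theta_bar \<omega> \<E> h \<mu> ` {- I_crit \<omega> \<E> <..< I_crit \<omega> \<E>}"
    and "\<rho>p \<in> Diophantine \<inter> theta_bar \<omega> \<E> h \<mu> ` {- I_crit \<omega> \<E> <..< I_crit \<omega> \<E>}"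
    and "critical_values \<omega> \<E> h \<mu> \<inter> {\<rho>m..\<rho>p} = {}"
  shows "\<exists>a b. twist_annulus \<omega> \<E> h \<mu> a b \<and>
    (\<exists>\<epsilon>bar>0. \<forall>\<epsilon>. \<bar>\<epsilon>\<bar> < \<epsilon>bar \<longrightarrow>
       (\<forall>\<rho>\<in>{\<rho>m..\<rho>p}. \<exists>x. is_orbit \<omega> \<E> h \<mu> a b f \<epsilon> x \<and> has_rotation_number x \<rho>)) \<and>
    (\<forall>(m::int) (n::nat). n > 0 \<and> 2 * pi * of_int m / of_nat n \<in> {\<rho>m..\<rho>p} \<longrightarrow>
       (\<exists>\<epsilon>0>0. \<forall>\<epsilon>. \<bar>\<epsilon>\<bar> < \<epsilon>0 \<longrightarrow>
          (\<exists>x y. is_mn_orbit \<omega> \<E> h \<mu> a b f \<epsilon> m n x \<and> is_mn_orbit \<omega> \<E> h \<mu> a b f \<epsilon> m n y \<and>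
                 disjoint_orbits x y)))"
proof -
 define K H where "K = 2*\<E> / \<omega>^2" and "H = \<E> + h"
 note K4 = assms(1-4) K_def H_def
 let ?A = "I_crit \<omega> \<E>" and ?\<theta>' = "theta' \<omega> \<E> h \<mu> K H"
 have nz: "?\<theta>' I ~= 0" if I: "abs I < ?A" "theta_bar \<omega> \<E> h \<mu> I : {\<rho>m..\<rho>p}" for I
 proof
  assume "?\<theta>' I = 0"
  hence "critical_action \<omega> \<E> h \<mu> I" using critical_iff[OF K4 I(1)] by simp
  hence "theta_bar \<omega> \<E> h \<mu> I : critical_values \<omega> \<E> h \<mu>"
   unfolding critical_values_def using I(1) by (intro imageI) (auto simp: abs_less_iff)
  thus False using assms(12) I(2) by blast
 qed
 have im: "\<rho>m : theta_bar \<omega> \<E> h \<mu> ` {- ?A<..<?A}" "\<rho>p : theta_bar \<omega> \<E> h \<mu> ` {- ?A<..<?A}" using assms(10,11) by auto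
 obtain a' a b b' \<sigma> :: real where ab: "- ?A < a'" "a' < a" "a < b" "b < b'" "b' < ?A" "\<sigma> = 1 | \<sigma> = -1"
  "!!I. a' <= I ==> I <= b' ==> 0 < \<sigma> * ?\<theta>' I"
  "!!\<rho>. \<rho>m <= \<rho> ==> \<rho> <= \<rho>p ==> \<sigma> * theta_bar \<omega> \<E> h \<mu> a < \<sigma> * \<rho> & \<sigma> * \<rho> < \<sigma> * theta_bar \<omega> \<E> h \<mu> b"
  by (rule annulus_exists[OF theta_deriv[OF K4] theta'_continuous[OF K4] assms(9) im nz]) (assumption | rule that)+
 have sub: "{a'..b'} <= {- ?A<..<?A}" "{a'..b'} ~= {}" using ab by auto
 have "continuous_on {a'..b'} (%I. abs (phi_E \<omega> \<E> I))" "continuous_on {a'..b'} (%I. abs (phi_I \<E> h \<mu> I))"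
  using continuous_on_subset[OF phi_continuous(1)[OF K4] sub(1)] continuous_on_subset[OF phi_continuous(2)[OF K4] sub(1)]
  by (auto intro: continuous_intros)
 from continuous_attains_sup[OF compact_Icc sub(2) this(1)] continuous_attains_sup[OF compact_Icc sub(2) this(2)]
 obtain IE II where IE: "IE : {a'..b'}" "!!I. I : {a'..b'} ==> abs (phi_E \<omega> \<E> I) <= abs (phi_E \<omega> \<E> IE)"
  and II: "II : {a'..b'}" "!!I. I : {a'..b'} ==> abs (phi_I \<E> h \<mu> I) <= abs (phi_I \<E> h \<mu> II)" by blast
 have "abs IE < ?A" "abs II < ?A" using IE(1) II(1) sub(1) by (auto simp: abs_less_iff)
 hence bd: "abs (phi_E \<omega> \<E> IE) < pi" "abs (phi_I \<E> h \<mu> II) < 2*pi" using phi_inverse[OF K4] by blast+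
 \<comment> \<open>A third of the distance from the largest swept angles on \<open>[a', b']\<close>
   to \<open>pi\<close> and \<open>2*pi\<close>; both distances are positive because these maxima
   are attained inside the range of admissible actions. The cap \<open>1\<close> keeps the margin
   below \<open>pi\<close>.\<close>
 define \<delta> where "\<delta> = min 1 (min ((pi - abs (phi_E \<omega> \<E> IE))/3) ((2*pi - abs (phi_I \<E> h \<mu> II))/3))"
 have \<delta>: "0 < \<delta>" "\<delta> <= 1" "3*\<delta> <= pi - abs (phi_E \<omega> \<E> IE)" "3*\<delta> <= 2*pi - abs (phi_I \<E> h \<mu> II)"
 proof -
  show "0 < \<delta>" "\<delta> <= 1" using bd by (auto simp: \<delta>_def)
  have "\<delta> <= (pi - abs (phi_E \<omega> \<E> IE))/3" "\<delta> <= (2*pi - abs (phi_I \<E> h \<mu> II))/3"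
   unfolding \<delta>_def by (rule min.coboundedI2[OF min.cobounded1], rule min.coboundedI2[OF min.cobounded2])
  thus "3*\<delta> <= pi - abs (phi_E \<omega> \<E> IE)" "3*\<delta> <= 2*pi - abs (phi_I \<E> h \<mu> II)" by simp_all
 qed
 have \<delta>pi: "\<delta> < pi" using \<delta>(2) pi_gt3 by linarith
 obtain f1 f2 M where "boundary_family f f1 f2 C M"
  by (rule boundary_family_exists[OF assms(5-8)]) (assumption | rule that)+
 then interpret boundary_family f f1 f2 C M .
 obtain e0 where "billiard f f1 f2 C M \<omega> \<E> h \<mu> K H \<delta> e0"
  using billiard_exists[OF assms(1-4) \<delta>(1) \<delta>pi] unfolding K_def H_def by blast
 then interpret B: billiard f f1 f2 C M \<omega> \<E> h \<mu> K H \<delta> e0 .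
 interpret A: annulus f f1 f2 C M \<omega> \<E> h \<mu> K H \<delta> e0 a' a b b' \<sigma> proof
  fix I assume "a' <= I" "I <= b'"
  hence "I : {a'..b'}" by simp
  from IE(2)[OF this] II(2)[OF this] \<delta> show "abs (phi_E \<omega> \<E> I) <= pi - 3*\<delta> & abs (phi_I \<E> h \<mu> I) <= 2*pi - 3*\<delta>" by linarith
 qed (use ab in auto)
 obtain m rr e1 where "slope f f1 f2 C M \<omega> \<E> h \<mu> K H \<delta> e0 a' a b b' \<sigma> m rr e1"
 proof (rule A.slope_exists)
  fix m rr e1 assume "m > 0" "0 < rr" "rr <= \<delta>" "0 < e1" "e1 <= e0"
   "!!e x I v. abs e <= e1 ==> I : {a'..b'} ==> abs v <= rr ==> m <= - \<sigma> * A.DG e (A.pt x I v) (0, 1)"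
   "!!e x I. abs e <= e1 ==> I : {a'..b'} ==> abs (A.G e (A.pt x I 0)) <= m*rr/4"
  thus thesis by (intro that[of m rr e1] slope.intro slope_axioms.intro A.annulus_axioms)
 qed
 then interpret S: slope f f1 f2 C M \<omega> \<E> h \<mu> K H \<delta> e0 a' a b b' \<sigma> m rr e1 .
 have twist: "twist_annulus \<omega> \<E> h \<mu> a b" unfolding twist_annulus_def proof (intro conjI ballI)
  fix I assume I: "I : {a..b}"
  hence "abs I < ?A" "0 < \<sigma> * ?\<theta>' I" using ab by auto
  thus "~ critical_action \<omega> \<E> h \<mu> I" using critical_iff[OF K4] by auto
 qed (use ab in auto)
 have rng: "S.al < \<rho> & \<rho> < S.be" if "\<rho>m <= \<rho>" "\<rho> <= \<rho>p" for \<rho>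
  using ab(8)[OF that] ab(6) by (auto simp: S.al_def S.be_def)
 show ?thesis using twist S.orbits[OF rng less_imp_le[OF assms(9)]] by blast
qed

end
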